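(* Let $d\in\mathbb{R}\setminus\{0\}$, $\zeta,\omega\in\mathbb{R}$ and $f\in H^2(0,2\pi)$. Then the equation $$-d u''+\mathrm{i}\omega u'+(\zeta-\mathrm{i})u-|u|^2u+\mathrm{i}f(s)=0,\qquad u\ 2\pi\text{-periodic},$$ has a unique solution $u\in H^2_{\mathrm{per}}(0,2\pi)$ in each of the following three cases: (i) $\operatorname{sign}(d)\,\zeta<\zeta_*$; (ii) $\operatorname{sign}(d)\,\zeta>\zeta^*$; (iii) $\sqrt{3}\,C<1$; where $\zeta_*\le0\le\zeta^*$ are given by $$\zeta_*=\zeta_*(d,f,\omega)=-C^2\mathbf{1}_{d<0}-\frac{27\,(F^{3/4}+2\pi B)^6\,\tilde D}{8\pi^3},\qquad \zeta^*=\zeta^*(d,f,\omega)=3C^2+\frac{\omega^2}{4|d|},$$ with $$F=\|f\|_2,\qquad B=\frac{F^{11/4}}{2|d|}+2\|f'\|_\infty F^{1/4}+\sqrt{\|f''\|_2F^{1/2}+2\|f'\|_\infty\Big(\sqrt{\tfrac{F}{2\pi}}+1\Big)},$$ $$C=\frac{F}{\sqrt{2\pi}}+\sqrt{2\pi}\,B\,F^{1/4},\qquad \tilde D=F^{3/2}+|\omega|BF^{3/4}+|d|B^2.$$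
   Context: All functions are complex valued. $\|\cdot\|_p$ is the norm of $L^p(0,2\pi)$. $\mathbf{1}_{d<0}$ equals $1$ if $d<0$ and $0$ otherwise. $H^2(0,2\pi)$ is the usual Sobolev space; $f\in H^2(0,2\pi)$ is regarded as extended $2\pi$-periodically to $\mathbb{R}$ (not necessarily continuously), and $f',f''$ are its weak derivatives on $(0,2\pi)$. $H^2_{\mathrm{per}}(0,2\pi)$ is the space of locally square-integrable $2\pi$-periodic functions on $\mathbb{R}$ whose weak derivatives on $\mathbb{R}$ up to order $2$ are locally square-integrable. *)

theory Defs
  imports "HOL-Probability.Essential_Supremum"
begin

text \<open>
  Elements of Lebesgue and Sobolev spaces are represented by functions on the whole line; every
  notion below depends only on the almost-everywhere class of the function on the set in question.
\<close>

definition L2_on :: "real set \<Rightarrow> (real \<Rightarrow> complex) \<Rightarrow> bool" where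
  "L2_on S f \<longleftrightarrow> f \<in> borel_measurable (lebesgue_on S) \<and>
     integrable (lebesgue_on S) (\<lambda>x. (cmod (f x))\<^sup>2)"

definition L2_norm_on :: "real set \<Rightarrow> (real \<Rightarrow> complex) \<Rightarrow> real" where
  "L2_norm_on S f = sqrt (LINT x|lebesgue_on S. (cmod (f x))\<^sup>2)"

text \<open>
  \<open>real_of_ereal\<close> sends \<open>\<infinity>\<close> to 0, so the following is the norm only for essentially bounded
  functions. It is applied below to the derivative of an \<open>H\<^sup>2\<close> function on a bounded interval,
  which is essentially bounded.
\<close>

definition Linf_norm_on :: "real set \<Rightarrow> (real \<Rightarrow> complex) \<Rightarrow> real" where
  "Linf_norm_on S f = real_of_ereal (esssup (lebesgue_on S) (\<lambda>x. ereal (cmod (f x))))"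

definition test_function_on :: "real set \<Rightarrow> (real \<Rightarrow> real) \<Rightarrow> bool" where
  "test_function_on S \<phi> \<longleftrightarrow> (\<forall>n x. (deriv ^^ n) \<phi> field_differentiable (at x)) \<and>
     (\<exists>K. compact K \<and> K \<subseteq> S \<and> (\<forall>x. x \<notin> K \<longrightarrow> \<phi> x = 0))"

definition loc_integrable_on :: "real set \<Rightarrow> (real \<Rightarrow> complex) \<Rightarrow> bool" where
  "loc_integrable_on S f \<longleftrightarrow> (\<forall>K. compact K \<and> K \<subseteq> S \<longrightarrow> integrable (lebesgue_on K) f)"

definition loc_L2_on :: "real set \<Rightarrow> (real \<Rightarrow> complex) \<Rightarrow> bool" where
  "loc_L2_on S f \<longleftrightarrow> (\<forall>K. compact K \<and> K \<subseteq> S \<longrightarrow> L2_on K f)"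

text \<open>
  The set \<open>S\<close> is meant to be open. Real-valued test functions suffice, since the defining identity
  is linear in \<open>\<phi>\<close>.
\<close>

definition has_weak_deriv_on :: "real set \<Rightarrow> (real \<Rightarrow> complex) \<Rightarrow> (real \<Rightarrow> complex) \<Rightarrow> bool" where
  "has_weak_deriv_on S f g \<longleftrightarrow> loc_integrable_on S f \<and> loc_integrable_on S g \<and>
     (\<forall>\<phi>. test_function_on S \<phi> \<longrightarrow>
        (LINT x|lebesgue_on S. deriv \<phi> x *\<^sub>R f x) = - (LINT x|lebesgue_on S. \<phi> x *\<^sub>R g x))"

text \<open>A representative of the weak derivative, which is unique up to null sets if it exists.\<close>

definition weak_deriv_on :: "real set \<Rightarrow> (real \<Rightarrow> complex) \<Rightarrow> (real \<Rightarrow> complex)" where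
  "weak_deriv_on S f = (SOME g. has_weak_deriv_on S f g)"

definition H2_on :: "real set \<Rightarrow> (real \<Rightarrow> complex) \<Rightarrow> bool" where
  "H2_on S f \<longleftrightarrow> (\<exists>g h. has_weak_deriv_on S f g \<and> has_weak_deriv_on S g h \<and>
     L2_on S f \<and> L2_on S g \<and> L2_on S h)"

definition H2_per :: "(real \<Rightarrow> complex) \<Rightarrow> bool" where
  "H2_per u \<longleftrightarrow> (AE x in lebesgue. u (x + 2 * pi) = u x) \<and>
     (\<exists>v w. has_weak_deriv_on UNIV u v \<and> has_weak_deriv_on UNIV v w \<and>
        loc_L2_on UNIV u \<and> loc_L2_on UNIV v \<and> loc_L2_on UNIV w)"

definition per_ext :: "(real \<Rightarrow> complex) \<Rightarrow> real \<Rightarrow> complex" where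
  "per_ext f s = f (s - 2 * pi * of_int \<lfloor>s / (2 * pi)\<rfloor>)"

definition LLE_solution :: "real \<Rightarrow> real \<Rightarrow> real \<Rightarrow> (real \<Rightarrow> complex) \<Rightarrow> (real \<Rightarrow> complex) \<Rightarrow> bool" where
  "LLE_solution d \<zeta> \<omega> f u \<longleftrightarrow> H2_per u \<and>
     (let u' = weak_deriv_on UNIV u; u'' = weak_deriv_on UNIV u' in
      AE s in lebesgue.
        - of_real d * u'' s + \<i> * of_real \<omega> * u' s + (of_real \<zeta> - \<i>) * u s
        - of_real ((cmod (u s))\<^sup>2) * u s + \<i> * per_ext f s = 0)"

abbreviation period :: "real set" where
  "period \<equiv> {0<..<2 * pi}"

definition LLE_F :: "(real \<Rightarrow> complex) \<Rightarrow> real" where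
  "LLE_F f = L2_norm_on period f"

definition LLE_B :: "real \<Rightarrow> (real \<Rightarrow> complex) \<Rightarrow> real" where
  "LLE_B d f = (let F = LLE_F f; f' = weak_deriv_on period f; f'' = weak_deriv_on period f' in
     F powr (11/4) / (2 * \<bar>d\<bar>) + 2 * Linf_norm_on period f' * F powr (1/4)
     + sqrt (L2_norm_on period f'' * F powr (1/2)
             + 2 * Linf_norm_on period f' * (sqrt (F / (2 * pi)) + 1)))"

definition LLE_C :: "real \<Rightarrow> (real \<Rightarrow> complex) \<Rightarrow> real" where
  "LLE_C d f = LLE_F f / sqrt (2 * pi) + sqrt (2 * pi) * LLE_B d f * LLE_F f powr (1/4)"

definition LLE_D :: "real \<Rightarrow> real \<Rightarrow> (real \<Rightarrow> complex) \<Rightarrow> real" where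
  "LLE_D d \<omega> f = LLE_F f powr (3/2) + \<bar>\<omega>\<bar> * LLE_B d f * LLE_F f powr (3/4) + \<bar>d\<bar> * (LLE_B d f)\<^sup>2"

definition zeta_lower :: "real \<Rightarrow> (real \<Rightarrow> complex) \<Rightarrow> real \<Rightarrow> real" where
  "zeta_lower d f \<omega> = - (LLE_C d f)\<^sup>2 * (if d < 0 then 1 else 0)
     - 27 * (LLE_F f powr (3/4) + 2 * pi * LLE_B d f) ^ 6 * LLE_D d \<omega> f / (8 * pi ^ 3)"

definition zeta_upper :: "real \<Rightarrow> (real \<Rightarrow> complex) \<Rightarrow> real \<Rightarrow> real" where
  "zeta_upper d f \<omega> = 3 * (LLE_C d f)\<^sup>2 + \<omega>\<^sup>2 / (4 * \<bar>d\<bar>)"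

end

theory Submission
  imports Defs
begin

text \<open>
  Let \<open>\<delta> = \<bar>d\<bar>\<close>, \<open>\<sigma> = sgn d\<close> and \<open>Z = \<sigma>\<zeta>\<close>. After complex conjugation in the case \<open>d < 0\<close>, the equation reads
  \<open>- \<delta>u'' + i\<omega>u' + (Z - i)u = \<sigma>\<bar>u\<bar>\<^sup>2u - if\<close>. The damping term \<open>- iu\<close> is the only one that
  is not conservative, and it decides uniqueness: testing the equation for the difference \<open>w\<close> of two
  solutions with the conjugate of \<open>w\<close> and taking imaginary parts leaves the square of the norm of \<open>w\<close> on
  one side and the Kerr terms on the other. If both solutions satisfy \<open>\<bar>u\<bar>\<^sup>2 \<le> a\<close>, the latter are at most
  \<open>a\<close> times that square (\<open>kerr_one_sided\<close>). So solutions with \<open>\<bar>u\<bar>\<^sup>2 < 1\<close> are unique, even with a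
  quantitative stability estimate (\<open>solution_stability\<close>), and the theorem reduces to an a priori bound:
  in each of the three regimes \<^emph>\<open>every\<close> solution satisfies \<open>\<bar>u\<bar>\<^sup>2 < 24/25\<close> (\<open>amplitude_bound\<close>).

  For the a priori bound let \<open>n\<close>, \<open>x\<close>, \<open>F\<close> be the \<open>L\<^sup>2\<close> norms of \<open>u\<close>, \<open>u'\<close>, \<open>f\<close>, let \<open>M\<close> bound \<open>\<bar>f'\<bar>\<close>, and
  let \<open>S\<close> be the maximum of \<open>\<bar>u\<bar>\<close>. Testing with the conjugate of \<open>u\<close> gives \<open>n \<le> F\<close> (imaginary part) and an
  energy balance (real part), and one always has \<open>S\<^sup>2 \<le> n\<^sup>2/(2\<pi>) + nx\<close>. The decisive identity tests with the conjugate
  of \<open>u''\<close> and eliminates the nonlinearity through the mass density (\<open>slope_identity\<close>); it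
  bounds \<open>x\<^sup>2\<close> in terms of \<open>F\<close>, \<open>M\<close> and a boundary term \<open>J\<bar>u'(0)\<bar>\<close>, where \<open>J\<close> is the jump of
  the periodic extension of \<open>f\<close>. That term is controlled by factoring the linear operator into two first-order operators,
  one growing and one decaying (\<open>initial_slope_bound\<close>), and by the two bounds on \<open>J\<close> that follow from
  the Lipschitz constant and the norm of \<open>f\<close> (\<open>jump_bounds\<close>). What remains is a system of
  inequalities between real numbers, and in each regime it contradicts \<open>S\<^sup>2 \<ge> 24/25\<close>. For \<open>Z\<close> far
  below 0 the energy balance forces a slope so steep that it violates the bound on \<open>x\<^sup>2\<close>
  (\<open>far_detuned_contradiction\<close>); for \<open>Z\<close> far above 0 the energy is coercive
  (\<open>coercive_contradiction\<close>); and for small \<open>C\<close> the bound on \<open>x\<^sup>2\<close> is already too small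
  (\<open>small_forcing_contradiction\<close>).

  All estimates survive if \<open>\<bar>u\<bar>\<^sup>2\<close> in the nonlinearity is replaced by a saturated
  intensity that agrees with it up to a level \<open>a\<close> and is bounded by \<open>2a\<close>. For \<open>a = 24/25\<close> the saturated equation has
  a stability constant that does not depend on the strength of the nonlinearity, so it can be solved by
  continuation from the linear equation, each step being a contraction
  (\<open>saturated_solution_exists\<close>). Its solution obeys the a priori bound and therefore never enters the
  saturated range: it solves the original equation.

  Finally, weak and classical solutions agree. By the du Bois-Reymond lemma a function with an integrable weak
  derivative is almost everywhere a primitive of it, so \<open>f\<close> has a continuously differentiable
  representative on the closed period (\<open>forcing_representative\<close>), and so does every weak solution, which is
  thus a classical one on the period with matching boundary values of \<open>u\<close> and \<open>u'\<close>
  (\<open>weak_to_classical\<close>, \<open>classical_to_weak\<close>).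
\<close>


section \<open>Integrals over one period\<close>

abbreviation circ :: "real set" where "circ \<equiv> {0..2*pi}"

definition l2 :: "(real \<Rightarrow> complex) \<Rightarrow> real" where
  "l2 g = sqrt (integral circ (\<lambda>s. (cmod (g s))^2))"

lemma integrable_circ: "continuous_on circ g \<Longrightarrow> (g :: real \<Rightarrow> 'a::banach) integrable_on circ"
  by (rule integrable_continuous_real)

lemma l2_nonneg [simp]: "0 \<le> l2 g"
  unfolding l2_def by (intro real_sqrt_ge_zero) (metis integral_nonneg not_integrable_integral order_refl zero_le_power2)

lemma l2_sq: "(l2 g)^2 = integral circ (\<lambda>s. (cmod (g s))^2)"
  unfolding l2_def
  by (intro real_sqrt_pow2) (metis integral_nonneg not_integrable_integral order_refl zero_le_power2)

lemma integral_Cauchy_Schwarz: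
  fixes p q :: "real \<Rightarrow> real"
  assumes "continuous_on circ p" "continuous_on circ q"
  shows "integral circ (\<lambda>s. p s * q s) \<le> sqrt (integral circ (\<lambda>s. (p s)^2)) * sqrt (integral circ (\<lambda>s. (q s)^2))"
proof -
  define A B C where "A = integral circ (\<lambda>s. (q s)^2)" and "B = integral circ (\<lambda>s. p s * q s)" and "C = integral circ (\<lambda>s. (p s)^2)"
  have A0: "0 \<le> A" unfolding A_def by (intro integral_nonneg integrable_circ continuous_intros assms) auto
  have C0: "0 \<le> C" unfolding C_def by (intro integral_nonneg integrable_circ continuous_intros assms) auto
  have q: "0 \<le> C + 2*t*B + t^2*A" for t
  proof -
    have "0 \<le> integral circ (\<lambda>s. (p s + t * q s)^2)" by (intro integral_nonneg integrable_circ continuous_intros assms) auto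
    also have "(\<lambda>s. (p s + t * q s)^2) = (\<lambda>s. (p s)^2 + (2*t)*(p s * q s) + t^2*(q s)^2)"
      by (auto simp: power2_eq_square algebra_simps)
    also have "integral circ \<dots> = C + 2*t*B + t^2*A"
      unfolding A_def B_def C_def
      by (subst integral_add integral_mult_right; (intro integrable_circ continuous_intros assms)?)+ simp
    finally show ?thesis .
  qed
  have "B^2 \<le> C*A"
  proof (cases "A = 0")
    case True
    have "B = 0"
    proof (rule ccontr)
      assume "B \<noteq> 0"
      then show False using q[of "-(C+1)/(2*B)"] True C0 by (simp add: field_simps)
    qed
    then show ?thesis using True by simp
  next
    case False
    then have "0 < A" using A0 by simp
    moreover have "0 \<le> C + 2*(-B/A)*B + (-B/A)^2*A" by (rule q)
    ultimately show ?thesis by (simp add: field_simps power2_eq_square)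
  qed
  then have "sqrt (B^2) \<le> sqrt (C*A)" by (rule real_sqrt_le_mono)
  then have "\<bar>B\<bar> \<le> sqrt C * sqrt A" by (simp add: real_sqrt_mult)
  then show ?thesis unfolding A_def B_def C_def by simp
qed

lemma integral_norm_mult_le_l2:
  fixes g h :: "real \<Rightarrow> complex"
  assumes "continuous_on circ g" "continuous_on circ h"
  shows "integral circ (\<lambda>s. cmod (g s) * cmod (h s)) \<le> l2 g * l2 h"
  unfolding l2_def by (rule integral_Cauchy_Schwarz; intro continuous_intros assms)

lemma integral_norm_le_l2:
  fixes g :: "real \<Rightarrow> complex"
  assumes "continuous_on circ g"
  shows "integral circ (\<lambda>s. cmod (g s)) \<le> sqrt (2*pi) * l2 g"
  using integral_norm_mult_le_l2[of "\<lambda>_. 1" g] assms by (simp add: l2_def)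

lemma cmod_sq: "(cmod z)^2 = Re z * Re z + Im z * Im z"
  unfolding cmod_power2 by (simp add: power2_eq_square)

text \<open>
  If \<open>e\<close> has mean zero, only the oscillation of \<open>r\<close> contributes to the integral of \<open>re\<close>; subtracting the
  midrange \<open>c\<close> of \<open>r\<close> halves the constant.
\<close>

lemma integral_mean_zero_le:
  fixes r e :: "real \<Rightarrow> real"
  assumes cr: "continuous_on circ r" and ce: "continuous_on circ e" and z: "integral circ e = 0"
    and K: "\<And>s. s \<in> circ \<Longrightarrow> \<bar>r s - c\<bar> \<le> K"
  shows "\<bar>integral circ (\<lambda>s. r s * e s)\<bar> \<le> K * integral circ (\<lambda>s. \<bar>e s\<bar>)"
proof -
  have "integral circ (\<lambda>s. (r s - c) * e s) = integral circ (\<lambda>s. r s * e s - c * e s)"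
    by (simp add: left_diff_distrib)
  also have "\<dots> = integral circ (\<lambda>s. r s * e s) - integral circ (\<lambda>s. c * e s)"
    by (rule integral_diff; intro integrable_circ continuous_intros cr ce)
  finally have eq: "integral circ (\<lambda>s. r s * e s) = integral circ (\<lambda>s. (r s - c) * e s)" using z by simp
  have "norm (integral circ (\<lambda>s. (r s - c) * e s)) \<le> integral circ (\<lambda>s. K * \<bar>e s\<bar>)"
  proof (intro integral_norm_bound_integral integrable_circ continuous_intros cr ce)
    fix s assume "s \<in> circ"
    then show "norm ((r s - c) * e s) \<le> K * \<bar>e s\<bar>" unfolding real_norm_def abs_mult by (intro mult_right_mono K) auto
  qed
  then show ?thesis unfolding eq by simp
qed

lemma FTC_circ:
  fixes G :: "real \<Rightarrow> 'a::banach"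
  assumes "\<And>s. s \<in> circ \<Longrightarrow> (G has_vector_derivative g s) (at s within circ)"
  shows "integral circ g = G (2*pi) - G 0"
  by (intro integral_unique fundamental_theorem_of_calculus assms) auto

lemma has_vector_derivative_continuous_on:
  assumes "\<And>s. s \<in> S \<Longrightarrow> (G has_vector_derivative g s) (at s within S)"
  shows "continuous_on S G"
  unfolding continuous_on_eq_continuous_within using assms has_vector_derivative_continuous by metis

text \<open>
  Between the minimum and the maximum of a periodic function there are two arcs, and its derivative has
  to make up the difference on each of them; hence the factor 2.
\<close>

lemma periodic_sup_le_mean:
  fixes q q' :: "real \<Rightarrow> real"
  assumes d: "\<And>s. s \<in> circ \<Longrightarrow> (q has_vector_derivative q' s) (at s within circ)"
    and c: "continuous_on circ q'" and per: "q 0 = q (2*pi)" and s: "s \<in> circ" "t \<in> circ"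
  shows "2*(q s - q t) \<le> integral circ (\<lambda>s. \<bar>q' s\<bar>)"
proof -
  have cabs: "continuous_on circ (\<lambda>s. \<bar>q' s\<bar>)" by (intro continuous_intros c)
  have step: "\<bar>q b - q a\<bar> \<le> integral {a..b} (\<lambda>s. \<bar>q' s\<bar>)" if "0 \<le> a" "a \<le> b" "b \<le> 2*pi" for a b
  proof -
    have sub: "{a..b} \<subseteq> circ" using that by auto
    have "integral {a..b} q' = q b - q a"
      by (intro integral_unique fundamental_theorem_of_calculus that has_vector_derivative_within_subset[OF d sub]) (use that in auto)
    moreover have "\<bar>integral {a..b} q'\<bar> \<le> integral {a..b} (\<lambda>s. \<bar>q' s\<bar>)"
      using integral_norm_bound_integral[of q' "{a..b}" "\<lambda>s. \<bar>q' s\<bar>"]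
        integrable_continuous_real[OF continuous_on_subset[OF c sub]]
        integrable_continuous_real[OF continuous_on_subset[OF cabs sub]] by simp
    ultimately show ?thesis by simp
  qed
  have main: "2*\<bar>q b - q a\<bar> \<le> integral circ (\<lambda>s. \<bar>q' s\<bar>)" if "0 \<le> a" "a \<le> b" "b \<le> 2*pi" for a b
  proof -
    have "integral {0..a} (\<lambda>s. \<bar>q' s\<bar>) + integral {a..2*pi} (\<lambda>s. \<bar>q' s\<bar>) = integral circ (\<lambda>s. \<bar>q' s\<bar>)"
      by (rule Henstock_Kurzweil_Integration.integral_combine) (use that integrable_circ[OF cabs] in auto)
    moreover have "integral {a..b} (\<lambda>s. \<bar>q' s\<bar>) + integral {b..2*pi} (\<lambda>s. \<bar>q' s\<bar>) = integral {a..2*pi} (\<lambda>s. \<bar>q' s\<bar>)"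
      by (rule Henstock_Kurzweil_Integration.integral_combine)
         (use that in \<open>auto intro!: integrable_continuous_real continuous_on_subset[OF cabs]\<close>)
    ultimately show ?thesis
    proof -
      assume I: "integral {0..a} (\<lambda>s. \<bar>q' s\<bar>) + integral {a..2*pi} (\<lambda>s. \<bar>q' s\<bar>) = integral circ (\<lambda>s. \<bar>q' s\<bar>)"
        "integral {a..b} (\<lambda>s. \<bar>q' s\<bar>) + integral {b..2*pi} (\<lambda>s. \<bar>q' s\<bar>) = integral {a..2*pi} (\<lambda>s. \<bar>q' s\<bar>)"
      have "\<bar>q b - q a\<bar> \<le> \<bar>q a - q 0\<bar> + \<bar>q (2*pi) - q b\<bar>" using per by arith
      moreover have "\<bar>q a - q 0\<bar> \<le> integral {0..a} (\<lambda>s. \<bar>q' s\<bar>)" "\<bar>q b - q a\<bar> \<le> integral {a..b} (\<lambda>s. \<bar>q' s\<bar>)"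
        "\<bar>q (2*pi) - q b\<bar> \<le> integral {b..2*pi} (\<lambda>s. \<bar>q' s\<bar>)" using that by (auto intro!: step)
      moreover have "2*D \<le> T" if "D \<le> A + C" "A \<le> i1" "D \<le> i2" "C \<le> i3" "i1 + i4 = T" "i2 + i3 = i4" for A C D T i1 i2 i3 i4 :: real
        using that by linarith
      ultimately show ?thesis using I by blast
    qed
  qed
  show ?thesis
  proof (cases "s \<le> t")
    case True then show ?thesis using main[of s t] s by (auto simp: abs_if split: if_splits)
  next
    case False then show ?thesis using main[of t s] s by (auto simp: abs_if split: if_splits)
  qed
qed

section \<open>Periodic linear equations: mass, energy and the sup norm\<close>

text \<open>
  The period is treated as a closed interval: \<open>u\<close> and \<open>u'\<close> match at its ends, but \<open>u''\<close> does not, because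
  the right-hand side \<open>k\<close> need not be periodic. The constants \<open>\<kappa>\<close>, \<open>\<mu>\<close> and \<open>y\<close> below belong to the
  gauge transform \<open>u exp(- i\<kappa>s)\<close> with \<open>\<kappa> = \<omega>/(2\<delta>)\<close>, which removes the first-order term at the price of replacing \<open>Z\<close>
  by \<open>\<mu> = Z - \<omega>\<^sup>2/(4\<delta>)\<close>. The transformed function is not periodic, but its modulus and the modulus of its derivative are.
\<close>

locale periodic_linear =
  fixes \<delta> \<omega> Z :: real and u u1 u2 k :: "real \<Rightarrow> complex"
  assumes delta: "0 < \<delta>"
    and du: "\<And>s. s \<in> circ \<Longrightarrow> (u has_vector_derivative u1 s) (at s within circ)"
    and du1: "\<And>s. s \<in> circ \<Longrightarrow> (u1 has_vector_derivative u2 s) (at s within circ)"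
    and per: "u 0 = u (2*pi)" "u1 0 = u1 (2*pi)"
    and k: "continuous_on circ k"
    and eq: "\<And>s. s \<in> circ \<Longrightarrow> - of_real \<delta> * u2 s + \<i> * of_real \<omega> * u1 s + (of_real Z - \<i>) * u s = k s"
begin

lemma cu [continuous_intros]: "continuous_on circ u" by (rule has_vector_derivative_continuous_on[OF du])
lemma cu1 [continuous_intros]: "continuous_on circ u1" by (rule has_vector_derivative_continuous_on[OF du1])
lemma u2_eq: "s \<in> circ \<Longrightarrow> u2 s = (\<i> * of_real \<omega> * u1 s + (of_real Z - \<i>) * u s - k s) / of_real \<delta>"
  using eq[of s] delta by (simp add: field_simps)
lemma cu2 [continuous_intros]: "continuous_on circ u2"
  by (rule continuous_on_eq[where f="\<lambda>s. (\<i> * of_real \<omega> * u1 s + (of_real Z - \<i>) * u s - k s) / of_real \<delta>"])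
     (auto intro!: continuous_intros k simp: u2_eq delta[THEN less_imp_neq, symmetric])

lemma dcu: "s \<in> circ \<Longrightarrow> ((\<lambda>s. cnj (u s)) has_vector_derivative cnj (u1 s)) (at s within circ)"
  by (rule bounded_linear.has_vector_derivative[OF bounded_linear_cnj du])
lemma dcu1: "s \<in> circ \<Longrightarrow> ((\<lambda>s. cnj (u1 s)) has_vector_derivative cnj (u2 s)) (at s within circ)"
  by (rule bounded_linear.has_vector_derivative[OF bounded_linear_cnj du1])

definition "n = l2 u"
definition "x = l2 u1"
definition "\<kappa> = \<omega>/(2*\<delta>)"
definition "y = l2 (\<lambda>s. u1 s - \<i> * of_real \<kappa> * u s)"
definition "\<mu> = Z - \<omega>^2/(4*\<delta>)"

lemma nonneg: "0 \<le> n" "0 \<le> x" "0 \<le> y" by (simp_all add: n_def x_def y_def)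

lemma Im_eq: "s \<in> circ \<Longrightarrow> - \<delta> * Im (u2 s * cnj (u s)) + \<omega> * Re (u1 s * cnj (u s)) - (cmod (u s))^2 = Im (k s * cnj (u s))"
  unfolding eq[symmetric] by (simp add: cmod_sq algebra_simps)

lemma Re_eq: "s \<in> circ \<Longrightarrow> - \<delta> * Re (u2 s * cnj (u s)) - \<omega> * Im (u1 s * cnj (u s)) + Z * (cmod (u s))^2 = Re (k s * cnj (u s))"
  unfolding eq[symmetric] by (simp add: cmod_sq algebra_simps)

text \<open>
  The imaginary part of the equation times the conjugate of \<open>u\<close> is a total derivative up to the damping
  term \<open>\<bar>u\<bar>\<^sup>2\<close> and the source.
\<close>

lemma mass_balance: "integral circ (\<lambda>s. (cmod (u s))^2 + Im (k s * cnj (u s))) = 0"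
proof -
  define G where "G s = - \<delta> * Im (u1 s * cnj (u s)) + \<omega>/2 * (cmod (u s))^2" for s
  have sq: "(cmod (u s))^2 = Re (u s * cnj (u s))" for s by (simp add: cmod_sq)
  have "(G has_vector_derivative (cmod (u s))^2 + Im (k s * cnj (u s))) (at s within circ)" if s: "s \<in> circ" for s
  proof -
    have "(G has_vector_derivative - \<delta> * Im (u1 s * cnj (u1 s) + u2 s * cnj (u s))
        + \<omega>/2 * Re (u s * cnj (u1 s) + u1 s * cnj (u s))) (at s within circ)"
      unfolding G_def sq
      by (intro has_vector_derivative_add has_vector_derivative_mult_right
          bounded_linear.has_vector_derivative[OF bounded_linear_Im] bounded_linear.has_vector_derivative[OF bounded_linear_Re]
          has_vector_derivative_mult du du1 dcu dcu1 s)
    then show ?thesis by (rule has_vector_derivative_eq_rhs) (use Im_eq[OF s] in \<open>simp add: algebra_simps\<close>)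
  qed
  then have "integral circ (\<lambda>s. (cmod (u s))^2 + Im (k s * cnj (u s))) = G (2*pi) - G 0" by (rule FTC_circ)
  then show ?thesis by (simp add: G_def per)
qed

lemma mass: "n^2 = - integral circ (\<lambda>s. Im (k s * cnj (u s)))"
proof -
  have "integral circ (\<lambda>s. (cmod (u s))^2 + Im (k s * cnj (u s))) = integral circ (\<lambda>s. (cmod (u s))^2) + integral circ (\<lambda>s. Im (k s * cnj (u s)))"
    by (rule integral_add; intro integrable_circ continuous_intros k)
  then show ?thesis using mass_balance unfolding n_def l2_sq by simp
qed

lemma energy: "\<delta> * x^2 - \<omega> * integral circ (\<lambda>s. Im (u1 s * cnj (u s))) + Z * n^2 = integral circ (\<lambda>s. Re (k s * cnj (u s)))"
proof -
  define G where "G s = - \<delta> * Re (u1 s * cnj (u s))" for s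
  have "(G has_vector_derivative Re (k s * cnj (u s)) - (\<delta> * (cmod (u1 s))^2 - \<omega> * Im (u1 s * cnj (u s)) + Z * (cmod (u s))^2)) (at s within circ)" if s: "s \<in> circ" for s
  proof -
    have "(G has_vector_derivative - \<delta> * Re (u1 s * cnj (u1 s) + u2 s * cnj (u s))) (at s within circ)"
      unfolding G_def
      by (intro has_vector_derivative_mult_right bounded_linear.has_vector_derivative[OF bounded_linear_Re]
          has_vector_derivative_mult du du1 dcu dcu1 s)
    then show ?thesis by (rule has_vector_derivative_eq_rhs) (use Re_eq[OF s] in \<open>simp add: cmod_sq algebra_simps\<close>)
  qed
  then have "integral circ (\<lambda>s. Re (k s * cnj (u s)) - (\<delta> * (cmod (u1 s))^2 - \<omega> * Im (u1 s * cnj (u s)) + Z * (cmod (u s))^2)) = G (2*pi) - G 0" by (rule FTC_circ)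
  also have "\<dots> = 0" by (simp add: G_def per)
  also have "integral circ (\<lambda>s. Re (k s * cnj (u s)) - (\<delta> * (cmod (u1 s))^2 - \<omega> * Im (u1 s * cnj (u s)) + Z * (cmod (u s))^2)) =
     integral circ (\<lambda>s. Re (k s * cnj (u s))) - (\<delta> * x^2 - \<omega> * integral circ (\<lambda>s. Im (u1 s * cnj (u s))) + Z * n^2)"
    unfolding n_def x_def l2_sq
    by (subst integral_diff integral_add integral_mult_right; (intro integrable_circ continuous_intros k)?)+ simp
  finally show ?thesis by simp
qed

text \<open>
  The energy balance with the square completed in the first-order term.
\<close>

lemma gauge_energy: "\<delta> * y^2 + \<mu> * n^2 = integral circ (\<lambda>s. Re (k s * cnj (u s)))"
proof -
  have pt: "(cmod (u1 s - \<i> * of_real \<kappa> * u s))^2 = (cmod (u1 s))^2 - 2*\<kappa> * Im (u1 s * cnj (u s)) + \<kappa>^2 * (cmod (u s))^2" for s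
    by (simp add: cmod_sq power2_eq_square[of \<kappa>] algebra_simps)
  have "y^2 = x^2 - 2*\<kappa> * integral circ (\<lambda>s. Im (u1 s * cnj (u s))) + \<kappa>^2 * n^2"
    unfolding n_def x_def y_def l2_sq pt
    by (subst integral_diff integral_add integral_mult_right; (intro integrable_circ continuous_intros k)?)+ simp
  moreover have "\<delta>*(a - 2*\<kappa>*b + \<kappa>^2*c) + \<mu>*c = \<delta>*a - (2*\<delta>*\<kappa>)*b + (\<delta>*\<kappa>^2 + \<mu>)*c" for a b c
    by (simp add: algebra_simps)
  ultimately have "\<delta>*y^2 + \<mu>*n^2 = \<delta>*x^2 - (2*\<delta>*\<kappa>) * integral circ (\<lambda>s. Im (u1 s * cnj (u s))) + (\<delta>*\<kappa>^2 + \<mu>) * n^2"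
    by simp
  moreover have "2*\<delta>*\<kappa> = \<omega>" "\<delta>*\<kappa>^2 + \<mu> = Z" unfolding \<kappa>_def \<mu>_def using delta by (simp_all add: field_simps power2_eq_square)
  ultimately show ?thesis using energy by simp
qed

text \<open>
  The derivative of \<open>\<bar>u\<bar>\<^sup>2\<close> sees \<open>u'\<close> only up to a multiple of \<open>iu\<close>, which is why the gauge parameter \<open>c\<close> is free.
\<close>

lemma osc_bound:
  assumes "s \<in> circ" "t \<in> circ"
  shows "(cmod (u s))^2 - (cmod (u t))^2 \<le> n * l2 (\<lambda>s. u1 s - \<i> * of_real c * u s)"
proof -
  define q' where "q' s = 2 * Re ((u1 s - \<i> * of_real c * u s) * cnj (u s))" for s
  have sq: "(cmod (u s))^2 = Re (u s * cnj (u s))" for s by (simp add: cmod_sq)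
  have d: "((\<lambda>s. (cmod (u s))^2) has_vector_derivative q' s) (at s within circ)" if s: "s \<in> circ" for s
  proof -
    have "((\<lambda>s. Re (u s * cnj (u s))) has_vector_derivative Re (u s * cnj (u1 s) + u1 s * cnj (u s))) (at s within circ)"
      by (intro bounded_linear.has_vector_derivative[OF bounded_linear_Re] has_vector_derivative_mult du dcu s)
    then show ?thesis unfolding sq q'_def by (simp add: algebra_simps)
  qed
  have cq: "continuous_on circ q'" unfolding q'_def by (intro continuous_intros)
  have "2*((cmod (u s))^2 - (cmod (u t))^2) \<le> integral circ (\<lambda>s. \<bar>q' s\<bar>)"
    by (rule periodic_sup_le_mean[OF d cq]) (use per assms in auto)
  also have "\<dots> \<le> integral circ (\<lambda>s. 2*(cmod (u s) * cmod (u1 s - \<i> * of_real c * u s)))"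
  proof (intro integral_le integrable_circ continuous_intros cq)
    fix s
    show "\<bar>q' s\<bar> \<le> 2*(cmod (u s) * cmod (u1 s - \<i> * of_real c * u s))"
      using abs_Re_le_cmod[of "(u1 s - \<i> * of_real c * u s) * cnj (u s)"] unfolding q'_def norm_mult complex_mod_cnj by (simp add: mult.commute abs_mult)
  qed
  also have "\<dots> = 2 * integral circ (\<lambda>s. cmod (u s) * cmod (u1 s - \<i> * of_real c * u s))" by simp
  also have "\<dots> \<le> 2*(n * l2 (\<lambda>s. u1 s - \<i> * of_real c * u s))"
    unfolding n_def by (intro mult_left_mono integral_norm_mult_le_l2 continuous_intros) auto
  finally show ?thesis by simp
qed

lemma sup_bound:
  assumes "s \<in> circ"
  shows "(cmod (u s))^2 \<le> n^2/(2*pi) + n * l2 (\<lambda>s. u1 s - \<i> * of_real c * u s)"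
proof -
  let ?R = "n * l2 (\<lambda>s. u1 s - \<i> * of_real c * u s)"
  have "integral circ (\<lambda>t. (cmod (u s))^2 - ?R) \<le> integral circ (\<lambda>t. (cmod (u t))^2)"
    by (intro integral_le integrable_circ continuous_intros) (use osc_bound[OF assms, of _ c] in \<open>auto simp: algebra_simps\<close>)
  then have "2*pi*((cmod (u s))^2 - ?R) \<le> n^2" unfolding n_def l2_sq by simp
  then show ?thesis by (simp add: field_simps)
qed

lemma sup_bound_x: "s \<in> circ \<Longrightarrow> (cmod (u s))^2 \<le> n^2/(2*pi) + n*x"
  using sup_bound[of s 0] by (simp add: x_def)
lemma sup_bound_y: "s \<in> circ \<Longrightarrow> (cmod (u s))^2 \<le> n^2/(2*pi) + n*y"
  using sup_bound[of s \<kappa>] by (simp add: y_def)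

end

section \<open>The saturated Kerr nonlinearity\<close>

text \<open>
  A \<open>C\<^sup>1\<close> function that is the identity up to \<open>a\<close> and stays below \<open>2a\<close>. Beyond \<open>a\<close> it is chosen such that
  \<open>t sat'(t) \<le> a\<close> there as well: this logarithmic Lipschitz bound keeps the one-sided constant of the
  saturated Kerr term at \<open>a\<close>, exactly that of the cubic term on \<open>\<bar>u\<bar>\<^sup>2 \<le> a\<close>.
\<close>

definition sat :: "real \<Rightarrow> real \<Rightarrow> real" where
  "sat a t = (if t \<le> a then t else 2*a - a^2/t)"

definition sat' :: "real \<Rightarrow> real \<Rightarrow> real" where
  "sat' a t = (if t \<le> a then 1 else a^2/t^2)"

lemma sat_props:
  assumes a: "0 < a" and t: "0 \<le> t"
  shows "0 \<le> sat a t" "sat a t \<le> t" "sat a t \<le> 2*a" "0 \<le> sat' a t" "sat' a t \<le> 1"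
proof -
  show "0 \<le> sat a t"
  proof (cases "t \<le> a")
    case False
    then have "a*a \<le> 2*a*t" using a by (intro mult_mono) auto
    then show ?thesis using False a by (simp add: sat_def field_simps power2_eq_square)
  qed (use t in \<open>simp add: sat_def\<close>)
  show "sat a t \<le> t"
  proof (cases "t \<le> a")
    case False
    have "0 \<le> (t-a)^2" by simp
    then show ?thesis using False a by (simp add: sat_def field_simps power2_eq_square)
  qed (simp add: sat_def)
  show "sat a t \<le> 2*a" using a t by (auto simp: sat_def)
  show "0 \<le> sat' a t" by (simp add: sat'_def)
  show "sat' a t \<le> 1"
  proof (cases "t \<le> a")
    case False
    then have "a^2 \<le> t^2" using a by (intro power_mono) auto
    then show ?thesis using False a by (simp add: sat'_def)
  qed (simp add: sat'_def)
qed

lemma sat_mono: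
  assumes a: "0 < a" and "0 \<le> p" "p \<le> r"
  shows "sat a p \<le> sat a r"
proof (cases "p \<le> a")
  case True
  have "a^2/r \<le> a" if "a < r" using that a by (simp add: field_simps power2_eq_square)
  then show ?thesis using True assms by (auto simp: sat_def not_le)
next
  case False
  then have "a^2/r \<le> a^2/p" using assms by (intro divide_left_mono) auto
  then show ?thesis using False assms by (simp add: sat_def)
qed

lemma sat_deriv:
  assumes a: "0 < a"
  shows "(sat a has_vector_derivative sat' a t) (at t)"
proof -
  have "((\<lambda>t. if t \<in> {..a} then t else 2*a - a^2/t) has_vector_derivative (if t \<in> {..a} then 1 else a^2/t^2)) (at t within UNIV)"
  proof (rule has_vector_derivative_If_within_closures[where T="{a..}"])
    assume "t \<in> {a..} \<union> closure {..a} \<inter> closure {a..}"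
    then have "0 < t" using a by auto
    then have "((\<lambda>t. 2*a - a^2/t) has_real_derivative a^2/t^2) (at t)"
      by (auto intro!: derivative_eq_intros simp: power2_eq_square)
    then show "((\<lambda>t. 2*a - a^2/t) has_vector_derivative a^2/t^2) (at t within {a..} \<union> closure {..a} \<inter> closure {a..})"
      by (rule has_vector_derivative_at_within[OF has_real_derivative_iff_has_vector_derivative[THEN iffD1]])
  qed (use a in \<open>auto simp: power2_eq_square intro!: has_vector_derivative_id_at derivative_eq_intros\<close>)
  then show ?thesis by (simp add: sat_def[abs_def] sat'_def)
qed

text \<open>
  The second bound is an integrated form of \<open>t sat'(t) \<le> a\<close>: the logarithmic mean of \<open>s\<close> and \<open>t\<close> is at least their
  geometric mean.
\<close>

lemma sat_lipschitz_log:
  assumes a: "0 < a" and s: "0 \<le> s" and t: "0 \<le> t"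
  shows "\<bar>sat a s - sat a t\<bar> \<le> \<bar>s - t\<bar>" "\<bar>sat a s - sat a t\<bar> * sqrt (s*t) \<le> a * \<bar>s - t\<bar>"
proof -
  have *: "0 \<le> sat a p - sat a q \<and> sat a p - sat a q \<le> p - q \<and> (sat a p - sat a q) * sqrt (p*q) \<le> a * (p - q)" if pq: "0 \<le> q" "q \<le> p" for p q
  proof (cases "p \<le> a")
    case True
    have "sqrt (p*q) \<le> sqrt (a*a)" using pq True by (intro real_sqrt_le_mono mult_mono) auto
    then have "(p - q)* sqrt (p*q) \<le> (p - q)*a" using pq a by (intro mult_left_mono) auto
    then show ?thesis using True pq by (simp add: sat_def mult.commute)
  next
    case False
    then have p0: "a < p" by simp
    show ?thesis
    proof (cases "q \<le> a")
      case True
      have e: "sat a p - sat a q = 2*a - a^2/p - q" using False True by (simp add: sat_def)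
      have "a^2/p \<le> a" using p0 a by (simp add: field_simps power2_eq_square)
      then have 1: "0 \<le> sat a p - sat a q" using True unfolding e by linarith
      have "0 \<le> (p-a)^2" by simp
      then have "2*a - a^2/p \<le> p" using p0 a by (simp add: field_simps power2_eq_square)
      then have 2: "sat a p - sat a q \<le> p - q" unfolding e by linarith
      have 3: "(2*a - a^2/p - q) * sqrt (p*q) \<le> a * (p - q)"
      proof (cases "q = 0")
        case True then show ?thesis using a p0 by simp
      next
        case False
        then have q0: "0 < q" using pq by simp
        define w where "w = sqrt (p*q)"
        have w: "0 < w" "w^2 = p*q" unfolding w_def using p0 q0 a by auto
        have "(2*a - a^2/p - q)*w \<le> a*(p - q)"
        proof -
          have "p*(a*(p - q) - (2*a - a^2/p - q)*w) = a*(p^2 - w^2) - 2*a*p*w + a^2*w + w^2*w"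
            unfolding w(2) using p0 a by (simp add: field_simps power2_eq_square)
          also have "\<dots> = a*(p - w)^2 + w*(a - w)^2"
            by (simp add: power2_eq_square algebra_simps)
          also have "\<dots> \<ge> 0" using a w by simp
          finally have "0 \<le> p*(a*(p - q) - (2*a - a^2/p - q)*w)" .
          then show ?thesis using p0 a by (simp add: zero_le_mult_iff)
        qed
        then show ?thesis unfolding w_def .
      qed
      show ?thesis using 1 2 3 e by simp
    next
      case F2: False
      then have q0: "a < q" by simp
      have e: "sat a p - sat a q = a^2*(p - q)/(p*q)" using False F2 a by (simp add: sat_def field_simps)
      have pq0: "0 < p*q" using p0 q0 a by simp
      have apq: "a^2 \<le> p*q" using p0 q0 a by (simp add: power2_eq_square mult_mono)
      have 1: "0 \<le> sat a p - sat a q" unfolding e using pq pq0 by simp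
      have "a^2*(p - q) \<le> p*q*(p - q)" using apq pq by (intro mult_right_mono) auto
      then have 2: "sat a p - sat a q \<le> p - q" unfolding e using pq0 by (simp add: pos_divide_le_eq mult.commute)
      have "sqrt (a^2) \<le> sqrt (p*q)" using apq by (rule real_sqrt_le_mono)
      then have sw: "a \<le> sqrt (p*q)" using a by simp
      define w where "w = sqrt (p*q)"
      have w: "0 < w" "p*q = w^2" "a \<le> w" unfolding w_def using pq0 sw by auto
      have "a^2*(p-q)/w^2*w = a*(p-q)*(a/w)" using w(1) by (simp add: power2_eq_square)
      also have "\<dots> \<le> a*(p-q)*1" by (rule mult_left_mono) (use w a pq in auto)
      finally have "a^2*(p-q)/(p*q) * sqrt (p*q) \<le> a*(p-q)" unfolding w_def[symmetric] w(2)[symmetric] by simp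
      then show ?thesis using 1 2 e by simp
    qed
  qed
  have "\<bar>sat a s - sat a t\<bar> \<le> \<bar>s - t\<bar> \<and> \<bar>sat a s - sat a t\<bar> * sqrt (s*t) \<le> a * \<bar>s - t\<bar>"
  proof (cases "t \<le> s")
    case True then show ?thesis using *[of t s] t by (simp add: abs_of_nonneg)
  next
    case False then show ?thesis using *[of s t] s by (simp add: abs_minus_commute[of _ "sat a t"] abs_minus_commute[of s] mult.commute[of s] abs_of_nonneg)
  qed
  then show "\<bar>sat a s - sat a t\<bar> \<le> \<bar>s - t\<bar>" "\<bar>sat a s - sat a t\<bar> * sqrt (s*t) \<le> a * \<bar>s - t\<bar>" by auto
qed

definition kerr :: "real \<Rightarrow> complex \<Rightarrow> complex" where
  "kerr a z = of_real (sat a ((cmod z)^2)) * z"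

text \<open>
  For \<open>\<bar>w\<bar> \<le> \<bar>z\<bar>\<close> write the difference as \<open>r(z - w) + (r - q)w\<close> with the saturated intensities \<open>r\<close>, \<open>q\<close> of \<open>z\<close>, \<open>w\<close>. Each term
  contributes \<open>2a\<close>, the second by the logarithmic Lipschitz bound.
\<close>

lemma kerr_lipschitz:
  assumes a: "0 < a"
  shows "cmod (kerr a z - kerr a w) \<le> 4*a*cmod (z - w)"
proof -
  have *: "cmod (kerr a z - kerr a w) \<le> 4*a*cmod (z - w)" if zw: "cmod w \<le> cmod z" for z w
  proof (cases "z = 0")
    case True then show ?thesis using zw by simp
  next
    case False
    define r q where "r = sat a ((cmod z)^2)" and "q = sat a ((cmod w)^2)"
    have z0: "0 < cmod z" using False by simp
    have "\<bar>r - q\<bar> * sqrt ((cmod z)^2*(cmod w)^2) \<le> a * \<bar>(cmod z)^2 - (cmod w)^2\<bar>"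
      unfolding r_def q_def by (rule sat_lipschitz_log(2)[OF a]) auto
    also have "sqrt ((cmod z)^2*(cmod w)^2) = cmod z * cmod w" by (simp add: real_sqrt_mult)
    also have "\<bar>(cmod z)^2 - (cmod w)^2\<bar> = (cmod z - cmod w)*(cmod z + cmod w)"
      using zw power_mono[OF zw, of 2] by (simp add: abs_of_nonneg power2_eq_square algebra_simps)
    also have "a*((cmod z - cmod w)*(cmod z + cmod w)) \<le> a*(cmod (z - w)*(2*cmod z))"
      using zw a norm_triangle_ineq2[of z w] by (intro mult_left_mono mult_mono) auto
    finally have "cmod z * (\<bar>r - q\<bar> * cmod w) \<le> cmod z * (2*a*cmod (z - w))" by (simp add: algebra_simps)
    then have 1: "\<bar>r - q\<bar> * cmod w \<le> 2*a*cmod (z - w)" using z0 by simp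
    have r: "0 \<le> r" "r \<le> 2*a" unfolding r_def using sat_props[OF a] by auto
    have "kerr a z - kerr a w = of_real r * (z - w) + of_real (r - q) * w"
      unfolding kerr_def r_def q_def by (simp add: algebra_simps)
    then have "cmod (kerr a z - kerr a w) \<le> cmod (of_real r * (z - w)) + cmod (of_real (r - q) * w)" by (metis norm_triangle_ineq)
    also have "\<dots> = r*cmod (z - w) + \<bar>r - q\<bar>*cmod w" using r by (simp only: norm_mult norm_of_real abs_of_nonneg)
    also have "r*cmod (z - w) \<le> 2*a*cmod (z - w)" using r by (intro mult_right_mono) auto
    finally show ?thesis using 1 by simp
  qed
  show ?thesis
  proof (cases "cmod w \<le> cmod z")
    case False then show ?thesis using *[of z w] by (simp add: norm_minus_commute)
  qed (rule *)
qed

text \<open>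
  Only the rotation of \<open>z\<close> against \<open>w\<close> enters: the left-hand side is \<open>\<bar>r - q\<bar>\<close> times \<open>\<bar>Im(z cnj w)\<bar>\<close>. By
  Cauchy-Schwarz against \<open>(r - q, 2a)\<close> and the logarithmic Lipschitz bound this is at most \<open>a\<bar>z - w\<bar>\<^sup>2\<close>. The constant \<open>a\<close>, rather than
  a multiple of it, is what makes amplitudes up to 1 admissible.
\<close>

lemma kerr_one_sided:
  assumes a: "0 < a"
  shows "\<bar>Im ((kerr a z - kerr a w) * cnj (z - w))\<bar> \<le> a * (cmod (z - w))^2"
proof -
  define r q where "r = sat a ((cmod z)^2)" and "q = sat a ((cmod w)^2)"
  define I R where "I = Im (z * cnj w)" and "R = Re (z * cnj w)"
  define A B where "A = (cmod z)^2" and "B = (cmod w)^2"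
  have IR: "I^2 + R^2 = A*B" unfolding I_def R_def A_def B_def
    by (metis add.commute cmod_power2 complex_mod_cnj norm_mult power_mult_distrib)
  have e: "Im ((kerr a z - kerr a w) * cnj (z - w)) = (q - r)*I"
    unfolding kerr_def r_def q_def I_def by (simp add: algebra_simps)
  have d: "(cmod (z - w))^2 = A + B - 2*R" unfolding A_def B_def R_def by (simp add: cmod_sq algebra_simps)
  have K: "\<bar>r - q\<bar>* sqrt (A*B) \<le> a*\<bar>A - B\<bar>" unfolding r_def q_def A_def B_def by (rule sat_lipschitz_log(2)[OF a]) auto
  have AB: "0 \<le> A" "0 \<le> B" unfolding A_def B_def by auto
  have K2: "(r - q)^2*(A*B) \<le> a^2*(A - B)^2"
    using power_mono[OF K, of 2] AB by (simp add: power_mult_distrib)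
  have "(\<bar>r - q\<bar>*\<bar>I\<bar> + 2*a*R)^2 \<le> ((r - q)^2 + (2*a)^2)*(I^2 + R^2)"
  proof -
    have "(d*i + c*e)^2 \<le> (d^2 + c^2)*(i^2 + e^2)" for d i c e :: real
    proof -
      have "0 \<le> (d*e - c*i)^2" by simp
      then show ?thesis by (simp add: power2_eq_square algebra_simps)
    qed
    from this[of "\<bar>r - q\<bar>" "\<bar>I\<bar>" "2*a" R] show ?thesis by simp
  qed
  also have "\<dots> = (r - q)^2*(A*B) + 4*a^2*(A*B)" unfolding IR by (simp add: power2_eq_square algebra_simps)
  also have "\<dots> \<le> a^2*(A - B)^2 + 4*a^2*(A*B)" using K2 by simp
  also have "\<dots> = (a*(A + B))^2" by (simp add: power2_eq_square algebra_simps)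
  finally have "\<bar>r - q\<bar>*\<bar>I\<bar> + 2*a*R \<le> a*(A + B)" by (rule power2_le_imp_le) (use a AB in simp)
  then have "\<bar>q - r\<bar>*\<bar>I\<bar> \<le> a*(A + B - 2*R)" by (simp add: abs_minus_commute algebra_simps)
  then show ?thesis unfolding e d by (simp add: abs_mult)
qed

section \<open>A priori identities for saturated solutions\<close>

text \<open>
  The forcing \<open>f\<close> is continuously differentiable on the closed period, with a possible jump between its
  ends. The saturation level \<open>a\<close> is arbitrary, so that the estimates apply both to the saturated equation and, with \<open>a\<close>
  above the maximum of \<open>\<bar>u\<bar>\<^sup>2\<close>, to every solution of the cubic one.
\<close>

locale kerr_solution =
  fixes \<delta> \<omega> Z \<sigma> a M :: real and f f1 u u1 u2 :: "real \<Rightarrow> complex"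
  assumes delta: "0 < \<delta>"
    and du: "\<And>s. s \<in> circ \<Longrightarrow> (u has_vector_derivative u1 s) (at s within circ)"
    and du1: "\<And>s. s \<in> circ \<Longrightarrow> (u1 has_vector_derivative u2 s) (at s within circ)"
    and per: "u 0 = u (2*pi)" "u1 0 = u1 (2*pi)"
    and df: "\<And>s. s \<in> circ \<Longrightarrow> (f has_vector_derivative f1 s) (at s within circ)"
    and cf1: "continuous_on circ f1"
    and M: "\<And>s. s \<in> circ \<Longrightarrow> cmod (f1 s) \<le> M"
    and sigma: "\<sigma> = 1 \<or> \<sigma> = -1" and a: "0 < a"
    and eq: "\<And>s. s \<in> circ \<Longrightarrow> - of_real \<delta> * u2 s + \<i> * of_real \<omega> * u1 s + (of_real Z - \<i>) * u s
        = of_real \<sigma> * kerr a (u s) - \<i> * f s"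
begin

lemma cf: "continuous_on circ f" by (rule has_vector_derivative_continuous_on[OF df])
lemma u_cont: "continuous_on circ u" by (rule has_vector_derivative_continuous_on[OF du])

definition "q s = (cmod (u s))^2"
definition "\<rho> s = sat a (q s)"

lemma kerr_u: "kerr a (u s) = of_real (\<rho> s) * u s" by (simp add: kerr_def \<rho>_def q_def)

lemma dq: "s \<in> circ \<Longrightarrow> (q has_vector_derivative 2 * Re (u1 s * cnj (u s))) (at s within circ)"
proof -
  assume s: "s \<in> circ"
  have sq: "q = (\<lambda>s. Re (u s * cnj (u s)))" by (auto simp: q_def cmod_sq)
  have "((\<lambda>s. Re (u s * cnj (u s))) has_vector_derivative Re (u s * cnj (u1 s) + u1 s * cnj (u s))) (at s within circ)"
    by (intro bounded_linear.has_vector_derivative[OF bounded_linear_Re] has_vector_derivative_mult du s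
        bounded_linear.has_vector_derivative[OF bounded_linear_cnj du[OF s]])
  then show ?thesis unfolding sq by (rule has_vector_derivative_eq_rhs) (simp add: algebra_simps)
qed

lemma q0: "0 \<le> q s" by (simp add: q_def)
lemma rho: "0 \<le> \<rho> s" "\<rho> s \<le> q s" unfolding \<rho>_def using sat_props[OF a q0] by auto

lemma drho: "s \<in> circ \<Longrightarrow> (\<rho> has_vector_derivative sat' a (q s) * (2 * Re (u1 s * cnj (u s)))) (at s within circ)"
proof -
  assume s: "s \<in> circ"
  have "(sat a \<circ> q has_vector_derivative (2 * Re (u1 s * cnj (u s))) *\<^sub>R sat' a (q s)) (at s within circ)"
    by (rule vector_diff_chain_within[OF dq[OF s] has_vector_derivative_at_within[OF sat_deriv[OF a]]])
  then show ?thesis by (simp add: comp_def \<rho>_def[abs_def] mult.commute)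
qed

lemma crho: "continuous_on circ \<rho>" by (rule has_vector_derivative_continuous_on[OF drho])

sublocale periodic_linear \<delta> \<omega> Z u u1 u2 "\<lambda>s. of_real \<sigma> * kerr a (u s) - \<i> * f s"
proof
  show "continuous_on circ (\<lambda>s. of_real \<sigma> * kerr a (u s) - \<i> * f s)"
    unfolding kerr_u by (intro continuous_intros crho u_cont cf)
qed (use delta du du1 per eq in auto)

definition "F = l2 f"
definition "J = cmod (f (2*pi) - f 0)"

lemma Fpos: "0 \<le> F" by (simp add: F_def)

lemma Im_k: "Im ((of_real \<sigma> * kerr a (u s) - \<i> * f s) * cnj (u s)) = - Re (f s * cnj (u s))"
  unfolding kerr_u by (simp add: algebra_simps)
lemma Re_k: "Re ((of_real \<sigma> * kerr a (u s) - \<i> * f s) * cnj (u s)) = \<sigma> * (\<rho> s * q s) + Im (f s * cnj (u s))"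
  unfolding kerr_u q_def by (simp add: cmod_sq algebra_simps)

lemma mass_f: "n^2 = integral circ (\<lambda>s. Re (f s * cnj (u s)))"
  using mass unfolding Im_k integral_neg by simp

lemma f_u_le: "integral circ (\<lambda>s. cmod (f s) * cmod (u s)) \<le> F * n"
  unfolding F_def n_def by (intro integral_norm_mult_le_l2 cf cu)

text \<open>
  The Kerr term is real relative to \<open>u\<close>, so the mass balance involves only the forcing.
\<close>

lemma n_le_F: "n \<le> F"
proof -
  have "n^2 \<le> integral circ (\<lambda>s. cmod (f s) * cmod (u s))"
    unfolding mass_f
    by (intro integral_le integrable_circ continuous_intros cf)
       (metis complex_Re_le_cmod complex_mod_cnj norm_mult)
  then have "n*n \<le> F*n" using f_u_le by (simp add: power2_eq_square)
  then show ?thesis using nonneg Fpos by (cases "n = 0") auto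
qed

lemma Im_f_le: "\<bar>integral circ (\<lambda>s. Im (f s * cnj (u s)))\<bar> \<le> F * n"
proof -
  have "norm (integral circ (\<lambda>s. Im (f s * cnj (u s)))) \<le> integral circ (\<lambda>s. cmod (f s) * cmod (u s))"
    by (intro integral_norm_bound_integral integrable_circ continuous_intros cf)
       (metis abs_Im_le_cmod complex_mod_cnj norm_mult real_norm_def)
  then show ?thesis using f_u_le by simp
qed

lemma Im_u1_le: "\<bar>integral circ (\<lambda>s. Im (u1 s * cnj (u s)))\<bar> \<le> x * n"
proof -
  have "norm (integral circ (\<lambda>s. Im (u1 s * cnj (u s)))) \<le> integral circ (\<lambda>s. cmod (u1 s) * cmod (u s))"
    by (intro integral_norm_bound_integral integrable_circ continuous_intros)
       (metis abs_Im_le_cmod complex_mod_cnj norm_mult real_norm_def)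
  also have "\<dots> \<le> x * n" unfolding x_def n_def by (intro integral_norm_mult_le_l2 continuous_intros)
  finally show ?thesis by simp
qed

definition "Q = integral circ (\<lambda>s. \<rho> s * q s)"

lemma cq [continuous_intros]: "continuous_on circ q" unfolding q_def by (intro continuous_intros)

lemma Q_nonneg: "0 \<le> Q" unfolding Q_def
  by (intro integral_nonneg integrable_circ continuous_intros crho) (intro mult_nonneg_nonneg rho q0)

lemma Q_le:
  assumes S: "\<And>s. s \<in> circ \<Longrightarrow> cmod (u s) \<le> S"
  shows "Q \<le> S^2 * n^2"
proof -
  have "Q \<le> integral circ (\<lambda>s. S^2 * (cmod (u s))^2)" unfolding Q_def
  proof (intro integral_le integrable_circ continuous_intros crho)
    fix s assume s: "s \<in> circ"
    have "\<rho> s \<le> S^2" using rho(2)[of s] power_mono[OF S[OF s], of 2] by (simp add: q_def)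
    then show "\<rho> s * q s \<le> S^2 * (cmod (u s))^2" unfolding q_def by (intro mult_right_mono) auto
  qed
  then show ?thesis unfolding n_def l2_sq by simp
qed

lemma int_Re_k: "integral circ (\<lambda>s. Re ((of_real \<sigma> * kerr a (u s) - \<i> * f s) * cnj (u s))) = \<sigma> * Q + integral circ (\<lambda>s. Im (f s * cnj (u s)))"
  unfolding Re_k Q_def
  by (subst integral_add integral_mult_right; (intro integrable_circ continuous_intros crho cf)?)+ simp

lemma gauge_energy_bound:
  assumes S: "\<And>s. s \<in> circ \<Longrightarrow> cmod (u s) \<le> S"
  shows "\<delta> * y^2 + \<mu> * n^2 \<le> (if \<sigma> = 1 then 1 else 0) * S^2 * n^2 + F * n"
proof -
  have E: "\<delta> * y^2 + \<mu> * n^2 = \<sigma> * Q + integral circ (\<lambda>s. Im (f s * cnj (u s)))"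
    using gauge_energy unfolding int_Re_k .
  have "\<sigma> * Q \<le> (if \<sigma> = 1 then 1 else 0) * S^2 * n^2"
    using sigma Q_nonneg Q_le[OF S] by (cases "\<sigma> = 1") simp_all
  then show ?thesis unfolding E using Im_f_le by linarith
qed

lemma energy_bound:
  assumes S: "\<And>s. s \<in> circ \<Longrightarrow> cmod (u s) \<le> S"
  shows "(- Z) * n^2 \<le> \<delta> * x^2 + \<bar>\<omega>\<bar> * x * n + F * n + (if \<sigma> = -1 then 1 else 0) * S^2 * n^2"
proof -
  define I1 where "I1 = integral circ (\<lambda>s. Im (u1 s * cnj (u s)))"
  define I2 where "I2 = integral circ (\<lambda>s. Im (f s * cnj (u s)))"
  have I1: "\<bar>I1\<bar> \<le> x * n" and I2: "\<bar>I2\<bar> \<le> F * n" unfolding I1_def I2_def by (rule Im_u1_le Im_f_le)+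
  have E: "\<delta> * x^2 - \<omega> * I1 + Z * n^2 = \<sigma> * Q + I2"
    using energy unfolding int_Re_k I1_def I2_def .
  have "\<omega> * I1 \<le> \<bar>\<omega> * I1\<bar>" "- (\<omega> * I1) \<le> \<bar>\<omega> * I1\<bar>" by auto
  moreover have "\<bar>\<omega> * I1\<bar> \<le> \<bar>\<omega>\<bar> * (x * n)" unfolding abs_mult by (rule mult_left_mono[OF I1]) simp
  moreover have "- (\<sigma> * Q) \<le> (if \<sigma> = -1 then 1 else 0) * S^2 * n^2"
    using sigma Q_nonneg Q_le[OF S] by (cases "\<sigma> = -1") simp_all
  moreover have "(- Z) * n^2 = - (Z * n^2)" "\<bar>\<omega>\<bar> * x * n = \<bar>\<omega>\<bar> * (x * n)" by simp_all
  ultimately show ?thesis using E I2 by linarith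
qed

text \<open>
  The function \<open>\<bar>u\<bar>\<^sup>2 - Re(f cnj u) = \<bar>u - f/2\<bar>\<^sup>2 - \<bar>f\<bar>\<^sup>2/4\<close> has mean zero by the mass balance, so its \<open>L\<^sup>1\<close> norm is twice
  that of its negative part, which is at most \<open>\<bar>f\<bar>\<^sup>2/4\<close>.
\<close>

lemma excess_mass: "integral circ (\<lambda>s. \<bar>q s - Re (f s * cnj (u s))\<bar>) \<le> F^2/2"
proof -
  have pt: "\<bar>q s - Re (f s * cnj (u s))\<bar> \<le> q s - Re (f s * cnj (u s)) + (cmod (f s))^2/2" for s
  proof -
    have "q s - Re (f s * cnj (u s)) + (cmod (f s))^2/4 = (cmod (u s - f s/2))^2"
      unfolding q_def by (simp add: cmod_sq field_simps)
    then have "0 \<le> q s - Re (f s * cnj (u s)) + (cmod (f s))^2/4" by (metis zero_le_power2)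
    moreover have "0 \<le> (cmod (f s))^2" by simp
    ultimately show ?thesis by linarith
  qed
  have "integral circ (\<lambda>s. \<bar>q s - Re (f s * cnj (u s))\<bar>) \<le> integral circ (\<lambda>s. q s - Re (f s * cnj (u s)) + (cmod (f s))^2/2)"
    by (intro integral_le integrable_circ continuous_intros cf pt) auto
  also have "\<dots> = integral circ q - integral circ (\<lambda>s. Re (f s * cnj (u s))) + integral circ (\<lambda>s. (cmod (f s))^2)/2"
  proof -
    have "integral circ (\<lambda>s. q s - Re (f s * cnj (u s)) + (cmod (f s))^2/2) =
        integral circ (\<lambda>s. q s - Re (f s * cnj (u s))) + integral circ (\<lambda>s. (cmod (f s))^2/2)"
      by (rule integral_add; intro integrable_circ continuous_intros cf; simp)
    moreover have "integral circ (\<lambda>s. q s - Re (f s * cnj (u s))) = integral circ q - integral circ (\<lambda>s. Re (f s * cnj (u s)))"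
      by (rule integral_diff; intro integrable_circ continuous_intros cf)
    moreover have "integral circ (\<lambda>s. (cmod (f s))^2/2) = integral circ (\<lambda>s. (cmod (f s))^2)/2" by (rule integral_divide)
    ultimately show ?thesis by (simp only:)
  qed
  also have "\<dots> = F^2/2" using mass_f unfolding F_def l2_sq n_def q_def by (simp only:)
  finally show ?thesis .
qed

text \<open>
  The second factor has mean zero and the first one, being no steeper than \<open>\<bar>u\<bar>\<^sup>2\<close>, oscillates by at most \<open>nx\<close>.
\<close>

lemma kerr_work: "\<bar>integral circ (\<lambda>s. \<rho> s * (q s - Re (f s * cnj (u s))))\<bar> \<le> n * x * F^2/4"
proof -
  obtain sm where sm: "sm \<in> circ" "\<And>s. s \<in> circ \<Longrightarrow> q s \<le> q sm"
    using continuous_attains_sup[of circ q] cq by auto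
  obtain sl where sl: "sl \<in> circ" "\<And>s. s \<in> circ \<Longrightarrow> q sl \<le> q s"
    using continuous_attains_inf[of circ q] cq by auto
  have osc: "q sm - q sl \<le> n*x" using osc_bound[OF sm(1) sl(1), of 0] unfolding q_def x_def by simp
  define c where "c = (\<rho> sm + \<rho> sl)/2"
  note mono = sat_mono[OF a]
  have c: "\<bar>\<rho> s - c\<bar> \<le> n*x/2" if s: "s \<in> circ" for s
  proof -
    have "\<rho> s \<le> \<rho> sm" "\<rho> sl \<le> \<rho> s" unfolding \<rho>_def by (intro mono q0 sm sl s)+
    moreover have "\<rho> sm - \<rho> sl \<le> n*x"
      using sat_lipschitz_log(1)[OF a q0 q0, of sm sl] sm(2)[OF sl(1)] osc unfolding \<rho>_def by linarith
    moreover have "\<bar>v - (m + l)/2\<bar> \<le> k/2" if "v \<le> m" "l \<le> v" "m - l \<le> k" for v m l k :: real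
      using that by (intro abs_leI) (simp_all add: field_simps)
    ultimately show ?thesis unfolding c_def by blast
  qed
  have z: "integral circ (\<lambda>s. q s - Re (f s * cnj (u s))) = 0"
  proof -
    have "integral circ (\<lambda>s. q s - Re (f s * cnj (u s))) = integral circ q - integral circ (\<lambda>s. Re (f s * cnj (u s)))"
      by (rule integral_diff; intro integrable_circ continuous_intros cf)
    then show ?thesis using mass_f unfolding n_def l2_sq q_def by (simp only: diff_self)
  qed
  have "\<bar>integral circ (\<lambda>s. \<rho> s * (q s - Re (f s * cnj (u s))))\<bar> \<le> n*x/2 * integral circ (\<lambda>s. \<bar>q s - Re (f s * cnj (u s))\<bar>)"
  proof (rule integral_mean_zero_le[where c=c])
    show "continuous_on circ \<rho>" by (rule crho)
    show "continuous_on circ (\<lambda>s. q s - Re (f s * cnj (u s)))" by (intro continuous_intros cf)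
  qed (fact z, rule c)
  also have "\<dots> \<le> n*x/2 * (F^2/2)" by (rule mult_left_mono[OF excess_mass]) (use nonneg in simp)
  finally show ?thesis by simp
qed

text \<open>
  Half the derivative of a primitive of the saturation function at \<open>\<bar>u\<bar>\<^sup>2\<close>.
\<close>

lemma rho_flux: "integral circ (\<lambda>s. \<rho> s * Re (u1 s * cnj (u s))) = 0"
proof -
  have c: "continuous_on {0..b} (sat a)" for b
    by (intro continuous_at_imp_continuous_on ballI has_vector_derivative_continuous[OF sat_deriv[OF a]])
  have "\<exists>x\<in>circ. \<forall>y\<in>circ. q y \<le> q x" by (rule continuous_attains_sup) (auto intro: cq)
  then obtain b where b: "\<And>s. s \<in> circ \<Longrightarrow> q s \<le> b" by metis
  define P where "P t = integral {0..t} (sat a)" for t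
  have dP: "(P has_vector_derivative sat a t) (at t within {0..b})" if "t \<in> {0..b}" for t
    unfolding P_def by (rule integral_has_vector_derivative[OF c that])
  have "((P \<circ> q) has_vector_derivative (2 * Re (u1 s * cnj (u s))) *\<^sub>R \<rho> s) (at s within circ)" if s: "s \<in> circ" for s
  proof -
    have "q s \<in> {0..b}" using q0 b s by auto
    then have "(P has_vector_derivative \<rho> s) (at (q s) within {0..b})" unfolding \<rho>_def by (rule dP)
    then have "(P has_vector_derivative \<rho> s) (at (q s) within q ` circ)"
      by (rule has_vector_derivative_within_subset) (use q0 b in auto)
    then show ?thesis by (rule vector_diff_chain_within[OF dq[OF s]])
  qed
  then have "integral circ (\<lambda>s. (2 * Re (u1 s * cnj (u s))) *\<^sub>R \<rho> s) = (P \<circ> q) (2*pi) - (P \<circ> q) 0" by (rule FTC_circ)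
  also have "\<dots> = 0" using per by (simp add: q_def)
  also have "(\<lambda>s. (2 * Re (u1 s * cnj (u s))) *\<^sub>R \<rho> s) = (\<lambda>s. 2 * (\<rho> s * Re (u1 s * cnj (u s))))" by (auto simp: algebra_simps)
  finally show ?thesis unfolding integral_mult_right by simp
qed

text \<open>
  The imaginary part of the equation times the conjugate of \<open>u''\<close> is a total derivative except for \<open>\<bar>u'\<bar>\<^sup>2\<close>, the
  forcing and the Kerr term \<open>\<rho> Im(u cnj u'')\<close>. The latter is rewritten with the imaginary part of the
  equation times the conjugate of \<open>u\<close>, which expresses \<open>Im(u cnj u'')\<close> by the mass density and the flux. Since \<open>f\<close> need not be
  periodic, a boundary term remains.
\<close>

lemma slope_identity:
  "x^2 = \<sigma>/\<delta> * integral circ (\<lambda>s. \<rho> s * (q s - Re (f s * cnj (u s)))) + integral circ (\<lambda>s. Re (f1 s * cnj (u1 s)))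
     - Re ((f (2*pi) - f 0) * cnj (u1 0))"
proof -
  \<comment> \<open>The quantity whose total variation over the period is the boundary term.\<close>
  define G where "G s = \<omega>/2 * Re (u1 s * cnj (u1 s)) + Z * Im (u s * cnj (u1 s)) - Re (u s * cnj (u1 s)) + Re (f s * cnj (u1 s))" for s
  define g where "g s = \<sigma>/\<delta> * (\<rho> s * (q s - Re (f s * cnj (u s)))) - \<sigma>*\<omega>/\<delta> * (\<rho> s * Re (u1 s * cnj (u s)))
     + Re (f1 s * cnj (u1 s)) - (cmod (u1 s))^2" for s
  have "(G has_vector_derivative g s) (at s within circ)" if s: "s \<in> circ" for s
  proof -
    have 1: "(G has_vector_derivative \<omega>/2 * Re (u1 s * cnj (u2 s) + u2 s * cnj (u1 s)) + Z * Im (u s * cnj (u2 s) + u1 s * cnj (u1 s))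
       - Re (u s * cnj (u2 s) + u1 s * cnj (u1 s)) + Re (f s * cnj (u2 s) + f1 s * cnj (u1 s))) (at s within circ)"
      unfolding G_def
      by (intro has_vector_derivative_add has_vector_derivative_diff has_vector_derivative_mult_right
          bounded_linear.has_vector_derivative[OF bounded_linear_Im] bounded_linear.has_vector_derivative[OF bounded_linear_Re]
          has_vector_derivative_mult du du1 dcu1 df s)
    have "Im ((- of_real \<delta> * u2 s + \<i> * of_real \<omega> * u1 s + (of_real Z - \<i>) * u s) * cnj (u2 s)) =
        Im ((of_real \<sigma> * (of_real (\<rho> s) * u s) - \<i> * f s) * cnj (u2 s))"
      using eq[OF s] unfolding kerr_u by simp
    moreover have "Im ((- of_real \<delta> * v2 + \<i> * of_real \<omega> * v1 + (of_real Z - \<i>) * v) * cnj v2) =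
        \<omega> * Re (v1 * cnj v2) + Z * Im (v * cnj v2) - Re (v * cnj v2)" for v v1 v2
      by (simp add: algebra_simps)
    moreover have "Im ((of_real \<sigma> * (of_real r * v) - \<i> * h) * cnj v2) = \<sigma> * (r * Im (v * cnj v2)) - Re (h * cnj v2)" for r v h v2
      by (simp add: algebra_simps)
    ultimately have e: "\<omega> * Re (u1 s * cnj (u2 s)) + Z * Im (u s * cnj (u2 s)) - Re (u s * cnj (u2 s)) =
        \<sigma> * (\<rho> s * Im (u s * cnj (u2 s))) - Re (f s * cnj (u2 s))" by (simp only:)
    have m: "Im (u s * cnj (u2 s)) = (- \<omega> * Re (u1 s * cnj (u s)) + (q s - Re (f s * cnj (u s))))/\<delta>"
    proof -
      have "Im (u s * cnj (u2 s)) = - Im (u2 s * cnj (u s))" by simp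
      then show ?thesis using Im_eq[OF s] delta unfolding Im_k q_def by (simp only: eq_divide_eq) (simp add: algebra_simps)
    qed
    have dist: "\<omega>/2 * Re (v1 * cnj v2 + v2 * cnj v1) + Z * Im (v * cnj v2 + v1 * cnj v1)
       - Re (v * cnj v2 + v1 * cnj v1) + Re (h * cnj v2 + h1 * cnj v1) =
       \<omega> * Re (v1 * cnj v2) + Z * Im (v * cnj v2) - Re (v * cnj v2) - (cmod v1)^2 + Re (h * cnj v2) + Re (h1 * cnj v1)" for v v1 v2 h h1
      by (simp add: cmod_sq algebra_simps)
    have "\<omega>/2 * Re (u1 s * cnj (u2 s) + u2 s * cnj (u1 s)) + Z * Im (u s * cnj (u2 s) + u1 s * cnj (u1 s))
       - Re (u s * cnj (u2 s) + u1 s * cnj (u1 s)) + Re (f s * cnj (u2 s) + f1 s * cnj (u1 s))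
      = \<sigma> * (\<rho> s * Im (u s * cnj (u2 s))) + Re (f1 s * cnj (u1 s)) - (cmod (u1 s))^2"
      unfolding dist using e by linarith
    also have "\<sigma> * (\<rho> s * Im (u s * cnj (u2 s))) = \<sigma>/\<delta> * (\<rho> s * (q s - Re (f s * cnj (u s)))) - \<sigma>*\<omega>/\<delta> * (\<rho> s * Re (u1 s * cnj (u s)))"
    proof -
      have "\<sigma> * (r * ((- \<omega> * A + B)/\<delta>)) = \<sigma>/\<delta> * (r * B) - \<sigma>*\<omega>/\<delta> * (r * A)" for r A B
        using delta by (simp add: field_simps)
      then show ?thesis unfolding m .
    qed
    finally have "\<omega>/2 * Re (u1 s * cnj (u2 s) + u2 s * cnj (u1 s)) + Z * Im (u s * cnj (u2 s) + u1 s * cnj (u1 s))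
       - Re (u s * cnj (u2 s) + u1 s * cnj (u1 s)) + Re (f s * cnj (u2 s) + f1 s * cnj (u1 s)) = g s"
      unfolding g_def .
    with 1 show ?thesis by (rule has_vector_derivative_eq_rhs)
  qed
  then have "integral circ g = G (2*pi) - G 0" by (rule FTC_circ)
  also have "\<dots> = Re ((f (2*pi) - f 0) * cnj (u1 0))" unfolding G_def using per by (simp add: algebra_simps)
  also have "integral circ g = \<sigma>/\<delta> * integral circ (\<lambda>s. \<rho> s * (q s - Re (f s * cnj (u s)))) - \<sigma>*\<omega>/\<delta> * integral circ (\<lambda>s. \<rho> s * Re (u1 s * cnj (u s)))
     + integral circ (\<lambda>s. Re (f1 s * cnj (u1 s))) - x^2"
  proof -
    define A B E1 N where "A s = \<rho> s * (q s - Re (f s * cnj (u s)))" and "B s = \<rho> s * Re (u1 s * cnj (u s))"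
      and "E1 s = Re (f1 s * cnj (u1 s))" and "N s = (cmod (u1 s))^2" for s
    have c: "continuous_on circ A" "continuous_on circ B" "continuous_on circ E1" "continuous_on circ N"
      unfolding A_def B_def E1_def N_def by (intro continuous_intros crho cf cf1)+
    have "integral circ (\<lambda>s. b*A s - d*B s + E1 s - N s) = b * integral circ A - d * integral circ B + integral circ E1 - integral circ N" for b d
      by (subst integral_diff integral_add integral_mult_right; (intro integrable_circ continuous_intros c)?)+ simp
    then show ?thesis unfolding g_def x_def l2_sq A_def B_def E1_def N_def .
  qed
  finally show ?thesis unfolding rho_flux by simp
qed

lemma slope_bound: "x^2 \<le> n * x * F^2/(4*\<delta>) + sqrt (2*pi) * M * x + J * cmod (u1 0)"
proof -
  have "\<sigma>/\<delta> * integral circ (\<lambda>s. \<rho> s * (q s - Re (f s * cnj (u s)))) \<le> 1/\<delta> * \<bar>integral circ (\<lambda>s. \<rho> s * (q s - Re (f s * cnj (u s))))\<bar>"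
  proof -
    have "\<sigma>/\<delta> * I \<le> 1/\<delta> * \<bar>I\<bar>" for I
      using sigma delta by (auto simp: field_simps)
    then show ?thesis .
  qed
  also have "\<dots> \<le> 1/\<delta> * (n * x * F^2/4)" using delta by (intro mult_left_mono kerr_work) auto
  finally have 1: "\<sigma>/\<delta> * integral circ (\<lambda>s. \<rho> s * (q s - Re (f s * cnj (u s)))) \<le> n * x * F^2/(4*\<delta>)" by (simp add: mult.commute)
  have M0: "0 \<le> M" using M[of 0] norm_ge_zero[of "f1 0"] by (simp add: order_trans[OF norm_ge_zero])
  have "integral circ (\<lambda>s. Re (f1 s * cnj (u1 s))) \<le> integral circ (\<lambda>s. M * cmod (u1 s))"
  proof (intro integral_le integrable_circ continuous_intros cf1)
    fix s assume s: "s \<in> circ"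
    have "Re (f1 s * cnj (u1 s)) \<le> cmod (f1 s) * cmod (u1 s)" by (metis complex_Re_le_cmod complex_mod_cnj norm_mult)
    also have "\<dots> \<le> M * cmod (u1 s)" by (intro mult_right_mono M s) auto
    finally show "Re (f1 s * cnj (u1 s)) \<le> M * cmod (u1 s)" .
  qed
  also have "\<dots> = M * integral circ (\<lambda>s. cmod (u1 s))" by simp
  also have "\<dots> \<le> M * (sqrt (2*pi) * x)" unfolding x_def using M0 by (intro mult_left_mono integral_norm_le_l2 cu1)
  finally have 2: "integral circ (\<lambda>s. Re (f1 s * cnj (u1 s))) \<le> sqrt (2*pi) * M * x" by (simp add: mult_ac)
  have "- Re ((f (2*pi) - f 0) * cnj (u1 0)) \<le> J * cmod (u1 0)"
    unfolding J_def by (metis abs_Re_le_cmod abs_le_iff complex_mod_cnj minus_le_iff neg_le_iff_le norm_mult order_trans abs_ge_minus_self)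
  then show ?thesis using slope_identity 1 2 by linarith
qed

end

lemma exp_of_real_deriv:
  "((\<lambda>s. exp (z * of_real s)) has_vector_derivative z * exp (z * of_real s)) (at s within T)" for z :: complex
proof -
  have "((\<lambda>w. exp (z * w)) has_field_derivative z * exp (z * of_real s)) (at (of_real s))"
    by (auto intro!: derivative_eq_intros)
  then show ?thesis by (rule has_vector_derivative_real_field)
qed

section \<open>The slope at the jump of the forcing\<close>

text \<open>
  Variation of constants over one period, for a solution that is periodic up to the jump \<open>j\<close>.
\<close>

lemma first_order_jump:
  fixes y h :: "real \<Rightarrow> complex"
  assumes dy: "\<And>s. s \<in> circ \<Longrightarrow> (y has_vector_derivative z * y s + h s) (at s within circ)"
    and jump: "y (2*pi) = y 0 + j"
  shows "(exp (- z * of_real (2*pi)) - 1) * y 0 = - (j * exp (- z * of_real (2*pi))) + integral circ (\<lambda>s. exp (- z * of_real s) * h s)"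
proof -
  have "((\<lambda>s. exp (- z * of_real s) * y s) has_vector_derivative exp (- z * of_real s) * h s) (at s within circ)" if "s \<in> circ" for s
    by (rule has_vector_derivative_eq_rhs[OF has_vector_derivative_mult[OF exp_of_real_deriv dy[OF that]]])
       (simp add: algebra_simps)
  from FTC_circ[OF this] have "integral circ (\<lambda>s. exp (- z * of_real s) * h s) = exp (- z * of_real (2*pi)) * (y 0 + j) - y 0"
    unfolding jump by simp
  then show ?thesis by (simp add: algebra_simps)
qed

text \<open>
  For a growing equation the initial value is read off by integrating backwards from the end of the period, for a decaying
  one by integrating forwards; either way the kernel is at most 1. The weights \<open>exp(- rs)\<close> and
  \<open>exp(- r(2\<pi> - s))\<close> are kept, because their sum has a small integral.
\<close>

lemma exponential_dichotomy_bound: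
  fixes y h :: "real \<Rightarrow> complex"
  assumes dy: "\<And>s. s \<in> circ \<Longrightarrow> (y has_vector_derivative z * y s + h s) (at s within circ)"
    and ch: "continuous_on circ h" and jump: "y (2*pi) = y 0 + j" and r: "0 < r"
  shows "Re z = r \<Longrightarrow> cmod (y 0) * (1 - exp (- 2*pi*r)) \<le> cmod j * exp (- 2*pi*r) + integral circ (\<lambda>s. exp (- r * s) * cmod (h s))"
    and "Re z = - r \<Longrightarrow> cmod (y 0) * (1 - exp (- 2*pi*r)) \<le> cmod j + integral circ (\<lambda>s. exp (- r * (2*pi - s)) * cmod (h s))"
proof -
  define e where "e = exp (- z * of_real (2*pi))"
  have ne: "cmod (exp (- z * of_real s)) = exp (- Re z * s)" for s by (simp add: norm_exp_eq_Re)
  have int: "cmod (integral circ (\<lambda>s. exp (- z * of_real s) * h s)) \<le> integral circ (\<lambda>s. exp (- Re z * s) * cmod (h s))"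
    by (intro integral_norm_bound_integral integrable_circ continuous_intros ch) (simp add: norm_mult ne)
  have "(e - 1) * y 0 = - (j * e) + integral circ (\<lambda>s. exp (- z * of_real s) * h s)"
    unfolding e_def by (rule first_order_jump[OF dy jump])
  then have "cmod ((e - 1) * y 0) \<le> cmod (j * e) + cmod (integral circ (\<lambda>s. exp (- z * of_real s) * h s))"
    using norm_triangle_ineq[of "- (j * e)" "integral circ (\<lambda>s. exp (- z * of_real s) * h s)"] by (simp only: norm_minus_cancel)
  then have main: "cmod (e - 1) * cmod (y 0) \<le> cmod j * cmod e + integral circ (\<lambda>s. exp (- Re z * s) * cmod (h s))"
    using int by (simp add: norm_mult)
  have e: "cmod e = exp (- Re z * (2*pi))" unfolding e_def by (rule ne)
  show "cmod (y 0) * (1 - exp (- 2*pi*r)) \<le> cmod j * exp (- 2*pi*r) + integral circ (\<lambda>s. exp (- r * s) * cmod (h s))" if z: "Re z = r"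
  proof -
    have e': "cmod e = exp (- 2*pi*r)" unfolding e z by (simp add: mult_ac)
    have "1 - cmod e \<le> cmod (e - 1)" using norm_triangle_ineq2[of 1 e] by (simp add: norm_minus_commute)
    then have "(1 - cmod e) * cmod (y 0) \<le> cmod (e - 1) * cmod (y 0)" by (rule mult_right_mono) simp
    then show ?thesis using main unfolding z e' by (simp add: mult.commute)
  qed
  show "cmod (y 0) * (1 - exp (- 2*pi*r)) \<le> cmod j + integral circ (\<lambda>s. exp (- r * (2*pi - s)) * cmod (h s))" if z: "Re z = - r"
  proof -
    define E where "E = exp (- 2*pi*r)"
    have E: "0 < E" unfolding E_def by simp
    have e': "cmod e = 1/E" unfolding e z E_def by (simp add: exp_minus mult_ac field_simps)
    have "cmod e - 1 \<le> cmod (e - 1)" using norm_triangle_ineq2[of e 1] by simp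
    then have "(cmod e - 1) * cmod (y 0) \<le> cmod (e - 1) * cmod (y 0)" by (rule mult_right_mono) simp
    then have "(1/E - 1) * cmod (y 0) \<le> cmod j * (1/E) + integral circ (\<lambda>s. exp (r * s) * cmod (h s))"
      using main unfolding z e' by simp
    from mult_left_mono[OF this, of E] have "E * ((1/E - 1) * cmod (y 0)) \<le> E * (cmod j * (1/E)) + integral circ (\<lambda>s. E * (exp (r * s) * cmod (h s)))"
      using E by (simp add: distrib_left)
    moreover have "E * ((1/E - 1) * cmod (y 0)) = cmod (y 0) * (1 - E)" "E * (cmod j * (1/E)) = cmod j" using E by (simp_all add: field_simps)
    moreover have "E * (exp (r * s) * cmod (h s)) = exp (- r * (2*pi - s)) * cmod (h s)" for s
    proof -
      have "E * exp (r* s) = exp (- r * (2*pi - s))" unfolding E_def exp_add[symmetric] by (simp add: algebra_simps)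
      then show ?thesis by (simp only: mult.assoc[symmetric])
    qed
    ultimately show ?thesis unfolding E_def by (simp only:)
  qed
qed

text \<open>
  The damping keeps the root away from the imaginary axis: \<open>2\<delta> Re k Im k = - 1\<close> and \<open>\<delta>\<bar>k\<bar>\<^sup>2 \<ge> 1\<close>, uniformly in \<open>\<mu>\<close>.
\<close>

lemma characteristic_root:
  fixes \<delta> \<mu> :: real
  assumes delta: "0 < \<delta>"
  obtains k :: complex where "of_real \<delta> * k^2 = of_real \<mu> - \<i>" "0 < Re k" "1/2 \<le> \<delta> * cmod k * Re k"
    "sqrt \<delta> \<le> \<delta> * cmod k"
proof
  define k where "k = csqrt ((of_real \<mu> - \<i>)/of_real \<delta>)"
  have k2: "k^2 = (of_real \<mu> - \<i>)/of_real \<delta>" unfolding k_def by (rule power2_csqrt)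
  show k2': "of_real \<delta> * k^2 = of_real \<mu> - \<i>" unfolding k2 using delta by simp
  from arg_cong[OF k2', of Im] have Imk: "\<delta> * (2 * (Re k * Im k)) = - 1"
    by (simp add: power2_eq_square mult_ac)
  have "0 \<le> Re k" using csqrt_principal[of "(of_real \<mu> - \<i>)/of_real \<delta>"] unfolding k_def by auto
  moreover have "Re k \<noteq> 0" using Imk by auto
  ultimately show r: "0 < Re k" by simp
  have "\<delta> * (2 * (Re k * \<bar>Im k\<bar>)) = \<bar>\<delta> * (2 * (Re k * Im k))\<bar>" using r delta by (simp add: abs_mult)
  then have "\<delta> * (2 * (Re k * \<bar>Im k\<bar>)) = 1" unfolding Imk by simp
  moreover have "\<delta> * (2 * (Re k * \<bar>Im k\<bar>)) \<le> \<delta> * (2 * (Re k * cmod k))"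
    using r delta by (intro mult_left_mono abs_Im_le_cmod) auto
  ultimately show "1/2 \<le> \<delta> * cmod k * Re k" by (simp add: mult_ac)
  show "sqrt \<delta> \<le> \<delta> * cmod k"
  proof (rule real_le_lsqrt)
    have "1 \<le> cmod (of_real \<mu> - \<i>)" using abs_Im_le_cmod[of "of_real \<mu> - \<i>"] by simp
    also have "\<dots> = \<delta> * (cmod k)^2" unfolding k2'[symmetric] norm_mult norm_power using delta by simp
    finally have "\<delta>*1 \<le> \<delta>*(\<delta> * (cmod k)^2)" using delta by (intro mult_left_mono) auto
    then show "\<delta> \<le> (\<delta> * cmod k)^2" by (simp add: power2_eq_square mult_ac)
  qed (use delta in auto)
qed

context kerr_solution
begin

text \<open>
  With \<open>z1, z2 = i\<kappa> \<plusminus> k\<close> the characteristic exponents of the linear part, \<open>u'' - z2 u'\<close> solves a growing and \<open>u'' - z1 u'\<close> a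
  decaying first-order equation whose source is the derivative of the right-hand side. Both functions jump by
  a multiple of the jump of \<open>f\<close>, and their difference at 0 is \<open>2k u'(0)\<close>. Adding the two dichotomy bounds gives the
  estimate, since \<open>\<delta>\<bar>k\<bar> \<ge> sqrt \<delta>\<close> and \<open>\<delta>\<bar>k\<bar> Re k \<ge> 1/2\<close>.
\<close>

lemma initial_slope_bound:
  assumes S: "\<And>s. s \<in> circ \<Longrightarrow> cmod (u s) \<le> S"
  shows "cmod (u1 0) \<le> (1/pi + 1/(2 * sqrt \<delta>)) * (J + 3*S*n*x) + 2*M"
proof -
  obtain k where k2': "of_real \<delta> * k^2 = of_real \<mu> - \<i>" and r': "0 < Re k" and kr': "1/2 \<le> \<delta> * cmod k * Re k"
    and k1: "sqrt \<delta> \<le> \<delta> * cmod k" by (rule characteristic_root[OF delta])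
  define r where "r = Re k"
  have r: "0 < r" and kr: "1/2 \<le> \<delta> * cmod k * r" using r' kr' by (simp_all add: r_def)
  define c m where "c = \<kappa>" and "m = \<mu>"
  define z1 z2 where "z1 = \<i> * of_real c + k" and "z2 = \<i> * of_real c - k"
  have Rez: "Re z1 = r" "Re z2 = - r" unfolding z1_def z2_def r_def by simp_all
  have om: "\<omega> = 2*\<delta>*c" unfolding c_def \<kappa>_def using delta by simp
  have Zm: "Z = m + \<delta>*c^2" unfolding c_def m_def \<kappa>_def \<mu>_def using delta by (simp add: field_simps power2_eq_square)
  have sumz: "of_real \<delta> * (z1 + z2) = \<i> * of_real \<omega>"
    by (subst om) (simp add: z1_def z2_def)
  have prodz: "of_real \<delta> * (z1 * z2) = - (of_real Z - \<i>)"
  proof -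
    have zz: "(\<i> * b + w) * (\<i> * b - w) = - (b^2 + w^2)" for b w :: complex
      by (simp add: algebra_simps power2_eq_square)
    have "of_real \<delta> * (z1 * z2) = - (of_real \<delta> * (of_real c)^2 + of_real \<delta> * k^2)"
      unfolding z1_def z2_def zz by (simp add: algebra_simps)
    also have "\<dots> = - (of_real (m + \<delta> * c^2) - \<i>)" unfolding k2' m_def by simp
    finally show ?thesis using Zm by simp
  qed
  \<comment> \<open>The derivative of the right-hand side \<open>\<sigma> kerr(u) - if\<close>.\<close>
  define h1 where "h1 s = of_real \<sigma> * (of_real (sat' a (q s) * (2 * Re (u1 s * cnj (u s)))) * u s + of_real (\<rho> s) * u1 s) - \<i> * f1 s" for s
  have dh: "((\<lambda>s. of_real \<sigma> * kerr a (u s) - \<i> * f s) has_vector_derivative h1 s) (at s within circ)" if s: "s \<in> circ" for s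
  proof -
    have dr: "((\<lambda>s. of_real (\<rho> s) :: complex) has_vector_derivative of_real (sat' a (q s) * (2 * Re (u1 s * cnj (u s))))) (at s within circ)"
      by (rule has_vector_derivative_of_real[OF has_real_derivative_iff_has_vector_derivative[THEN iffD2, OF drho[OF s]]])
    have "((\<lambda>s. of_real \<sigma> * (of_real (\<rho> s) * u s) - \<i> * f s) has_vector_derivative
        of_real \<sigma> * (of_real (\<rho> s) * u1 s + of_real (sat' a (q s) * (2 * Re (u1 s * cnj (u s)))) * u s) - \<i> * f1 s) (at s within circ)"
      by (intro has_vector_derivative_diff has_vector_derivative_mult_right has_vector_derivative_mult dr du df s)
    then show ?thesis unfolding kerr_u h1_def by (simp only: add.commute)
  qed
  have csat: "continuous_on circ (\<lambda>s. sat' a (q s))"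
  proof -
    have "continuous_on UNIV (\<lambda>t. if t \<le> a then 1 else a^2/t^2)"
      by (rule continuous_on_cases_le) (use a in \<open>auto intro!: continuous_intros\<close>)
    then have "continuous_on UNIV (sat' a)" by (simp add: sat'_def[abs_def])
    then show ?thesis by (rule continuous_on_compose2) (auto intro: cq)
  qed
  have ch1: "continuous_on circ h1" unfolding h1_def by (intro continuous_intros csat crho cf1)
  have h1_le: "cmod (h1 s) \<le> 3 * (q s * cmod (u1 s)) + M" if s: "s \<in> circ" for s
  proof -
    have "\<bar>Re (u1 s * cnj (u s))\<bar> \<le> cmod (u1 s) * cmod (u s)" by (metis abs_Re_le_cmod complex_mod_cnj norm_mult)
    then have "\<bar>sat' a (q s) * (2 * Re (u1 s * cnj (u s)))\<bar> \<le> 1 * (2 * (cmod (u1 s) * cmod (u s)))"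
      unfolding abs_mult using sat_props[OF a q0] by (intro mult_mono) auto
    then have "\<bar>sat' a (q s) * (2 * Re (u1 s * cnj (u s)))\<bar> * cmod (u s) \<le> 2 * (cmod (u1 s) * cmod (u s)) * cmod (u s)"
      by (intro mult_right_mono) auto
    also have "\<dots> = 2 * (q s * cmod (u1 s))" unfolding q_def by (simp add: power2_eq_square)
    finally have 1: "\<bar>sat' a (q s) * (2 * Re (u1 s * cnj (u s)))\<bar> * cmod (u s) \<le> 2 * (q s * cmod (u1 s))" .
    have 2: "\<rho> s * cmod (u1 s) \<le> q s * cmod (u1 s)" using rho by (intro mult_right_mono) auto
    have s1: "cmod (of_real \<sigma>) = 1" using sigma by auto
    have "cmod (h1 s) \<le> cmod (of_real \<sigma> * (of_real (sat' a (q s) * (2 * Re (u1 s * cnj (u s)))) * u s + of_real (\<rho> s) * u1 s)) + cmod (\<i> * f1 s)"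
      unfolding h1_def by (rule norm_triangle_ineq4)
    also have "\<dots> = cmod (of_real (sat' a (q s) * (2 * Re (u1 s * cnj (u s)))) * u s + of_real (\<rho> s) * u1 s) + cmod (f1 s)"
      by (simp only: norm_mult[of "of_real \<sigma>"] s1 norm_mult[of \<i>] norm_ii mult_1)
    also have "\<dots> \<le> (cmod (of_real (sat' a (q s) * (2 * Re (u1 s * cnj (u s)))) * u s) + cmod (of_real (\<rho> s) * u1 s)) + M"
      by (intro add_mono norm_triangle_ineq M s)
    also have "\<dots> = (\<bar>sat' a (q s) * (2 * Re (u1 s * cnj (u s)))\<bar> * cmod (u s) + \<rho> s * cmod (u1 s)) + M"
      using rho(1)[of s] by (simp only: norm_mult norm_of_real abs_of_nonneg)
    finally show ?thesis using 1 2 by linarith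
  qed
  define u3 where "u3 s = (\<i> * of_real \<omega> * u2 s + (of_real Z - \<i>) * u1 s - h1 s)/of_real \<delta>" for s
  have du2: "(u2 has_vector_derivative u3 s) (at s within circ)" if s: "s \<in> circ" for s
  proof (rule has_vector_derivative_transform[OF s])
    show "((\<lambda>s. (\<i> * of_real \<omega> * u1 s + (of_real Z - \<i>) * u s - (of_real \<sigma> * kerr a (u s) - \<i> * f s)) / of_real \<delta>) has_vector_derivative u3 s) (at s within circ)"
      unfolding u3_def
      by (intro has_vector_derivative_divide has_vector_derivative_diff has_vector_derivative_add has_vector_derivative_mult_right du du1 dh s)
  qed (rule u2_eq)
  have dY: "((\<lambda>s. u2 s - w' * u1 s) has_vector_derivative w * (u2 s - w' * u1 s) + (- h1 s/of_real \<delta>)) (at s within circ)"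
    if s: "s \<in> circ" and w: "of_real \<delta> * (w + w') = \<i> * of_real \<omega>" "of_real \<delta> * (w * w') = - (of_real Z - \<i>)" for w w' s
  proof -
    have "((\<lambda>s. u2 s - w' * u1 s) has_vector_derivative u3 s - w' * u2 s) (at s within circ)"
      by (intro has_vector_derivative_diff has_vector_derivative_mult_right du2 du1 s)
    moreover have "u3 s - w' * u2 s = w * (u2 s - w' * u1 s) + (- h1 s/of_real \<delta>)"
    proof -
      have "of_real \<delta> * u3 s = of_real \<delta> * (w + w') * u2 s - of_real \<delta> * (w * w') * u1 s - h1 s"
      proof -
        have "of_real \<delta> * u3 s = \<i> * of_real \<omega> * u2 s + (of_real Z - \<i>) * u1 s - h1 s"
          unfolding u3_def using delta by simp
        then show ?thesis unfolding w by (simp only: minus_mult_left[symmetric] diff_minus_eq_add)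
      qed
      then have "of_real \<delta> * (u3 s - w' * u2 s) = of_real \<delta> * (w * (u2 s - w' * u1 s) + (- h1 s/of_real \<delta>))"
        using delta by (simp add: algebra_simps)
      then show ?thesis using delta by simp
    qed
    ultimately show ?thesis by simp
  qed
  define j where "j = \<i> * (f (2*pi) - f 0)/of_real \<delta>"
  have nj: "cmod j = J/\<delta>" unfolding j_def J_def using delta by (simp add: norm_divide norm_mult)
  have jump: "u2 (2*pi) - w * u1 (2*pi) = (u2 0 - w * u1 0) + j" for w
  proof -
    have gen: "(X - (A - \<i> * g2))/d - W = ((X - (A - \<i> * g0))/d - W) + \<i> * (g2 - g0)/d" for X A g2 g0 d W :: complex
      by (simp add: diff_divide_distrib right_diff_distrib add_divide_distrib)
    show ?thesis unfolding u2_eq[of 0, simplified] u2_eq[of "2*pi", simplified] j_def per[symmetric] by (rule gen)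
  qed
  define E where "E = exp (- 2*pi*r)"
  have E: "0 < E" "E < 1" unfolding E_def using r by simp_all
  have ch: "continuous_on circ (\<lambda>s. - h1 s/of_real \<delta>)" by (intro continuous_intros ch1) (use delta in auto)
  have sumz': "of_real \<delta> * (z2 + z1) = \<i> * of_real \<omega>" "of_real \<delta> * (z2 * z1) = - (of_real Z - \<i>)"
    using sumz prodz by (simp_all add: add.commute mult.commute)
  have Y1: "cmod (u2 0 - z2 * u1 0) * (1 - E) \<le> cmod j * E + integral circ (\<lambda>s. exp (- r * s) * cmod (- h1 s/of_real \<delta>))"
    unfolding E_def by (rule exponential_dichotomy_bound(1)[OF dY[OF _ sumz prodz] ch jump r Rez(1)])
  have Y2: "cmod (u2 0 - z1 * u1 0) * (1 - E) \<le> cmod j + integral circ (\<lambda>s. exp (- r * (2*pi - s)) * cmod (- h1 s/of_real \<delta>))"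
    unfolding E_def by (rule exponential_dichotomy_bound(2)[OF dY[OF _ sumz'] ch jump r Rez(2)])
  define w where "w s = exp (- r * s) + exp (- r * (2*pi - s))" for s
  have cw: "continuous_on circ w" unfolding w_def by (intro continuous_intros)
  have w0: "0 \<le> w s" for s unfolding w_def by simp
  have w1: "w s \<le> 1 + E" if s: "s \<in> circ" for s
  proof -
    have "exp (- r * s) \<le> 1" "exp (- r * (2*pi - s)) \<le> 1" using r s by auto
    then have "0 \<le> (1 - exp (- r * s)) * (1 - exp (- r * (2*pi - s)))" by simp
    also have "\<dots> = 1 + exp (- r * s) * exp (- r * (2*pi - s)) - w s" unfolding w_def by (simp add: algebra_simps)
    also have "exp (- r * s) * exp (- r * (2*pi - s)) = E" unfolding E_def exp_add[symmetric] by (simp add: algebra_simps)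
    finally show ?thesis by simp
  qed
  have intw: "integral circ w = 2*(1 - E)/r"
  proof -
    have "((\<lambda>s. (- exp (- r * s) + exp (- r * (2*pi - s)))/r) has_vector_derivative w s) (at s within circ)" for s
      unfolding has_real_derivative_iff_has_vector_derivative[symmetric] w_def
      using r by (auto intro!: derivative_eq_intros simp: field_simps)
    from FTC_circ[OF this] have "integral circ w = (1 - E)/r - (E - 1)/r" unfolding E_def by (simp add: mult_ac)
    also have "\<dots> = 2*(1 - E)/r" by (simp add: diff_divide_distrib[symmetric])
    finally show ?thesis .
  qed
  have qu: "integral circ (\<lambda>s. q s * cmod (u1 s)) \<le> S*n*x"
  proof -
    have S0: "0 \<le> S" using S[of 0] by (rule order_trans[OF norm_ge_zero]) simp
    have "integral circ (\<lambda>s. q s * cmod (u1 s)) \<le> integral circ (\<lambda>s. S * (cmod (u s) * cmod (u1 s)))"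
    proof (intro integral_le integrable_circ continuous_intros)
      fix s assume s: "s \<in> circ"
      have "cmod (u s) * (cmod (u s) * cmod (u1 s)) \<le> S * (cmod (u s) * cmod (u1 s))" by (intro mult_right_mono S s) auto
      then show "q s * cmod (u1 s) \<le> S * (cmod (u s) * cmod (u1 s))" unfolding q_def by (simp add: power2_eq_square)
    qed
    also have "\<dots> = S * integral circ (\<lambda>s. cmod (u s) * cmod (u1 s))" by simp
    also have "\<dots> \<le> S * (n * x)" unfolding n_def x_def using S0 by (intro mult_left_mono integral_norm_mult_le_l2 continuous_intros)
    finally show ?thesis by simp
  qed
  have M0: "0 \<le> M" using order_trans[OF norm_ge_zero M[of 0]] by simp
  have inth: "integral circ (\<lambda>s. exp (- r * s) * cmod (- h1 s/of_real \<delta>)) + integral circ (\<lambda>s. exp (- r * (2*pi - s)) * cmod (- h1 s/of_real \<delta>))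
      \<le> ((1 + E) * (3*S*n*x) + 2*M*(1 - E)/r)/\<delta>"
  proof -
    have "integral circ (\<lambda>s. exp (- r * s) * cmod (- h1 s/of_real \<delta>)) + integral circ (\<lambda>s. exp (- r * (2*pi - s)) * cmod (- h1 s/of_real \<delta>))
      = integral circ (\<lambda>s. exp (- r * s) * cmod (- h1 s/of_real \<delta>) + exp (- r * (2*pi - s)) * cmod (- h1 s/of_real \<delta>))"
      by (rule integral_add[symmetric]; intro integrable_circ continuous_intros ch)
    also have "\<dots> = integral circ (\<lambda>s. w s * cmod (h1 s) / \<delta>)"
      using delta by (simp add: w_def norm_divide distrib_right add_divide_distrib)
    also have "\<dots> \<le> integral circ (\<lambda>s. ((1 + E) * 3 * (q s * cmod (u1 s)) + M * w s)/\<delta>)"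
    proof (intro integral_le integrable_circ continuous_intros cw ch1)
      fix s assume s: "s \<in> circ"
      have "w s * cmod (h1 s) \<le> w s * (3 * (q s * cmod (u1 s)) + M)" by (intro mult_left_mono h1_le s w0)
      also have "\<dots> = w s * (3 * (q s * cmod (u1 s))) + M * w s" by (simp add: algebra_simps)
      also have "w s * (3 * (q s * cmod (u1 s))) \<le> (1 + E) * (3 * (q s * cmod (u1 s)))" using q0[of s] by (intro mult_right_mono w1 s) auto
      finally have "w s * cmod (h1 s) \<le> (1 + E) * 3 * (q s * cmod (u1 s)) + M * w s" by (simp only: mult.assoc)
      then show "w s * cmod (h1 s) / \<delta> \<le> ((1 + E) * 3 * (q s * cmod (u1 s)) + M * w s)/\<delta>"
        by (rule divide_right_mono) (use delta in simp)
    qed (use delta in auto)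
    also have "\<dots> = ((1 + E) * 3 * integral circ (\<lambda>s. q s * cmod (u1 s)) + M * integral circ w)/\<delta>"
    proof -
      have "integral circ (\<lambda>s. (1 + E) * 3 * (q s * cmod (u1 s)) + M * w s) = integral circ (\<lambda>s. (1 + E) * 3 * (q s * cmod (u1 s))) + integral circ (\<lambda>s. M * w s)"
        by (rule integral_add; intro integrable_circ continuous_intros cw)
      then show ?thesis unfolding integral_divide integral_mult_right by simp
    qed
    also have "\<dots> \<le> ((1 + E) * 3 * (S*n*x) + M * (2*(1 - E)/r))/\<delta>"
      unfolding intw using delta E qu by (intro divide_right_mono add_right_mono mult_left_mono) auto
    finally show ?thesis by (simp add: mult_ac)
  qed
  have "2 * k * u1 0 = (u2 0 - z2 * u1 0) - (u2 0 - z1 * u1 0)" unfolding z1_def z2_def by (simp add: algebra_simps)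
  then have "2 * cmod k * cmod (u1 0) = cmod ((u2 0 - z2 * u1 0) - (u2 0 - z1 * u1 0))" by (metis norm_mult norm_numeral)
  also have "\<dots> \<le> cmod (u2 0 - z2 * u1 0) + cmod (u2 0 - z1 * u1 0)" by (rule norm_triangle_ineq4)
  finally have "2 * cmod k * cmod (u1 0) * (1 - E) \<le> (cmod (u2 0 - z2 * u1 0) + cmod (u2 0 - z1 * u1 0)) * (1 - E)"
    using E by (intro mult_right_mono) auto
  also have "\<dots> \<le> cmod j * (1 + E) + ((1 + E) * (3*S*n*x) + 2*M*(1 - E)/r)/\<delta>"
    using Y1 Y2 inth by (simp add: distrib_left distrib_right)
  also have "\<dots> = ((1 + E) * (J + 3*S*n*x) + 2*M*(1 - E)/r)/\<delta>" unfolding nj using delta by (simp add: add_divide_distrib algebra_simps)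
  finally have main: "2 * cmod k * cmod (u1 0) * (1 - E) \<le> ((1 + E) * (J + 3*S*n*x) + 2*M*(1 - E)/r)/\<delta>" .
  define T where "T = J + 3*S*n*x"
  have T0: "0 \<le> T" unfolding T_def J_def using order_trans[OF norm_ge_zero S[of 0]] nonneg by simp
  \<comment> \<open>\<open>(1 + E)/(1 - E)\<close> is the hyperbolic cotangent of \<open>\<pi>r\<close>, hence at most \<open>1 + 1/(\<pi>r)\<close>.\<close>
  have coth: "(1 + E) \<le> (1 + 1/(pi*r)) * (1 - E)"
  proof -
    have "1 + 2*pi*r \<le> exp (2*pi*r)" by (rule exp_ge_add_one_self)
    then have "E * (1 + 2*pi*r) \<le> E * exp (2*pi*r)" using E by (intro mult_left_mono) auto
    also have "E * exp (2*pi*r) = 1" unfolding E_def exp_add[symmetric] by simp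
    finally have "E * (2*pi*r) \<le> 1 - E" by (simp add: algebra_simps)
    then have "2 * E \<le> (1 - E)/(pi*r)" using r by (simp add: pos_le_divide_eq mult_ac)
    then show ?thesis by (simp add: algebra_simps)
  qed
  define K where "K = \<delta> * cmod k"
  have K: "0 < K" "sqrt \<delta> \<le> K" "1/2 \<le> K*r" unfolding K_def using k1 kr delta by (auto intro: less_le_trans[OF _ k1])
  have "2*K*cmod (u1 0) * (1 - E) \<le> (1 + E) * T + 2*M*(1 - E)/r"
    using main delta unfolding K_def T_def by (simp add: pos_le_divide_eq mult_ac)
  also have "\<dots> \<le> (1 + 1/(pi*r)) * (1 - E) * T + 2*M*(1 - E)/r" using coth T0 by (intro add_right_mono mult_right_mono)
  also have "\<dots> = ((1 + 1/(pi*r)) * T + 2*M/r) * (1 - E)" by (simp add: algebra_simps)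
  finally have "2*K*cmod (u1 0) \<le> (1 + 1/(pi*r)) * T + 2*M/r" using E by (simp add: mult_le_cancel_right)
  then have "cmod (u1 0) \<le> ((1 + 1/(pi*r)) * T + 2*M/r)/(2*K)" using K by (simp add: pos_le_divide_eq mult_ac)
  also have "\<dots> = (1/(2*K) + 1/(2*pi*(K*r))) * T + M/(K*r)" using K r by (simp add: field_simps)
  also have "\<dots> \<le> (1/(2 * sqrt \<delta>) + 1/pi) * T + 2*M"
  proof (intro add_mono mult_right_mono T0)
    show "1/(2*K) \<le> 1/(2 * sqrt \<delta>)" using K delta by (intro divide_left_mono) auto
    have "pi*1 \<le> pi*(2*(K*r))" using K by (intro mult_left_mono) auto
    then show "1/(2*pi*(K*r)) \<le> 1/pi" using K r by (intro divide_left_mono) (auto simp: mult_ac)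
    have "M*1 \<le> M*(2*(K*r))" using K M0 by (intro mult_left_mono) auto
    then show "M/(K*r) \<le> 2*M" using K r by (simp add: pos_divide_le_eq mult_ac)
  qed
  finally show ?thesis unfolding T_def by (simp add: add.commute)
qed

end

section \<open>Real inequalities excluding large amplitudes\<close>

lemma pi_bounds: "(31415/10000) < pi" "pi < (31416/10000)"
  using pi_approx by simp_all

text \<open>
  Tangent bounds, used to extract single monomials in \<open>F\<close> and \<open>B\<close> from powers of \<open>F powr (3/4) + 2\<pi>B\<close>.
\<close>

lemma binomial_power_lower_bounds: fixes z :: real assumes "0 \<le> z"
  shows "27/4 * z \<le> (1+z)^3" "27/4 * z^2 \<le> (1+z)^3" "13 * z \<le> (1+z)^6"
proof -
  have "(1+z)^3 - 27/4*z = (z - 1/2)^2 * (z + 4)"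
    by (simp add: power3_eq_cube power2_eq_square algebra_simps)
  moreover have "0 \<le> (z - 1/2)^2 * (z + 4)" using assms by simp
  ultimately show "27/4 * z \<le> (1+z)^3" by linarith
  have "(1+z)^3 - 27/4*z^2 = (z - 2)^2 * (z + 1/4)"
    by (simp add: power3_eq_cube power2_eq_square algebra_simps)
  moreover have "0 \<le> (z - 2)^2 * (z + 1/4)" using assms by simp
  ultimately show "27/4 * z^2 \<le> (1+z)^3" by linarith
  have "(1+z)^6 = 1 + 6*z + 15*z^2 + (20*z^3+15*z^4+6*z^5+z^6)"
    by (simp add: numeral_eq_Suc algebra_simps)
  moreover have "0 \<le> 20*z^3+15*z^4+6*z^5+z^6" using assms by simp
  moreover have "0 \<le> 15 * (z - 7/30)^2 + (1 - 15 * (7/30)^2)" by (auto intro!: add_nonneg_nonneg simp: power2_eq_square)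
  moreover have "15 * (z - 7/30)^2 + (1 - 15 * (7/30)^2) = 1 - 7*z + 15*z^2" by (simp add: power2_eq_square algebra_simps)
  ultimately show "13 * z \<le> (1+z)^6" by linarith
qed

text \<open>
  From here on \<open>\<phi> = F powr (1/4)\<close> and \<open>\<psi> = n powr (1/4)\<close>, which turns all powers of \<open>F\<close> and \<open>n\<close> into natural ones; \<open>Y\<close> stands for \<open>- Z\<close>,
  \<open>W\<close> for \<open>\<bar>\<omega>\<bar>\<close>, and \<open>\<epsilon>\<close> is 1 for \<open>\<sigma> = - 1\<close> and 0 for \<open>\<sigma> = 1\<close>. The detuning is so large that
  the potential term in the energy balance can only be compensated by the slope. The constant
  \<open>27/(8\<pi>\<^sup>3)\<close> enters as \<open>27q\<^sup>3\<close> with \<open>q\<close> the bound on \<open>S\<^sup>2\<close> for a flat profile, where \<open>S\<^sup>2 \<ge> 24/25\<close> gives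
  \<open>27q\<^sup>3 > 4\<close>.
\<close>

lemma detuning_forces_steep_slope:
  fixes \<phi> \<psi> B \<delta> x S W Y \<epsilon> :: real
  assumes pos: "0 < \<psi>" "\<psi> \<le> \<phi>" "0 < \<delta>" "0 < B" "0 \<le> x" "0 \<le> W" "0 \<le> \<epsilon>" "\<epsilon> \<le> 1"
    and S: "24/25 \<le> S^2" "S^2 \<le> \<psi>^8/(2*pi) + \<psi>^4*x"
    and E: "Y * \<psi>^8 \<le> \<delta>*x^2 + W*x*\<psi>^4 + \<phi>^4*\<psi>^4 + \<epsilon>*S^2*\<psi>^8"
    and Y: "\<epsilon> * (\<phi>^2*(\<phi>^3+2*pi*B)^2/(2*pi)) + 27*(\<phi>^3+2*pi*B)^6*(\<phi>^6+W*B*\<phi>^3+\<delta>*B^2)/(8*pi^3) < Y"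
    and B: "\<phi>^11 \<le> 2*\<delta>*B"
  shows "2*B*\<psi> \<le> x" "(2949/10000) * (\<phi>^3+2*pi*B)^3 * B * \<psi>^4 \<le> x"
proof -
  define P where "P = \<phi>^3 + 2*pi*B"
  define D where "D = \<phi>^6 + W*B*\<phi>^3 + \<delta>*B^2"
  define K where "K = 27*P^6/(8*pi^3)"
  define C2 where "C2 = \<phi>^2*P^2/(2*pi)"
  have phi: "0 < \<phi>" using pos by linarith
  have Dpos: "0 < D" unfolding D_def using pos phi by (intro add_pos_nonneg add_nonneg_nonneg) auto
  have Y': "\<epsilon>*C2 + K*D < Y" using Y by (simp add: C2_def K_def D_def P_def)
  have psi8: "0 < \<psi>^8" using pos by simp
  have E': "(\<epsilon>*C2 + K*D)*\<psi>^8 < \<delta>*x^2 + W*x*\<psi>^4 + \<phi>^4*\<psi>^4 + \<epsilon>*S^2*\<psi>^8"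
    using mult_strict_right_mono[OF Y' psi8] E by linarith
  have pw: "\<psi>^k \<le> \<phi>^k" for k using pos by (intro power_mono) auto
  have C2: "C2 = \<phi>^8/(2*pi) + 2*B*\<phi>^5 + 2*pi*B^2*\<phi>^2"
    unfolding C2_def P_def by (simp add: field_simps numeral_eq_Suc)
  show 1: "2*B*\<psi> \<le> x"
  proof (rule ccontr)
    assume "\<not> ?thesis"
    then have x: "x < 2*B*\<psi>" by simp
    define q where "q = P^2*\<psi>^2/(2*pi)"
    have q: "q = \<phi>^6*\<psi>^2/(2*pi) + 2*B*\<phi>^3*\<psi>^2 + 2*pi*B^2*\<psi>^2"
      unfolding q_def P_def by (simp add: field_simps numeral_eq_Suc)
    have a1: "\<psi>^8 \<le> \<phi>^6*\<psi>^2" using mult_right_mono[OF pw[of 6], of "\<psi>^2"] by (simp flip: power_add)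
    have a2: "\<psi>^5 \<le> \<phi>^3*\<psi>^2" using mult_right_mono[OF pw[of 3], of "\<psi>^2"] by (simp flip: power_add)
    have a3: "\<psi>^4*x \<le> 2*B*\<psi>^5" using mult_left_mono[OF less_imp_le[OF x], of "\<psi>^4"] pos by (simp add: numeral_eq_Suc algebra_simps)
    have a4: "\<psi>^8/(2*pi) \<le> \<phi>^6*\<psi>^2/(2*pi)" using a1 by (simp add: divide_right_mono)
    have a5: "2*B*\<psi>^5 \<le> 2*B*\<phi>^3*\<psi>^2" using mult_left_mono[OF a2, of "2*B"] pos by (simp add: algebra_simps)
    have Sq: "S^2 \<le> q" using S(2) a3 a4 a5 pos unfolding q by (smt (verit) mult_nonneg_nonneg pi_ge_zero zero_le_power2)
    have "q \<le> C2" unfolding q_def C2_def using pw[of 2] by (intro divide_right_mono) (auto simp: mult.commute intro!: mult_left_mono)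
    then have "\<epsilon>*S^2*\<psi>^8 \<le> \<epsilon>*C2*\<psi>^8" using Sq pos by (intro mult_right_mono mult_left_mono) auto
    then have *: "K*D*\<psi>^8 < \<delta>*x^2 + W*x*\<psi>^4 + \<phi>^4*\<psi>^4" using E' by (simp add: algebra_simps)
    have "x^2 \<le> (2*B*\<psi>)^2" using x pos by (intro power_mono) auto
    then have b1: "\<delta>*x^2 \<le> 4*\<psi>^2*(\<delta>*B^2)" using pos by (simp add: power_mult_distrib mult_left_mono algebra_simps)
    have "\<psi>^4*x \<le> 2*B*\<phi>^3*\<psi>^2" using a3 a5 by linarith
    then have "W*(\<psi>^4*x) \<le> W*(2*B*\<phi>^3*\<psi>^2)" using pos(6) by (rule mult_left_mono)
    then have b2: "W*x*\<psi>^4 \<le> 2*(\<psi>^2*(W*B*\<phi>^3))" by (simp add: algebra_simps)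
    have b2': "0 \<le> \<psi>^2*(W*B*\<phi>^3)" using pos phi by simp
    have "\<psi>^2*\<phi>^4*\<psi>^2 \<le> \<psi>^2*\<phi>^4*\<phi>^2" using pw[of 2] phi by (intro mult_left_mono) auto
    then have b3: "\<phi>^4*\<psi>^4 \<le> \<psi>^2*\<phi>^6" by (simp add: numeral_eq_Suc algebra_simps)
    have b3': "0 \<le> \<psi>^2*\<phi>^6" using phi by simp
    have dec: "4*\<psi>^2*D = 4*(\<psi>^2*\<phi>^6) + 4*(\<psi>^2*(W*B*\<phi>^3)) + 4*\<psi>^2*(\<delta>*B^2)" unfolding D_def by (simp add: algebra_simps)
    have r0: "0 < \<psi>^2*\<phi>^6" using phi pos by simp
    have "K*D*\<psi>^8 < 4*\<psi>^2*D" 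
    proof -
      have aux: "k < 4*r + 4* s + t" if "k < a + b + c" "a \<le> t" "b \<le> 2* s" "0 \<le> s" "c \<le> r" "0 < r" for k a b c r s t :: real
        using that by linarith
      show ?thesis unfolding dec by (rule aux[OF * b1 b2 b2' b3 r0])
    qed
    then have "(\<psi>^2*D)*(K*\<psi>^6) < (\<psi>^2*D)*4" by (simp add: numeral_eq_Suc algebra_simps)
    then have "K*\<psi>^6 < 4" using Dpos pos by (simp add: mult_less_cancel_left_pos)
    moreover have "K*\<psi>^6 = 27*q^3" unfolding K_def q_def by (simp add: power_divide power_mult_distrib flip: power_mult)
    moreover have "(24/25)^3 \<le> q^3" using Sq S by (intro power_mono) auto
    ultimately show False by (simp add: power3_eq_cube)
  qed
  \<comment> \<open>The slope in units of \<open>B\<psi>\<close>; the energy balance becomes \<open>K\<psi>\<^sup>6 < l\<^sup>2 + 2(l - 2)\<close>.\<close>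
  define l where "l = x/(B*\<psi>)"
  have x: "x = l*B*\<psi>" using pos by (simp add: l_def)
  have lam: "2 \<le> l" using 1 pos by (simp add: l_def field_simps)
  have "\<psi>^8/(2*pi) \<le> \<phi>^8/(2*pi)" using pw by (intro divide_right_mono) auto
  moreover have "2*B*\<psi>^5 \<le> 2*B*\<phi>^5" using pw pos by simp
  moreover have "\<psi>^4*x = l*(B*\<psi>^5)" unfolding x by (simp add: numeral_eq_Suc)
  moreover have "0 \<le> 2*pi*B^2*\<phi>^2" by simp
  moreover have "(l-2)*(B*\<psi>^5) = l*(B*\<psi>^5) - 2*B*\<psi>^5" by (simp add: algebra_simps)
  ultimately have SC: "S^2 - C2 \<le> (l-2)*(B*\<psi>^5)" using S(2) unfolding C2 by linarith
  have "\<epsilon>*(S^2 - C2) \<le> (l-2)*(B*\<psi>^5)"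
  proof -
    have "\<epsilon>*(S^2 - C2) \<le> \<epsilon>*((l-2)*(B*\<psi>^5))" using SC pos by (intro mult_left_mono) auto
    also have "\<dots> \<le> 1*((l-2)*(B*\<psi>^5))" using lam pos by (intro mult_right_mono) auto
    finally show ?thesis by simp
  qed
  then have "\<epsilon>*(S^2 - C2)*\<psi>^8 \<le> (l-2)*(B*\<psi>^5)*\<psi>^8" using psi8 by (intro mult_right_mono) auto
  also have "\<dots> = (l-2)*\<psi>^2*B*\<psi>^11" by (simp add: numeral_eq_Suc algebra_simps)
  also have "\<dots> \<le> (l-2)*\<psi>^2*B*(2*\<delta>*B)" using order_trans[OF pw[of 11] B] lam pos by (intro mult_left_mono) auto
  also have "\<dots> = 2*(l-2)*\<psi>^2*(\<delta>*B^2)" by (simp add: power2_eq_square)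
  also have "\<dots> \<le> 2*(l-2)*\<psi>^2*D" unfolding D_def using lam pos phi by (intro mult_left_mono) auto
  finally have c0: "\<epsilon>*(S^2 - C2)*\<psi>^8 \<le> 2*(l-2)*\<psi>^2*D" .
  have c1: "\<delta>*x^2 = l^2*\<psi>^2*(\<delta>*B^2)" unfolding x by (simp add: power_mult_distrib)
  have "W*x*\<psi>^4 = l*\<psi>^2*(W*B*\<psi>^3)" unfolding x by (simp add: numeral_eq_Suc)
  also have "\<dots> \<le> l^2*\<psi>^2*(W*B*\<phi>^3)" using lam pos pw[of 3] by (intro mult_mono) (auto simp: power2_eq_square)
  finally have c2: "W*x*\<psi>^4 \<le> l^2*\<psi>^2*(W*B*\<phi>^3)" .
  have "\<phi>^4*\<psi>^4 = 1*\<psi>^2*(\<phi>^4*\<psi>^2)" by (simp add: numeral_eq_Suc)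
  also have "\<dots> \<le> l^2*\<psi>^2*(\<phi>^4*\<phi>^2)" using lam pos phi pw[of 2] by (intro mult_mono) (auto simp: one_le_power)
  also have "\<phi>^4*\<phi>^2 = \<phi>^6" by (simp flip: power_add)
  finally have c3: "\<phi>^4*\<psi>^4 \<le> l^2*\<psi>^2*\<phi>^6" .
  have "l^2*\<psi>^2*D = l^2*\<psi>^2*\<phi>^6 + l^2*\<psi>^2*(W*B*\<phi>^3) + l^2*\<psi>^2*(\<delta>*B^2)" unfolding D_def by (simp add: algebra_simps)
  moreover have "K*D*\<psi>^8 = (\<epsilon>*C2 + K*D)*\<psi>^8 - \<epsilon>*S^2*\<psi>^8 + \<epsilon>*(S^2 - C2)*\<psi>^8" by (simp add: algebra_simps)
  ultimately have "K*D*\<psi>^8 < l^2*\<psi>^2*D + 2*(l-2)*\<psi>^2*D"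
    using E' c0 c1 c2 c3 by linarith
  then have "(\<psi>^2*D)*(K*\<psi>^6) < (\<psi>^2*D)*(l^2+2*(l-2))" by (simp add: numeral_eq_Suc algebra_simps)
  then have k: "K*\<psi>^6 < l^2+2*(l-2)" using Dpos pos by (simp add: mult_less_cancel_left_pos)
  have "0 \<le> (l-4)^2" by simp
  then have "l^2+2*(l-2) \<le> 5/4*l^2" by (simp add: power2_eq_square algebra_simps)
  then have "K*\<psi>^6 \<le> 5/4*l^2" using k by linarith
  then have "4/5*(K*\<psi>^6) * (B*\<psi>)^2 \<le> l^2*(B*\<psi>)^2" by (intro mult_right_mono) auto
  then have x2: "4/5*(K*\<psi>^6)*(B*\<psi>)^2 \<le> x^2" unfolding x by (simp add: power_mult_distrib algebra_simps)
  have "pi^3 \<le> (31416/10000)^3" using pi_bounds by (intro power_mono) auto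
  \<comment> \<open>The constant is the square root of \<open>(4/5) 27/(8\<pi>\<^sup>3)\<close>, rounded down.\<close>
  then have pi3: "(2949/10000)^2 * (8*pi^3) \<le> (216/10)" by (simp add: power3_eq_cube power2_eq_square)
  have sq: "(c*P^3*B*\<psi>^4)^2 = c^2*(P^6*B^2*\<psi>^8)" for c :: real
    by (simp add: power_mult_distrib flip: power_mult)
  have "(2949/10000)^2 \<le> (216/10)/(8*pi^3)" using pi3 by (subst pos_le_divide_eq) auto
  then have "((2949/10000)*P^3*B*\<psi>^4)^2 \<le> (216/10)/(8*pi^3) * (P^6*B^2*\<psi>^8)"
    unfolding sq by (rule mult_right_mono) auto
  also have "\<dots> = 4/5*(K*\<psi>^6)*(B*\<psi>)^2"
  proof -
    have "\<psi>^8 = \<psi>^6*\<psi>^2" by (simp flip: power_add)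
    then show ?thesis unfolding K_def power_mult_distrib by simp
  qed
  finally have "((2949/10000)*P^3*B*\<psi>^4)^2 \<le> x^2" using x2 by linarith
  then have "(2949/10000)*P^3*B*\<psi>^4 \<le> x" using pos(5) by (rule power2_le_imp_le)
  then show "(2949/10000) * (\<phi>^3+2*pi*B)^3 * B * \<psi>^4 \<le> x" unfolding P_def .
qed

text \<open>
  This absorbs the factor \<open>1/sqrt \<delta>\<close> of the boundary term, which is a multiple of \<open>sqrt (B/\<phi>^11)\<close>. For \<open>n < 1\<close> the lower
  bound on \<open>nx\<close> compensates the negative power of \<open>\<phi>\<close>; otherwise \<open>\<phi> \<ge> 1\<close>, and the linear or the cubic lower bound on \<open>x\<close>
  is used according to the size of \<open>B\<close>.
\<close>

lemma quintic_bound: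
  fixes \<phi> B x n :: real
  assumes phi: "0 < \<phi>" and Bpos: "0 < B" and xpos: "0 < x" and npos: "0 < n"
    and nF: "n \<le> \<phi>^4" and xM: "(76/10)*B^2 \<le> x"
    and nx: "n < 1 \<Longrightarrow> (8/10) \<le> n*x"
    and large: "\<not> n < 1 \<Longrightarrow> 1 \<le> \<phi>" "\<not> n < 1 \<Longrightarrow> 2*B \<le> x" "\<not> n < 1 \<Longrightarrow> (785/10)*B^3 \<le> x"
  shows "B^5/\<phi>^3 \<le> (125/10000)*x^4"
proof (cases "n < 1")
  case True
  have x8: "(8/10) \<le> x" 
  proof -
    have "n*x \<le> 1*x" using True xpos by (intro mult_right_mono) auto
    then show ?thesis using nx[OF True] by linarith
  qed
  have f: "1/\<phi>^4 \<le> (125/100)*x"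
  proof -
    have "(8/10) \<le> n*x" by (rule nx[OF True])
    also have "\<dots> \<le> \<phi>^4*x" using nF xpos by (intro mult_right_mono) auto
    finally show ?thesis using phi by (simp add: field_simps)
  qed
  have B4: "B^4 \<le> x^2/(5776/100)"
  proof -
    have "(c*B^2)^2 = c^2*B^4" for c by (simp add: power_mult_distrib)
    note this[of "(76/10)"]
    moreover have "((76/10)*B^2)^2 \<le> x^2" by (rule power_mono[OF xM]) simp
    ultimately show ?thesis by (simp add: power2_eq_square[of "_/_"])
  qed
  have f3: "(1/\<phi>^4)^3 \<le> ((125/100)*x)^3" by (rule power_mono[OF f]) (use phi in simp)
  have "(B/\<phi>^3)^4 = B^4*(1/\<phi>^4)^3" by (simp add: power_divide flip: power_mult)
  also have "\<dots> \<le> (x^2/(5776/100))*((125/100)*x)^3" by (rule mult_mono[OF B4 f3]) (use phi in auto)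
  also have "\<dots> = ((125/100)^3/(5776/100))*x^5"
  proof -
    have "(x^2/a)*(c*x)^3 = (c^3/a)*x^5" for a c by (simp add: power_mult_distrib numeral_eq_Suc)
    then show ?thesis .
  qed
  also have "\<dots> \<le> (339/10000)*x^5" by (rule mult_right_mono) (use xpos in \<open>auto simp: power3_eq_cube\<close>)
  also have "\<dots> \<le> (339/10000)*x^5*(x/(8/10))^3"
  proof -
    have "1 \<le> (x/(8/10))^3" by (rule one_le_power) (use x8 in simp)
    from mult_left_mono[OF this, of "(339/10000)*x^5"] show ?thesis using xpos by simp
  qed
  also have "\<dots> \<le> ((52/100)*x^2)^4"
  proof -
    have 1: "c*x^5*(x/a)^3 = c/a^3*x^8" "(b*x^2)^4 = b^4*x^8" for a b c
      by (simp_all add: power_divide power_mult_distrib flip: power_mult power_add)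
    show ?thesis unfolding 1 by (rule mult_right_mono) (auto simp: power3_eq_cube power4_eq_xxxx)
  qed
  finally have "(B/\<phi>^3)^Suc 3 \<le> ((52/100)*x^2)^Suc 3" by simp
  then have "B/\<phi>^3 \<le> (52/100)*x^2" by (rule power_le_imp_le_base) simp
  from mult_mono[OF B4 this] have "B^4*(B/\<phi>^3) \<le> (x^2/(5776/100))*((52/100)*x^2)" using Bpos phi by simp
  also have "\<dots> = ((52/100)/(5776/100))*x^4" 
  proof -
    have "(x^2/a)*(c*x^2) = c/a*x^4" for a c by (simp flip: power_add)
    then show ?thesis .
  qed
  also have "\<dots> \<le> (125/10000)*x^4" by (rule mult_right_mono) auto
  also have "B^4*(B/\<phi>^3) = B^5/\<phi>^3" by (simp add: numeral_eq_Suc)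
  finally show ?thesis .
next
  case False
  note phi1 = large(1)[OF False]
  have "B^5/\<phi>^3 \<le> B^5/1" by (rule divide_left_mono) (use phi1 Bpos in \<open>auto simp: one_le_power\<close>)
  moreover have "B^5 \<le> (125/10000)*x^4"
  proof (cases "B \<le> (2/10)")
    case True
    have "2*B \<le> x" by (rule large(2)[OF False])
    then have "(2*B)^4 \<le> x^4" by (rule power_mono) (use Bpos in simp)
    moreover have "B^4*B \<le> B^4*(2/10)" by (rule mult_left_mono[OF True]) simp
    moreover have "(2*B)^4 = 16*B^4" "B^4*B = B^5" by (simp_all add: power_mult_distrib numeral_eq_Suc)
    ultimately show ?thesis by simp
  next
    case B2: False
    have "(785/10)*B^3 \<le> x" by (rule large(3)[OF False])
    then have "((785/10)*B^3)^4 \<le> x^4" by (rule power_mono) (use Bpos in simp)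
    moreover have "(c*B^3)^4 = c^4*B^12" for c by (simp add: power_mult_distrib flip: power_mult)
    note this[of "(785/10)"]
    ultimately have 2: "(785/10)^4*B^12 \<le> x^4" by linarith
    have "(2/10)^7 \<le> B^7" by (rule power_mono) (use B2 in auto)
    from mult_left_mono[OF this, of "B^5"] have "B^5*(2/10)^7 \<le> B^12" using Bpos by (simp flip: power_add)
    then have "(785/10)^4*(B^5*(2/10)^7) \<le> (785/10)^4*B^12" by (rule mult_left_mono) simp
    then have "(785/10)^4*(B^5*(2/10)^7) \<le> x^4" using 2 by linarith
    moreover have "80*B^5 \<le> ((785/10)^4*(2/10)^7)*B^5" by (rule mult_right_mono) (use Bpos in \<open>auto simp: power_divide\<close>)
    moreover have "(785/10)^4*(B^5*(2/10)^7) = ((785/10)^4*(2/10)^7)*B^5" by (simp only: mult_ac)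
    moreover have "0 \<le> B^5" using Bpos by simp
    ultimately show ?thesis by linarith
  qed
  ultimately show ?thesis by linarith
qed

text \<open>
  The part of the boundary term that contains both \<open>1/sqrt \<delta>\<close> and the amplitude \<open>S\<close>. For \<open>n < 1\<close> the amplitude is
  dominated by \<open>nx\<close>, and for \<open>n \<ge> 1\<close> the term \<open>n\<^sup>2/(2\<pi>)\<close> is paid for by the sixth power of \<open>P\<close>.
\<close>

lemma sup_term_bound:
  fixes \<phi> B x n S P :: real
  assumes phi: "0 < \<phi>" and Bpos: "0 < B" and xpos: "0 < x" and npos: "0 < n"
    and nF: "n \<le> \<phi>^4" and P6: "(816/10)*B*\<phi>^15 \<le> P^6" and Ppos: "0 \<le> P"
    and xL: "(2949/10000) * P^3 * B * n \<le> x" and xb: "(785/10)*(B^3*\<phi>^3*n) \<le> x" and xc: "(731/10)*(B^4*n) \<le> x"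
    and nx: "n < 1 \<Longrightarrow> (8/10) \<le> n*x"
    and S1: "n < 1 \<Longrightarrow> S^2 \<le> (12/10)*(n*x)" and S2: "S^2 \<le> n^2/(2*pi) + n*x"
    and phi1: "\<not> n < 1 \<Longrightarrow> 1 \<le> \<phi>"
  shows "(1879/100)*B^3/\<phi>^7*(S^2*n^2) \<le> x^2"
proof (cases "n < 1")
  case True
  have "(226/10)*(B^3*n^3/\<phi>^7) \<le> x"
  proof (cases "1 \<le> \<phi>")
    case T: True
    have "n^3 \<le> n^1" by (rule power_decreasing) (use True npos in auto)
    also have "n^1*1 \<le> n*\<phi>^10" unfolding power_one_right by (rule mult_left_mono) (use T npos in \<open>auto simp: one_le_power\<close>)
    finally have "n^3 \<le> n*\<phi>^10" by simp
    from divide_right_mono[OF this, of "\<phi>^7"] have "n^3/\<phi>^7 \<le> n*\<phi>^10/\<phi>^7" using phi by simp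
    also have "\<phi>^10 = \<phi>^3*\<phi>^7" by (simp flip: power_add)
    also have "n*(\<phi>^3*\<phi>^7)/\<phi>^7 = \<phi>^3*n" using phi by (simp del: power_add power_add_numeral power_add_numeral2)
    finally have "n^3/\<phi>^7 \<le> \<phi>^3*n" .
    from mult_left_mono[OF this, of "B^3"] have "B^3*n^3/\<phi>^7 \<le> B^3*\<phi>^3*n" using Bpos by simp
    moreover have "0 \<le> B^3*n^3/\<phi>^7" using Bpos npos phi by simp
    ultimately show ?thesis using xb by linarith
  next
    case F: False
    have "n^10 \<le> (\<phi>^4)^10" by (rule power_mono[OF nF]) (use npos in simp)
    also have "(\<phi>^4)^10 = \<phi>^40" by (simp flip: power_mult)
    also have "\<phi>^40 \<le> \<phi>^28" by (rule power_decreasing) (use F phi in auto)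
    finally have n10: "n^10/\<phi>^28 \<le> 1" using phi by simp
    have xd: "(8/10)/n \<le> x" using nx[OF True] unfolding pos_divide_le_eq[OF npos] mult.commute[of x n] .
    have "(c*(B^3*n^3/\<phi>^7))^4 = c^4*(B^12*n^2)*(n^10/\<phi>^28)" for c
      by (simp add: power_mult_distrib power_divide flip: power_mult power_add)
    note this[of "(226/10)"]
    also have "(226/10)^4*(B^12*n^2)*(n^10/\<phi>^28) \<le> (226/10)^4*(B^12*n^2)*1"
      by (rule mult_left_mono[OF n10]) simp
    also have "\<dots> \<le> ((731/10)^3*(8/10))*(B^12*n^2)" unfolding mult_1_right by (rule mult_right_mono) (auto simp: power_divide)
    also have "\<dots> = ((731/10)*(B^4*n))^3*((8/10)/n)"
    proof -
      have "(c*(B^4*n))^3*(d/n) = (c^3*d)*(B^12*(n^3/n))" for c d by (simp add: power_mult_distrib flip: power_mult)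
      moreover have "n^3/n = n^2" using npos by (simp add: power2_eq_square power3_eq_cube)
      ultimately show ?thesis by metis
    qed
    also have "\<dots> \<le> x^3*x" by (rule mult_mono[OF power_mono[OF xc] xd]) (use npos xpos in auto)
    also have "\<dots> = x^Suc 3" by (simp add: numeral_eq_Suc)
    finally have "((226/10)*(B^3*n^3/\<phi>^7))^Suc 3 \<le> x^Suc 3" by simp
    then show ?thesis by (rule power_le_imp_le_base) (use xpos in simp)
  qed
  from mult_right_mono[OF this, of x] have *: "(226/10)*(B^3*n^3/\<phi>^7)*x \<le> x^2" using xpos by (simp add: power2_eq_square)
  have "(1879/100)*B^3/\<phi>^7*(S^2*n^2) \<le> (1879/100)*B^3/\<phi>^7*((12/10)*(n*x)*n^2)"
    by (intro mult_left_mono mult_right_mono S1[OF True]) (use Bpos phi in auto)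
  also have "\<dots> = (22548/1000)*((B^3*n^3/\<phi>^7)*x)" by (simp add: power2_eq_square power3_eq_cube)
  also have "\<dots> \<le> (226/10)*((B^3*n^3/\<phi>^7)*x)" by (rule mult_right_mono) (use Bpos phi npos xpos in auto)
  finally show ?thesis using * by simp
next
  case False
  note phi1 = phi1[OF False]
  have n2: "n^2 \<le> \<phi>^8" using power_mono[OF nF, of 2] npos by (simp flip: power_mult)
  have "n^2/\<phi>^7 \<le> \<phi>^8/\<phi>^7" by (rule divide_right_mono[OF n2]) (use phi in simp)
  also have "\<phi>^8 = \<phi>*\<phi>^7" by (simp add: numeral_eq_Suc)
  finally have n27: "n^2/\<phi>^7 \<le> \<phi>" using phi by simp
  have p3: "\<phi> \<le> \<phi>^3" and p15: "\<phi> \<le> \<phi>^15" using phi1 by (simp_all add: self_le_power)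
  have a: "(1879/100)*B^3/\<phi>^7*(n^3*x) \<le> (25/100)*x^2"
  proof -
    from mult_left_mono[OF order_trans[OF n27 p3], of "B^3*n"]
    have "B^3*n*(n^2/\<phi>^7) \<le> B^3*\<phi>^3*n" using Bpos npos by (simp add: mult_ac)
    also have "B^3*n*(n^2/\<phi>^7) = B^3*n^3/\<phi>^7" by (simp add: power2_eq_square power3_eq_cube)
    finally have "(1879/100)*(B^3*n^3/\<phi>^7) \<le> (25/100)*x"
      using xb xpos by linarith
    from mult_right_mono[OF this, of x] show ?thesis using xpos by (simp add: power2_eq_square mult_ac)
  qed
  have b: "(1879/100)*B^3/\<phi>^7*(n^4/(2*pi)) \<le> (5/10)*x^2"
  proof -
    have "((2949/10000)*P^3*B*n)^2 \<le> x^2" by (rule power_mono[OF xL]) (use Bpos npos Ppos in simp)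
    moreover have "(c*P^3*B*n)^2 = c^2*(P^6*(B^2*n^2))" for c by (simp add: power_mult_distrib flip: power_mult)
    note this[of "(2949/10000)"]
    moreover have "(816/10)*B*\<phi>^15*(B^2*n^2) \<le> P^6*(B^2*n^2)" by (rule mult_right_mono[OF P6]) simp
    from mult_left_mono[OF this, of "(2949/10000)^2"] have "(2949/10000)^2*((816/10)*B*\<phi>^15*(B^2*n^2)) \<le> (2949/10000)^2*(P^6*(B^2*n^2))" by simp
    moreover have "a*(c*B*\<phi>^15*(B^2*n^2)) = (a*c)*(B^3*n^2*\<phi>^15)" for a c by (simp add: power2_eq_square power3_eq_cube)
    note this[of "(2949/10000)^2" "(816/10)"]
    ultimately have 2: "((2949/10000)^2*(816/10))*(B^3*n^2*\<phi>^15) \<le> x^2" by linarith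
    from mult_left_mono[OF order_trans[OF n27 p15], of "B^3*n^2"]
    have "B^3*n^2*(n^2/\<phi>^7) \<le> B^3*n^2*\<phi>^15" using Bpos by simp
    moreover have "B^3*n^2*(n^2/\<phi>^7) = B^3*n^4/\<phi>^7" by (simp flip: power_add)
    ultimately have 3: "B^3*n^4/\<phi>^7 \<le> B^3*n^2*\<phi>^15" by metis
    have "(1879/100)/(2*pi) \<le> 3" using pi_bounds by (simp add: field_simps)
    then have "(1879/100)/(2*pi)*(B^3*n^4/\<phi>^7) \<le> 3*(B^3*n^2*\<phi>^15)" by (rule mult_mono[OF _ 3]) (use Bpos phi in auto)
    moreover have "(1879/100)*B^3/\<phi>^7*(n^4/(2*pi)) = (1879/100)/(2*pi)*(B^3*n^4/\<phi>^7)"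
    proof -
      have "c*B^3/a*(n^4/b) = c/b*(B^3*n^4/a)" for a b c :: real by (simp add: mult_ac)
      then show ?thesis .
    qed
    moreover have "3*(B^3*n^2*\<phi>^15) \<le> (5/10)*((2949/10000)^2*(816/10))*(B^3*n^2*\<phi>^15)"
      by (rule mult_right_mono) (use Bpos phi in \<open>auto simp: power2_eq_square\<close>)
    ultimately show ?thesis using 2 by linarith
  qed
  have "(1879/100)*B^3/\<phi>^7*(S^2*n^2) \<le> (1879/100)*B^3/\<phi>^7*((n^2/(2*pi) + n*x)*n^2)"
    by (intro mult_left_mono mult_right_mono S2) (use Bpos phi in auto)
  also have "(n^2/(2*pi) + n*x)*n^2 = n^4/(2*pi) + n^3*x"
    by (simp add: algebra_simps power2_eq_square power3_eq_cube power4_eq_xxxx)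
  also have "(1879/100)*B^3/\<phi>^7*(n^4/(2*pi) + n^3*x) = (1879/100)*B^3/\<phi>^7*(n^4/(2*pi)) + (1879/100)*B^3/\<phi>^7*(n^3*x)"
    by (rule distrib_left)
  finally have c: "(1879/100)*B^3/\<phi>^7*(S^2*n^2) \<le> (1879/100)*B^3/\<phi>^7*(n^4/(2*pi)) + (1879/100)*B^3/\<phi>^7*(n^3*x)" .
  have aux: "t \<le> y" if "t \<le> p + q" "p \<le> (5/10)*y" "q \<le> (25/100)*y" "0 \<le> y" for t p q y :: real
    using that by linarith
  show ?thesis by (rule aux[OF c b a]) simp
qed

text \<open>
  The part of the boundary term that contains \<open>S\<close> without \<open>1/sqrt \<delta>\<close>. It is the tightest one: it takes 19/20 of the
  share \<open>\<theta>\<close> of \<open>B\<close>.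
\<close>

lemma jump_sup_term_bound:
  fixes \<phi> B x n S M \<theta> \<eta> :: real
  assumes phi: "0 < \<phi>" and Bpos: "0 < B" and xpos: "0 < x" and npos: "0 < n" and M: "0 \<le> M" and th0: "0 \<le> \<theta>" and S0: "0 \<le> S"
    and nF: "n \<le> \<phi>^4" and xa: "25/2*(B^2*\<phi>^6*n) \<le> x"
    and th: "2*M*\<phi> = \<theta>*B" and et: "2*M = \<eta>^2*B^2"
    and S1: "n < 1 \<Longrightarrow> S^2 \<le> 6/5*(n*x)" and S2: "S^2 \<le> n^2/(2*pi) + n*x"
    and phi1: "\<not> n < 1 \<Longrightarrow> 1 \<le> \<phi>"
  shows "3*(2*M)*S*n \<le> (19/20*\<theta> + 1/10*\<eta>^2)*x"
proof -
  have th': "2*M = \<theta>*B/\<phi>" using th phi by (simp add: field_simps)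
  have n2: "n^2 \<le> \<phi>^8" using power_mono[OF nF, of 2] npos by (simp flip: power_mult)
  have key: "25/2*(B^2*n^3/\<phi>^2) \<le> x"
  proof -
    have "n^2/\<phi>^2 \<le> \<phi>^8/\<phi>^2" by (rule divide_right_mono[OF n2]) simp
    also have "\<dots> = \<phi>^6" using phi by (simp add: numeral_eq_Suc)
    finally have "B^2*n*(n^2/\<phi>^2) \<le> B^2*n*\<phi>^6" by (rule mult_left_mono) (use npos in simp)
    moreover have "B^2*n*(n^2/\<phi>^2) = B^2*n^3/\<phi>^2" by (simp add: power2_eq_square power3_eq_cube)
    moreover have "B^2*n*\<phi>^6 = B^2*\<phi>^6*n" by simp
    ultimately show ?thesis using xa by linarith
  qed
  define R where "R = sqrt (6/5*(n*x))"
  have R0: "0 \<le> R" unfolding R_def using npos xpos by simp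
  have R2: "R^2 = 6/5*(n*x)" unfolding R_def using npos xpos by simp
  have main: "3*(2*M)*n*R \<le> 19/20*\<theta>*x"
  proof (rule power2_le_imp_le)
    have "(3*(2*M)*n*R)^2 = 9*(\<theta>*B/\<phi>)^2*n^2*(6/5*(n*x))"
      unfolding th' power_mult_distrib R2 by simp
    also have "\<dots> = (108/125*\<theta>^2*x)*(25/2*(B^2*n^3/\<phi>^2))"
      by (simp add: power_divide power_mult_distrib power2_eq_square power3_eq_cube mult_ac)
    also have "\<dots> \<le> (108/125*\<theta>^2*x)*x" by (rule mult_left_mono[OF key]) (use xpos in simp)
    also have "\<dots> = 108/125*(\<theta>^2*x^2)" by (simp add: power2_eq_square)
    also have "\<dots> \<le> (19/20)^2*(\<theta>^2*x^2)" by (rule mult_right_mono) (auto simp: power2_eq_square)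
    also have "\<dots> = (19/20*\<theta>*x)^2" unfolding power_mult_distrib by simp
    finally show "(3*(2*M)*n*R)^2 \<le> (19/20*\<theta>*x)^2" .
  qed (use th0 xpos in simp)
  show ?thesis
  proof (cases "n < 1")
    case True
    have "S \<le> R" by (rule power2_le_imp_le[OF _ R0]) (simp only: R2 S1[OF True])
    then have "3*(2*M)*n*S \<le> 3*(2*M)*n*R" by (rule mult_left_mono) (use M npos in simp)
    moreover have "0 \<le> 1/10*\<eta>^2*x" using xpos by simp
    moreover have "3*(2*M)*S*n = 3*(2*M)*n*S" "(19/20*\<theta> + 1/10*\<eta>^2)*x = 19/20*\<theta>*x + 1/10*\<eta>^2*x"
      by (simp_all add: distrib_right)
    ultimately show ?thesis using main by linarith
  next
    case False
    note phi1 = phi1[OF False]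
    have nx0: "0 \<le> n*x" using npos xpos by simp
    have S: "S \<le> 2/5*n + R"
    proof (rule power2_le_imp_le)
      have "n^2/(2*pi) \<le> n^2/(25/4)" by (rule divide_left_mono) (use pi_bounds in auto)
      then have "S^2 \<le> 4/25*n^2 + 6/5*(n*x)" using S2 nx0 by simp
      also have "\<dots> \<le> 4/25*n^2 + R^2 + 2*(2/5*n)*R" unfolding R2 using npos R0 by simp
      also have "\<dots> = (2/5*n + R)^2" by (simp add: power2_eq_square algebra_simps)
      finally show "S^2 \<le> (2/5*n + R)^2" .
    qed (use npos R0 in simp)
    have "3*(2*M)*n*S \<le> 3*(2*M)*n*(2/5*n + R)" by (rule mult_left_mono[OF S]) (use M npos in simp)
    also have "\<dots> = 6/5*(2*M*n^2) + 3*(2*M)*n*R" by (simp add: algebra_simps power2_eq_square)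
    finally have 1: "3*(2*M)*n*S \<le> 6/5*(2*M*n^2) + 3*(2*M)*n*R" .
    have "\<phi>^4 \<le> \<phi>^6" by (rule power_increasing) (use phi1 in auto)
    then have "n \<le> \<phi>^6" using nF by linarith
    then have "\<eta>^2*B^2*n*n \<le> \<eta>^2*B^2*n*\<phi>^6" by (rule mult_left_mono) (use npos in simp)
    then have "2*M*n^2 \<le> \<eta>^2*(B^2*\<phi>^6*n)" unfolding et by (simp add: power2_eq_square mult_ac)
    moreover have "\<eta>^2*(25/2*(B^2*\<phi>^6*n)) \<le> \<eta>^2*x" by (rule mult_left_mono[OF xa]) simp
    moreover have "\<eta>^2*(25/2*(B^2*\<phi>^6*n)) = 25/2*(\<eta>^2*(B^2*\<phi>^6*n))" by simp
    moreover have "0 \<le> \<eta>^2*x" using xpos by simp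
    ultimately have 2: "6/5*(2*M*n^2) \<le> 1/10*(\<eta>^2*x)" by linarith
    have "3*(2*M)*S*n = 3*(2*M)*n*S" "(19/20*\<theta> + 1/10*\<eta>^2)*x = 19/20*\<theta>*x + 1/10*(\<eta>^2*x)"
      by (simp_all add: distrib_right)
    then show ?thesis using main 1 2 by linarith
  qed
qed

text \<open>
  Let \<open>\<alpha>\<close>, \<open>\<theta>\<close>, \<open>\<eta>\<close> be the shares of the three summands in \<open>B\<close>. Every summand of the upper bound on \<open>x\<^sup>2\<close> is a product of powers of
  these shares, \<open>B\<close>, \<open>\<phi>\<close> and \<open>n\<close>, and the lower bounds on \<open>x\<close> forced by the detuning reduce it to a multiple of \<open>x\<^sup>2\<close> by the shares
  alone. Since \<open>\<alpha> + \<theta> + \<eta> \<le> 1\<close>, the multiples add up to less than 1.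
\<close>

lemma far_detuned_contradiction:
  fixes \<phi> \<psi> B \<delta> M J x S W Y \<epsilon> :: real
  assumes pos: "0 < \<psi>" "\<psi> \<le> \<phi>" "0 < \<delta>" "0 \<le> x" "0 \<le> W" "0 \<le> \<epsilon>" "\<epsilon> \<le> 1" "0 \<le> M" "0 \<le> J" "0 \<le> S"
    and S: "24/25 \<le> S^2" "S^2 \<le> \<psi>^8/(2*pi) + \<psi>^4*x"
    and E: "Y * \<psi>^8 \<le> \<delta>*x^2 + W*x*\<psi>^4 + \<phi>^4*\<psi>^4 + \<epsilon>*S^2*\<psi>^8"
    and Y: "\<epsilon> * (\<phi>^2*(\<phi>^3+2*pi*B)^2/(2*pi)) + 27*(\<phi>^3+2*pi*B)^6*(\<phi>^6+W*B*\<phi>^3+\<delta>*B^2)/(8*pi^3) < Y"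
    and B: "\<phi>^11/(2*\<delta>) + 2*M*\<phi> + sqrt (2*M) \<le> B"
    and x: "x^2 \<le> \<psi>^4*x*\<phi>^8/(4*\<delta>) + sqrt (2*pi)*M*x + J*((1/pi + 1/(2* sqrt \<delta>))*(J + 3*S*\<psi>^4*x) + 2*M)"
    and J: "J \<le> 2*pi*M" "J^2 \<le> (101/10)*M*\<phi>^4"
  shows False
proof -
  have phi: "0 < \<phi>" using pos by linarith
  have Bpos: "0 < B"
  proof -
    have "0 < \<phi>^11/(2*\<delta>)" using phi pos by simp
    moreover have "0 \<le> 2*M*\<phi>" "0 \<le> sqrt (2*M)" using phi pos by auto
    ultimately show ?thesis using B by linarith
  qed
  have pw: "\<psi>^k \<le> \<phi>^k" for k using pos by (intro power_mono) auto
  define \<alpha> \<theta> \<eta> where "\<alpha> = \<phi>^11/(2*\<delta>*B)" and "\<theta> = 2*M*\<phi>/B" and "\<eta> = sqrt (2*M)/B"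
  have nn: "0 \<le> \<alpha>" "0 \<le> \<theta>" "0 \<le> \<eta>" unfolding \<alpha>_def \<theta>_def \<eta>_def using phi pos Bpos by auto
  have "\<alpha> + \<theta> + \<eta> = (\<phi>^11/(2*\<delta>) + 2*M*\<phi> + sqrt (2*M))/B"
    unfolding \<alpha>_def \<theta>_def \<eta>_def using Bpos by (simp add: add_divide_distrib)
  also have "\<dots> \<le> 1" using B Bpos by simp
  finally have sum: "\<alpha> + \<theta> + \<eta> \<le> 1" .
  have al: "1/\<delta> = 2*\<alpha>*B/\<phi>^11" unfolding \<alpha>_def using phi pos Bpos by (simp add: field_simps)
  have th: "2*M*\<phi> = \<theta>*B" unfolding \<theta>_def using Bpos by simp
  have et: "2*M = \<eta>^2*B^2" unfolding \<eta>_def using Bpos pos by (simp add: power_divide)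
  have Mval: "M = \<eta>^2*B^2/2" using et by simp
  have "\<alpha> \<le> 1" using sum nn by linarith
  then have "\<phi>^11 \<le> 2*\<delta>*B" unfolding \<alpha>_def using pos Bpos by simp
  note dsb = detuning_forces_steep_slope[OF pos(1-3) Bpos pos(4-7) S E Y this]
  have x2B: "2*B*\<psi> \<le> x" by (rule dsb)
  have xpos: "0 < x" using x2B Bpos pos(1) by (smt (verit) mult_pos_pos)
  define n where "n = \<psi>^4"
  have npos: "0 < n" using pos by (simp add: n_def)
  have nF: "n \<le> \<phi>^4" unfolding n_def by (rule pw)
  define P where "P = \<phi>^3 + 2*pi*B"
  have xL: "(2949/10000) * P^3 * B * n \<le> x" using dsb(2) by (simp add: P_def n_def)
  define z where "z = 2*pi*B/\<phi>^3"
  have z0: "0 \<le> z" unfolding z_def using phi Bpos by simp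
  have Pz: "P = \<phi>^3*(1+z)" unfolding P_def z_def using phi by (simp add: field_simps)
  have zB: "\<phi>^3*z = 2*pi*B" unfolding z_def using phi by simp
  have Bz: "(6283/1000)*B \<le> \<phi>^3*z" unfolding zB using pi_bounds Bpos by simp
  have P3a: "(424/10)*\<phi>^6*B \<le> P^3"
  proof -
    have "27/4*((6283/1000)*B)*\<phi>^6 \<le> 27/4*(\<phi>^3*z)*\<phi>^6" using Bz phi by (intro mult_right_mono mult_left_mono) auto
    also have "\<dots> = \<phi>^9*(27/4*z)" by (simp add: numeral_eq_Suc algebra_simps)
    also have "\<dots> \<le> \<phi>^9*(1+z)^3" using binomial_power_lower_bounds(1)[OF z0] phi by (intro mult_left_mono) auto
    also have "\<dots> = P^3" unfolding Pz by (simp add: power_mult_distrib flip: power_mult)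
    finally have "27/4*((6283/1000)*B)*\<phi>^6 \<le> P^3" .
    moreover have "(424/10)*\<phi>^6*B \<le> 27/4*((6283/1000)*B)*\<phi>^6" using Bpos phi by (simp add: algebra_simps)
    ultimately show ?thesis by linarith
  qed
  have P3b: "(2664/10)*(B^2*\<phi>^3) \<le> P^3"
  proof -
    have "((6283/1000)*B)^2 \<le> (\<phi>^3*z)^2" using Bz Bpos by (intro power_mono) auto
    then have "27/4*((6283/1000)*B)^2*\<phi>^3 \<le> 27/4*(\<phi>^3*z)^2*\<phi>^3" using phi by (intro mult_right_mono mult_left_mono) auto
    also have "\<dots> = \<phi>^9*(27/4*z^2)" by (simp add: numeral_eq_Suc algebra_simps)
    also have "\<dots> \<le> \<phi>^9*(1+z)^3" using binomial_power_lower_bounds(2)[OF z0] phi by (intro mult_left_mono) auto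
    also have "\<dots> = P^3" unfolding Pz by (simp add: power_mult_distrib flip: power_mult)
    finally have "27/4*((6283/1000)*B)^2*\<phi>^3 \<le> P^3" .
    moreover have "27/4*(c*B)^2*\<phi>^3 = 27/4*c^2*(B^2*\<phi>^3)" for c by (simp add: power_mult_distrib)
    note this[of "(6283/1000)"]
    moreover have "(2664/10)*(B^2*\<phi>^3) \<le> 27/4*(6283/1000)^2*(B^2*\<phi>^3)" using phi by (intro mult_right_mono) (auto simp: power2_eq_square)
    ultimately show ?thesis by linarith
  qed
  have P3c: "248*B^3 \<le> P^3"
  proof -
    have "(6283/1000)*B \<le> P" using Bz zero_less_power[OF phi, of 3] unfolding P_def zB by linarith
    then have "((6283/1000)*B)^3 \<le> P^3" using Bpos by (intro power_mono) auto
    moreover have "248*B^3 \<le> ((6283/1000)*B)^3" unfolding power_mult_distrib using Bpos by (intro mult_right_mono) (auto simp: power3_eq_cube)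
    ultimately show ?thesis by linarith
  qed
  have P6: "(816/10)*B*\<phi>^15 \<le> P^6"
  proof -
    have "13*((6283/1000)*B)*\<phi>^15 \<le> 13*(\<phi>^3*z)*\<phi>^15" using Bz phi by (intro mult_right_mono mult_left_mono) auto
    also have "\<dots> = \<phi>^18*(13*z)" by (simp add: numeral_eq_Suc algebra_simps)
    also have "\<dots> \<le> \<phi>^18*(1+z)^6" using binomial_power_lower_bounds(3)[OF z0] phi by (intro mult_left_mono) auto
    also have "\<dots> = P^6" unfolding Pz by (simp add: power_mult_distrib flip: power_mult)
    finally have "13*((6283/1000)*B)*\<phi>^15 \<le> P^6" .
    moreover have "(816/10)*B*\<phi>^15 \<le> 13*((6283/1000)*B)*\<phi>^15" using Bpos phi by (simp add: algebra_simps)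
    ultimately show ?thesis by linarith
  qed
  \<comment> \<open>Each lower bound on \<open>P\<^sup>3\<close> yields one on \<open>x\<close>.\<close>
  have xP: "(2949/10000)*k*(Q*B*n) \<le> x" if "k*Q \<le> P^3" for k Q
  proof -
    have "(2949/10000)*(k*Q)*B*n \<le> (2949/10000)*P^3*B*n" using that Bpos npos by (intro mult_right_mono mult_left_mono) auto
    moreover have "(2949/10000)*k*(Q*B*n) = (2949/10000)*(k*Q)*B*n" by simp
    ultimately show ?thesis using xL by linarith
  qed
  have xa: "(125/10)*(B^2*\<phi>^6*n) \<le> x"
  proof -
    have "(424/10)*(\<phi>^6*B) \<le> P^3" using P3a by simp
    note xP[OF this]
    moreover have "\<phi>^6*B*B*n = B^2*\<phi>^6*n" by (simp add: power2_eq_square)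
    moreover have "0 \<le> B^2*\<phi>^6*n" using npos by simp
    ultimately show ?thesis by simp
  qed
  have xb: "(785/10)*(B^3*\<phi>^3*n) \<le> x"
  proof -
    note xP[OF P3b]
    moreover have "B^2*\<phi>^3*B*n = B^3*\<phi>^3*n" by (simp add: power2_eq_square power3_eq_cube)
    moreover have "0 \<le> B^3*\<phi>^3*n" using npos Bpos phi by simp
    ultimately show ?thesis by simp
  qed
  have xc: "(731/10)*(B^4*n) \<le> x"
  proof -
    note xP[OF P3c]
    moreover have "B^3*B*n = B^4*n" by (simp add: numeral_eq_Suc)
    moreover have "0 \<le> B^4*n" using npos by simp
    ultimately show ?thesis by simp
  qed
  have nx: "(8/10) \<le> n*x" if "n < 1"
  proof -
    have "n^2 \<le> 1" using that npos by (simp add: power_le_one)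
    then have "n^2/(2*pi) \<le> 1/(2*(31415/10000))" using pi_bounds by (intro frac_le) auto
    moreover have "\<psi>^8 = n^2" by (simp add: n_def flip: power_mult)
    ultimately show ?thesis using S by (simp add: n_def[symmetric])
  qed
  have S1: "S^2 \<le> (12/10)*(n*x)" if "n < 1"
  proof -
    have "n^2 \<le> 1" using that npos by (simp add: power_le_one)
    then have "n^2/(2*pi) \<le> 1/(2*(31415/10000))" using pi_bounds by (intro frac_le) auto
    moreover have "\<psi>^8 = n^2" by (simp add: n_def flip: power_mult)
    ultimately show ?thesis using S nx[OF that] by (simp add: n_def[symmetric])
  qed
  have S2: "S^2 \<le> n^2/(2*pi) + n*x" using S(2) by (simp add: n_def flip: power_mult)
  have phi1: "1 \<le> \<phi>" if "\<not> n < 1"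
    using that nF phi by (meson linorder_not_le order_less_le_trans order_le_less_trans power_less_one_iff less_imp_le zero_less_numeral)
  have xM: "(76/10)*B^2 \<le> x"
  proof (cases "n < 1")
    case True
    have "((76/10)*B^2)^2 = (5776/100)*B^4" by (simp add: power_divide power_mult_distrib)
    also have "\<dots> \<le> (8/10)*((731/10)*B^4)" by simp
    also have "\<dots> \<le> (n*x)*((731/10)*B^4)" using nx[OF True] by (intro mult_right_mono) auto
    also have "\<dots> = x*((731/10)*(B^4*n))" by simp
    also have "\<dots> \<le> x*x" using xc xpos by (intro mult_left_mono) auto
    finally have "((76/10)*B^2)^2 \<le> x^2" by (simp only: power2_eq_square[of x])
    then show ?thesis using less_imp_le[OF xpos] by (rule power2_le_imp_le)
  next
    case False
    then have "1 * 1 \<le> \<phi>^6*n" using phi1[OF False] by (intro mult_mono) (auto simp: one_le_power)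
    then have "(125/10)*(B^2*1) \<le> (125/10)*(B^2*(\<phi>^6*n))" by (intro mult_left_mono) auto
    moreover have "B^2*(\<phi>^6*n) = B^2*\<phi>^6*n" by simp
    moreover have "0 \<le> B^2" by simp
    ultimately show ?thesis using xa by linarith
  qed
  have Mx: "M \<le> (658/10000)*\<eta>^2*x"
  proof -
    have "\<eta>^2*((76/10)*B^2) \<le> \<eta>^2*x" using xM by (intro mult_left_mono) auto
    moreover have "0 \<le> \<eta>^2*x" using xpos by simp
    ultimately show ?thesis unfolding Mval by (simp add: algebra_simps)
  qed
  \<comment> \<open>In each of the next seven bounds one summand of the assumed bound on \<open>x\<^sup>2\<close> is compared with \<open>x\<^sup>2\<close>
    itself; the factors in \<open>\<alpha>\<close>, \<open>\<theta>\<close>, \<open>\<eta>\<close> must add up to less than 1.\<close>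
  have t1: "\<psi>^4*x*\<phi>^8/(4*\<delta>) \<le> \<alpha>/4*x^2"
  proof -
    have "\<psi>^4*\<phi>^8/(4*\<delta>) = \<psi>^4*\<phi>^8/4*(1/\<delta>)" by simp
    also have "\<dots> = \<alpha>*B*\<psi>*(\<psi>^3/\<phi>^3)/2" unfolding al using phi by (simp add: field_simps numeral_eq_Suc)
    also have "\<dots> \<le> \<alpha>*B*\<psi>*1/2"
      using pw[of 3] phi pos Bpos nn by (intro divide_right_mono mult_left_mono) auto
    also have "\<dots> \<le> \<alpha>/4*x" using mult_left_mono[OF x2B, of "\<alpha>/4"] nn by (simp add: algebra_simps)
    finally have "\<psi>^4*\<phi>^8/(4*\<delta>)*x \<le> \<alpha>/4*x*x" using xpos by (intro mult_right_mono) auto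
    then show ?thesis by (simp add: power2_eq_square algebra_simps)
  qed
  have sq2pi: "sqrt (2*pi) \<le> (2507/1000)" using pi_bounds by (intro real_le_lsqrt) (auto simp: power2_eq_square)
  have t2: "sqrt (2*pi)*M*x \<le> (165/1000)*\<eta>^2*x^2"
  proof -
    have "sqrt (2*pi)*M \<le> (2507/1000)*((658/10000)*\<eta>^2*x)" using sq2pi Mx pos by (intro mult_mono) auto
    also have "\<dots> \<le> (165/1000)*\<eta>^2*x" using mult_nonneg_nonneg[of "\<eta>^2" x] xpos by simp
    finally have "sqrt (2*pi)*M*x \<le> (165/1000)*\<eta>^2*x*x" using xpos by (intro mult_right_mono) auto
    then show ?thesis by (simp add: power2_eq_square)
  qed
  have eta1: "\<eta>^4 \<le> \<eta>^2" using nn sum by (intro power_decreasing) auto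
  have M2: "M^2 \<le> (433/100000)*\<eta>^2*x^2"
  proof -
    have "M^2 \<le> ((658/10000)*\<eta>^2*x)^2" using Mx pos by (intro power_mono) auto
    also have "((658/10000)*\<eta>^2*x)^2 = (658/10000)^2*(\<eta>^4*x^2)"
    proof -
      have "(c*\<eta>^2*x)^2 = c^2*(\<eta>^4*x^2)" for c by (simp add: power_mult_distrib flip: power_mult)
      then show ?thesis .
    qed
    also have "\<dots> \<le> (658/10000)^2*(\<eta>^2*x^2)" using eta1 by (intro mult_left_mono mult_right_mono) auto
    also have "\<dots> \<le> (433/100000)*(\<eta>^2*x^2)" by (intro mult_right_mono) (auto simp: power2_eq_square)
    finally show ?thesis by simp
  qed
  have J2: "J^2 \<le> 4*pi^2*M^2" using power_mono[OF J(1), of 2] pos by (simp add: power_mult_distrib)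
  have t3: "2*M*J \<le> (55/1000)*\<eta>^2*x^2"
  proof -
    have "2*M*J \<le> 2*M*(2*pi*M)" using J pos by (intro mult_left_mono) auto
    also have "\<dots> = (4*pi)*M^2" by (simp add: power2_eq_square)
    also have "\<dots> \<le> (125664/10000)*((433/100000)*\<eta>^2*x^2)" using M2 pi_bounds by (intro mult_mono) auto
    also have "\<dots> \<le> (55/1000)*\<eta>^2*x^2" by simp
    finally show ?thesis .
  qed
  have t4: "J^2/pi \<le> (55/1000)*\<eta>^2*x^2"
  proof -
    have "J^2/pi \<le> 4*pi^2*M^2/pi" by (rule divide_right_mono[OF J2]) simp
    also have "\<dots> = (4*pi)*M^2" by (simp add: power2_eq_square)
    also have "\<dots> \<le> (125664/10000)*((433/100000)*\<eta>^2*x^2)" using M2 pi_bounds by (intro mult_mono) auto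
    also have "\<dots> \<le> (55/1000)*\<eta>^2*x^2" by simp
    finally show ?thesis .
  qed
  have MF: "J^2 \<le> (505/100)*\<eta>^2*B^2*\<phi>^4" using J(2) unfolding Mval by simp
  have psi1: "1 \<le> \<psi>" if "\<not> n < 1"
  proof (rule ccontr)
    assume "\<not> 1 \<le> \<psi>"
    then have "\<psi>^4 < 1" using pos(1) by (simp add: power_less_one_iff)
    then show False using that by (simp add: n_def)
  qed
  have big1: "2*B \<le> x" if "\<not> n < 1"
  proof -
    have "2*B*1 \<le> 2*B*\<psi>" by (rule mult_left_mono[OF psi1[OF that]]) (use Bpos in simp)
    then show ?thesis using x2B by linarith
  qed
  have big2: "(785/10)*B^3 \<le> x" if "\<not> n < 1"
  proof -
    have "1*1 \<le> \<phi>^3*n" by (rule mult_mono) (use phi1[OF that] that in \<open>auto simp: one_le_power\<close>)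
    then have "B^3*(1*1) \<le> B^3*(\<phi>^3*n)" by (rule mult_left_mono) (use Bpos in simp)
    moreover have "B^3*(\<phi>^3*n) = B^3*\<phi>^3*n" by simp
    ultimately show ?thesis using xb by linarith
  qed
  note B5 = quintic_bound[OF phi Bpos xpos npos nF xM nx phi1 big1 big2]
  have sd: "1/(2* sqrt \<delta>) = sqrt (\<alpha>*B/(2*\<phi>^11))"
  proof -
    have "sqrt (\<alpha>*B/(2*\<phi>^11)) = sqrt (1/(4*\<delta>))" using arg_cong[OF al, of "\<lambda>t. t/4"] by (simp add: mult_ac)
    also have "\<dots> = 1/(2* sqrt \<delta>)" by (simp add: real_sqrt_divide real_sqrt_mult)
    finally show ?thesis by simp
  qed
  have t5: "J^2*(1/(2* sqrt \<delta>)) \<le> (4/10)*(sqrt \<alpha>*\<eta>)*x^2"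
  proof (rule power2_le_imp_le)
    have "(J^2*(1/(2* sqrt \<delta>)))^2 = (J^2)^2*(\<alpha>*B/(2*\<phi>^11))"
      unfolding sd power_mult_distrib using nn Bpos phi by (subst real_sqrt_pow2) auto
    also have "\<dots> \<le> ((505/100)*\<eta>^2*B^2*\<phi>^4)^2*(\<alpha>*B/(2*\<phi>^11))"
      by (intro mult_right_mono power_mono[OF MF]) (use nn Bpos phi in auto)
    also have "\<dots> = (505/100)^2/2*(\<alpha>*\<eta>^4)*(B^5/\<phi>^3)"
    proof -
      have gen: "(c*h*b*u)^2*(a*B/(2*(u^2*q))) = c^2/2*(a*h^2)*(b^2*B/q)" if "u \<noteq> 0" for c h b u a q :: real
        using that by (simp add: power_mult_distrib mult_ac)
      have e: "\<phi>^11 = (\<phi>^4)^2*\<phi>^3" "\<eta>^4 = (\<eta>^2)^2" "B^5 = (B^2)^2*B" by (simp_all add: numeral_eq_Suc)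
      show ?thesis unfolding e by (rule gen) (use phi in simp)
    qed
    also have "\<dots> \<le> (505/100)^2/2*(\<alpha>*\<eta>^2)*((125/10000)*x^4)"
      by (intro mult_mono[OF _ B5] mult_left_mono eta1) (use nn Bpos phi in auto)
    also have "\<dots> = ((505/100)^2/2*(125/10000))*(\<alpha>*\<eta>^2*x^4)" by simp
    also have "\<dots> \<le> (4/10)^2*(\<alpha>*\<eta>^2*x^4)" by (rule mult_right_mono) (use nn in \<open>auto simp: power2_eq_square\<close>)
    also have "\<dots> = ((4/10)*(sqrt \<alpha>*\<eta>)*x^2)^2" unfolding power_mult_distrib using nn by simp
    finally show "(J^2*(1/(2* sqrt \<delta>)))^2 \<le> ((4/10)*(sqrt \<alpha>*\<eta>)*x^2)^2" .
  qed (use nn in auto)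
  have P0: "0 \<le> P" unfolding P_def using phi Bpos by simp
  have S1': "S^2 \<le> (12/10)*(n*x)" if "n < 1" using S1[OF that] by simp
  have SB: "(1879/100)*B^3/\<phi>^7*(S^2*n^2) \<le> x^2"
    by (rule sup_term_bound[OF phi Bpos xpos npos nF P6 P0 xL xb xc nx S1' S2 phi1])
  have t6: "3*(J*(1/(2* sqrt \<delta>)))*S*n*x \<le> 11/10*(sqrt \<alpha>*\<eta>)*x^2"
  proof (rule power2_le_imp_le)
    have "(3*(J*(1/(2* sqrt \<delta>)))*S*n*x)^2 = 9*J^2*(\<alpha>*B/(2*\<phi>^11))*(S^2*n^2)*x^2"
      unfolding sd power_mult_distrib using nn Bpos phi by (subst real_sqrt_pow2) auto
    also have "\<dots> \<le> 9*((505/100)*\<eta>^2*B^2*\<phi>^4)*(\<alpha>*B/(2*\<phi>^11))*(S^2*n^2)*x^2"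
      by (intro mult_right_mono mult_left_mono MF) (use nn Bpos phi in auto)
    also have "\<dots> = (9*(505/100)/2/(1879/100))*(\<alpha>*\<eta>^2)*x^2*((1879/100)*B^3/\<phi>^7*(S^2*n^2))"
    proof -
      have gen: "k*(c*h*b*u)*(a*B/(2*(q*u)))*w*y = (k*c/2/e)*(a*h)*y*(e*(b*B)/q*w)" if "u \<noteq> 0" "e \<noteq> 0" for k c h b u a q w y e :: real
        using that by (simp add: mult_ac)
      have e: "\<phi>^11 = \<phi>^7*\<phi>^4" "B^3 = B^2*B" by (simp_all add: numeral_eq_Suc)
      show ?thesis unfolding e by (rule gen) (use phi in simp_all)
    qed
    also have "\<dots> \<le> (9*(505/100)/2/(1879/100))*(\<alpha>*\<eta>^2)*x^2*x^2"
      by (rule mult_left_mono[OF SB]) (intro mult_nonneg_nonneg, use nn in auto)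
    also have "\<dots> \<le> (11/10)^2*(\<alpha>*\<eta>^2*x^2*x^2)" unfolding mult.assoc[of "_/_"] by (rule mult_right_mono) (use nn in \<open>auto simp: power2_eq_square\<close>)
    also have "\<dots> = (11/10*(sqrt \<alpha>*\<eta>)*x^2)^2" unfolding power_mult_distrib using nn by (simp add: power2_eq_square)
    finally show "(3*(J*(1/(2* sqrt \<delta>)))*S*n*x)^2 \<le> (11/10*(sqrt \<alpha>*\<eta>)*x^2)^2" .
  qed (use nn in auto)
  have t7: "3*(J/pi)*S*n*x \<le> (19/20*\<theta> + 1/10*\<eta>^2)*x^2"
  proof -
    have Jp: "J/pi \<le> 2*M" using J(1) by (simp add: field_simps)
    have xa': "25/2*(B^2*\<phi>^6*n) \<le> x" using xa by simp
    have S1'': "S^2 \<le> 6/5*(n*x)" if "n < 1" using S1[OF that] by simp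
    have "3*(J/pi)*S*n \<le> 3*(2*M)*S*n" by (intro mult_right_mono mult_left_mono Jp) (use pos npos in auto)
    also have "\<dots> \<le> (19/20*\<theta> + 1/10*\<eta>^2)*x"
      by (rule jump_sup_term_bound[OF phi Bpos xpos npos pos(8) nn(2) pos(10) nF xa' th et S1'' S2 phi1])
    finally have "3*(J/pi)*S*n*x \<le> (19/20*\<theta> + 1/10*\<eta>^2)*x*x" by (rule mult_right_mono) (use xpos in simp)
    then show ?thesis by (simp add: power2_eq_square mult.assoc)
  qed
  define \<tau> where "\<tau> = 1 - \<theta>"
  have tau: "\<alpha> + \<eta> \<le> \<tau>" "0 \<le> \<tau>" "\<tau> \<le> 1" using sum nn unfolding \<tau>_def by auto
  \<comment> \<open>The maximum of \<open>\<alpha>\<eta>\<^sup>2\<close> for given \<open>\<alpha> + \<eta>\<close> is attained at \<open>\<eta> = 2\<alpha>\<close>.\<close>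
  have ae: "sqrt \<alpha>*\<eta> \<le> (385/1000)*\<tau>"
  proof (rule power2_le_imp_le)
    have "0 \<le> (2*\<alpha> - \<eta>)^2*(\<alpha> + 4*\<eta>)" using nn by simp
    also have "\<dots> = 4*(\<alpha>+\<eta>)^3 - 27*(\<alpha>*\<eta>^2)" by (simp add: power2_eq_square power3_eq_cube algebra_simps)
    finally have "27*(\<alpha>*\<eta>^2) \<le> 4*(\<alpha>+\<eta>)^3" by simp
    also have "\<dots> \<le> 4*\<tau>^3" using tau nn by (intro mult_left_mono power_mono) auto
    also have "\<dots> \<le> 4*\<tau>^2" using tau by (intro mult_left_mono power_decreasing) auto
    finally have "\<alpha>*\<eta>^2 \<le> (4/27)*\<tau>^2" by simp
    also have "\<dots> \<le> (385/1000)^2*\<tau>^2" by (intro mult_right_mono) (auto simp: power2_eq_square)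
    finally show "(sqrt \<alpha>*\<eta>)^2 \<le> ((385/1000)*\<tau>)^2" unfolding power_mult_distrib using nn by simp
  qed (use tau in auto)
  have "J*((1/pi + 1/(2* sqrt \<delta>))*(J + 3*S*\<psi>^4*x) + 2*M) =
      J^2/pi + J^2*(1/(2* sqrt \<delta>)) + 3*(J/pi)*S*n*x + 3*(J*(1/(2* sqrt \<delta>)))*S*n*x + 2*M*J"
    unfolding n_def by (simp add: algebra_simps power2_eq_square add_divide_distrib)
  note dec = this
  have aux: "X \<le> (\<alpha>/4 + 375/1000*\<eta>^2 + 15/10*(sqrt \<alpha>*\<eta>) + 95/100*\<theta>)*X"
    if "X \<le> a + b + R" "R = c1 + c2 + c3 + c4 + c5" "a \<le> \<alpha>/4*X" "b \<le> 165/1000*\<eta>^2*X" "c5 \<le> 55/1000*\<eta>^2*X"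
      "c1 \<le> 55/1000*\<eta>^2*X" "c2 \<le> 4/10*(sqrt \<alpha>*\<eta>)*X" "c4 \<le> 11/10*(sqrt \<alpha>*\<eta>)*X" "c3 \<le> (19/20*\<theta> + 1/10*\<eta>^2)*X"
    for X a b R c1 c2 c3 c4 c5
    using that by (simp add: algebra_simps)
  have "x^2 \<le> (\<alpha>/4 + 375/1000*\<eta>^2 + 15/10*(sqrt \<alpha>*\<eta>) + 95/100*\<theta>)*x^2"
    by (rule aux[OF x dec]) (use t1 t2 t3 t4 t5 t6 t7 in simp_all)
  also have "\<dots> < 1*x^2"
  proof (rule mult_strict_right_mono)
    have "\<eta>^2 \<le> \<eta>" using nn sum by (simp add: power2_eq_square mult_left_le)
    then have "\<alpha>/4 + 375/1000*\<eta>^2 + 15/10*(sqrt \<alpha>*\<eta>) + 95/100*\<theta> \<le> 375/1000*\<tau> + 15/10*(385/1000*\<tau>) + 95/100*\<theta>"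
      using ae tau nn by linarith
    also have "\<dots> < 1" using nn unfolding \<tau>_def by (simp add: field_simps)
    finally show "\<alpha>/4 + 375/1000*\<eta>^2 + 15/10*(sqrt \<alpha>*\<eta>) + 95/100*\<theta> < 1" .
  qed (use xpos in simp)
  finally show False by simp
qed

text \<open>
  Here \<open>\<mu> > 3C\<^sup>2\<close>, so the gauge-transformed energy controls \<open>y\<close> as long as \<open>S\<^sup>2\<close> is below \<open>3C\<^sup>2\<close>, and it bounds \<open>y\<close> in terms of \<open>S\<^sup>2\<close> beyond.
  Inserting this into the sup bound yields a quadratic inequality for \<open>s = S\<^sup>2\<close> which, once \<open>s \<ge> 24/25\<close> has been used to make the
  constant term proportional to \<open>s\<close>, has negative discriminant.
\<close>

lemma coercive_contradiction:
  fixes F n y S \<delta> C \<mu> \<epsilon> :: real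
  assumes F: "0 < F" and n: "0 \<le> n" "n \<le> F" and y: "0 \<le> y" and d: "0 < \<delta>" and ep: "0 \<le> \<epsilon>" "\<epsilon> \<le> 1"
    and C: "F/sqrt (2*pi) + sqrt (2*pi)*F^3/(2*\<delta>) \<le> C" and mu: "3*C^2 < \<mu>"
    and E: "\<delta>*y^2 + \<mu>*n^2 \<le> \<epsilon>*S^2*n^2 + F*n"
    and S: "24/25 \<le> S^2" "S^2 \<le> n^2/(2*pi) + n*y"
  shows False
proof -
  define s where "s = S^2"
  define p where "p = F/sqrt (2*pi)"
  define e where "e = F^4/\<delta>"
  define nu where "nu = n/F"
  have p: "0 < p" "p^2 = F^2/(2*pi)" unfolding p_def using F by (auto simp: power_divide)
  have e: "0 < e" unfolding e_def using F d by simp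
  have n0: "0 < n" using S n by (cases "n = 0") auto
  have nu: "0 < nu" "nu \<le> 1" "n = nu*F" unfolding nu_def using F n n0 by auto
  have "sqrt (2*pi)*F^3/(2*\<delta>) = e/(2*p)"
    unfolding e_def p_def using F d by (simp add: field_simps numeral_eq_Suc)
  then have Cp: "p + e/(2*p) \<le> C" using C by (simp add: p_def)
  have "p*(p + e/(2*p)) \<le> p*C" using Cp p by (intro mult_left_mono) auto
  moreover have "p*(p + e/(2*p)) = p^2 + e/2" using p by (simp add: power2_eq_square algebra_simps)
  ultimately have pe: "2*p^2 + e \<le> 2*(p*C)" by simp
  have pC: "p \<le> C" using Cp p e by (smt (verit) divide_nonneg_nonneg)
  have "p*C \<le> C*C" using pC p by (intro mult_right_mono) auto
  then have pe2: "2*p^2 + e \<le> 2*C^2" using pe by (simp add: power2_eq_square)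
  have C0: "0 < C" using pC p by linarith
  have p2C: "p^2 \<le> C^2" using pC p by (intro power_mono) auto
  have "\<epsilon>*S^2*n^2 \<le> 1*S^2*n^2" using ep by (intro mult_right_mono) auto
  moreover have "3*C^2*n^2 \<le> \<mu>*n^2" using mu by (intro mult_right_mono) auto
  ultimately have E1: "\<delta>*y^2 \<le> F*n + (s - 3*C^2)*n^2" using E unfolding s_def by (simp add: algebra_simps)
  define q where "q = p^2*nu^2"
  have q: "q = n^2/(2*pi)" unfolding q_def p(2) nu(3) by (simp add: power_mult_distrib)
  have nu2: "nu^2 \<le> 1" using nu by (simp add: power_le_one)
  have qp: "q \<le> p^2" unfolding q_def using nu2 by (simp add: mult_left_le)
  have s1: "24/25 \<le> s" "s \<le> q + n*y" using S by (simp_all add: s_def q)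
  show False
  proof (cases "s < q")
    case True
    have "0 \<le> F*n + (s - 3*C^2)*n^2" using E1 d by (smt (verit) mult_nonneg_nonneg zero_le_power2)
    then have "0 \<le> n*(F + (s - 3*C^2)*n)" by (simp add: power2_eq_square algebra_simps)
    then have "0 \<le> F + (s - 3*C^2)*n" using n0 by (simp add: zero_le_mult_iff)
    moreover have "(s - 3*C^2)*n \<le> (- 2*p^2)*n" using True qp p2C n0 by (intro mult_right_mono) auto
    ultimately have "2*p^2*n \<le> F" by simp
    then have "2*p^2*nu \<le> 1" using nu F by (simp add: algebra_simps mult_le_cancel_left_pos)
    then have "(2*p^2*nu)^2 \<le> 1" using nu by (simp add: power_le_one)
    then have "4*p^2*q \<le> 1" unfolding q_def by (simp add: power_mult_distrib power2_eq_square algebra_simps)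
    moreover have "4*(24/25)*(24/25) \<le> 4*p^2*q" using True s1 qp by (intro mult_mono) auto
    ultimately show False by simp
  next
    case False
    have "(s - q)^2 \<le> (n*y)^2" using s1 False by (intro power_mono) auto
    also have "\<dots> = n^2/\<delta>*(\<delta>*y^2)" using d by (simp add: power_mult_distrib)
    also have "\<dots> \<le> n^2/\<delta>*(F*n + (s - 3*C^2)*n^2)" using d by (intro mult_left_mono[OF E1]) auto
    also have "\<dots> = e*nu^3 + (s - 3*C^2)*(e*nu^4)" unfolding nu(3) e_def using d
      by (simp add: field_simps numeral_eq_Suc)
    finally have a: "(s - q)^2 \<le> e*nu^3 + (s - 3*C^2)*(e*nu^4)" .
    have "e*nu^3*1 \<le> e*nu^3*(25/24* s)" using s1 e nu by (intro mult_left_mono) auto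
    moreover have "e*nu^3*(25/24* s) = 25/24* s*(e*nu^3)" by simp
    ultimately have b: "(s - q)^2 \<le> 25/24* s*(e*nu^3) + (s - 3*C^2)*(e*nu^4)" using a by linarith
    \<comment> \<open>Half the coefficient of \<open>s\<close> on the right-hand side, for completing the square.\<close>
    define h where "h = e*nu^3*(25/24 + nu)/2"
    have b': "(s - q - h)^2 \<le> 2*q*h + h^2 - 3*C^2*(e*nu^4)"
    proof -
      have "2*(s*h) = 25/24* s*(e*nu^3) + s*(e*nu^4)" unfolding h_def by (simp add: numeral_eq_Suc algebra_simps)
      moreover have "(s - q - h)^2 = (s - q)^2 - 2*(s*h) + 2*q*h + h^2" by (simp add: power2_eq_square algebra_simps)
      moreover have "(s - 3*C^2)*(e*nu^4) = s*(e*nu^4) - 3*C^2*(e*nu^4)" by (simp add: algebra_simps)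
      ultimately show ?thesis using b by linarith
    qed
    have h: "0 \<le> h" "h \<le> 49/48*(e*nu^3)" unfolding h_def using e nu by (auto simp: algebra_simps mult_left_le)
    have nu3: "0 \<le> nu^3" "nu^3 \<le> 1" using nu by (auto simp: power_le_one)
    have "q*h \<le> q*(49/48*(e*nu^3))" by (rule mult_left_mono[OF h(2)]) (simp add: q_def)
    also have "\<dots> = 49/48*(p^2*(e*nu^4))*nu" unfolding q_def by (simp add: numeral_eq_Suc)
    also have "\<dots> \<le> 49/48*(p^2*(e*nu^4))*1" by (rule mult_left_mono[OF nu(2)]) (use e in simp)
    finally have c1: "2*q*h \<le> 49/24*p^2*(e*nu^4)" by simp
    have "h^2 \<le> (49/48*(e*nu^3))^2" using h by (intro power_mono) auto
    also have "\<dots> = (49/48)^2*(e*(e*nu^4))*nu^2" by (simp add: power_mult_distrib numeral_eq_Suc)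
    also have "\<dots> \<le> (49/48)^2*(e*(e*nu^4))*1" by (rule mult_left_mono[OF nu2]) (use e in simp)
    finally have c2: "h^2 \<le> (49/48)^2*e*(e*nu^4)" by simp
    define k where "k = e*nu^4"
    have k: "0 < k" unfolding k_def using e nu by simp
    have "(49/24*p^2 + (49/48)^2*e)*k \<le> (21/20*(2*p^2 + e))*k"
    proof (rule mult_right_mono)
      have "49/24*p^2 \<le> 21/20*2*p^2" "(49/48)^2*e \<le> 21/20*e"
        by (rule mult_right_mono; use e in \<open>simp add: power2_eq_square\<close>)+
      then have "49/24*p^2 + (49/48)^2*e \<le> 21/20*2*p^2 + 21/20*e" by (rule add_mono)
      then show "49/24*p^2 + (49/48)^2*e \<le> 21/20*(2*p^2 + e)" by (simp add: algebra_simps)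
    qed (use k in simp)
    also have "\<dots> \<le> (21/20*(2*C^2))*k" using pe2 k by (intro mult_right_mono) auto
    also have "\<dots> < (3*C^2)*k" using C0 k by (intro mult_strict_right_mono) auto
    finally have "49/24*p^2*k + (49/48)^2*e*k < 3*C^2*k" by (simp add: distrib_right)
    then show False using b' c1 c2 zero_le_power2[of "s - q - h"] unfolding k_def by linarith
  qed
qed

text \<open>
  Multiplied by \<open>n\<^sup>2\<close>, the bound on \<open>x\<^sup>2\<close> compares \<open>X = nx\<close> with numbers: \<open>p + c \<le> 1/sqrt 3\<close> gives \<open>w = pc \<le> 1/12\<close> and small \<open>b\<close>, whereas a
  large amplitude requires \<open>X \<ge> 62/100\<close>.
\<close>

lemma small_forcing_contradiction:
  fixes \<phi> \<psi> B \<delta> M J x S :: real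
  assumes pos: "0 < \<psi>" "\<psi> \<le> \<phi>" "0 < \<delta>" "0 \<le> x" "0 \<le> M" "0 \<le> J" "0 \<le> S"
    and S: "24/25 \<le> S^2" "S^2 \<le> \<psi>^8/(2*pi) + \<psi>^4*x"
    and C: "sqrt 3*(\<phi>^4/sqrt (2*pi) + sqrt (2*pi)*B*\<phi>) < 1"
    and B: "\<phi>^11/(2*\<delta>) + 2*M*\<phi> + sqrt (2*M) \<le> B"
    and x: "x^2 \<le> \<psi>^4*x*\<phi>^8/(4*\<delta>) + sqrt (2*pi)*M*x + J*((1/pi + 1/(2* sqrt \<delta>))*(J + 3*S*\<psi>^4*x) + 2*M)"
    and J: "J \<le> 2*pi*M" "J^2 \<le> 101/10*M*\<phi>^4"
  shows False
proof -
  have phi: "0 < \<phi>" using pos by linarith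
  have B0: "0 < \<phi>^11/(2*\<delta>)" "0 \<le> 2*M*\<phi>" "0 \<le> sqrt (2*M)" using phi pos by auto
  have Bpos: "0 < B" using B B0 by linarith
  define n where "n = \<psi>^4"
  define X where "X = n*x"
  define b where "b = B*\<phi>"
  define w where "w = B*\<phi>^5"
  have n0: "0 < n" unfolding n_def using pos by simp
  have nF: "n \<le> \<phi>^4" unfolding n_def using pos by (intro power_mono) auto
  have bw0: "0 \<le> b" "0 \<le> w" unfolding b_def w_def using Bpos phi by auto
  define p c where "p = \<phi>^4/sqrt (2*pi)" and "c = sqrt (2*pi)*B*\<phi>"
  have pc0: "0 \<le> p" "0 \<le> c" unfolding p_def c_def using Bpos phi by auto
  have "(sqrt 3*(p + c))^2 \<le> 1" using C pc0 unfolding p_def c_def by (intro power_le_one) auto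
  then have pc: "(p + c)^2 \<le> 1/3" unfolding power_mult_distrib by simp
  have pcw: "p*c = w" unfolding p_def c_def w_def by (simp add: numeral_eq_Suc)
  have "0 \<le> (p - c)^2" by simp
  then have "4*(p*c) \<le> (p+c)^2" by (simp add: power2_eq_square algebra_simps)
  then have w: "w \<le> 1/12" using pc pcw by simp
  have "p^2 \<le> (p+c)^2" "c^2 \<le> (p+c)^2" using pc0 by (auto intro!: power_mono)
  then have p2: "p^2 \<le> 1/3" and c2: "c^2 \<le> 1/3" using pc by auto
  have "c^2 = 2*pi*b^2" unfolding c_def b_def by (simp add: power_mult_distrib)
  moreover have "6283/1000*b^2 \<le> 2*pi*b^2" using pi_bounds by (intro mult_right_mono) auto
  ultimately have b2: "b^2 \<le> 531/10000" using c2 by simp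
  have "b^2 \<le> (2305/10000)^2" using b2 by (simp add: power2_eq_square)
  then have b1: "b \<le> 2305/10000" by (rule power2_le_imp_le) simp
  have b3: "b^3 \<le> 1224/100000"
  proof -
    have "b^3 = b^2*b" by (simp add: numeral_eq_Suc)
    also have "\<dots> \<le> 531/10000*(2305/10000)" using b1 b2 bw0 by (intro mult_mono) auto
    finally show ?thesis by simp
  qed
  have "n^2 \<le> (\<phi>^4)^2" using nF n0 by (intro power_mono) auto
  then have "n^2/(2*pi) \<le> (\<phi>^4)^2/(2*pi)" by (intro divide_right_mono) auto
  also have "\<dots> = p^2" unfolding p_def by (simp add: power_divide)
  finally have np: "n^2/(2*pi) \<le> 1/3" using p2 by linarith
  have psi8: "\<psi>^8 = n^2" by (simp add: n_def flip: power_mult)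
  have X: "62/100 \<le> X" using S np unfolding X_def psi8 n_def[symmetric] by linarith
  have SX: "S^2 \<le> 154/100*X" using S np X unfolding X_def psi8 n_def[symmetric] by linarith
  have sq2: "sqrt (2*M) \<le> B" "\<phi>^11/(2*\<delta>) \<le> B" using B B0 by linarith+
  have M: "M \<le> B^2/2" using power_mono[OF sq2(1), of 2] pos by simp
  have d1: "1/(4*\<delta>) \<le> B/(2*\<phi>^11)" using sq2(2) pos phi by (simp add: field_simps)
  define R where "R = 1/(2* sqrt \<delta>)"
  have R: "0 \<le> R" "R^2 \<le> B/(2*\<phi>^11)" using d1 pos unfolding R_def by (auto simp: power_divide power_mult_distrib)
  define m where "m = M*n"
  have m0: "0 \<le> m" unfolding m_def using pos n0 by simp
  have m: "m \<le> (B^2*\<phi>^4)/2" unfolding m_def using mult_mono[OF M nF] n0 by simp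
  have "(B^2*\<phi>^4)^2 = w*b^3" unfolding w_def b_def by (simp add: power_mult_distrib numeral_eq_Suc)
  also have "\<dots> \<le> 1/12*(1224/100000)" using w b3 bw0 by (intro mult_mono) auto
  also have "\<dots> \<le> (32/1000)^2" by (simp add: power2_eq_square)
  finally have "B^2*\<phi>^4 \<le> 32/1000" by (rule power2_le_imp_le) simp
  then have m1: "m \<le> 16/1000" using m by linarith
  have m2: "m^2 \<le> 256/1000000" using power_mono[OF m1 m0, of 2] by (simp add: power2_eq_square)
  have t1: "n^2*(n*x*\<phi>^8/(4*\<delta>)) \<le> 7/100*X^2"
  proof -
    have "n^2*\<phi>^8*(1/(4*\<delta>)) \<le> (\<phi>^4)^2*\<phi>^8*(B/(2*\<phi>^11))"
      by (intro mult_mono power_mono nF d1) (use n0 phi pos in auto)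
    also have "\<dots> = w/2"
    proof -
      have "\<phi>^11 = \<phi>^8*\<phi>^3" "\<phi>^5*\<phi>^3 = (\<phi>^4)^2" by (simp_all add: numeral_eq_Suc)
      then show ?thesis unfolding w_def using phi by (simp add: field_simps)
    qed
    also have "\<dots> \<le> 7/100*X" using w X by linarith
    finally have "n^2*\<phi>^8*(1/(4*\<delta>))*X \<le> 7/100*X*X" by (rule mult_right_mono) (use X in simp)
    then show ?thesis unfolding X_def by (simp add: power2_eq_square mult_ac)
  qed
  have sq2pi: "sqrt (2*pi) \<le> 2507/1000" by (rule real_le_lsqrt) (use pi_bounds in \<open>auto simp: power2_eq_square\<close>)
  have t2: "n^2*(sqrt (2*pi)*M*x) \<le> 7/100*X^2"
  proof -
    have "sqrt (2*pi)*m \<le> 2507/1000*(16/1000)" by (rule mult_mono[OF sq2pi m1]) (use m0 in auto)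
    also have "\<dots> \<le> 7/100*X" using X by simp
    finally have "sqrt (2*pi)*m*X \<le> 7/100*X*X" by (rule mult_right_mono) (use X in simp)
    then show ?thesis unfolding X_def m_def by (simp add: power2_eq_square mult_ac)
  qed
  have X2: "(62/100)^2 \<le> X^2" using X by (intro power_mono) auto
  have pm: "4*pi*m^2 \<le> 1/100*X^2"
  proof -
    have "4*pi*m^2 \<le> 4*(31416/10000)*(256/1000000)" using m2 pi_bounds by (intro mult_mono) auto
    also have "\<dots> \<le> 1/100*(62/100)^2" by (simp add: power2_eq_square)
    also have "\<dots> \<le> 1/100*X^2" using X2 by simp
    finally show ?thesis .
  qed
  have t3: "n^2*(2*M*J) \<le> 1/100*X^2"
  proof -
    have "n^2*(2*M*J) \<le> n^2*(2*M*(2*pi*M))" using J pos by (intro mult_left_mono) auto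
    also have "\<dots> = 4*pi*m^2" unfolding m_def by (simp add: power2_eq_square)
    finally show ?thesis using pm by linarith
  qed
  have t4: "n^2*(J^2/pi) \<le> 1/100*X^2"
  proof -
    have "J^2 \<le> (2*pi*M)^2" using J pos by (intro power_mono) auto
    then have "n^2*(J^2/pi) \<le> n^2*((2*pi*M)^2/pi)" by (intro mult_left_mono divide_right_mono) auto
    also have "\<dots> = 4*pi*m^2" unfolding m_def by (simp add: power2_eq_square)
    finally show ?thesis using pm by linarith
  qed
  have J2: "J^2 \<le> 505/100*(B^2*\<phi>^4)"
  proof -
    have "101/10*M*\<phi>^4 \<le> 101/10*(B^2/2)*\<phi>^4" using M phi by (intro mult_right_mono mult_left_mono) auto
    then show ?thesis using J(2) by simp
  qed
  have t5: "n^2*(J^2*R) \<le> 9/100*X^2"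
  proof (rule power2_le_imp_le)
    have "(n^2*(J^2*R))^2 = (n^2)^2*((J^2)^2*R^2)" by (simp only: power_mult_distrib)
    also have "\<dots> \<le> ((\<phi>^4)^2)^2*((505/100*(B^2*\<phi>^4))^2*(B/(2*\<phi>^11)))"
      by (intro mult_mono power_mono nF J2 R(2)) (use n0 phi Bpos in auto)
    also have "\<dots> = (505/100)^2/2*(w^2*b^3)"
    proof -
      have gen: "(u^2)^2*((k*(h*u))^2*(B/(2*q1))) = k^2/2*g" if "u^6*h^2*B = g*q1" "q1 \<noteq> 0" for u k h q1 g :: real
      proof -
        have "(u^2)^2*((k*(h*u))^2*(B/(2*q1))) = k^2/2*((u^6*h^2*B)/q1)" by (simp add: power_mult_distrib mult_ac flip: power_add power_mult)
        then show ?thesis using that by simp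
      qed
      show ?thesis by (rule gen) (use phi in \<open>auto simp: w_def b_def power_mult_distrib numeral_eq_Suc\<close>)
    qed
    also have "\<dots> \<le> (505/100)^2/2*((1/12)^2*(1224/100000))"
      using w b3 bw0 by (intro mult_left_mono mult_mono power_mono) auto
    also have "\<dots> \<le> (9/100)^2*((62/100)^2)^2" by (simp add: power2_eq_square)
    also have "\<dots> \<le> (9/100)^2*(X^2)^2" by (intro mult_left_mono power_mono X2) auto
    also have "\<dots> = (9/100*X^2)^2" by (simp only: power_mult_distrib)
    finally show "(n^2*(J^2*R))^2 \<le> (9/100*X^2)^2" .
  qed simp
  have t6: "n^2*(3*(J/pi)*S*n*x) \<le> 6/100*X^2"
  proof -
    have Jp: "J/pi \<le> 2*M" using J(1) by (simp add: field_simps)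
    have "6*(m*n)*S \<le> 6/100*X"
    proof (rule power2_le_imp_le)
      have "m*n \<le> (B^2*\<phi>^4)/2*\<phi>^4" by (rule mult_mono[OF m nF]) (use n0 phi in auto)
      then have "(m*n)^2 \<le> ((B^2*\<phi>^4)/2*\<phi>^4)^2" by (rule power_mono) (use m0 n0 in simp)
      also have "\<dots> = 1/4*(w^3*b)" unfolding w_def b_def by (simp add: power_mult_distrib power_divide numeral_eq_Suc)
      also have "\<dots> \<le> 1/4*((1/12)^3*(2305/10000))" using w b1 bw0 by (intro mult_left_mono mult_mono power_mono) auto
      finally have mn: "(m*n)^2 \<le> 334/10000000" by (simp add: power3_eq_cube)
      have "(6*(m*n)*S)^2 = 36*(m*n)^2*S^2" by (simp only: power_mult_distrib) simp
      also have "\<dots> \<le> 36*(334/10000000)*(154/100*X)" using mn SX by (intro mult_mono) auto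
      also have "\<dots> \<le> 36/10000*X*(62/100)" using X by simp
      also have "\<dots> \<le> 36/10000*X*X" using X by (intro mult_left_mono) auto
      also have "\<dots> = (6/100*X)^2" by (simp add: power2_eq_square)
      finally show "(6*(m*n)*S)^2 \<le> (6/100*X)^2" .
    qed (use X in simp)
    then have 1: "6*(m*n)*S*X \<le> 6/100*X*X" by (rule mult_right_mono) (use X in simp)
    have "n^2*(3*(J/pi)*S*n*x) \<le> n^2*(3*(2*M)*S*n*x)"
      by (intro mult_left_mono mult_right_mono Jp) (use pos n0 in auto)
    also have "\<dots> = 6*(m*n)*S*X" unfolding m_def X_def by (simp add: power2_eq_square)
    also note 1
    also have "6/100*X*X = 6/100*X^2" by (simp add: power2_eq_square)
    finally show ?thesis .
  qed
  have t7: "n^2*(3*(J*R)*S*n*x) \<le> 4/10*X^2"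
  proof -
    have "3*(J*R)*S*n^2 \<le> 4/10*X"
    proof (rule power2_le_imp_le)
      have "(B^3*\<phi>^9)^2 = w^3*b^3" unfolding w_def b_def by (simp add: power_mult_distrib numeral_eq_Suc)
      also have "\<dots> \<le> (1/12)^3*(1224/100000)" using w b3 bw0 by (intro mult_mono power_mono) auto
      also have "\<dots> \<le> (267/100000)^2" by (simp add: power2_eq_square power3_eq_cube)
      finally have B9: "B^3*\<phi>^9 \<le> 267/100000" by (rule power2_le_imp_le) simp
      have "(3*(J*R)*S*n^2)^2 = 9*(J^2*R^2*(n^2)^2)*S^2" by (simp only: power_mult_distrib) simp
      also have "\<dots> \<le> 9*(505/100*(B^2*\<phi>^4)*(B/(2*\<phi>^11))*((\<phi>^4)^2)^2)*(154/100*X)"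
        by (intro mult_mono power_mono nF J2 R(2) SX) (use n0 phi Bpos X in auto)
      also have "505/100*(B^2*\<phi>^4)*(B/(2*\<phi>^11))*((\<phi>^4)^2)^2 = 505/200*(B^3*\<phi>^9)"
      proof -
        have gen: "k*(h*u)*(B/(2*q1))*(u^2)^2 = k/2*g" if "u^5*h*B = g*q1" "q1 \<noteq> 0" for u k h q1 g :: real
        proof -
          have "k*(h*u)*(B/(2*q1))*(u^2)^2 = k/2*((u^5*h*B)/q1)" by (simp add: mult_ac numeral_eq_Suc)
          then show ?thesis using that by simp
        qed
        have "505/100*(B^2*\<phi>^4)*(B/(2*\<phi>^11))*((\<phi>^4)^2)^2 = 505/100/2*(B^3*\<phi>^9)"
          by (rule gen) (use phi in \<open>auto simp: numeral_eq_Suc\<close>)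
        then show ?thesis by simp
      qed
      also have "9*(505/200*(B^3*\<phi>^9))*(154/100*X) \<le> 9*(505/200*(267/100000))*(154/100*X)"
        using B9 X by (intro mult_right_mono mult_left_mono) auto
      also have "\<dots> \<le> 16/100*X*(62/100)" using X by simp
      also have "\<dots> \<le> 16/100*X*X" using X by (intro mult_left_mono) auto
      also have "\<dots> = (4/10*X)^2" by (simp add: power2_eq_square)
      finally show "(3*(J*R)*S*n^2)^2 \<le> (4/10*X)^2" .
    qed (use X in simp)
    then have "3*(J*R)*S*n^2*X \<le> 4/10*X*X" by (rule mult_right_mono) (use X in simp)
    then show ?thesis unfolding X_def by (simp add: power2_eq_square mult_ac)
  qed
  have "n^2*x^2 \<le> n^2*(n*x*\<phi>^8/(4*\<delta>) + sqrt (2*pi)*M*x + J*((1/pi + R)*(J + 3*S*n*x) + 2*M))"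
    by (rule mult_left_mono) (use x in \<open>auto simp: n_def R_def\<close>)
  also have "\<dots> = n^2*(n*x*\<phi>^8/(4*\<delta>)) + n^2*(sqrt (2*pi)*M*x) + n^2*(2*M*J) + n^2*(J^2/pi) + n^2*(J^2*R)
      + n^2*(3*(J/pi)*S*n*x) + n^2*(3*(J*R)*S*n*x)"
    by (simp add: algebra_simps power2_eq_square add_divide_distrib)
  also have "\<dots> \<le> 7/100*X^2 + 7/100*X^2 + 1/100*X^2 + 1/100*X^2 + 9/100*X^2 + 6/100*X^2 + 4/10*X^2"
    by (intro add_mono t1 t2 t3 t4 t5 t6 t7)
  also have "\<dots> < X^2" using X2 X by (simp add: power2_eq_square)
  finally show False unfolding X_def by (simp add: power_mult_distrib)
qed

section \<open>The a priori amplitude bound\<close>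

text \<open>
  If \<open>f\<close> is \<open>M\<close>-Lipschitz and jumps by \<open>J\<close>, then \<open>\<bar>f(s)\<bar> + \<bar>f(2\<pi> - s)\<bar> \<ge> J - 2Ms\<close>. Integrated over \<open>0 \<le> s \<le> J/(2M)\<close> this
  says that a jump costs \<open>L\<^sup>1\<close> norm: \<open>J\<^sup>2/(4M)\<close> is at most \<open>sqrt (2\<pi>)\<close> times the \<open>L\<^sup>2\<close> norm.
\<close>

lemma jump_bounds:
  fixes f f1 :: "real \<Rightarrow> complex"
  assumes df: "\<And>s. s \<in> circ \<Longrightarrow> (f has_vector_derivative f1 s) (at s within circ)"
    and M: "\<And>s. s \<in> circ \<Longrightarrow> cmod (f1 s) \<le> M"
  defines "J \<equiv> cmod (f (2*pi) - f 0)"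
  shows "J \<le> 2*pi*M" "J^2 \<le> 101/10*M*l2 f"
proof -
  have cf: "continuous_on circ f" by (rule has_vector_derivative_continuous_on[OF df])
  have M0: "0 \<le> M" using order_trans[OF norm_ge_zero M[of 0]] by simp
  have lip: "cmod (f t - f s) \<le> M*(t - s)" if "0 \<le> s" "s \<le> t" "t \<le> 2*pi" for s t
  proof -
    have "(f1 has_integral (f t - f s)) {s..t}"
      by (rule fundamental_theorem_of_calculus) (use that in \<open>auto intro!: has_vector_derivative_within_subset[OF df]\<close>)
    from has_integral_bound_real[OF M0 finite.emptyI this] that show ?thesis using M by simp
  qed
  show J1: "J \<le> 2*pi*M" using lip[of 0 "2*pi"] unfolding J_def by (simp add: mult.commute)
  show "J^2 \<le> 101/10*M*l2 f"
  proof (cases "M = 0")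
    case True
    then have "J = 0" using J1 unfolding J_def by simp
    then show ?thesis using True by simp
  next
    case False
    then have Mp: "0 < M" using M0 by simp
    have J0: "0 \<le> J" unfolding J_def by simp
    define L where "L = J/(2*M)"
    have L: "0 \<le> L" "L \<le> pi" unfolding L_def using J0 J1 Mp by (auto simp: field_simps)
    define P where "P t = integral {0..t} (\<lambda>s. cmod (f s))" for t
    have cnf: "continuous_on circ (\<lambda>s. cmod (f s))" by (intro continuous_intros cf)
    have dP: "(P has_real_derivative cmod (f s)) (at s)" if "0 < s" "s < 2*pi" for s
    proof -
      have "(P has_real_derivative cmod (f s)) (at s within circ)"
        unfolding P_def by (rule integral_has_real_derivative[OF cnf]) (use that in auto)
      then show ?thesis using that by (simp add: at_within_Icc_at)
    qed
    have cP: "continuous_on circ P" unfolding P_def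
      by (rule indefinite_integral_continuous_1[OF integrable_circ[OF cnf]])
    \<comment> \<open>Up to a constant, the integral of \<open>\<bar>f(r)\<bar> + \<bar>f(2\<pi> - r)\<bar> - (J - 2Mr)\<close> over \<open>0 \<le> r \<le> s\<close>.\<close>
    define \<Phi> where "\<Phi> s = P s - P (2*pi - s) - (J* s - M* s^2)" for s
    have "\<Phi> 0 \<le> \<Phi> L"
    proof (rule DERIV_nonneg_imp_increasing_open[OF L(1)])
      fix s assume s: "0 < s" "s < L"
      then have s': "s < pi" using L by simp
      have "(\<Phi> has_real_derivative cmod (f s) + cmod (f (2*pi - s)) - (J - 2*M* s)) (at s)"
      proof -
        have "((\<lambda>s. P (2*pi - s)) has_real_derivative cmod (f (2*pi - s)) * (-1)) (at s)"
          by (rule DERIV_chain'[where g=P, OF _ dP]) (use s s' in \<open>auto intro!: derivative_eq_intros\<close>)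
        then show ?thesis unfolding \<Phi>_def using dP[of s] s s'
          by (auto intro!: derivative_eq_intros)
      qed
      moreover have "0 \<le> cmod (f s) + cmod (f (2*pi - s)) - (J - 2*M* s)"
      proof -
        have "f (2*pi) - f 0 = (f (2*pi) - f (2*pi - s)) + (f (2*pi - s) - f s) + (f s - f 0)" by simp
        then have "J \<le> cmod (f (2*pi) - f (2*pi - s)) + cmod (f (2*pi - s) - f s) + cmod (f s - f 0)"
          unfolding J_def by (metis norm_triangle_ineq norm_triangle_mono order_refl)
        moreover have "cmod (f (2*pi) - f (2*pi - s)) \<le> M* s" "cmod (f s - f 0) \<le> M* s"
          using lip[of "2*pi - s" "2*pi"] lip[of 0 s] s s' by auto
        moreover have "cmod (f (2*pi - s) - f s) \<le> cmod (f (2*pi - s)) + cmod (f s)" by (rule norm_triangle_ineq4)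
        ultimately show ?thesis by linarith
      qed
      ultimately show "\<exists>y. (\<Phi> has_real_derivative y) (at s) \<and> 0 \<le> y" by blast
    next
      have "continuous_on {0..L} P" by (rule continuous_on_subset[OF cP]) (use L in auto)
      moreover have "continuous_on {0..L} (\<lambda>s. P (2*pi - s))"
        by (rule continuous_on_compose2[OF cP]) (use L in \<open>auto intro!: continuous_intros\<close>)
      ultimately show "continuous_on {0..L} \<Phi>" unfolding \<Phi>_def by (intro continuous_intros)
    qed
    moreover have "P L \<le> P (2*pi - L)"
      unfolding P_def using L
      by (intro integral_subset_le integrable_continuous_real continuous_on_subset[OF cnf]) auto
    ultimately have "J*L - M*L^2 \<le> P (2*pi)" unfolding \<Phi>_def P_def by simp
    also have "P (2*pi) \<le> sqrt (2*pi) * l2 f" unfolding P_def by (rule integral_norm_le_l2[OF cf])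
    also have "J*L - M*L^2 = J^2/(4*M)" unfolding L_def using Mp by (simp add: power2_eq_square field_simps)
    finally have "J^2 \<le> 4 * sqrt (2*pi) * M * l2 f" using Mp by (simp add: field_simps)
    also have "\<dots> \<le> 101/10*M*l2 f"
    proof (intro mult_right_mono)
      have "sqrt (2*pi) \<le> 2507/1000" by (rule real_le_lsqrt) (use pi_bounds in \<open>auto simp: power2_eq_square\<close>)
      then show "4 * sqrt (2*pi) \<le> 101/10" by simp
    qed (use M0 in auto)
    finally show ?thesis .
  qed
qed

context kerr_solution
begin

text \<open>
  Uniqueness requires a bound below 1; the value 24/25 leaves room for rounding the constants in the three regimes. The
  maximum of \<open>\<bar>u\<bar>\<close> is used, since all estimates are in terms of it.
\<close>

lemma amplitude_bound:
  assumes B: "F powr (11/4)/(2*\<delta>) + 2*M*F powr (1/4) + sqrt (2*M) \<le> B"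
    and C: "C = F/sqrt (2*pi) + sqrt (2*pi)*B*F powr (1/4)"
    and D: "D = F powr (3/2) + \<bar>\<omega>\<bar>*B*F powr (3/4) + \<delta>*B^2"
    and regime: "Z < - (C^2 * (if \<sigma> = -1 then 1 else 0)) - 27*(F powr (3/4) + 2*pi*B)^6*D/(8*pi^3)
      \<or> 3*C^2 + \<omega>^2/(4*\<delta>) < Z \<or> sqrt 3 * C < 1"
    and t: "t \<in> circ"
  shows "(cmod (u t))^2 < 24/25"
proof (rule ccontr)
  assume "\<not> ?thesis"
  then have large: "24/25 \<le> (cmod (u t))^2" by simp
  have "\<exists>x\<in>circ. \<forall>y\<in>circ. cmod (u y) \<le> cmod (u x)" by (rule continuous_attains_sup) (auto intro!: continuous_intros)
  then obtain s0 where s0: "s0 \<in> circ" "\<And>s. s \<in> circ \<Longrightarrow> cmod (u s) \<le> cmod (u s0)" by metis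
  define S where "S = cmod (u s0)"
  have Smax: "\<And>s. s \<in> circ \<Longrightarrow> cmod (u s) \<le> S" and S0: "0 \<le> S" unfolding S_def using s0 by auto
  have S: "24/25 \<le> S^2" using large power_mono[OF Smax[OF t], of 2] by simp
  have Sx: "S^2 \<le> n^2/(2*pi) + n*x" and Sy: "S^2 \<le> n^2/(2*pi) + n*y"
    unfolding S_def using sup_bound_x[OF s0(1)] sup_bound_y[OF s0(1)] .
  have npos: "0 < n" using S Sx nonneg by (cases "n = 0") auto
  have Fpos: "0 < F" using npos n_le_F by linarith
  define \<phi> \<psi> where "\<phi> = F powr (1/4)" and "\<psi> = n powr (1/4)"
  have phi: "F powr (11/4) = \<phi>^11" "F powr (3/2) = \<phi>^6" "F powr (3/4) = \<phi>^3" "F powr (1/4) = \<phi>" "F = \<phi>^4"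
    unfolding \<phi>_def using Fpos by (simp_all add: powr_power)
  have psi: "n = \<psi>^4" "n^2 = \<psi>^8" unfolding \<psi>_def using npos by (simp_all add: powr_power)
  have pos: "0 < \<psi>" "\<psi> \<le> \<phi>" unfolding \<phi>_def \<psi>_def using npos n_le_F by (auto intro!: powr_mono2)
  have M0: "0 \<le> M" using order_trans[OF norm_ge_zero M[of 0]] by simp
  have J0: "0 \<le> J" by (simp add: J_def)
  have J: "J \<le> 2*pi*M" "J^2 \<le> 101/10*M*\<phi>^4"
    using jump_bounds[OF df M] unfolding J_def F_def[symmetric] phi(5)[symmetric] by auto
  have "J * cmod (u1 0) \<le> J*((1/pi + 1/(2 * sqrt \<delta>))*(J + 3*S*n*x) + 2*M)"
    by (intro mult_left_mono initial_slope_bound Smax J0)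
  then have X: "x^2 \<le> \<psi>^4*x*\<phi>^8/(4*\<delta>) + sqrt (2*pi)*M*x + J*((1/pi + 1/(2 * sqrt \<delta>))*(J + 3*S*\<psi>^4*x) + 2*M)"
    using slope_bound unfolding psi(1)[symmetric] by (simp add: phi(5) flip: power_mult)
  have B': "\<phi>^11/(2*\<delta>) + 2*M*\<phi> + sqrt (2*M) \<le> B" using B unfolding phi(1,4) .
  have S8: "S^2 \<le> \<psi>^8/(2*pi) + \<psi>^4*x" using Sx unfolding psi(2) psi(1)[symmetric] .
  have Cphi: "C = \<phi>^4/sqrt (2*pi) + sqrt (2*pi)*B*\<phi>" unfolding C phi(4) by (simp flip: phi(5))
  from regime consider "Z < - (C^2 * (if \<sigma> = -1 then 1 else 0)) - 27*(F powr (3/4) + 2*pi*B)^6*D/(8*pi^3)"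
    | "3*C^2 + \<omega>^2/(4*\<delta>) < Z" | "sqrt 3 * C < 1" by blast
  then show False
  proof cases
    case 1
    define e where "e = (if \<sigma> = -1 then 1 else (0::real))"
    have e: "0 \<le> e" "e \<le> 1" unfolding e_def by auto
    have C2: "C^2 = \<phi>^2*(\<phi>^3 + 2*pi*B)^2/(2*pi)"
    proof -
      have "\<phi>^4/w + w*B*\<phi> = \<phi>*(\<phi>^3 + (w*w)*B)/w" if "0 < w" for w
        using that by (simp add: field_simps numeral_eq_Suc)
      from this[of "sqrt (2*pi)"] have "C = \<phi>*(\<phi>^3 + 2*pi*B)/sqrt (2*pi)" unfolding Cphi by simp
      then show ?thesis by (simp add: power_divide power_mult_distrib)
    qed
    have "e * (\<phi>^2*(\<phi>^3+2*pi*B)^2/(2*pi)) + 27*(\<phi>^3+2*pi*B)^6*(\<phi>^6+\<bar>\<omega>\<bar>*B*\<phi>^3+\<delta>*B^2)/(8*pi^3) < - Z"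
      using 1 unfolding C2[symmetric] D phi(2,3) e_def by (simp add: mult.commute)
    moreover have "- Z * \<psi>^8 \<le> \<delta>*x^2 + \<bar>\<omega>\<bar>*x*\<psi>^4 + \<phi>^4*\<psi>^4 + e*S^2*\<psi>^8"
      using energy_bound[OF Smax] unfolding e_def psi(2)[symmetric] psi(1)[symmetric] phi(5)[symmetric] .
    ultimately show False
      using far_detuned_contradiction[OF pos delta nonneg(2) abs_ge_zero e M0 J0 S0 S S8 _ _ B' X J] by blast
  next
    case 2
    have "F/sqrt (2*pi) + sqrt (2*pi)*F^3/(2*\<delta>) \<le> C"
    proof -
      have "\<phi>^11/(2*\<delta>) \<le> B" using B' M0 pos by (smt (verit) mult_nonneg_nonneg real_sqrt_ge_zero)
      then have "sqrt (2*pi)*(\<phi>^11/(2*\<delta>))*\<phi> \<le> sqrt (2*pi)*B*\<phi>" using pos by (intro mult_right_mono mult_left_mono) auto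
      moreover have "sqrt (2*pi)*(\<phi>^11/(2*\<delta>))*\<phi> = sqrt (2*pi)*F^3/(2*\<delta>)" unfolding phi(5) by (simp add: numeral_eq_Suc)
      ultimately show ?thesis unfolding C phi(4) by linarith
    qed
    moreover have "0 \<le> (if \<sigma> = 1 then 1 else (0::real))" "(if \<sigma> = 1 then 1 else (0::real)) \<le> 1" by auto
    moreover have "3*C^2 < \<mu>" using 2 unfolding \<mu>_def by simp
    moreover have "\<delta>*y^2 + \<mu>*n^2 \<le> (if \<sigma> = 1 then 1 else 0)*S^2*n^2 + F*n" by (rule gauge_energy_bound[OF Smax])
    ultimately show False
      using coercive_contradiction[OF Fpos nonneg(1) n_le_F nonneg(3) delta _ _ _ _ _ S Sy, of "if \<sigma> = 1 then 1 else 0" C \<mu>] by blast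
  next
    case 3
    then have "sqrt 3*(\<phi>^4/sqrt (2*pi) + sqrt (2*pi)*B*\<phi>) < 1" unfolding Cphi .
    then show False
      by (rule small_forcing_contradiction[OF pos delta nonneg(2) M0 J0 S0 S S8 _ B' X J])
  qed
qed

end

section \<open>Existence for the saturated equation\<close>

text \<open>
  The linear operator is the product of two first-order operators, with exponents on either side of the imaginary axis.
\<close>

lemma characteristic_factors:
  fixes \<delta> \<omega> Z :: real
  assumes delta: "0 < \<delta>"
  obtains z1 z2 :: complex where "of_real \<delta> * (z1 + z2) = \<i> * of_real \<omega>" "of_real \<delta> * (z1 * z2) = - (of_real Z - \<i>)"
    "0 < Re z1" "Re z2 < 0"
proof -
  define c where "c = \<omega>/(2*\<delta>)"
  define m where "m = Z - \<omega>^2/(4*\<delta>)"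
  obtain k where k: "of_real \<delta> * k^2 = of_real m - \<i>" "0 < Re k" by (rule characteristic_root[OF delta])
  have om: "2*\<delta>*c = \<omega>" and Zm: "m + \<delta>*c^2 = Z" unfolding c_def m_def using delta by (simp_all add: field_simps power2_eq_square)
  show ?thesis
  proof (rule that[of "\<i> * of_real c + k" "\<i> * of_real c - k"])
    show "of_real \<delta> * ((\<i> * of_real c + k) + (\<i> * of_real c - k)) = \<i> * of_real \<omega>"
      unfolding om[symmetric] by simp
    have zz: "(\<i> * b + w) * (\<i> * b - w) = - (b^2 + w^2)" for b w :: complex
      by (simp add: algebra_simps power2_eq_square)
    have "of_real \<delta> * ((\<i> * of_real c + k) * (\<i> * of_real c - k)) = - (of_real \<delta> * (of_real c)^2 + of_real \<delta> * k^2)"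
      unfolding zz by (simp add: algebra_simps)
    also have "\<dots> = - (of_real (m + \<delta> * c^2) - \<i>)" unfolding k(1) by simp
    finally show "of_real \<delta> * ((\<i> * of_real c + k) * (\<i> * of_real c - k)) = - (of_real Z - \<i>)" unfolding Zm .
  qed (use k in auto)
qed

lemma first_order_periodic:
  fixes h :: "real \<Rightarrow> complex"
  assumes z: "Re z \<noteq> 0" and ch: "continuous_on circ h"
  obtains y where "\<And>s. s \<in> circ \<Longrightarrow> (y has_vector_derivative z * y s + h s) (at s within circ)" "y 0 = y (2*pi)"
proof -
  define g where "g s = exp (- z * of_real s) * h s" for s
  have cg: "continuous_on circ g" unfolding g_def by (intro continuous_intros ch)
  define G where "G s = integral {0..s} g" for s
  define e where "e = exp (z * of_real (2*pi))"
  have "cmod e \<noteq> 1" unfolding e_def norm_exp_eq_Re using z by simp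
  then have e1: "1 - e \<noteq> 0" by auto
  define c where "c = e * G (2*pi)/(1 - e)"
  define y where "y s = exp (z * of_real s) * (c + G s)" for s
  show ?thesis
  proof (rule that[of y])
    fix s assume s: "s \<in> circ"
    have dG: "(G has_vector_derivative g s) (at s within circ)"
      unfolding G_def by (rule integral_has_vector_derivative[OF cg s])
    have "(y has_vector_derivative exp (z * of_real s) * (0 + g s) + z * exp (z * of_real s) * (c + G s)) (at s within circ)"
      unfolding y_def
      by (intro has_vector_derivative_mult exp_of_real_deriv has_vector_derivative_add has_vector_derivative_const dG)
    moreover have "exp (z * of_real s) * g s = h s" unfolding g_def mult.assoc[symmetric] exp_add[symmetric] by simp
    ultimately show "(y has_vector_derivative z * y s + h s) (at s within circ)"
      unfolding y_def by (simp add: algebra_simps)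
  next
    have "e * (c + G (2*pi)) = c" unfolding c_def using e1 by (simp add: field_simps)
    moreover have "G 0 = 0" unfolding G_def by simp
    ultimately show "y 0 = y (2*pi)" unfolding y_def e_def[symmetric] by simp
  qed
qed

lemma linear_solution_exists:
  assumes delta: "0 < \<delta>" and ch: "continuous_on circ h"
  shows "\<exists>u u1 u2. periodic_linear \<delta> \<omega> Z u u1 u2 h"
proof -
  obtain z1 z2 where z: "of_real \<delta> * (z1 + z2) = \<i> * of_real \<omega>" "of_real \<delta> * (z1 * z2) = - (of_real Z - \<i>)" "0 < Re z1" "Re z2 < 0"
    by (rule characteristic_factors[OF delta])
  have "Re z1 \<noteq> 0" "Re z2 \<noteq> 0" using z by auto
  obtain y where y: "\<And>s. s \<in> circ \<Longrightarrow> (y has_vector_derivative z1 * y s + (- h s/of_real \<delta>)) (at s within circ)" "y 0 = y (2*pi)"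
    by (rule first_order_periodic[OF \<open>Re z1 \<noteq> 0\<close>, of "\<lambda>s. - h s/of_real \<delta>"]) (use delta in \<open>auto intro!: continuous_intros ch\<close>)
  have cy: "continuous_on circ y" by (rule has_vector_derivative_continuous_on[OF y(1)])
  obtain u where u: "\<And>s. s \<in> circ \<Longrightarrow> (u has_vector_derivative z2 * u s + y s) (at s within circ)" "u 0 = u (2*pi)"
    using first_order_periodic[OF \<open>Re z2 \<noteq> 0\<close> cy] by blast
  define u1 where "u1 s = z2 * u s + y s" for s
  define u2 where "u2 s = z2 * u1 s + (z1 * y s + (- h s/of_real \<delta>))" for s
  have "periodic_linear \<delta> \<omega> Z u u1 u2 h"
  proof
    show "(u has_vector_derivative u1 s) (at s within circ)" if "s \<in> circ" for s unfolding u1_def by (rule u(1)[OF that])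
    show "(u1 has_vector_derivative u2 s) (at s within circ)" if "s \<in> circ" for s
    proof -
      have "(u has_vector_derivative u1 s) (at s within circ)" unfolding u1_def by (rule u(1)[OF that])
      then have "((\<lambda>s. z2 * u s + y s) has_vector_derivative z2 * u1 s + (z1 * y s + (- h s/of_real \<delta>))) (at s within circ)"
        by (intro has_vector_derivative_add has_vector_derivative_mult_right y that)
      then show ?thesis unfolding u2_def u1_def[abs_def] .
    qed
    show "u 0 = u (2*pi)" "u1 0 = u1 (2*pi)" unfolding u1_def using u(2) y(2) by auto
    show "- of_real \<delta> * u2 s + \<i> * of_real \<omega> * u1 s + (of_real Z - \<i>) * u s = h s" if "s \<in> circ" for s
    proof -
      have ys: "y s = u1 s - z2 * u s" unfolding u1_def by simp
      have "of_real \<delta> * u2 s = of_real \<delta> * (z1 + z2) * u1 s - of_real \<delta> * (z1 * z2) * u s - h s"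
        unfolding u2_def ys using delta by (simp add: algebra_simps)
      then have e: "of_real \<delta> * u2 s = \<i> * of_real \<omega> * u1 s + (of_real Z - \<i>) * u s - h s"
        unfolding z by (simp only: minus_mult_left[symmetric] diff_minus_eq_add)
      have "- of_real \<delta> * u2 s = - (of_real \<delta> * u2 s)" by simp
      then show ?thesis unfolding e by simp
    qed
  qed (use delta ch in auto)
  then show ?thesis by blast
qed

text \<open>
  The factor \<open>\<tau>\<close> is the continuation parameter: the equation is linear for \<open>\<tau> = 0\<close>.
\<close>

definition saturated_solution :: "real \<Rightarrow> real \<Rightarrow> real \<Rightarrow> real \<Rightarrow> real \<Rightarrow> (real \<Rightarrow> complex) \<Rightarrow> (real \<Rightarrow> complex) \<Rightarrow> bool" where
  "saturated_solution \<delta> \<omega> Z a \<tau> h u \<longleftrightarrow> (\<exists>u1 u2. periodic_linear \<delta> \<omega> Z u u1 u2 (\<lambda>s. of_real \<tau> * kerr a (u s) + h s))"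

text \<open>
  The number \<open>b\<close> bounds the \<open>L\<^sup>2\<close> norm of a difference of solutions, the inner square root the one of its gauge-transformed
  derivative, and the outer one is the sup bound from both; all relative to the sup norm of the difference of the
  sources. What matters is that it does not depend on \<open>\<tau>\<close>.
\<close>

definition stability_constant :: "real \<Rightarrow> real \<Rightarrow> real \<Rightarrow> real \<Rightarrow> real" where
  "stability_constant \<delta> \<omega> Z a = (let b = sqrt (2*pi)/(1 - a) in
     sqrt (b^2/(2*pi) + b * sqrt (((4*a + \<bar>Z - \<omega>^2/(4*\<delta>)\<bar>)*b^2 + sqrt (2*pi)*b)/\<delta>)))"

text \<open>
  The imaginary part of the balance for the difference \<open>w\<close> absorbs the Kerr term, as \<open>a < 1\<close>, and bounds the \<open>L\<^sup>2\<close> norm; the real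
  part then bounds the derivative, with the Lipschitz constant of the Kerr term. With equal sources this is uniqueness.
\<close>

lemma solution_stability:
  assumes a: "0 < a" "a < 1" and tau: "\<bar>\<tau>\<bar> \<le> 1"
    and u: "saturated_solution \<delta> \<omega> Z a \<tau> h u" and v: "saturated_solution \<delta> \<omega> Z a \<tau> g v" and ch: "continuous_on circ h" and cg: "continuous_on circ g"
    and H: "\<And>s. s \<in> circ \<Longrightarrow> cmod (h s - g s) \<le> H" and s: "s \<in> circ"
  shows "cmod (u s - v s) \<le> stability_constant \<delta> \<omega> Z a * H"
proof -
  obtain u1 u2 where U: "periodic_linear \<delta> \<omega> Z u u1 u2 (\<lambda>s. of_real \<tau> * kerr a (u s) + h s)" using u unfolding saturated_solution_def by blast
  obtain v1 v2 where V: "periodic_linear \<delta> \<omega> Z v v1 v2 (\<lambda>s. of_real \<tau> * kerr a (v s) + g s)" using v unfolding saturated_solution_def by blast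
  interpret U: periodic_linear \<delta> \<omega> Z u u1 u2 "\<lambda>s. of_real \<tau> * kerr a (u s) + h s" by (rule U)
  interpret V: periodic_linear \<delta> \<omega> Z v v1 v2 "\<lambda>s. of_real \<tau> * kerr a (v s) + g s" by (rule V)
  define k where "k s = of_real \<tau> * (kerr a (u s) - kerr a (v s)) + (h s - g s)" for s
  have k_eq: "k s = (of_real \<tau> * kerr a (u s) + h s) - (of_real \<tau> * kerr a (v s) + g s)" for s
    unfolding k_def by (simp add: algebra_simps)
  interpret W: periodic_linear \<delta> \<omega> Z "\<lambda>s. u s - v s" "\<lambda>s. u1 s - v1 s" "\<lambda>s. u2 s - v2 s" k
  proof
    show "((\<lambda>s. u s - v s) has_vector_derivative u1 s - v1 s) (at s within circ)" if "s \<in> circ" for s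
      by (intro has_vector_derivative_diff U.du V.du that)
    show "((\<lambda>s. u1 s - v1 s) has_vector_derivative u2 s - v2 s) (at s within circ)" if "s \<in> circ" for s
      by (intro has_vector_derivative_diff U.du1 V.du1 that)
    show "u 0 - v 0 = u (2*pi) - v (2*pi)" "u1 0 - v1 0 = u1 (2*pi) - v1 (2*pi)" using U.per V.per by auto
    show "continuous_on circ k" unfolding k_eq[abs_def] by (intro continuous_intros U.k V.k)
    show "- of_real \<delta> * (u2 s - v2 s) + \<i> * of_real \<omega> * (u1 s - v1 s) + (of_real Z - \<i>) * (u s - v s) = k s" if "s \<in> circ" for s
      unfolding k_eq U.eq[OF that, symmetric] V.eq[OF that, symmetric] by (simp add: algebra_simps)
  qed (rule U.delta)
  define w where "w s = u s - v s" for s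
  have cw: "continuous_on circ w" unfolding w_def by (rule W.cu)
  define N where "N = W.n"
  have N: "N = l2 w" unfolding N_def W.n_def w_def ..
  have N0: "0 \<le> N" unfolding N by simp
  have H0: "0 \<le> H" using order_trans[OF norm_ge_zero H[OF s]] .
  have sqrt_H: "sqrt (c * H^2) = sqrt c * H" for c using H0 by (simp add: real_sqrt_mult)
  have intw: "integral circ (\<lambda>s. H * cmod (w s)) \<le> sqrt (2*pi) * H * N"
  proof -
    have "H * integral circ (\<lambda>s. cmod (w s)) \<le> H * (sqrt (2*pi) * N)" unfolding N by (intro mult_left_mono integral_norm_le_l2 cw H0)
    then show ?thesis by (simp add: mult_ac)
  qed
  have intc: "integral circ (\<lambda>s. c * (cmod (w s))^2 + H * cmod (w s)) \<le> c * N^2 + sqrt (2*pi) * H * N" for c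
  proof -
    have "integral circ (\<lambda>s. c * (cmod (w s))^2 + H * cmod (w s)) = integral circ (\<lambda>s. c * (cmod (w s))^2) + integral circ (\<lambda>s. H * cmod (w s))"
      by (rule integral_add; intro integrable_circ continuous_intros cw)
    also have "integral circ (\<lambda>s. c * (cmod (w s))^2) = c * N^2" unfolding N l2_sq by simp
    finally show ?thesis using intw by simp
  qed
  have hg: "cmod ((h s - g s) * cnj (w s)) \<le> H * cmod (w s)" if "s \<in> circ" for s
    unfolding norm_mult complex_mod_cnj by (intro mult_right_mono H that) auto
  have kd: "k s * cnj (w s) = of_real \<tau> * ((kerr a (u s) - kerr a (v s)) * cnj (u s - v s)) + (h s - g s) * cnj (w s)" for s
    unfolding k_def w_def by (simp add: algebra_simps)
  have "N^2 \<le> a * N^2 + sqrt (2*pi) * H * N"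
  proof -
    have "N^2 = - integral circ (\<lambda>s. Im (k s * cnj (w s)))" unfolding N_def w_def by (rule W.mass)
    also have "\<dots> = integral circ (\<lambda>s. - Im (k s * cnj (w s)))" by (simp only: integral_neg)
    also have "\<dots> \<le> integral circ (\<lambda>s. a * (cmod (w s))^2 + H * cmod (w s))"
    proof (intro integral_le integrable_circ continuous_intros cw W.k)
      fix s assume s: "s \<in> circ"
      have "\<bar>\<tau> * Im ((kerr a (u s) - kerr a (v s)) * cnj (u s - v s))\<bar> \<le> 1 * (a * (cmod (u s - v s))^2)"
        unfolding abs_mult by (intro mult_mono tau kerr_one_sided a) auto
      moreover have "\<bar>Im ((h s - g s) * cnj (w s))\<bar> \<le> H * cmod (w s)" using abs_Im_le_cmod hg[OF s] order_trans by blast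
      moreover have "Im (k s * cnj (w s)) = \<tau> * Im ((kerr a (u s) - kerr a (v s)) * cnj (u s - v s)) + Im ((h s - g s) * cnj (w s))"
        unfolding kd by (simp only: plus_complex.simps Im_complex_of_real times_complex.simps Re_complex_of_real)
      ultimately show "- Im (k s * cnj (w s)) \<le> a * (cmod (w s))^2 + H * cmod (w s)" unfolding w_def by linarith
    qed
    also have "\<dots> \<le> a * N^2 + sqrt (2*pi) * H * N" by (rule intc)
    finally show ?thesis .
  qed
  then have "N * ((1 - a) * N) \<le> N * (sqrt (2*pi) * H)" by (simp add: algebra_simps power2_eq_square)
  then have "(1 - a) * N \<le> sqrt (2*pi) * H" using N0 H0 a by (cases "N = 0") auto
  then have Nb: "N \<le> sqrt (2*pi)/(1 - a) * H" using a by (simp add: field_simps)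
  define b where "b = sqrt (2*pi)/(1 - a)"
  define m where "m = Z - \<omega>^2/(4*\<delta>)"
  have b0: "0 \<le> b" unfolding b_def using a by simp
  have Nb: "N \<le> b * H" using Nb unfolding b_def .
  define Y where "Y = W.y"
  have Y0: "0 \<le> Y" unfolding Y_def by (rule W.nonneg)
  have d: "0 < \<delta>" by (rule U.delta)
  have "\<delta> * Y^2 + m * N^2 \<le> 4*a * N^2 + sqrt (2*pi) * H * N"
  proof -
    have "\<delta> * Y^2 + m * N^2 = integral circ (\<lambda>s. Re (k s * cnj (w s)))" unfolding N_def w_def Y_def m_def W.\<mu>_def[symmetric] by (rule W.gauge_energy)
    also have "\<dots> \<le> integral circ (\<lambda>s. (4*a) * (cmod (w s))^2 + H * cmod (w s))"
    proof (intro integral_le integrable_circ continuous_intros cw W.k)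
      fix s assume s: "s \<in> circ"
      have "Re (k s * cnj (w s)) \<le> cmod (k s * cnj (w s))" by (rule complex_Re_le_cmod)
      also have "\<dots> \<le> cmod (of_real \<tau> * ((kerr a (u s) - kerr a (v s)) * cnj (u s - v s))) + cmod ((h s - g s) * cnj (w s))"
        unfolding kd by (rule norm_triangle_ineq)
      also have "cmod (of_real \<tau> * ((kerr a (u s) - kerr a (v s)) * cnj (u s - v s))) = \<bar>\<tau>\<bar> * (cmod (kerr a (u s) - kerr a (v s)) * cmod (u s - v s))"
        by (simp only: norm_mult norm_of_real complex_mod_cnj)
      also have "\<dots> \<le> 1 * ((4*a*cmod (u s - v s)) * cmod (u s - v s))"
        by (intro mult_mono tau kerr_lipschitz a) (use a in auto)
      finally show "Re (k s * cnj (w s)) \<le> (4*a) * (cmod (w s))^2 + H * cmod (w s)" using hg[OF s] unfolding w_def by (simp add: power2_eq_square)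
    qed
    also have "\<dots> \<le> 4*a * N^2 + sqrt (2*pi) * H * N" by (rule intc)
    finally show ?thesis .
  qed
  moreover have "- m * N^2 \<le> \<bar>m\<bar> * N^2" by (intro mult_right_mono) auto
  ultimately have "\<delta> * Y^2 \<le> (4*a + \<bar>m\<bar>) * N^2 + sqrt (2*pi) * H * N" by (simp add: distrib_right)
  also have "\<dots> \<le> (4*a + \<bar>m\<bar>) * (b*H)^2 + sqrt (2*pi) * H * (b*H)"
    using Nb N0 H0 a by (intro add_mono mult_left_mono power_mono) auto
  also have "\<dots> = ((4*a + \<bar>m\<bar>) * b^2 + sqrt (2*pi) * b) * H^2" by (simp add: power2_eq_square algebra_simps)
  finally have "Y^2 \<le> ((4*a + \<bar>m\<bar>) * b^2 + sqrt (2*pi) * b)/\<delta> * H^2" using d by (simp add: pos_le_divide_eq mult.commute)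
  then have "sqrt (Y^2) \<le> sqrt (((4*a + \<bar>m\<bar>) * b^2 + sqrt (2*pi) * b)/\<delta> * H^2)" by (rule real_sqrt_le_mono)
  then have Yb: "Y \<le> sqrt (((4*a + \<bar>m\<bar>) * b^2 + sqrt (2*pi) * b)/\<delta>) * H" using Y0 unfolding sqrt_H by simp
  define e where "e = sqrt (((4*a + \<bar>m\<bar>) * b^2 + sqrt (2*pi) * b)/\<delta>)"
  have e0: "0 \<le> e" unfolding e_def using d b0 a by simp
  have Yb: "Y \<le> e*H" using Yb unfolding e_def .
  have "(cmod (u s - v s))^2 \<le> N^2/(2*pi) + N*Y" unfolding N_def Y_def by (rule W.sup_bound_y[OF s])
  also have "\<dots> \<le> (b*H)^2/(2*pi) + (b*H)*(e*H)"
    using Nb N0 Yb Y0 b0 H0 by (intro add_mono divide_right_mono power_mono mult_mono) auto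
  also have "\<dots> = (b^2/(2*pi) + b*e)*H^2" by (simp add: power2_eq_square algebra_simps)
  finally have "sqrt ((cmod (u s - v s))^2) \<le> sqrt ((b^2/(2*pi) + b*e)*H^2)" by (rule real_sqrt_le_mono)
  then have "cmod (u s - v s) \<le> sqrt (b^2/(2*pi) + b*e) * H" unfolding sqrt_H by simp
  moreover have "stability_constant \<delta> \<omega> Z a = sqrt (b^2/(2*pi) + b*e)" unfolding stability_constant_def Let_def b_def e_def m_def by simp
  ultimately show ?thesis by simp
qed

lemma saturated_solution_continuous: "saturated_solution \<delta> \<omega> Z a \<tau> h u \<Longrightarrow> continuous_on circ u"
  unfolding saturated_solution_def by (auto dest: periodic_linear.cu)

lemma kerr_continuous: "0 < a \<Longrightarrow> continuous_on S u \<Longrightarrow> continuous_on S (\<lambda>s. kerr a (u s))"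
proof -
  assume a: "0 < a" and u: "continuous_on S u"
  have "continuous_on UNIV (kerr a)"
  proof (rule lipschitz_on_continuous_on[where L="4*a"], rule lipschitz_onI)
    show "dist (kerr a x) (kerr a y) \<le> 4*a*dist x y" for x y unfolding dist_norm by (rule kerr_lipschitz[OF a])
  qed (use a in simp)
  then show "continuous_on S (\<lambda>s. kerr a (u s))" by (rule continuous_on_compose2[OF _ u]) auto
qed

lemma stability_constant_nonneg:
  assumes "0 < a" "a < 1" "0 < \<delta>"
  shows "0 \<le> stability_constant \<delta> \<omega> Z a"
  using assms unfolding stability_constant_def Let_def by (intro real_sqrt_ge_zero add_nonneg_nonneg mult_nonneg_nonneg divide_nonneg_nonneg) auto

text \<open>
  Freezing the additional part of the nonlinearity turns the equation at \<open>\<tau>'\<close> into the solvable one at \<open>\<tau>\<close> with a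
  modified source. By stability the solution map is a contraction in the sup norm if \<open>\<tau>'\<close> is close to \<open>\<tau>\<close>, and its
  fixed point solves the equation at \<open>\<tau>'\<close>.
\<close>

lemma continuation_step:
  assumes a: "0 < a" "a < 1" and d: "0 < \<delta>" and t1: "\<bar>\<tau>\<bar> \<le> 1"
    and small: "stability_constant \<delta> \<omega> Z a * (\<bar>\<tau>' - \<tau>\<bar> * (4*a)) \<le> 1/2"
    and IH: "\<And>h. continuous_on circ h \<Longrightarrow> \<exists>u. saturated_solution \<delta> \<omega> Z a \<tau> h u"
    and ch: "continuous_on circ h"
  shows "\<exists>u. saturated_solution \<delta> \<omega> Z a \<tau>' h u"
proof -
  \<comment> \<open>Clamping extends functions on the period to bounded continuous functions on the line, which form a complete
    metric space.\<close>
  define cl where "cl s = max 0 (min s (2*pi))" for s :: real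
  have cl: "cl s \<in> circ" "s \<in> circ \<Longrightarrow> cl s = s" for s unfolding cl_def by auto
  have ccl: "continuous_on UNIV cl" unfolding cl_def by (intro continuous_intros)
  define R where "R v s = of_real (\<tau>' - \<tau>) * kerr a (apply_bcontfun v s) + h s" for v :: "real \<Rightarrow>\<^sub>C complex" and s
  have cR: "continuous_on circ (R v)" for v unfolding R_def by (intro continuous_intros ch kerr_continuous a) auto
  define sol where "sol v = (SOME u. saturated_solution \<delta> \<omega> Z a \<tau> (R v) u)" for v
  have sol: "saturated_solution \<delta> \<omega> Z a \<tau> (R v) (sol v)" for v unfolding sol_def by (rule someI_ex[OF IH[OF cR]])
  have bc: "(\<lambda>s. sol v (cl s)) \<in> bcontfun" for v
  proof -
    have c: "continuous_on circ (sol v)" by (rule saturated_solution_continuous[OF sol])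
    have "continuous_on UNIV (\<lambda>s. sol v (cl s))" by (rule continuous_on_compose2[OF c ccl]) (use cl in auto)
    moreover have "bounded (range (\<lambda>s. sol v (cl s)))"
      by (rule bounded_subset[OF compact_imp_bounded[OF compact_continuous_image[OF c compact_Icc]]]) (use cl in auto)
    ultimately show ?thesis by (simp add: bcontfun_def)
  qed
  define \<Phi> where "\<Phi> v = Bcontfun (\<lambda>s. sol v (cl s))" for v
  have app: "apply_bcontfun (\<Phi> v) s = sol v (cl s)" for v s unfolding \<Phi>_def by (simp add: Bcontfun_inverse[OF bc])
  have "\<exists>!v. \<Phi> v = v"
  proof (rule banach_fix_type[of "1/2"])
    show "\<forall>v w. dist (\<Phi> v) (\<Phi> w) \<le> 1/2 * dist v w"
    proof (intro allI dist_bound)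
      fix v w s
      have "cmod (sol v (cl s) - sol w (cl s)) \<le> stability_constant \<delta> \<omega> Z a * (\<bar>\<tau>' - \<tau>\<bar> * (4*a) * dist v w)"
      proof (rule solution_stability[OF a t1 sol sol cR cR _ cl(1)])
        fix r assume "r \<in> circ"
        have "R v r - R w r = of_real (\<tau>' - \<tau>) * (kerr a (apply_bcontfun v r) - kerr a (apply_bcontfun w r))"
          unfolding R_def by (simp add: algebra_simps)
        then have "cmod (R v r - R w r) = \<bar>\<tau>' - \<tau>\<bar> * cmod (kerr a (apply_bcontfun v r) - kerr a (apply_bcontfun w r))"
          by (simp only: norm_mult norm_of_real)
        also have "\<dots> \<le> \<bar>\<tau>' - \<tau>\<bar> * (4*a*cmod (apply_bcontfun v r - apply_bcontfun w r))"
          by (intro mult_left_mono kerr_lipschitz a) auto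
        also have "\<dots> \<le> \<bar>\<tau>' - \<tau>\<bar> * (4*a*dist v w)"
          using dist_bounded[of v r w] a by (intro mult_left_mono) (auto simp: dist_norm)
        finally show "cmod (R v r - R w r) \<le> \<bar>\<tau>' - \<tau>\<bar> * (4*a) * dist v w" by (simp add: mult.assoc)
      qed
      also have "\<dots> = stability_constant \<delta> \<omega> Z a * (\<bar>\<tau>' - \<tau>\<bar> * (4*a)) * dist v w" by simp
      also have "\<dots> \<le> 1/2 * dist v w" by (intro mult_right_mono small) auto
      finally show "dist (apply_bcontfun (\<Phi> v) s) (apply_bcontfun (\<Phi> w) s) \<le> 1/2 * dist v w" unfolding app dist_norm .
    qed
  qed auto
  then obtain v where v: "\<Phi> v = v" by blast
  define u where "u = sol v"
  have vu: "apply_bcontfun v s = u s" if "s \<in> circ" for s using app[of v s] cl(2)[OF that] unfolding v u_def by simp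
  obtain u1 u2 where U: "periodic_linear \<delta> \<omega> Z u u1 u2 (\<lambda>s. of_real \<tau> * kerr a (u s) + R v s)"
    using sol[of v] unfolding saturated_solution_def u_def by blast
  interpret U: periodic_linear \<delta> \<omega> Z u u1 u2 "\<lambda>s. of_real \<tau> * kerr a (u s) + R v s" by (rule U)
  have "periodic_linear \<delta> \<omega> Z u u1 u2 (\<lambda>s. of_real \<tau>' * kerr a (u s) + h s)"
  proof
    show "continuous_on circ (\<lambda>s. of_real \<tau>' * kerr a (u s) + h s)" by (intro continuous_intros kerr_continuous U.cu a ch)
    show "- of_real \<delta> * u2 s + \<i> * of_real \<omega> * u1 s + (of_real Z - \<i>) * u s = of_real \<tau>' * kerr a (u s) + h s" if "s \<in> circ" for s
      unfolding U.eq[OF that] R_def vu[OF that] by (simp add: algebra_simps)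
  qed (use U.du U.du1 U.per d in auto)
  then show ?thesis unfolding saturated_solution_def by blast
qed

text \<open>
  The step size allowed by the continuation step does not depend on the position, so finitely many equal steps lead from the
  linear equation to \<open>\<tau> = \<sigma>\<close>.
\<close>

lemma saturated_solution_exists:
  assumes a: "0 < a" "a < 1" and d: "0 < \<delta>" and s: "\<bar>\<sigma>\<bar> \<le> 1" and ch: "continuous_on circ h"
  shows "\<exists>u. saturated_solution \<delta> \<omega> Z a \<sigma> h u"
proof -
  define K where "K = stability_constant \<delta> \<omega> Z a * (4*a)"
  have K0: "0 \<le> K" unfolding K_def using stability_constant_nonneg[OF a d] a by simp
  obtain N :: nat where N: "2*K < real N" using reals_Archimedean2 by blast
  then have N0: "0 < real N" using K0 by linarith
  have "\<forall>h. continuous_on circ h \<longrightarrow> (\<exists>u. saturated_solution \<delta> \<omega> Z a (real j/real N * \<sigma>) h u)" if "j \<le> N" for j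
    using that
  proof (induction j)
    case 0
    show ?case
    proof (intro allI impI)
      fix h :: "real \<Rightarrow> complex" assume "continuous_on circ h"
      then show "\<exists>u. saturated_solution \<delta> \<omega> Z a (real 0/real N * \<sigma>) h u" using linear_solution_exists[OF d] unfolding saturated_solution_def by auto
    qed
  next
    case (Suc j)
    show ?case
    proof (intro allI impI)
      fix h :: "real \<Rightarrow> complex" assume h: "continuous_on circ h"
      show "\<exists>u. saturated_solution \<delta> \<omega> Z a (real (Suc j)/real N * \<sigma>) h u"
      proof (rule continuation_step[OF a d _ _ _ h, of "real j/real N * \<sigma>"])
        have "\<bar>real j/real N\<bar> * \<bar>\<sigma>\<bar> \<le> 1 * 1" using Suc.prems N0 s by (intro mult_mono) auto
        then show "\<bar>real j/real N * \<sigma>\<bar> \<le> 1" by (simp add: abs_mult)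
        have "real (Suc j)/real N * \<sigma> - real j/real N * \<sigma> = \<sigma>/real N" using N0 by (simp add: field_simps)
        moreover have "\<bar>\<sigma>/real N\<bar> \<le> 1/real N" using s N0 by (simp add: divide_right_mono)
        ultimately have "stability_constant \<delta> \<omega> Z a * (\<bar>real (Suc j)/real N * \<sigma> - real j/real N * \<sigma>\<bar> * (4*a)) \<le> stability_constant \<delta> \<omega> Z a * (1/real N * (4*a))"
          using a stability_constant_nonneg[OF a d] by (intro mult_left_mono mult_right_mono) auto
        also have "\<dots> = K/real N" unfolding K_def by simp
        also have "\<dots> \<le> 1/2" using N N0 by (simp add: field_simps)
        finally show "stability_constant \<delta> \<omega> Z a * (\<bar>real (Suc j)/real N * \<sigma> - real j/real N * \<sigma>\<bar> * (4*a)) \<le> 1/2" .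
      qed (use Suc in auto)
    qed
  qed
  from this[of N] show ?thesis using ch N0 by simp
qed

section \<open>Classical solutions\<close>

definition classical_solution :: "real \<Rightarrow> real \<Rightarrow> real \<Rightarrow> (real \<Rightarrow> complex) \<Rightarrow> (real \<Rightarrow> complex) \<Rightarrow> (real \<Rightarrow> complex) \<Rightarrow> (real \<Rightarrow> complex) \<Rightarrow> bool" where
  "classical_solution d \<zeta> \<omega> f u u1 u2 \<longleftrightarrow>
     (\<forall>s\<in>circ. (u has_vector_derivative u1 s) (at s within circ) \<and> (u1 has_vector_derivative u2 s) (at s within circ) \<and>
       - of_real d * u2 s + \<i> * of_real \<omega> * u1 s + (of_real \<zeta> - \<i>) * u s - of_real ((cmod (u s))^2) * u s + \<i> * f s = 0) \<and>
     u 0 = u (2*pi) \<and> u1 0 = u1 (2*pi)"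

lemma kerr_unsaturated: "(cmod z)^2 \<le> a \<Longrightarrow> kerr a z = of_real ((cmod z)^2) * z"
  unfolding kerr_def sat_def by simp

lemma has_vector_derivative_cnj:
  "(g has_vector_derivative g') F \<Longrightarrow> ((\<lambda>s. cnj (g s)) has_vector_derivative cnj g') F"
  by (rule bounded_linear.has_vector_derivative[OF bounded_linear_cnj])

lemma classical_positive_iff:
  "- of_real d * w + \<i> * of_real \<omega> * v + (of_real Z - \<i>) * u - q * u + \<i> * h = 0
    \<longleftrightarrow> - of_real d * w + \<i> * of_real \<omega> * v + (of_real Z - \<i>) * u = of_real 1 * (q * u) - \<i> * h" for u v w h q :: complex
  by (auto simp: algebra_simps)

lemma classical_negative_iff:
  "- of_real d * cnj w + \<i> * of_real \<omega> * cnj v + (of_real Z - \<i>) * cnj u - of_real q * cnj u + \<i> * cnj h = 0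
    \<longleftrightarrow> - of_real (- d) * w + \<i> * of_real \<omega> * v + (of_real (- Z) - \<i>) * u = of_real (- 1) * (of_real q * u) - \<i> * h" for u v w h :: complex and q :: real
proof -
  have "- of_real d * cnj w + \<i> * of_real \<omega> * cnj v + (of_real Z - \<i>) * cnj u - of_real q * cnj u + \<i> * cnj h =
     - cnj (- of_real (- d) * w + \<i> * of_real \<omega> * v + (of_real (- Z) - \<i>) * u - (of_real (- 1) * (of_real q * u) - \<i> * h))"
    by (simp add: algebra_simps)
  also have "\<dots> = 0 \<longleftrightarrow> - of_real (- d) * w + \<i> * of_real \<omega> * v + (of_real (- Z) - \<i>) * u - (of_real (- 1) * (of_real q * u) - \<i> * h) = 0"
    by (metis complex_cnj_zero complex_cnj_zero_iff neg_equal_0_iff_equal)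
  finally show ?thesis unfolding right_minus_eq .
qed

text \<open>
  Conjugation maps the equation with \<open>d < 0\<close> and forcing \<open>f\<close> to the one with coefficient \<open>\<bar>d\<bar>\<close>, detuning
  \<open>- \<zeta>\<close>, the opposite sign of the Kerr term and the conjugate forcing; the drift \<open>\<omega>\<close> keeps its sign.
\<close>

definition conj_if :: "real \<Rightarrow> complex \<Rightarrow> complex" where
  "conj_if d z = (if 0 < d then z else cnj z)"

lemma conj_if_props [simp]: "conj_if d (conj_if d z) = z" "cmod (conj_if d z) = cmod z"
  unfolding conj_if_def by auto

lemma has_vector_derivative_conj_if:
  "(g has_vector_derivative g') F \<Longrightarrow> ((\<lambda>s. conj_if d (g s)) has_vector_derivative conj_if d g') F"
  unfolding conj_if_def using has_vector_derivative_cnj by auto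

lemma equation_conj_if:
  assumes "d \<noteq> 0"
  shows "- of_real d * conj_if d w + \<i> * of_real \<omega> * conj_if d v + (of_real \<zeta> - \<i>) * conj_if d u - of_real q * conj_if d u + \<i> * conj_if d h = 0
    \<longleftrightarrow> - of_real \<bar>d\<bar> * w + \<i> * of_real \<omega> * v + (of_real (sgn d * \<zeta>) - \<i>) * u = of_real (sgn d) * (of_real q * u) - \<i> * h"
proof (cases "0 < d")
  case True
  then show ?thesis unfolding conj_if_def using classical_positive_iff[of d w \<omega> v \<zeta> u "of_real q" h] by simp
next
  case False
  then have "d < 0" using assms by simp
  then show ?thesis unfolding conj_if_def using classical_negative_iff[of d w \<omega> v \<zeta> u q h] by simp
qed

lemma classical_solution_conj_if:
  assumes d: "d \<noteq> 0"
  shows "classical_solution d \<zeta> \<omega> f (\<lambda>s. conj_if d (u s)) (\<lambda>s. conj_if d (u1 s)) (\<lambda>s. conj_if d (u2 s)) \<longleftrightarrow>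
    (\<forall>s\<in>circ. (u has_vector_derivative u1 s) (at s within circ) \<and> (u1 has_vector_derivative u2 s) (at s within circ) \<and>
       - of_real \<bar>d\<bar> * u2 s + \<i> * of_real \<omega> * u1 s + (of_real (sgn d * \<zeta>) - \<i>) * u s = of_real (sgn d) * (of_real ((cmod (u s))^2) * u s) - \<i> * conj_if d (f s)) \<and>
     u 0 = u (2*pi) \<and> u1 0 = u1 (2*pi)"
proof -
  have D: "((\<lambda>s. conj_if d (g s)) has_vector_derivative conj_if d g') F \<longleftrightarrow> (g has_vector_derivative g') F" for g g' F
    using has_vector_derivative_conj_if[of g g' F d] has_vector_derivative_conj_if[of "\<lambda>s. conj_if d (g s)" "conj_if d g'" F d] by auto
  have I: "conj_if d z = conj_if d w \<longleftrightarrow> z = w" for z w by (metis conj_if_props(1))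
  have E: "- of_real d * conj_if d (u2 s) + \<i> * of_real \<omega> * conj_if d (u1 s) + (of_real \<zeta> - \<i>) * conj_if d (u s)
      - of_real ((cmod (u s))^2) * conj_if d (u s) + \<i> * f s = 0 \<longleftrightarrow>
      - of_real \<bar>d\<bar> * u2 s + \<i> * of_real \<omega> * u1 s + (of_real (sgn d * \<zeta>) - \<i>) * u s = of_real (sgn d) * (of_real ((cmod (u s))^2) * u s) - \<i> * conj_if d (f s)" for s
    using equation_conj_if[OF d, of "u2 s" \<omega> "u1 s" \<zeta> "u s" "(cmod (u s))^2" "conj_if d (f s)"] by simp
  show ?thesis unfolding classical_solution_def conj_if_props(2) D E I ..
qed

text \<open>
  Every classical solution solves a saturated equation with level above its maximum, hence obeys the a priori bound, hence solves the
  saturated equation with level 24/25. The latter has exactly one solution, and by the a priori bound this one is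
  classical.
\<close>

theorem classical_solution_unique_existence:
  assumes d: "d \<noteq> 0"
    and df: "\<And>s. s \<in> circ \<Longrightarrow> (f has_vector_derivative f1 s) (at s within circ)" and cf1: "continuous_on circ f1"
    and M: "\<And>s. s \<in> circ \<Longrightarrow> cmod (f1 s) \<le> M"
    and B: "l2 f powr (11/4) / (2*\<bar>d\<bar>) + 2 * M * l2 f powr (1/4) + sqrt (2 * M) \<le> B"
    and C: "C = l2 f / sqrt (2*pi) + sqrt (2*pi) * B * l2 f powr (1/4)"
    and D: "D = l2 f powr (3/2) + \<bar>\<omega>\<bar> * B * l2 f powr (3/4) + \<bar>d\<bar> * B^2"
    and regime: "sgn d * \<zeta> < - (C^2 * (if d < 0 then 1 else 0)) - 27 * (l2 f powr (3/4) + 2*pi*B)^6 * D / (8*pi^3)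
      \<or> 3 * C^2 + \<omega>^2/(4*\<bar>d\<bar>) < sgn d * \<zeta> \<or> sqrt 3 * C < 1"
  shows "\<exists>u u1 u2. classical_solution d \<zeta> \<omega> f u u1 u2 \<and>
    (\<forall>v v1 v2. classical_solution d \<zeta> \<omega> f v v1 v2 \<longrightarrow> (\<forall>s\<in>circ. v s = u s))"
proof -
  define h where "h s = conj_if d (f s)" for s
  define h1 where "h1 s = conj_if d (f1 s)" for s
  define \<delta> where "\<delta> = \<bar>d\<bar>"
  define Z where "Z = sgn d * \<zeta>"
  have dp: "0 < \<delta>" unfolding \<delta>_def using d by simp
  have dh: "(h has_vector_derivative h1 s) (at s within circ)" if "s \<in> circ" for s
    unfolding h_def h1_def by (rule has_vector_derivative_conj_if[OF df[OF that]])
  have ch1: "continuous_on circ h1" unfolding h1_def conj_if_def using cf1 by (cases "0 < d") (auto intro!: continuous_intros)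
  have ch: "continuous_on circ h" by (rule has_vector_derivative_continuous_on[OF dh])
  have l2h: "l2 h = l2 f" unfolding l2_def h_def by simp
  have sg: "sgn d = 1 \<or> sgn d = -1" "\<bar>sgn d\<bar> \<le> 1" "sgn d = -1 \<longleftrightarrow> d < 0" using d by (auto simp: sgn_real_def)
  have bound: "(cmod (u t))^2 < 24/25"
    if U: "kerr_solution \<delta> \<omega> Z (sgn d) a M h h1 u u1 u2" and t: "t \<in> circ" for a u u1 u2 t
    by (rule kerr_solution.amplitude_bound[OF U _ _ _ _ t, of B C D])
      (use B C D regime in \<open>simp_all only: kerr_solution.F_def[OF U] l2h \<delta>_def Z_def sg(3)\<close>)
  have to_saturated: "saturated_solution \<delta> \<omega> Z (24/25) (sgn d) (\<lambda>s. - (\<i> * h s)) (\<lambda>s. conj_if d (v s))"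
    if V: "classical_solution d \<zeta> \<omega> f v v1 v2" for v v1 v2
  proof -
    define w w1 w2 where "w s = conj_if d (v s)" and "w1 s = conj_if d (v1 s)" and "w2 s = conj_if d (v2 s)" for s
    have W: "(w has_vector_derivative w1 s) (at s within circ)" "(w1 has_vector_derivative w2 s) (at s within circ)"
       "- of_real \<delta> * w2 s + \<i> * of_real \<omega> * w1 s + (of_real Z - \<i>) * w s = of_real (sgn d) * (of_real ((cmod (w s))^2) * w s) - \<i> * h s"
       "w 0 = w (2*pi)" "w1 0 = w1 (2*pi)" if "s \<in> circ" for s
      using V classical_solution_conj_if[OF d, of \<zeta> \<omega> f w w1 w2] that
      unfolding \<delta>_def Z_def h_def by (simp_all add: w_def w1_def w2_def)
    have cw: "continuous_on circ w" by (rule has_vector_derivative_continuous_on[OF W(1)])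
    have "\<exists>x\<in>circ. \<forall>y\<in>circ. (cmod (w y))^2 \<le> (cmod (w x))^2"
      by (rule continuous_attains_sup) (auto intro!: continuous_intros cw)
    then obtain x where x: "\<And>y. y \<in> circ \<Longrightarrow> (cmod (w y))^2 \<le> (cmod (w x))^2" by blast
    \<comment> \<open>A level above the maximum, so that the saturation is not felt.\<close>
    define a where "a = (cmod (w x))^2 + 1"
    have "(cmod (w y))^2 \<le> a" if "y \<in> circ" for y using x[OF that] unfolding a_def by linarith
    moreover have "0 < a" unfolding a_def by (intro add_nonneg_pos) simp_all
    ultimately have a: "0 < a" "\<And>y. y \<in> circ \<Longrightarrow> (cmod (w y))^2 \<le> a" by blast+
    have "kerr_solution \<delta> \<omega> Z (sgn d) a M h h1 w w1 w2"
    proof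
      show "- of_real \<delta> * w2 s + \<i> * of_real \<omega> * w1 s + (of_real Z - \<i>) * w s = of_real (sgn d) * kerr a (w s) - \<i> * h s"
        if "s \<in> circ" for s unfolding kerr_unsaturated[OF a(2)[OF that]] by (rule W(3)[OF that])
      show "cmod (h1 s) \<le> M" if "s \<in> circ" for s using M[OF that] by (simp add: h1_def)
    qed (use dp W(1,2) W(4,5)[of 0] dh ch1 sg a in auto)
    from bound[OF this] have w: "(cmod (w t))^2 \<le> 24/25" if "t \<in> circ" for t using that by (simp add: less_imp_le)
    have "periodic_linear \<delta> \<omega> Z w w1 w2 (\<lambda>s. of_real (sgn d) * kerr (24/25) (w s) + - (\<i> * h s))"
    proof
      show "continuous_on circ (\<lambda>s. of_real (sgn d) * kerr (24/25) (w s) + - (\<i> * h s))"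
        by (intro continuous_intros kerr_continuous cw ch) simp
      show "- of_real \<delta> * w2 s + \<i> * of_real \<omega> * w1 s + (of_real Z - \<i>) * w s = of_real (sgn d) * kerr (24/25) (w s) + - (\<i> * h s)"
        if "s \<in> circ" for s unfolding kerr_unsaturated[OF w[OF that]] using W(3)[OF that] by simp
    qed (use dp W(1,2) W(4,5)[of 0] in auto)
    then show ?thesis unfolding saturated_solution_def w_def by blast
  qed
  have "continuous_on circ (\<lambda>s. - (\<i> * h s))" by (intro continuous_intros ch)
  note chh = this
  have "\<exists>w. saturated_solution \<delta> \<omega> Z (24/25) (sgn d) (\<lambda>s. - (\<i> * h s)) w"
    by (rule saturated_solution_exists[OF _ _ dp sg(2) chh]) simp_all
  then obtain w w1 w2 where w: "periodic_linear \<delta> \<omega> Z w w1 w2 (\<lambda>s. of_real (sgn d) * kerr (24/25) (w s) + - (\<i> * h s))"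
    unfolding saturated_solution_def by blast
  interpret W: periodic_linear \<delta> \<omega> Z w w1 w2 "\<lambda>s. of_real (sgn d) * kerr (24/25) (w s) + - (\<i> * h s)" by (rule w)
  have "kerr_solution \<delta> \<omega> Z (sgn d) (24/25) M h h1 w w1 w2"
  proof
    show "- of_real \<delta> * w2 s + \<i> * of_real \<omega> * w1 s + (of_real Z - \<i>) * w s = of_real (sgn d) * kerr (24/25) (w s) - \<i> * h s"
      if "s \<in> circ" for s unfolding W.eq[OF that] by simp
    show "cmod (h1 s) \<le> M" if "s \<in> circ" for s using M[OF that] by (simp add: h1_def)
  qed (use dp W.du W.du1 W.per dh ch1 sg in auto)
  from bound[OF this] have wb: "(cmod (w t))^2 \<le> 24/25" if "t \<in> circ" for t using that by (simp add: less_imp_le)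
  have wE: "- of_real \<delta> * w2 s + \<i> * of_real \<omega> * w1 s + (of_real Z - \<i>) * w s = of_real (sgn d) * (of_real ((cmod (w s))^2) * w s) - \<i> * h s"
    if "s \<in> circ" for s using W.eq[OF that] unfolding kerr_unsaturated[OF wb[OF that]] by simp
  have cl: "classical_solution d \<zeta> \<omega> f (\<lambda>s. conj_if d (w s)) (\<lambda>s. conj_if d (w1 s)) (\<lambda>s. conj_if d (w2 s))"
    unfolding classical_solution_conj_if[OF d] \<delta>_def[symmetric] Z_def[symmetric] h_def[symmetric]
    using W.du W.du1 W.per wE by blast
  have "v s = conj_if d (w s)" if V: "classical_solution d \<zeta> \<omega> f v v1 v2" and s: "s \<in> circ" for v v1 v2 s
  proof -
    have "saturated_solution \<delta> \<omega> Z (24/25) (sgn d) (\<lambda>s. - (\<i> * h s)) w" using w unfolding saturated_solution_def by blast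
    then have "cmod (conj_if d (v s) - w s) \<le> stability_constant \<delta> \<omega> Z (24/25) * 0"
      by (intro solution_stability[OF _ _ sg(2) to_saturated[OF V] _ chh chh _ s]) simp_all
    then have "conj_if d (v s) = w s" by simp
    then show ?thesis by (metis conj_if_props(1))
  qed
  with cl show ?thesis by blast
qed

section \<open>Smooth test functions\<close>

definition smooth :: "(real \<Rightarrow> real) \<Rightarrow> bool" where
  "smooth \<phi> \<longleftrightarrow> (\<forall>n x. (deriv ^^ n) \<phi> field_differentiable (at x))"

text \<open>
  Smoothness is the largest property of functions that is passed on to a derivative; naming a class of functions closed under
  differentiation is easier than computing higher derivatives.
\<close>

lemma smooth_coinduct:
  assumes "P \<phi>" and step: "\<And>\<psi>. P \<psi> \<Longrightarrow> \<exists>\<psi>'. P \<psi>' \<and> (\<forall>x. (\<psi> has_real_derivative \<psi>' x) (at x))"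
  shows "smooth \<phi>"
proof -
  have "P ((deriv ^^ n) \<phi>)" for n
  proof (induction n)
    case (Suc n)
    from step[OF this] obtain \<psi>' where "P \<psi>'" "\<And>x. ((deriv ^^ n) \<phi> has_real_derivative \<psi>' x) (at x)" by blast
    moreover then have "deriv ((deriv ^^ n) \<phi>) = \<psi>'" by (auto intro: DERIV_imp_deriv)
    ultimately show ?case by simp
  qed (simp add: assms(1))
  then show ?thesis unfolding smooth_def field_differentiable_def using step by blast
qed

lemma smooth_deriv:
  assumes "smooth \<phi>"
  shows "smooth (deriv \<phi>)" "(\<phi> has_real_derivative deriv \<phi> x) (at x)"
proof -
  have "(deriv ^^ n) (deriv \<phi>) = (deriv ^^ Suc n) \<phi>" for n by (simp add: funpow_swap1)
  then show "smooth (deriv \<phi>)" using assms unfolding smooth_def by metis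
  have "(deriv ^^ 0) \<phi> field_differentiable (at x)" using assms unfolding smooth_def by blast
  then show "(\<phi> has_real_derivative deriv \<phi> x) (at x)" by (simp add: DERIV_deriv_iff_field_differentiable)
qed

lemma smooth_primitive:
  assumes "smooth \<phi>" "\<And>x. (g has_real_derivative \<phi> x) (at x)"
  shows "smooth g"
proof (rule smooth_coinduct[where P="\<lambda>\<psi>. \<psi> = g \<or> smooth \<psi>"])
  show "\<exists>\<psi>'. (\<psi>' = g \<or> smooth \<psi>') \<and> (\<forall>x. (\<psi> has_real_derivative \<psi>' x) (at x))" if "\<psi> = g \<or> smooth \<psi>" for \<psi>
    using that assms smooth_deriv by blast
qed simp

lemma smooth_affine:
  assumes "smooth \<phi>"
  shows "smooth (\<lambda>x. \<phi> (a * x + b))"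
proof (rule smooth_coinduct[where P="\<lambda>\<psi>. \<exists>c \<phi>. smooth \<phi> \<and> \<psi> = (\<lambda>x. c * \<phi> (a * x + b))"])
  show "\<exists>c \<phi>'. smooth \<phi>' \<and> (\<lambda>x. \<phi> (a * x + b)) = (\<lambda>x. c * \<phi>' (a * x + b))"
    by (intro exI[of _ 1] exI[of _ \<phi>]) (simp add: assms)
next
  fix \<psi> assume "\<exists>c \<phi>. smooth \<phi> \<and> \<psi> = (\<lambda>x. c * \<phi> (a * x + b))"
  then obtain c \<phi> where p: "smooth \<phi>" "\<psi> = (\<lambda>x. c * \<phi> (a * x + b))" by blast
  have "(\<psi> has_real_derivative (c*a) * deriv \<phi> (a * x + b)) (at x)" for x
    unfolding p(2) by (rule derivative_eq_intros DERIV_chain2[OF smooth_deriv(2)[OF p(1)]] refl | simp)+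
  then show "\<exists>\<psi>'. (\<exists>c \<phi>. smooth \<phi> \<and> \<psi>' = (\<lambda>x. c * \<phi> (a * x + b))) \<and> (\<forall>x. (\<psi> has_real_derivative \<psi>' x) (at x))"
    using smooth_deriv(1)[OF p(1)] by blast
qed

text \<open>
  The smallest class that contains the products of smooth functions and is closed under differentiation by the Leibniz rule.
\<close>

inductive sum_of_products :: "(real \<Rightarrow> real) \<Rightarrow> bool" where
  product: "smooth f \<Longrightarrow> smooth g \<Longrightarrow> sum_of_products (\<lambda>x. f x * g x)"
| sum: "sum_of_products f \<Longrightarrow> sum_of_products g \<Longrightarrow> sum_of_products (\<lambda>x. f x + g x)"

lemma smooth_sum_of_products: "sum_of_products \<phi> \<Longrightarrow> smooth \<phi>"
proof (rule smooth_coinduct[where P=sum_of_products])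
  fix \<psi> assume "sum_of_products \<psi>"
  then show "\<exists>\<psi>'. sum_of_products \<psi>' \<and> (\<forall>x. (\<psi> has_real_derivative \<psi>' x) (at x))"
  proof induction
    case (product f g)
    have "sum_of_products (\<lambda>x. deriv f x * g x + f x * deriv g x)"
      by (intro sum_of_products.intros smooth_deriv product)
    moreover have "((\<lambda>x. f x * g x) has_real_derivative deriv f x * g x + f x * deriv g x) (at x)" for x
      using DERIV_mult[OF smooth_deriv(2)[OF product(1)] smooth_deriv(2)[OF product(2)]] by (simp add: mult.commute add.commute)
    ultimately show ?case by blast
  next
    case (sum f g)
    then obtain f' g' where "sum_of_products f'" "\<And>x. (f has_real_derivative f' x) (at x)"
      "sum_of_products g'" "\<And>x. (g has_real_derivative g' x) (at x)" by blast
    then have "sum_of_products (\<lambda>x. f' x + g' x) \<and> (\<forall>x. ((\<lambda>x. f x + g x) has_real_derivative f' x + g' x) (at x))"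
      by (intro conjI allI sum_of_products.sum DERIV_add)
    then show ?case by blast
  qed
qed

lemma smooth_const: "smooth (\<lambda>x. c)"
  by (rule smooth_coinduct[where P="\<lambda>\<psi>. \<exists>c. \<psi> = (\<lambda>x. c)"]) (auto intro: exI[of _ "\<lambda>x. 0"])

lemma smooth_lincomb:
  assumes "smooth f" "smooth g"
  shows "smooth (\<lambda>x. f x - c * g x)"
proof -
  have "sum_of_products (\<lambda>x. 1 * f x + - c * g x)" by (intro sum_of_products.intros smooth_const assms)
  from smooth_sum_of_products[OF this] show ?thesis by simp
qed

lemma smooth_mult: "smooth f \<Longrightarrow> smooth g \<Longrightarrow> smooth (\<lambda>x. f x * g x)"
  by (rule smooth_sum_of_products[OF sum_of_products.product])

definition flat_exp :: "real \<Rightarrow> real" where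
  "flat_exp x = (if 0 < x then exp (- (1/x)) else 0)"

lemma poly_exp_decay: "((\<lambda>y::real. poly p y * exp (- y)) \<longlongrightarrow> 0) at_top"
proof -
  have "((\<lambda>y::real. \<Sum>i\<le>degree p. coeff p i * (y^i / exp y)) \<longlongrightarrow> (\<Sum>i\<le>degree p. coeff p i * 0)) at_top"
    by (intro tendsto_sum tendsto_mult tendsto_const tendsto_power_div_exp_0)
  then show ?thesis by (simp add: poly_altdef sum_distrib_right exp_minus divide_inverse mult.assoc)
qed

text \<open>
  The class closed under differentiation consists of the functions \<open>p(1/x) exp(- 1/x)\<close>, extended by 0 to \<open>x \<le> 0\<close>, with a polynomial
  \<open>p\<close>. At 0 the difference quotient is again of this form and tends to 0.
\<close>

lemma smooth_flat_exp: "smooth flat_exp"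
proof (rule smooth_coinduct[where P="\<lambda>\<psi>. \<exists>p::real poly. \<psi> = (\<lambda>x. if 0 < x then poly p (1/x) * exp (- (1/x)) else 0)"])
  show "\<exists>p::real poly. flat_exp = (\<lambda>x. if 0 < x then poly p (1/x) * exp (- (1/x)) else 0)"
    by (rule exI[of _ 1]) (auto simp: flat_exp_def)
next
  fix \<psi> assume "\<exists>p::real poly. \<psi> = (\<lambda>x. if 0 < x then poly p (1/x) * exp (- (1/x)) else 0)"
  then obtain p :: "real poly" where p: "\<psi> = (\<lambda>x. if 0 < x then poly p (1/x) * exp (- (1/x)) else 0)" by blast
  define r where "r = [:0,0,1:] * (p - pderiv p)"
  have "(\<psi> has_real_derivative (if 0 < x then poly r (1/x) * exp (- (1/x)) else 0)) (at x)" for x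
  proof -
    consider "0 < x" | "x < 0" | "x = 0" by linarith
    then show ?thesis
    proof cases
      case 1
      have "((\<lambda>x. poly p (1/x) * exp (- (1/x))) has_real_derivative poly r (1/x) * exp (- (1/x))) (at x)"
        unfolding r_def using 1
        by (auto intro!: derivative_eq_intros DERIV_chain2[OF poly_DERIV] simp: field_simps power2_eq_square)
      then have "(\<psi> has_real_derivative poly r (1/x) * exp (- (1/x))) (at x)"
        by (rule has_field_derivative_transform_within_open[of _ _ _ "{0<..}"]) (use 1 p in auto)
      then show ?thesis using 1 by simp
    next
      case 2
      have "((\<lambda>x. 0) has_real_derivative 0) (at x)" by simp
      then have "(\<psi> has_real_derivative 0) (at x)"
        by (rule has_field_derivative_transform_within_open[of _ _ _ "{..<0}"]) (use 2 p in auto)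
      then show ?thesis using 2 by simp
    next
      case 3
      have "((\<lambda>h. \<psi> h / h) \<longlongrightarrow> 0) (at 0)"
      proof (rule filterlim_split_at)
        have "\<forall>\<^sub>F h in at_left 0. 0 = \<psi> h / h" unfolding p eventually_at_filter by simp
        then show "((\<lambda>h. \<psi> h / h) \<longlongrightarrow> 0) (at_left 0)" by (rule Lim_transform_eventually[OF tendsto_const])
        have "((\<lambda>h. poly (pCons 0 p) (inverse h) * exp (- (inverse h))) \<longlongrightarrow> 0) (at_right 0)"
          by (rule filterlim_compose[OF poly_exp_decay filterlim_inverse_at_top_right])
        moreover have "\<forall>\<^sub>F h in at_right 0. poly (pCons 0 p) (inverse h) * exp (- (inverse h)) = \<psi> h / h"
          unfolding p eventually_at_filter by (simp add: field_simps)
        ultimately show "((\<lambda>h. \<psi> h / h) \<longlongrightarrow> 0) (at_right 0)" by (rule Lim_transform_eventually)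
      qed
      then show ?thesis unfolding has_field_derivative_iff 3 by (simp add: p)
    qed
  qed
  then show "\<exists>\<psi>'. (\<exists>p::real poly. \<psi>' = (\<lambda>x. if 0 < x then poly p (1/x) * exp (- (1/x)) else 0)) \<and> (\<forall>x. (\<psi> has_real_derivative \<psi>' x) (at x))"
    by blast
qed

text \<open>
  The offsets by 1 push the support into the open interval, as compactness requires, while the growing factor \<open>n + 1\<close> makes the
  functions converge to the indicator of the interval.
\<close>

definition bump :: "real \<Rightarrow> real \<Rightarrow> nat \<Rightarrow> real \<Rightarrow> real" where
  "bump a b n x = flat_exp (real (Suc n) * (x - a) - 1) * flat_exp (real (Suc n) * (b - x) - 1)"

lemma flat_exp_bounds: "0 \<le> flat_exp x" "flat_exp x \<le> 1" unfolding flat_exp_def by auto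

lemma bump_le_1: "\<bar>bump a b n x\<bar> \<le> 1"
  unfolding bump_def using flat_exp_bounds by (auto intro!: mult_le_one mult_nonneg_nonneg simp: abs_mult)

lemma bump_smooth: "smooth (bump a b n)"
proof -
  define c where "c = real (Suc n)"
  have "smooth (\<lambda>x. flat_exp (c * x + (- c * a - 1)) * flat_exp (- c * x + (c * b - 1)))"
    by (intro smooth_mult smooth_affine smooth_flat_exp)
  moreover have "bump a b n = (\<lambda>x. flat_exp (c * x + (- c * a - 1)) * flat_exp (- c * x + (c * b - 1)))"
    unfolding bump_def c_def[symmetric] by (simp add: algebra_simps)
  ultimately show ?thesis by simp
qed

lemma bump_support: "x \<notin> {a + 1/real (Suc n)..b - 1/real (Suc n)} \<Longrightarrow> bump a b n x = 0"
  unfolding bump_def flat_exp_def by (auto simp: field_simps)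

lemma bump_tendsto: "(\<lambda>n. bump a b n x) \<longlonglongrightarrow> indicator {a<..<b} x"
proof (cases "x \<in> {a<..<b}")
  case True
  have lim: "(\<lambda>n. flat_exp (real (Suc n) * t - 1)) \<longlonglongrightarrow> 1" if t: "0 < t" for t
  proof -
    have top: "LIM n sequentially. real (Suc n) * t - 1 :> at_top"
    proof -
      have "LIM n sequentially. (- 1) + t * real (Suc n) :> at_top"
        by (intro filterlim_tendsto_add_at_top[OF tendsto_const] filterlim_tendsto_pos_mult_at_top[OF tendsto_const t]
            filterlim_compose[OF filterlim_real_sequentially filterlim_Suc])
      then show ?thesis by (simp add: algebra_simps)
    qed
    have "(\<lambda>n. exp (- inverse (real (Suc n) * t - 1))) \<longlonglongrightarrow> exp (- 0)"
      by (intro tendsto_exp tendsto_minus tendsto_inverse_0_at_top[OF top])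
    moreover have "\<forall>\<^sub>F n in sequentially. exp (- inverse (real (Suc n) * t - 1)) = flat_exp (real (Suc n) * t - 1)"
      using filterlim_at_top_dense[THEN iffD1, OF top, rule_format, of 0]
      by eventually_elim (simp add: flat_exp_def inverse_eq_divide)
    ultimately show ?thesis using Lim_transform_eventually by force
  qed
  have "(\<lambda>n. bump a b n x) \<longlonglongrightarrow> 1 * 1" unfolding bump_def by (intro tendsto_mult lim) (use True in auto)
  then show ?thesis using True by simp
next
  case False
  have "bump a b n x = 0" for n
  proof (rule bump_support)
    define e where "e = 1/real (Suc n)"
    have "0 < e" unfolding e_def by simp
    then show "x \<notin> {a + 1/real (Suc n)..b - 1/real (Suc n)}" using False unfolding e_def[symmetric] by auto
  qed
  then show ?thesis using False by simp
qed

lemma test_function_iff: "test_function_on S \<phi> \<longleftrightarrow> smooth \<phi> \<and> (\<exists>K. compact K \<and> K \<subseteq> S \<and> (\<forall>x. x \<notin> K \<longrightarrow> \<phi> x = 0))"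
  unfolding test_function_on_def smooth_def ..

lemma bump_test:
  assumes "{a<..<b} \<subseteq> S"
  shows "test_function_on S (bump a b n)"
  unfolding test_function_iff
proof (intro conjI exI allI impI)
  show "compact {a + 1/real (Suc n)..b - 1/real (Suc n)}" by simp
  define e where "e = 1/real (Suc n)"
  have "0 < e" unfolding e_def by simp
  then have "{a + 1/real (Suc n)..b - 1/real (Suc n)} \<subseteq> {a<..<b}" unfolding e_def[symmetric] by auto
  then show "{a + 1/real (Suc n)..b - 1/real (Suc n)} \<subseteq> S" using assms by blast
qed (use bump_smooth bump_support in auto)

lemma smooth_continuous: "smooth \<phi> \<Longrightarrow> continuous_on S \<phi>"
  by (intro continuous_at_imp_continuous_on ballI DERIV_isCont[OF smooth_deriv(2)])

lemma test_function_facts: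
  assumes "test_function_on S \<phi>"
  shows "continuous_on T \<phi>" "(\<phi> has_real_derivative deriv \<phi> x) (at x)" "continuous_on T (deriv \<phi>)"
    "\<exists>K. compact K \<and> K \<subseteq> S \<and> (\<forall>x. x \<notin> K \<longrightarrow> \<phi> x = 0 \<and> deriv \<phi> x = 0)"
proof -
  have s: "smooth \<phi>" using assms unfolding test_function_iff by blast
  show "continuous_on T \<phi>" "(\<phi> has_real_derivative deriv \<phi> x) (at x)" "continuous_on T (deriv \<phi>)"
    by (intro smooth_continuous smooth_deriv s)+
  obtain K where K: "compact K" "K \<subseteq> S" "\<And>x. x \<notin> K \<Longrightarrow> \<phi> x = 0" using assms unfolding test_function_iff by blast
  have "deriv \<phi> x = 0" if x: "x \<notin> K" for x
  proof -
    have "((\<lambda>x. 0) has_real_derivative 0) (at x)" by simp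
    then have "(\<phi> has_real_derivative 0) (at x)"
      by (rule has_field_derivative_transform_within_open[of _ _ _ "- K"]) (use x K compact_imp_closed in auto)
    then show ?thesis by (rule DERIV_imp_deriv)
  qed
  then show "\<exists>K. compact K \<and> K \<subseteq> S \<and> (\<forall>x. x \<notin> K \<longrightarrow> \<phi> x = 0 \<and> deriv \<phi> x = 0)" using K by blast
qed

section \<open>The fundamental lemma and the du Bois-Reymond lemma\<close>

lemma sigma_finite_lebesgue: "sigma_finite_measure (lebesgue :: real measure)"
proof
  obtain A :: "real set set" where A: "countable A" "A \<subseteq> sets lborel" "\<Union>A = space lborel" "\<And>a. a \<in> A \<Longrightarrow> emeasure lborel a \<noteq> \<infinity>"
    using lborel.sigma_finite_countable by metis
  then show "\<exists>A::real set set. countable A \<and> A \<subseteq> sets lebesgue \<and> \<Union>A = space lebesgue \<and> (\<forall>a\<in>A. emeasure lebesgue a \<noteq> \<infinity>)"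
    by (intro exI[of _ A]) auto
qed

text \<open>
  The intervals generate the Borel sets, and every Lebesgue set is a Borel set up to a null set; so all integrals of \<open>W\<close> over
  measurable sets vanish.
\<close>

lemma interval_integrals_determine:
  fixes W :: "real \<Rightarrow> complex"
  assumes W: "integrable lebesgue W" and supp: "\<And>x. x \<notin> {p<..<q} \<Longrightarrow> W x = 0" and pq: "p < q"
    and zero: "\<And>a b. p \<le> a \<Longrightarrow> a < b \<Longrightarrow> b \<le> q \<Longrightarrow> (LINT x|lebesgue. indicator {a<..<b} x *\<^sub>R W x) = 0"
  shows "AE x in lebesgue. W x = 0"
proof -
  define I where "I A = (LINT x|lebesgue. indicator A x *\<^sub>R W x)" for A
  have int: "integrable lebesgue (\<lambda>x. indicator A x *\<^sub>R W x)" if "A \<in> sets lebesgue" for A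
    by (rule integrable_mult_indicator[OF that W])
  have borel: "I A = 0" if "A \<in> sets borel" for A
    using that
  proof (induction rule: borel_set_induct)
    case (interval a b)
    have e: "AE x in lebesgue. indicat_real {a..b} x *\<^sub>R W x = indicat_real {max a p<..<min b q} x *\<^sub>R W x"
    proof -
      have "{a, b} \<in> null_sets lebesgue" by (intro null_sets_completionI finite_imp_null_set_lborel) simp
      from AE_not_in[OF this] show ?thesis
      proof eventually_elim
        fix x assume "x \<notin> {a, b}"
        then show "indicat_real {a..b} x *\<^sub>R W x = indicat_real {max a p<..<min b q} x *\<^sub>R W x"
          using supp[of x] by (cases "x \<in> {p<..<q}") (auto simp: indicator_def)
      qed
    qed
    have "I {a..b} = (LINT x|lebesgue. indicat_real {max a p<..<min b q} x *\<^sub>R W x)"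
      unfolding I_def by (intro integral_cong_AE e borel_measurable_integrable int) simp_all
    also have "\<dots> = 0"
    proof (cases "max a p < min b q")
      case True
      then show ?thesis by (intro zero) auto
    next
      case False
      then have "{max a p<..<min b q} = {}" by (simp only: greaterThanLessThan_empty_iff not_less)
      then show ?thesis by (simp only:) simp
    qed
    finally show ?case .
  next
    case (compl A)
    have A: "A \<in> sets lebesgue" using compl(1) by simp
    have "I (- A) = (LINT x|lebesgue. W x - indicator A x *\<^sub>R W x)"
      unfolding I_def by (rule Bochner_Integration.integral_cong) (auto simp: indicator_def)
    also have "\<dots> = (LINT x|lebesgue. W x) - I A" unfolding I_def by (rule Bochner_Integration.integral_diff[OF W int[OF A]])
    also have "(LINT x|lebesgue. W x) = (LINT x|lebesgue. indicator {p<..<q} x *\<^sub>R W x)"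
      by (rule Bochner_Integration.integral_cong) (use supp in \<open>auto simp: indicator_def\<close>)
    finally show ?case using zero[of p q] pq compl(2) by simp
  next
    case (union A)
    have A: "A i \<in> sets lebesgue" for i using union(2)[of i] by simp
    have "(LINT x:(\<Union>i. A i)|lebesgue. W x) = (\<Sum>i. (LINT x:(A i)|lebesgue. W x))"
    proof (rule lebesgue_integral_countable_add)
      show "set_integrable lebesgue (\<Union>i. A i) W" unfolding set_integrable_def by (intro int sets.countable_UN) (use A in auto)
    qed (use A union(1) in \<open>auto simp: disjoint_family_on_def\<close>)
    then show ?case using union(3) unfolding I_def set_lebesgue_integral_def by simp
  qed (simp add: I_def)
  have "set_lebesgue_integral lebesgue A W = 0" if A: "A \<in> sets lebesgue" for A
  proof -
    obtain S N N' where S: "A = S \<union> N" "N \<subseteq> N'" "N' \<in> null_sets lborel" "S \<in> sets lborel"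
      using A by (rule sets_completionE) blast
    have N': "N' \<in> null_sets lebesgue" using S(3) by (rule null_sets_completionI)
    have "(LINT x|lebesgue. indicator A x *\<^sub>R W x) = I S" unfolding I_def
    proof (rule integral_cong_AE)
      show "AE x in lebesgue. indicat_real A x *\<^sub>R W x = indicat_real S x *\<^sub>R W x"
        using AE_not_in[OF N'] by eventually_elim (use S in \<open>auto simp: indicator_def\<close>)
      show "(\<lambda>x. indicat_real A x *\<^sub>R W x) \<in> borel_measurable lebesgue" by (rule borel_measurable_integrable[OF int[OF A]])
      have "S \<in> sets lebesgue" using S(4) by simp
      then show "(\<lambda>x. indicat_real S x *\<^sub>R W x) \<in> borel_measurable lebesgue" by (intro borel_measurable_integrable int)
    qed
    then show ?thesis unfolding set_lebesgue_integral_def using borel S(4) by simp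
  qed
  then show ?thesis by (rule sigma_finite_measure.density_zero[OF sigma_finite_lebesgue W])
qed

lemma continuous_lebesgue_measurable:
  fixes \<phi> :: "real \<Rightarrow> 'a::euclidean_space"
  shows "continuous_on UNIV \<phi> \<Longrightarrow> \<phi> \<in> borel_measurable lebesgue"
  by (intro measurable_completion) (simp add: borel_measurable_continuous_onI)

text \<open>
  The bump functions approximate the indicators of intervals boundedly.
\<close>

lemma fundamental_lemma:
  fixes W :: "real \<Rightarrow> complex"
  assumes W: "integrable lebesgue W" and supp: "\<And>x. x \<notin> {p<..<q} \<Longrightarrow> W x = 0" and pq: "p < q"
    and test: "\<And>\<phi>. test_function_on {p<..<q} \<phi> \<Longrightarrow> (LINT x|lebesgue. \<phi> x *\<^sub>R W x) = 0"
  shows "AE x in lebesgue. W x = 0"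
proof (rule interval_integrals_determine[OF W supp pq])
  fix a b :: real assume ab: "p \<le> a" "a < b" "b \<le> q"
  have "(\<lambda>n. LINT x|lebesgue. bump a b n x *\<^sub>R W x) \<longlonglongrightarrow> (LINT x|lebesgue. indicator {a<..<b} x *\<^sub>R W x)"
  proof (rule integral_dominated_convergence[where w="\<lambda>x. norm (W x)"])
    show "AE x in lebesgue. (\<lambda>n. bump a b n x *\<^sub>R W x) \<longlonglongrightarrow> indicator {a<..<b} x *\<^sub>R W x"
      by (intro AE_I2 tendsto_scaleR bump_tendsto tendsto_const)
    show "AE x in lebesgue. norm (bump a b n x *\<^sub>R W x) \<le> norm (W x)" for n
      using bump_le_1 by (intro AE_I2) (simp add: mult_left_le_one_le)
    show "(\<lambda>x. bump a b n x *\<^sub>R W x) \<in> borel_measurable lebesgue" for n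
      by (intro borel_measurable_scaleR continuous_lebesgue_measurable smooth_continuous bump_smooth borel_measurable_integrable W)
    show "(\<lambda>x. indicat_real {a<..<b} x *\<^sub>R W x) \<in> borel_measurable lebesgue"
      by (intro borel_measurable_integrable integrable_mult_indicator W) simp
  qed (intro integrable_norm W)
  moreover have "(LINT x|lebesgue. bump a b n x *\<^sub>R W x) = 0" for n
    by (intro test bump_test) (use ab in auto)
  ultimately show "(LINT x|lebesgue. indicator {a<..<b} x *\<^sub>R W x) = 0"
    by (simp add: LIMSEQ_const_iff)
qed simp_all

interpretation lebesgue_pair: pair_sigma_finite "lebesgue :: real measure" "lebesgue :: real measure"
  by (intro pair_sigma_finite.intro sigma_finite_lebesgue)

lemma indicator_atMost_measurable:
  "(\<lambda>z. indicat_real {..fst z} (snd z)) \<in> borel_measurable (lebesgue \<Otimes>\<^sub>M (lebesgue :: real measure))"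
proof -
  have id: "(\<lambda>x::real. x) \<in> borel_measurable lebesgue" by (intro measurable_completion) simp
  have [measurable]: "fst \<in> borel_measurable ((lebesgue :: real measure) \<Otimes>\<^sub>M (lebesgue :: real measure))"
    by (rule measurable_compose[OF measurable_fst id])
  have [measurable]: "snd \<in> borel_measurable ((lebesgue :: real measure) \<Otimes>\<^sub>M (lebesgue :: real measure))"
    by (rule measurable_compose[OF measurable_snd id])
  have "(\<lambda>z. if snd z \<le> fst z then 1 else 0::real) \<in> borel_measurable ((lebesgue :: real measure) \<Otimes>\<^sub>M lebesgue)"
    by measurable
  then show ?thesis by (simp add: indicator_def of_bool_def)
qed

text \<open>
  For \<open>v\<close> supported in a bounded interval this is the primitive that vanishes at its left end.
\<close>

definition prim :: "(real \<Rightarrow> complex) \<Rightarrow> real \<Rightarrow> complex" where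
  "prim v x = (LINT t|lebesgue. indicator {..x} t *\<^sub>R v t)"

lemma prim_bound:
  assumes v: "integrable lebesgue v"
  shows "norm (prim v x) \<le> (LINT t|lebesgue. norm (v t))"
proof -
  have i: "integrable lebesgue (\<lambda>t. indicator {..x} t *\<^sub>R v t)" by (rule integrable_mult_indicator[OF _ v]) simp
  have "norm (prim v x) \<le> (LINT t|lebesgue. norm (indicator {..x} t *\<^sub>R v t))" unfolding prim_def by (rule integral_norm_bound)
  also have "\<dots> \<le> (LINT t|lebesgue. norm (v t))"
    by (intro integral_mono integrable_norm i v) (auto simp: indicator_def)
  finally show ?thesis .
qed

lemma prim_measurable:
  assumes v: "integrable lebesgue v"
  shows "prim v \<in> borel_measurable lebesgue"
proof -
  have "(\<lambda>x. LINT t|lebesgue. indicat_real {..x} t *\<^sub>R v t) \<in> borel_measurable lebesgue"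
  proof (rule sigma_finite_measure.borel_measurable_lebesgue_integral[OF sigma_finite_lebesgue])
    have "(\<lambda>z. indicat_real {..fst z} (snd z) *\<^sub>R v (snd z)) \<in> borel_measurable (lebesgue \<Otimes>\<^sub>M lebesgue)"
      by (intro borel_measurable_scaleR indicator_atMost_measurable measurable_compose[OF measurable_snd borel_measurable_integrable[OF v]])
    then show "case_prod (\<lambda>x t. indicat_real {..x} t *\<^sub>R v t) \<in> borel_measurable (lebesgue \<Otimes>\<^sub>M lebesgue)"
      by (simp add: case_prod_beta')
  qed
  then show ?thesis unfolding prim_def[abs_def] .
qed

lemma prim_integrable:
  assumes v: "integrable lebesgue v" and h: "integrable lebesgue h"
  shows "integrable lebesgue (\<lambda>x. h x *\<^sub>R prim v x)"
proof (rule Bochner_Integration.integrable_bound)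
  show "integrable lebesgue (\<lambda>x. (LINT t|lebesgue. norm (v t)) * h x)" using h by simp
  show "(\<lambda>x. h x *\<^sub>R prim v x) \<in> borel_measurable lebesgue"
    by (intro borel_measurable_scaleR prim_measurable v borel_measurable_integrable h)
  show "AE x in lebesgue. norm (h x *\<^sub>R prim v x) \<le> norm ((LINT t|lebesgue. norm (v t)) * h x)"
  proof (rule AE_I2)
    fix x
    have "0 \<le> (LINT t|lebesgue. norm (v t))" by (rule integral_nonneg_AE) simp
    then show "norm (h x *\<^sub>R prim v x) \<le> norm ((LINT t|lebesgue. norm (v t)) * h x)"
      using mult_left_mono[OF prim_bound[OF v, of x], of "\<bar>h x\<bar>"] by (simp add: abs_mult mult.commute)
  qed
qed

text \<open>
  Integration by parts for a merely integrable \<open>v\<close>: exchange the order of integration over the region \<open>t \<le> x\<close>.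
\<close>

lemma prim_swap:
  assumes v: "integrable lebesgue v" and h: "integrable lebesgue h"
  shows "(LINT x|lebesgue. h x *\<^sub>R prim v x) = (LINT t|lebesgue. (LINT x|lebesgue. indicator {t..} x * h x) *\<^sub>R v t)"
proof -
  define F where "F x t = (indicat_real {..x} t * h x) *\<^sub>R v t" for x t
  have vm: "v \<in> borel_measurable lebesgue" and hm: "h \<in> borel_measurable lebesgue" by (intro borel_measurable_integrable v h)+
  have Gm: "(\<lambda>z. h (fst z) *\<^sub>R v (snd z)) \<in> borel_measurable (lebesgue \<Otimes>\<^sub>M lebesgue)"
    by (intro borel_measurable_scaleR measurable_compose[OF measurable_snd vm] measurable_compose[OF measurable_fst hm])
  have G: "integrable (lebesgue \<Otimes>\<^sub>M lebesgue) (\<lambda>z. h (fst z) *\<^sub>R v (snd z))"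
  proof (rule lebesgue_pair.Fubini_integrable[OF Gm])
    show "integrable lebesgue (\<lambda>x. LINT t|lebesgue. norm (h (fst (x, t)) *\<^sub>R v (snd (x, t))))" using h by simp
    show "AE x in lebesgue. integrable lebesgue (\<lambda>t. h (fst (x, t)) *\<^sub>R v (snd (x, t)))" using v by simp
  qed
  have "integrable (lebesgue \<Otimes>\<^sub>M lebesgue) (\<lambda>z. F (fst z) (snd z))"
  proof (rule Bochner_Integration.integrable_bound[OF G])
    show "(\<lambda>z. F (fst z) (snd z)) \<in> borel_measurable (lebesgue \<Otimes>\<^sub>M lebesgue)" unfolding F_def
      by (intro borel_measurable_scaleR borel_measurable_times indicator_atMost_measurable measurable_compose[OF measurable_snd vm] measurable_compose[OF measurable_fst hm])
    show "AE z in lebesgue \<Otimes>\<^sub>M lebesgue. norm (F (fst z) (snd z)) \<le> norm (h (fst z) *\<^sub>R v (snd z))"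
      by (intro AE_I2) (auto simp: F_def indicator_def)
  qed
  then have "integrable (lebesgue \<Otimes>\<^sub>M lebesgue) (case_prod F)" by (simp add: case_prod_beta')
  then have "(LINT t|lebesgue. (LINT x|lebesgue. F x t)) = (LINT x|lebesgue. (LINT t|lebesgue. F x t))"
    by (rule lebesgue_pair.Fubini_integral)
  moreover have "(LINT t|lebesgue. F x t) = h x *\<^sub>R prim v x" for x
    unfolding F_def prim_def integral_scaleR_right[symmetric] by (simp add: mult.commute)
  moreover have "(LINT x|lebesgue. F x t) = (LINT x|lebesgue. indicator {t..} x * h x) *\<^sub>R v t" for t
  proof -
    have "(LINT x|lebesgue. F x t) = (LINT x|lebesgue. (indicator {t..} x * h x) *\<^sub>R v t)"
      unfolding F_def by (rule Bochner_Integration.integral_cong) (auto simp: indicator_def)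
    also have "\<dots> = (LINT x|lebesgue. indicator {t..} x * h x) *\<^sub>R v t"
    proof (rule integral_scaleR_left)
      have "integrable lebesgue (\<lambda>x. indicator {t..} x *\<^sub>R h x)" by (rule integrable_mult_indicator[OF _ h]) simp
      then show "integrable lebesgue (\<lambda>x. indicator {t..} x * h x)" by simp
    qed
    finally show ?thesis .
  qed
  ultimately show ?thesis by simp
qed

lemma continuous_support_integrable:
  fixes \<phi> :: "real \<Rightarrow> 'a::euclidean_space"
  assumes c: "continuous_on UNIV \<phi>" and s: "\<And>x. x \<notin> {a..b} \<Longrightarrow> \<phi> x = 0"
  shows "integrable lebesgue \<phi>"
proof -
  have "\<phi> absolutely_integrable_on {a..b}"
    by (rule absolutely_integrable_continuous_real[OF continuous_on_subset[OF c]]) simp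
  then have "integrable lebesgue (\<lambda>x. indicat_real {a..b} x *\<^sub>R \<phi> x)" unfolding set_integrable_def .
  moreover have "(\<lambda>x. indicat_real {a..b} x *\<^sub>R \<phi> x) = \<phi>" using s by (auto simp: indicator_def fun_eq_iff)
  ultimately show ?thesis by simp
qed

lemma continuous_support_bound:
  fixes \<phi> :: "real \<Rightarrow> real"
  assumes c: "continuous_on UNIV \<phi>" and s: "\<And>x. x \<notin> {a..b} \<Longrightarrow> \<phi> x = 0"
  obtains B where "0 \<le> B" "\<And>x. \<bar>\<phi> x\<bar> \<le> B"
proof -
  have "compact (\<phi> ` {a..b})" by (intro compact_continuous_image continuous_on_subset[OF c]) auto
  then have "bounded (\<phi> ` {a..b})" by (rule compact_imp_bounded)
  then obtain B where B: "\<And>x. x \<in> {a..b} \<Longrightarrow> norm (\<phi> x) \<le> B" unfolding bounded_iff by blast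
  show ?thesis
  proof (rule that[of "max B 0"])
    show "\<bar>\<phi> x\<bar> \<le> max B 0" for x using B[of x] s[of x] by (cases "x \<in> {a..b}") auto
  qed simp
qed

lemma continuous_times_integrable:
  fixes u :: "real \<Rightarrow> complex" and \<phi> :: "real \<Rightarrow> real"
  assumes c: "continuous_on UNIV \<phi>" and s: "\<And>x. x \<notin> {a..b} \<Longrightarrow> \<phi> x = 0" and u: "integrable lebesgue u"
  shows "integrable lebesgue (\<lambda>x. \<phi> x *\<^sub>R u x)"
proof -
  obtain B where B: "0 \<le> B" "\<And>x. \<bar>\<phi> x\<bar> \<le> B" using continuous_support_bound[OF c s] by metis
  show ?thesis
  proof (rule Bochner_Integration.integrable_bound)
    show "integrable lebesgue (\<lambda>x. B *\<^sub>R u x)" using u by simp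
    show "(\<lambda>x. \<phi> x *\<^sub>R u x) \<in> borel_measurable lebesgue"
      by (intro borel_measurable_scaleR continuous_lebesgue_measurable c borel_measurable_integrable u)
    show "AE x in lebesgue. norm (\<phi> x *\<^sub>R u x) \<le> norm (B *\<^sub>R u x)"
      using B by (intro AE_I2) (simp add: mult_right_mono)
  qed
qed

lemma lebesgue_FTC:
  fixes g h :: "real \<Rightarrow> real"
  assumes ab: "a \<le> b" and d: "\<And>x. (g has_real_derivative h x) (at x)" and c: "continuous_on UNIV h"
  shows "(LINT x|lebesgue. indicator {a..b} x * h x) = g b - g a"
proof -
  have "(\<lambda>x. indicat_real {a..b} x * h x) \<in> borel_measurable borel"
    by (intro borel_measurable_times borel_measurable_indicator borel_measurable_continuous_onI c) simp
  then have "(LINT x|lebesgue. indicator {a..b} x * h x) = (LINT x|lborel. indicator {a..b} x * h x)"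
    by (intro integral_completion) simp
  also have "\<dots> = (LINT x|lborel. h x * indicator {a..b} x)" by (simp add: mult.commute)
  also have "\<dots> = g b - g a"
    by (rule integral_FTC_Icc_real[OF ab]) (use d c in \<open>auto simp: continuous_on_eq_continuous_at\<close>)
  finally show ?thesis .
qed

lemma compact_in_interval:
  fixes K :: "real set"
  assumes "compact K" "K \<subseteq> {p<..<q}" "p < q"
  obtains a b where "p < a" "a \<le> b" "b < q" "K \<subseteq> {a..b}"
proof -
  define m where "m = (p+q)/2"
  have m: "m \<in> {p<..<q}" using assms(3) by (auto simp: m_def)
  have c: "compact (insert m K)" using assms(1) by simp
  obtain a where a: "a \<in> insert m K" "\<And>x. x \<in> insert m K \<Longrightarrow> a \<le> x" using compact_attains_inf[OF c] by auto
  obtain b where b: "b \<in> insert m K" "\<And>x. x \<in> insert m K \<Longrightarrow> x \<le> b" using compact_attains_sup[OF c] by auto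
  show ?thesis
  proof (rule that)
    show "p < a" "b < q" using a(1) b(1) m assms(2) by auto
    show "a \<le> b" using a(2)[of m] b(2)[of m] by simp
    show "K \<subseteq> {a..b}" using a(2) b(2) by auto
  qed
qed

lemma test_function_interval:
  assumes "test_function_on {p<..<q} \<phi>" "p < q"
  obtains a b where "p < a" "a \<le> b" "b < q" "\<And>x. x \<notin> {a..b} \<Longrightarrow> \<phi> x = 0 \<and> deriv \<phi> x = 0"
proof -
  obtain K where K: "compact K" "K \<subseteq> {p<..<q}" "\<And>x. x \<notin> K \<Longrightarrow> \<phi> x = 0 \<and> deriv \<phi> x = 0"
    using test_function_facts(4)[OF assms(1)] by blast
  obtain a b where ab: "p < a" "a \<le> b" "b < q" "K \<subseteq> {a..b}" by (rule compact_in_interval[OF K(1,2) assms(2)])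
  show ?thesis
  proof (rule that[OF ab(1-3)])
    show "\<phi> x = 0 \<and> deriv \<phi> x = 0" if "x \<notin> {a..b}" for x using that ab(4) K(3) by blast
  qed
qed

lemma prim_weak_derivative:
  assumes v: "integrable lebesgue v" and pq: "p < q" and g: "test_function_on {p<..<q} g"
  shows "(LINT x|lebesgue. deriv g x *\<^sub>R prim v x) = - (LINT x|lebesgue. g x *\<^sub>R v x)"
proof -
  obtain a b where ab: "a \<le> b" "\<And>x. x \<notin> {a..b} \<Longrightarrow> g x = 0 \<and> deriv g x = 0" using test_function_interval[OF g pq] by metis
  have "integrable lebesgue (deriv g)"
    by (rule continuous_support_integrable[OF test_function_facts(3)[OF g], of a b]) (use ab in auto)
  note swap = prim_swap[OF v this]
  have "(LINT x|lebesgue. indicator {t..} x * deriv g x) = - g t" for t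
  proof -
    define R where "R = max t b + 1"
    have R: "t \<le> R" "b < R" unfolding R_def by auto
    have e: "indicat_real {t..} x * deriv g x = indicator {t..R} x * deriv g x" for x
      using ab(2)[of x] R by (cases "x \<le> R") (auto simp: indicator_def)
    have "(LINT x|lebesgue. indicator {t..} x * deriv g x) = (LINT x|lebesgue. indicator {t..R} x * deriv g x)" unfolding e ..
    also have "\<dots> = g R - g t" by (rule lebesgue_FTC[OF R(1) test_function_facts(2)[OF g] test_function_facts(3)[OF g]])
    finally show ?thesis using ab(2)[of R] R by simp
  qed
  then show ?thesis unfolding swap by simp
qed

text \<open>
  A test function is the derivative of a test function if and only if its integral vanishes.
\<close>

lemma test_function_primitive:
  assumes pq: "p < q" and \<phi>: "test_function_on {p<..<q} \<phi>" and z: "(LINT x|lebesgue. \<phi> x) = 0"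
  obtains g where "test_function_on {p<..<q} g" "deriv g = \<phi>"
proof -
  obtain a b where ab: "p < a" "a \<le> b" "b < q" "\<And>x. x \<notin> {a..b} \<Longrightarrow> \<phi> x = 0" using test_function_interval[OF \<phi> pq] by metis
  have c: "continuous_on UNIV \<phi>" by (rule test_function_facts(1)[OF \<phi>])
  have "\<exists>F. \<forall>x :: real. -\<infinity> < ereal x \<longrightarrow> ereal x < \<infinity> \<longrightarrow> (F has_vector_derivative \<phi> x) (at x)"
    by (rule einterval_antiderivative) (use c in \<open>auto simp: continuous_on_eq_continuous_at\<close>)
  then obtain F where F: "\<And>x. (F has_real_derivative \<phi> x) (at x)"
    unfolding has_real_derivative_iff_has_vector_derivative by auto
  define g where "g x = F x - F p" for x
  have dg: "(g has_real_derivative \<phi> x) (at x)" for x unfolding g_def by (auto intro!: derivative_eq_intros F)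
  have diff: "g y - g x = (LINT s|lebesgue. indicator {x..y} s * \<phi> s)" if "x \<le> y" for x y
    by (rule lebesgue_FTC[OF that dg c, symmetric])
  have gq: "g q = 0"
  proof -
    have e: "indicat_real {p..q} s * \<phi> s = \<phi> s" for s using ab(4)[of s] ab by (cases "s \<in> {p..q}") (auto simp: indicator_def)
    have "g q - g p = (LINT s|lebesgue. \<phi> s)" using diff[of p q] pq unfolding e by simp
    then show ?thesis using z by (simp add: g_def)
  qed
  have zero: "(LINT s|lebesgue. indicator {x..y} s * \<phi> s) = 0" if "y < a \<or> b < x" for x y
  proof -
    have e: "indicat_real {x..y} s * \<phi> s = 0" for s using ab(4)[of s] that by (cases "s \<in> {x..y}") auto
    show ?thesis unfolding e by simp
  qed
  have g0: "g x = 0" if "x \<notin> {a..b}" for x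
  proof -
    have "x < a \<or> b < x" using that by auto
    then show ?thesis
    proof
      assume "x < a"
      then show ?thesis using diff[of x p] diff[of p x] zero[of p x] zero[of x p] ab by (cases "x \<le> p") (auto simp: g_def)
    next
      assume "b < x"
      then show ?thesis using diff[of x q] diff[of q x] zero[of q x] zero[of x q] ab gq by (cases "x \<le> q") auto
    qed
  qed
  show ?thesis
  proof (rule that)
    show "test_function_on {p<..<q} g" unfolding test_function_iff
    proof (intro conjI exI allI impI)
      show "smooth g" by (rule smooth_primitive[OF _ dg]) (use \<phi> test_function_iff in blast)
      show "compact {a..b}" "{a..b} \<subseteq> {p<..<q}" using ab by auto
    qed (rule g0)
    show "deriv g = \<phi>" by (auto intro: DERIV_imp_deriv dg)
  qed
qed

lemma integrable_bounded_indicator: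
  "bounded S \<Longrightarrow> S \<in> sets lebesgue \<Longrightarrow> integrable lebesgue (indicat_real S)"
  using bounded_set_imp_lmeasurable lmeasurable_iff_integrable by blast

lemma bump_integral_nonzero:
  assumes "p < q"
  obtains n where "(LINT x|lebesgue. bump p q n x) \<noteq> 0"
proof -
  have "(\<lambda>n. LINT x|lebesgue. bump p q n x) \<longlonglongrightarrow> (LINT x|lebesgue. indicator {p<..<q} x)"
  proof (rule integral_dominated_convergence[where w="indicator {p..q}"])
    show "integrable lebesgue (indicat_real {p..q})" by (rule integrable_bounded_indicator) auto
    show "AE x in lebesgue. (\<lambda>n. bump p q n x) \<longlonglongrightarrow> indicat_real {p<..<q} x" by (intro AE_I2 bump_tendsto)
    show "AE x in lebesgue. norm (bump p q n x) \<le> indicat_real {p..q} x" for n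
    proof (rule AE_I2)
      fix x
      define e where "e = 1/real (Suc n)"
      have "0 < e" by (simp add: e_def)
      then show "norm (bump p q n x) \<le> indicat_real {p..q} x"
        using bump_le_1[of p q n x] bump_support[of x p n q] unfolding e_def[symmetric] by (cases "x \<in> {p..q}") auto
    qed
    show "bump p q n \<in> borel_measurable lebesgue" for n
      by (intro continuous_lebesgue_measurable smooth_continuous bump_smooth)
    show "indicat_real {p<..<q} \<in> borel_measurable lebesgue"
      by (intro borel_measurable_integrable integrable_bounded_indicator) auto
  qed
  moreover have "(LINT x|lebesgue. indicat_real {p<..<q} x) = q - p" using assms by simp
  ultimately have "(\<lambda>n. LINT x|lebesgue. bump p q n x) \<longlonglongrightarrow> q - p" by (simp only:)
  then have "\<exists>n. (LINT x|lebesgue. bump p q n x) \<noteq> 0"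
    using assms by (metis LIMSEQ_unique diff_gt_0_iff_gt ext less_irrefl tendsto_const)
  then show ?thesis using that by blast
qed

text \<open>
  The difference \<open>w\<close> of \<open>u\<close> and the primitive of \<open>v\<close> is orthogonal to all test functions with mean zero. Correcting a test
  function by a multiple of a fixed one with nonzero mean shows that \<open>w - c\<close> is orthogonal to all of them, for a
  suitable constant \<open>c\<close>.
\<close>

lemma du_Bois_Reymond:
  fixes u v :: "real \<Rightarrow> complex"
  assumes u: "integrable lebesgue u" and v: "integrable lebesgue v" and su: "\<And>x. x \<notin> {p<..<q} \<Longrightarrow> u x = 0" and pq: "p < q"
    and weak: "\<And>g. test_function_on {p<..<q} g \<Longrightarrow> (LINT x|lebesgue. deriv g x *\<^sub>R u x) = - (LINT x|lebesgue. g x *\<^sub>R v x)"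
  obtains c where "AE x in lebesgue. x \<in> {p<..<q} \<longrightarrow> u x = c + prim v x"
proof -
  define w where "w x = u x - prim v x" for x
  have int: "integrable lebesgue \<phi>" "integrable lebesgue (\<lambda>x. \<phi> x *\<^sub>R u x)" "integrable lebesgue (\<lambda>x. \<phi> x *\<^sub>R prim v x)"
      "integrable lebesgue (\<lambda>x. \<phi> x *\<^sub>R w x)"
      "(LINT x|lebesgue. \<phi> x *\<^sub>R w x) = (LINT x|lebesgue. \<phi> x *\<^sub>R u x) - (LINT x|lebesgue. \<phi> x *\<^sub>R prim v x)"
    if c: "continuous_on UNIV \<phi>" and sup: "\<forall>x. x \<notin> {a..b} \<longrightarrow> \<phi> x = 0" for \<phi> :: "real \<Rightarrow> real" and a b
  proof -
    have s: "\<And>x. x \<notin> {a..b} \<Longrightarrow> \<phi> x = 0" using sup by blast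
    show 1: "integrable lebesgue \<phi>" by (rule continuous_support_integrable[OF c s])
    show 2: "integrable lebesgue (\<lambda>x. \<phi> x *\<^sub>R u x)" by (rule continuous_times_integrable[OF c s u])
    show 3: "integrable lebesgue (\<lambda>x. \<phi> x *\<^sub>R prim v x)" by (rule prim_integrable[OF v 1])
    show "integrable lebesgue (\<lambda>x. \<phi> x *\<^sub>R w x)" unfolding w_def scaleR_diff_right using 2 3 by (rule Bochner_Integration.integrable_diff)
    show "(LINT x|lebesgue. \<phi> x *\<^sub>R w x) = (LINT x|lebesgue. \<phi> x *\<^sub>R u x) - (LINT x|lebesgue. \<phi> x *\<^sub>R prim v x)"
      unfolding w_def scaleR_diff_right using 2 3 by (rule Bochner_Integration.integral_diff)
  qed
  have mean_free: "(LINT x|lebesgue. \<phi> x *\<^sub>R w x) = 0" if \<phi>: "test_function_on {p<..<q} \<phi>" and z: "(LINT x|lebesgue. \<phi> x) = 0" for \<phi>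
  proof -
    obtain g where g: "test_function_on {p<..<q} g" "deriv g = \<phi>" by (rule test_function_primitive[OF pq \<phi> z])
    obtain a b where ab: "\<forall>x. x \<notin> {a..b} \<longrightarrow> \<phi> x = 0" using test_function_interval[OF \<phi> pq] by metis
    show ?thesis
      using int(5)[OF test_function_facts(1)[OF \<phi>] ab] weak[OF g(1)] prim_weak_derivative[OF v pq g(1)] unfolding g(2) by simp
  qed
  obtain n where n: "(LINT x|lebesgue. bump p q n x) \<noteq> 0" by (rule bump_integral_nonzero[OF pq])
  define \<psi> where "\<psi> = bump p q n"
  have \<psi>: "test_function_on {p<..<q} \<psi>" unfolding \<psi>_def by (rule bump_test) simp
  define m where "m = (LINT x|lebesgue. \<psi> x)"
  have m: "m \<noteq> 0" unfolding m_def \<psi>_def by (rule n)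
  define c where "c = (1/m) *\<^sub>R (LINT x|lebesgue. \<psi> x *\<^sub>R w x)"
  define W where "W x = indicator {p<..<q} x *\<^sub>R (w x - c)" for x
  have "AE x in lebesgue. W x = 0"
  proof (rule fundamental_lemma[OF _ _ pq])
    have "integrable lebesgue (\<lambda>x. u x - (indicator {p<..<q} x *\<^sub>R prim v x + indicator {p<..<q} x *\<^sub>R c))"
      by (intro Bochner_Integration.integrable_diff Bochner_Integration.integrable_add u prim_integrable v
          Bochner_Integration.integrable_scaleR_left integrable_bounded_indicator) auto
    moreover have "(\<lambda>x. u x - (indicator {p<..<q} x *\<^sub>R prim v x + indicator {p<..<q} x *\<^sub>R c)) = W"
      unfolding W_def w_def using su by (auto simp: fun_eq_iff indicator_def)
    ultimately show "integrable lebesgue W" by simp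
    show "W x = 0" if "x \<notin> {p<..<q}" for x using that by (simp add: W_def)
    fix \<phi> assume \<phi>: "test_function_on {p<..<q} \<phi>"
    obtain a b where ab: "p < a" "b < q" "\<forall>x. x \<notin> {a..b} \<longrightarrow> \<phi> x = 0" using test_function_interval[OF \<phi> pq] by metis
    obtain a' b' where ab': "p < a'" "b' < q" "\<forall>x. x \<notin> {a'..b'} \<longrightarrow> \<psi> x = 0" using test_function_interval[OF \<psi> pq] by metis
    note I = int[OF test_function_facts(1)[OF \<phi>] ab(3)] and I' = int[OF test_function_facts(1)[OF \<psi>] ab'(3)]
    define k where "k = (LINT x|lebesgue. \<phi> x) / m"
    have k: "(LINT x|lebesgue. \<phi> x) = k * m" unfolding k_def using m by simp
    have h: "test_function_on {p<..<q} (\<lambda>x. \<phi> x - k * \<psi> x)" unfolding test_function_iff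
    proof (intro conjI exI allI impI)
      show "smooth (\<lambda>x. \<phi> x - k * \<psi> x)" using \<phi> \<psi> unfolding test_function_iff by (blast intro: smooth_lincomb)
      show "compact ({a..b} \<union> {a'..b'})" "{a..b} \<union> {a'..b'} \<subseteq> {p<..<q}" using ab ab' by auto
    qed (use ab ab' in auto)
    have "(LINT x|lebesgue. \<phi> x - k * \<psi> x) = (LINT x|lebesgue. \<phi> x) - (LINT x|lebesgue. k * \<psi> x)"
      by (rule Bochner_Integration.integral_diff) (use I(1) I'(1) in auto)
    also have "\<dots> = 0" unfolding k m_def by simp
    finally have "(LINT x|lebesgue. (\<phi> x - k * \<psi> x) *\<^sub>R w x) = 0" by (rule mean_free[OF h])
    moreover have "(LINT x|lebesgue. (\<phi> x - k * \<psi> x) *\<^sub>R w x) = (LINT x|lebesgue. \<phi> x *\<^sub>R w x - k *\<^sub>R (\<psi> x *\<^sub>R w x))"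
      by (simp add: scaleR_diff_left)
    moreover have "\<dots> = (LINT x|lebesgue. \<phi> x *\<^sub>R w x) - (LINT x|lebesgue. k *\<^sub>R (\<psi> x *\<^sub>R w x))"
      by (intro Bochner_Integration.integral_diff I(4) Bochner_Integration.integrable_scaleR_right I'(4))
    moreover have "(LINT x|lebesgue. k *\<^sub>R (\<psi> x *\<^sub>R w x)) = (k * m) *\<^sub>R c" unfolding integral_scaleR_right c_def using m by simp
    ultimately have eq: "(LINT x|lebesgue. \<phi> x *\<^sub>R w x) = (LINT x|lebesgue. \<phi> x) *\<^sub>R c" unfolding k by simp
    have "\<phi> x *\<^sub>R W x = \<phi> x *\<^sub>R w x - \<phi> x *\<^sub>R c" for x
      using ab unfolding W_def by (cases "x \<in> {a..b}") (auto simp: scaleR_diff_right)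
    then have "(LINT x|lebesgue. \<phi> x *\<^sub>R W x) = (LINT x|lebesgue. \<phi> x *\<^sub>R w x - \<phi> x *\<^sub>R c)" by simp
    also have "\<dots> = (LINT x|lebesgue. \<phi> x *\<^sub>R w x) - (LINT x|lebesgue. \<phi> x *\<^sub>R c)"
      by (rule Bochner_Integration.integral_diff) (use I(1,4) in auto)
    also have "(LINT x|lebesgue. \<phi> x *\<^sub>R c) = (LINT x|lebesgue. \<phi> x) *\<^sub>R c" by (rule integral_scaleR_left) (use I(1) in auto)
    finally show "(LINT x|lebesgue. \<phi> x *\<^sub>R W x) = 0" using eq by simp
  qed
  then have "AE x in lebesgue. x \<in> {p<..<q} \<longrightarrow> u x = c + prim v x"
    by eventually_elim (auto simp: W_def w_def algebra_simps)
  then show ?thesis by (rule that)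
qed

section \<open>Representatives of Sobolev functions\<close>

lemma AE_lebesgue_iff_negligible: "(AE x in lebesgue. P x) \<longleftrightarrow> negligible {x. \<not> P x}"
proof
  assume "AE x in lebesgue. P x"
  then obtain N where "{x \<in> space lebesgue. \<not> P x} \<subseteq> N" "N \<in> null_sets lebesgue" by (auto simp: eventually_ae_filter)
  then show "negligible {x. \<not> P x}" using negligible_subset negligible_iff_null_sets by auto
next
  assume "negligible {x. \<not> P x}"
  then have "{x. \<not> P x} \<in> null_sets lebesgue" by (simp add: negligible_iff_null_sets)
  from AE_not_in[OF this] show "AE x in lebesgue. P x" by simp
qed

lemma integrable_lebesgue_on_iff:
  fixes f :: "real \<Rightarrow> 'a::{banach, second_countable_topology}"
  shows "S \<in> sets lebesgue \<Longrightarrow> integrable (lebesgue_on S) f \<longleftrightarrow> integrable lebesgue (\<lambda>x. indicator S x *\<^sub>R f x)"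
  by (rule integrable_restrict_space) simp

lemma integral_lebesgue_on_eq:
  fixes f :: "real \<Rightarrow> 'a::{banach, second_countable_topology}"
  shows "S \<in> sets lebesgue \<Longrightarrow> (LINT x|lebesgue_on S. f x) = (LINT x|lebesgue. indicator S x *\<^sub>R f x)"
  by (rule integral_restrict_space) simp

lemma AE_lebesgue_on_iff:
  "S \<in> sets lebesgue \<Longrightarrow> (AE x in lebesgue_on S. P x) \<longleftrightarrow> (AE x in lebesgue. x \<in> S \<longrightarrow> P x)"
  by (rule AE_restrict_space_iff) simp

lemma integrable_lebesgue_on_subset:
  fixes f :: "real \<Rightarrow> complex"
  assumes f: "integrable (lebesgue_on T) f" and S: "S \<subseteq> T" "S \<in> sets lebesgue" "T \<in> sets lebesgue"
  shows "integrable (lebesgue_on S) f"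
proof -
  have "integrable lebesgue (\<lambda>x. indicator S x *\<^sub>R (indicator T x *\<^sub>R f x))"
    by (rule integrable_mult_indicator[OF S(2)]) (use f in \<open>simp add: integrable_lebesgue_on_iff S\<close>)
  moreover have "indicat_real S x *\<^sub>R (indicat_real T x *\<^sub>R f x) = indicator S x *\<^sub>R f x" for x using S(1) by (auto simp: indicator_def)
  ultimately show ?thesis by (simp only: integrable_lebesgue_on_iff[OF S(2)])
qed

lemma weak_deriv_restrict:
  assumes w: "has_weak_deriv_on S f g" and S: "S \<in> sets lebesgue" "{p<..<q} \<subseteq> S" and \<phi>: "test_function_on {p<..<q} \<phi>" and pq: "p < q"
  shows "(LINT x|lebesgue. deriv \<phi> x *\<^sub>R (indicator {p<..<q} x *\<^sub>R f x)) = - (LINT x|lebesgue. \<phi> x *\<^sub>R (indicator {p<..<q} x *\<^sub>R g x))"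
proof -
  have t: "test_function_on S \<phi>" using \<phi> S(2) unfolding test_function_iff by blast
  obtain a b where ab: "p < a" "b < q" "\<And>x. x \<notin> {a..b} \<Longrightarrow> \<phi> x = 0 \<and> deriv \<phi> x = 0" using test_function_interval[OF \<phi> pq] by metis
  have inside: "indicat_real S x = 1" "indicat_real {p<..<q} x = 1" if "x \<in> {a..b}" for x
    using that ab(1,2) S(2) by (auto simp: indicator_def)
  have e1: "indicat_real S x *\<^sub>R (deriv \<phi> x *\<^sub>R f x) = deriv \<phi> x *\<^sub>R (indicator {p<..<q} x *\<^sub>R f x)" for x
    using inside[of x] ab(3)[of x] by (cases "x \<in> {a..b}") simp_all
  have e2: "indicat_real S x *\<^sub>R (\<phi> x *\<^sub>R g x) = \<phi> x *\<^sub>R (indicator {p<..<q} x *\<^sub>R g x)" for x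
    using inside[of x] ab(3)[of x] by (cases "x \<in> {a..b}") simp_all
  have "(LINT x|lebesgue_on S. deriv \<phi> x *\<^sub>R f x) = - (LINT x|lebesgue_on S. \<phi> x *\<^sub>R g x)"
    using w t unfolding has_weak_deriv_on_def by blast
  then show ?thesis unfolding integral_lebesgue_on_eq[OF S(1)] e1 e2 .
qed

lemma prim_eq_integral:
  assumes g: "integrable lebesgue (\<lambda>x. indicator {p<..<q} x *\<^sub>R g x)" and x: "x \<in> {p<..<q}"
  shows "prim (\<lambda>x. indicator {p<..<q} x *\<^sub>R g x) x = integral {p..x} g"
proof -
  define e where "e t = indicat_real {..x} t *\<^sub>R (indicat_real {p<..<q} t *\<^sub>R g t)" for t
  have "integrable lebesgue e" unfolding e_def by (rule integrable_mult_indicator[OF _ g]) simp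
  then have "(e has_integral prim (\<lambda>x. indicator {p<..<q} x *\<^sub>R g x) x) UNIV"
    unfolding prim_def e_def[symmetric] by (rule has_integral_integral_lebesgue)
  then have "((\<lambda>t. if t \<in> {p..x} then g t else 0) has_integral prim (\<lambda>x. indicator {p<..<q} x *\<^sub>R g x) x) UNIV"
    by (rule has_integral_spike_finite[of "{p}", rotated 2]) (use x in \<open>auto simp: e_def indicator_def\<close>)
  then have "(g has_integral prim (\<lambda>x. indicator {p<..<q} x *\<^sub>R g x) x) {p..x}" by (simp only: has_integral_restrict_UNIV)
  then show ?thesis by (rule integral_unique[symmetric])
qed

lemma weak_derivative_primitive:
  assumes w: "has_weak_deriv_on S f g" and S: "S \<in> sets lebesgue" "{p<..<q} \<subseteq> S" and pq: "p < q"
    and f: "integrable (lebesgue_on {p<..<q}) f" and g: "integrable (lebesgue_on {p<..<q}) g"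
  obtains c where "AE x in lebesgue. x \<in> {p<..<q} \<longrightarrow> f x = c + integral {p..x} g" "g integrable_on {p..q}"
proof -
  have I: "{p<..<q} \<in> sets lebesgue" by simp
  define u v where "u x = indicat_real {p<..<q} x *\<^sub>R f x" and "v x = indicat_real {p<..<q} x *\<^sub>R g x" for x
  have u: "integrable lebesgue u" and v: "integrable lebesgue v"
    using f g unfolding integrable_lebesgue_on_iff[OF I] u_def v_def by auto
  obtain c where c: "AE x in lebesgue. x \<in> {p<..<q} \<longrightarrow> u x = c + prim v x"
  proof (rule du_Bois_Reymond[OF u v _ pq])
    show "u x = 0" if "x \<notin> {p<..<q}" for x using that by (simp add: u_def)
    show "(LINT x|lebesgue. deriv \<phi> x *\<^sub>R u x) = - (LINT x|lebesgue. \<phi> x *\<^sub>R v x)" if "test_function_on {p<..<q} \<phi>" for \<phi>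
      unfolding u_def v_def by (rule weak_deriv_restrict[OF w S that pq])
  qed
  have "AE x in lebesgue. x \<in> {p<..<q} \<longrightarrow> f x = c + integral {p..x} g"
    using c
  proof eventually_elim
    fix x assume x: "x \<in> {p<..<q} \<longrightarrow> u x = c + prim v x"
    show "x \<in> {p<..<q} \<longrightarrow> f x = c + integral {p..x} g"
      using x prim_eq_integral[of p q g x] v unfolding u_def v_def by auto
  qed
  moreover have "g integrable_on {p..q}"
    using integrable_on_lebesgue_on[OF g I] unfolding integrable_on_open_interval_real .
  ultimately show ?thesis by (rule that)
qed

text \<open>
  If the first two weak derivatives are integrable up to the ends of the interval, integrating twice gives a representative
  that is continuously differentiable on the closed interval.
\<close>

lemma H2_representative:
  assumes w: "has_weak_deriv_on S f g" "has_weak_deriv_on S g h" and S: "S \<in> sets lebesgue" "{p<..<q} \<subseteq> S" and pq: "p < q"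
    and int: "integrable (lebesgue_on {p<..<q}) f" "integrable (lebesgue_on {p<..<q}) g" "integrable (lebesgue_on {p<..<q}) h"
  obtains F F1 where "\<forall>x\<in>{p..q}. (F has_vector_derivative F1 x) (at x within {p..q})" "continuous_on {p..q} F1"
    "\<forall>x\<in>{p..q}. F1 x = F1 p + integral {p..x} h" "h integrable_on {p..q}"
    "AE x in lebesgue. x \<in> {p<..<q} \<longrightarrow> f x = F x" "AE x in lebesgue. x \<in> {p<..<q} \<longrightarrow> g x = F1 x"
proof -
  obtain c0 where c0: "AE x in lebesgue. x \<in> {p<..<q} \<longrightarrow> f x = c0 + integral {p..x} g" "g integrable_on {p..q}"
    by (rule weak_derivative_primitive[OF w(1) S pq int(1,2)])
  obtain c1 where c1: "AE x in lebesgue. x \<in> {p<..<q} \<longrightarrow> g x = c1 + integral {p..x} h" "h integrable_on {p..q}"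
    by (rule weak_derivative_primitive[OF w(2) S pq int(2,3)])
  define F1 where "F1 x = c1 + integral {p..x} h" for x
  define F where "F x = c0 + integral {p..x} F1" for x
  have cF1: "continuous_on {p..q} F1" unfolding F1_def by (intro continuous_intros indefinite_integral_continuous_1 c1)
  show ?thesis
  proof (rule that[of F F1])
    show "\<forall>x\<in>{p..q}. (F has_vector_derivative F1 x) (at x within {p..q})"
    proof
      fix x assume that: "x \<in> {p..q}"
      have "((\<lambda>x. c0 + integral {p..x} F1) has_vector_derivative 0 + F1 x) (at x within {p..q})"
        by (intro has_vector_derivative_add has_vector_derivative_const integral_has_vector_derivative[OF cF1 that])
      then show "(F has_vector_derivative F1 x) (at x within {p..q})" unfolding F_def[abs_def] by simp
    qed
    have gF1: "AE x in lebesgue. x \<in> {p<..<q} \<longrightarrow> g x = F1 x" using c1(1) unfolding F1_def .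
    show "AE x in lebesgue. x \<in> {p<..<q} \<longrightarrow> g x = F1 x" by (rule gF1)
    have "integral {p..x} g = integral {p..x} F1" if "x \<in> {p<..<q}" for x
    proof -
      have "integral {p<..<x} g = integral {p<..<x} F1"
        by (rule integral_spike[OF gF1[unfolded AE_lebesgue_iff_negligible]]) (use that in auto)
      then show ?thesis unfolding integral_open_interval_real .
    qed
    then show "AE x in lebesgue. x \<in> {p<..<q} \<longrightarrow> f x = F x" using c0(1) unfolding F_def by (auto elim!: eventually_mono)
  qed (use cF1 c1(2) in \<open>auto simp: F1_def\<close>)
qed

text \<open>
  Locally this is the fundamental lemma; the intervals with rational ends cover the open set.
\<close>

lemma weak_deriv_unique:
  assumes g: "has_weak_deriv_on S f g" and g': "has_weak_deriv_on S f g'" and S: "open S"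
  shows "AE x in lebesgue. x \<in> S \<longrightarrow> g x = g' x"
proof -
  have Sm: "S \<in> sets lebesgue" using S by simp
  have loc: "AE x in lebesgue. {fst z..snd z} \<subseteq> S \<longrightarrow> x \<in> {fst z<..<snd z} \<longrightarrow> g x = g' x" for z :: "real \<times> real"
  proof (cases "{fst z..snd z} \<subseteq> S \<and> fst z < snd z")
    case True
    define p q where "p = fst z" and "q = snd z"
    have K: "{p..q} \<subseteq> S" "p < q" using True by (auto simp: p_def q_def)
    have sub: "{p<..<q} \<subseteq> {p..q}" by auto
    have i: "integrable (lebesgue_on {p<..<q}) g" "integrable (lebesgue_on {p<..<q}) g'"
      using g g' K unfolding has_weak_deriv_on_def loc_integrable_on_def
      by (auto intro!: integrable_lebesgue_on_subset[OF _ sub])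
    have I: "{p<..<q} \<in> sets lebesgue" by simp
    define v v' where "v x = indicat_real {p<..<q} x *\<^sub>R g x" and "v' x = indicat_real {p<..<q} x *\<^sub>R g' x" for x
    have v: "integrable lebesgue v" and v': "integrable lebesgue v'"
      using i unfolding integrable_lebesgue_on_iff[OF I] v_def v'_def by auto
    have "AE x in lebesgue. v x - v' x = 0"
    proof (rule fundamental_lemma[OF _ _ K(2)])
      show "integrable lebesgue (\<lambda>x. v x - v' x)" by (intro Bochner_Integration.integrable_diff v v')
      show "v x - v' x = 0" if "x \<notin> {p<..<q}" for x using that by (simp add: v_def v'_def)
      fix \<phi> assume \<phi>: "test_function_on {p<..<q} \<phi>"
      obtain a b where ab: "\<And>x. x \<notin> {a..b} \<Longrightarrow> \<phi> x = 0" using test_function_interval[OF \<phi> K(2)] by metis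
      have iv: "integrable lebesgue (\<lambda>x. \<phi> x *\<^sub>R v x)" "integrable lebesgue (\<lambda>x. \<phi> x *\<^sub>R v' x)"
        by (rule continuous_times_integrable[OF test_function_facts(1)[OF \<phi>], of a b]; use ab v v' in blast)+
      have pS: "{p<..<q} \<subseteq> S" using K sub by blast
      have "(LINT x|lebesgue. \<phi> x *\<^sub>R v x) = (LINT x|lebesgue. \<phi> x *\<^sub>R v' x)"
        using weak_deriv_restrict[OF g Sm pS \<phi> K(2)] weak_deriv_restrict[OF g' Sm pS \<phi> K(2)] unfolding v_def v'_def by simp
      then show "(LINT x|lebesgue. \<phi> x *\<^sub>R (v x - v' x)) = 0"
        unfolding scaleR_diff_right Bochner_Integration.integral_diff[OF iv] by simp
    qed
    then show ?thesis by eventually_elim (auto simp: v_def v'_def p_def q_def)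
  next
    case False
    then show ?thesis by (intro AE_I2) auto
  qed
  have "AE x in lebesgue. \<forall>z\<in>\<rat>\<times>\<rat>. {fst z..snd z} \<subseteq> S \<longrightarrow> x \<in> {fst z<..<snd z} \<longrightarrow> g x = g' x"
    by (subst AE_ball_countable) (intro countable_SIGMA countable_rat, intro ballI loc)
  then show ?thesis
  proof eventually_elim
    fix x assume *: "\<forall>z\<in>\<rat>\<times>\<rat>. {fst z..snd z} \<subseteq> S \<longrightarrow> x \<in> {fst z<..<snd z} \<longrightarrow> g x = g' x"
    show "x \<in> S \<longrightarrow> g x = g' x"
    proof
      assume "x \<in> S"
      then obtain e where e: "0 < e" "\<And>y. dist y x < e \<Longrightarrow> y \<in> S" using S unfolding open_dist by blast
      obtain p where p: "p \<in> \<rat>" "x - e < p" "p < x" using Rats_dense_in_real[of "x - e" x] e by auto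
      obtain q where q: "q \<in> \<rat>" "x < q" "q < x + e" using Rats_dense_in_real[of x "x + e"] e by auto
      have "{p..q} \<subseteq> S" using p q by (auto intro!: e simp: dist_real_def)
      then show "g x = g' x" using *[rule_format, of "(p, q)"] p q by auto
    qed
  qed
qed

lemma has_weak_deriv_weak_deriv_on: "has_weak_deriv_on S f g \<Longrightarrow> has_weak_deriv_on S f (weak_deriv_on S f)"
  unfolding weak_deriv_on_def by (rule someI[of "has_weak_deriv_on S f"])

lemma has_weak_deriv_AE_cong:
  assumes w: "has_weak_deriv_on S g h" and S: "S \<in> sets lebesgue" and g': "loc_integrable_on S g'"
    and ae: "AE x in lebesgue. x \<in> S \<longrightarrow> g x = g' x"
  shows "has_weak_deriv_on S g' h"
  unfolding has_weak_deriv_on_def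
proof (intro conjI allI impI)
  show "loc_integrable_on S g'" by (rule g')
  show "loc_integrable_on S h" using w unfolding has_weak_deriv_on_def by blast
  fix \<phi> assume \<phi>: "test_function_on S \<phi>"
  obtain K where K: "compact K" "K \<subseteq> S" "\<And>x. x \<notin> K \<Longrightarrow> \<phi> x = 0 \<and> deriv \<phi> x = 0"
    using test_function_facts(4)[OF \<phi>] by blast
  have Km: "K \<in> sets lebesgue" using K(1) by (simp add: compact_imp_closed borel_closed)
  have e: "indicat_real S x *\<^sub>R (deriv \<phi> x *\<^sub>R f x) = indicat_real K x *\<^sub>R (deriv \<phi> x *\<^sub>R f x)" for x and f :: "real \<Rightarrow> complex"
    using K(2,3) by (cases "x \<in> K") auto
  have m: "(\<lambda>x. deriv \<phi> x *\<^sub>R k x) \<in> borel_measurable (lebesgue_on K)" if "loc_integrable_on S k" for k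
  proof (intro borel_measurable_scaleR)
    show "deriv \<phi> \<in> borel_measurable (lebesgue_on K)"
      by (rule measurable_restrict_space1[OF continuous_lebesgue_measurable[OF test_function_facts(3)[OF \<phi>]]])
    show "k \<in> borel_measurable (lebesgue_on K)"
      by (rule borel_measurable_integrable) (use that K in \<open>simp add: loc_integrable_on_def\<close>)
  qed
  have lg: "loc_integrable_on S g" using w unfolding has_weak_deriv_on_def by blast
  have "(LINT x|lebesgue_on S. deriv \<phi> x *\<^sub>R g' x) = (LINT x|lebesgue_on K. deriv \<phi> x *\<^sub>R g' x)"
    unfolding integral_lebesgue_on_eq[OF S] integral_lebesgue_on_eq[OF Km] e ..
  also have "\<dots> = (LINT x|lebesgue_on K. deriv \<phi> x *\<^sub>R g x)"
  proof (rule integral_cong_AE[OF m[OF g'] m[OF lg]])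
    show "AE x in lebesgue_on K. deriv \<phi> x *\<^sub>R g' x = deriv \<phi> x *\<^sub>R g x"
      unfolding AE_lebesgue_on_iff[OF Km] using ae by eventually_elim (use K(2) in auto)
  qed
  also have "\<dots> = (LINT x|lebesgue_on S. deriv \<phi> x *\<^sub>R g x)"
    unfolding integral_lebesgue_on_eq[OF S] integral_lebesgue_on_eq[OF Km] e ..
  also have "\<dots> = - (LINT x|lebesgue_on S. \<phi> x *\<^sub>R h x)" using w \<phi> unfolding has_weak_deriv_on_def by blast
  finally show "(LINT x|lebesgue_on S. deriv \<phi> x *\<^sub>R g' x) = - (LINT x|lebesgue_on S. \<phi> x *\<^sub>R h x)" .
qed

text \<open>
  The choice operator in the definition of the weak derivative picks some representative. All representatives agree almost
  everywhere, and iterating the choice is harmless since weak derivatives do not see null sets.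
\<close>

lemma weak_derivs_determined:
  assumes g: "has_weak_deriv_on S f g" and h: "has_weak_deriv_on S g h" and S: "open S"
  shows "AE x in lebesgue. x \<in> S \<longrightarrow> weak_deriv_on S f x = g x"
    "AE x in lebesgue. x \<in> S \<longrightarrow> weak_deriv_on S (weak_deriv_on S f) x = h x"
    "has_weak_deriv_on S f (weak_deriv_on S f)"
    "has_weak_deriv_on S (weak_deriv_on S f) (weak_deriv_on S (weak_deriv_on S f))"
proof -
  show 1: "has_weak_deriv_on S f (weak_deriv_on S f)" by (rule has_weak_deriv_weak_deriv_on[OF g])
  show 2: "AE x in lebesgue. x \<in> S \<longrightarrow> weak_deriv_on S f x = g x" by (rule weak_deriv_unique[OF 1 g S])
  have "AE x in lebesgue. x \<in> S \<longrightarrow> g x = weak_deriv_on S f x" using 2 by eventually_elim simp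
  then have 3: "has_weak_deriv_on S (weak_deriv_on S f) h"
    by (intro has_weak_deriv_AE_cong[OF h]) (use 1 S in \<open>auto simp: has_weak_deriv_on_def\<close>)
  show 4: "has_weak_deriv_on S (weak_deriv_on S f) (weak_deriv_on S (weak_deriv_on S f))" by (rule has_weak_deriv_weak_deriv_on[OF 3])
  show "AE x in lebesgue. x \<in> S \<longrightarrow> weak_deriv_on S (weak_deriv_on S f) x = h x" by (rule weak_deriv_unique[OF 4 3 S])
qed

lemma L2_integrable:
  assumes f: "L2_on S f" and S: "bounded S" "S \<in> sets lebesgue"
  shows "integrable (lebesgue_on S) f"
proof (rule Bochner_Integration.integrable_bound)
  have "integrable (lebesgue_on S) (\<lambda>x. 1::real)" unfolding integrable_lebesgue_on_iff[OF S(2)]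
    using integrable_bounded_indicator[OF S] by simp
  then show "integrable (lebesgue_on S) (\<lambda>x. 1 + (cmod (f x))^2)"
    by (intro Bochner_Integration.integrable_add) (use f in \<open>auto simp: L2_on_def\<close>)
  show "f \<in> borel_measurable (lebesgue_on S)" using f by (simp add: L2_on_def)
  have "t \<le> \<bar>1 + t^2\<bar>" for t :: real using zero_le_power2[of "t - 1/2"] by (simp add: power2_eq_square algebra_simps)
  then show "AE x in lebesgue_on S. norm (f x) \<le> norm (1 + (cmod (f x))^2)" by (intro AE_I2) simp
qed

lemma AE_continuous_le:
  fixes h :: "real \<Rightarrow> real"
  assumes c: "continuous_on {p..q} h" and ae: "AE x in lebesgue. x \<in> {p<..<q} \<longrightarrow> h x \<le> c" and pq: "p < q" and x: "x \<in> {p..q}"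
  shows "h x \<le> c"
proof (rule continuous_le_on_closure[of "{p<..<q}" h x c])
  show "continuous_on (closure {p<..<q}) h" "x \<in> closure {p<..<q}" using c x pq by simp_all
  fix y assume y: "y \<in> {p<..<q}"
  have c': "continuous_on {p<..<q} h" by (rule continuous_on_subset[OF c]) auto
  have o: "open ({p<..<q} \<inter> h -` {c<..})" by (rule continuous_open_preimage[OF c']) auto
  have "negligible {x. \<not> (x \<in> {p<..<q} \<longrightarrow> h x \<le> c)}" using ae unfolding AE_lebesgue_iff_negligible .
  then have "negligible ({p<..<q} \<inter> h -` {c<..})" by (rule negligible_subset) auto
  then have "{p<..<q} \<inter> h -` {c<..} = {}" using o open_not_negligible by blast
  then show "h y \<le> c" using y by (auto simp: not_less[symmetric])
qed

lemma AE_continuous_eq: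
  fixes F G :: "real \<Rightarrow> complex"
  assumes "continuous_on {p..q} F" "continuous_on {p..q} G" and ae: "AE x in lebesgue. x \<in> {p<..<q} \<longrightarrow> F x = G x" and "p < q" "x \<in> {p..q}"
  shows "F x = G x"
proof -
  have "cmod (F x - G x) \<le> 0"
    by (rule AE_continuous_le[OF _ _ assms(4,5), of "\<lambda>x. cmod (F x - G x)"])
       (use ae in \<open>auto intro!: continuous_intros assms elim!: eventually_mono\<close>)
  then show ?thesis by simp
qed

section \<open>Periodic extension\<close>

definition frac_period :: "real \<Rightarrow> real" where
  "frac_period s = s - 2*pi * of_int \<lfloor>s/(2*pi)\<rfloor>"

lemma per_ext_eq: "per_ext f s = f (frac_period s)"
  unfolding per_ext_def frac_period_def ..

lemma frac_period_bounds: "0 \<le> frac_period s" "frac_period s < 2*pi"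
proof -
  have "of_int \<lfloor>s/(2*pi)\<rfloor> \<le> s/(2*pi)" "s/(2*pi) < of_int \<lfloor>s/(2*pi)\<rfloor> + 1" by linarith+
  moreover have "c * r \<le> s \<and> s < c * r + c" if "r \<le> s/c" "s/c < r + 1" "0 < c" for c r :: real
    using that by (simp add: field_simps)
  ultimately have "2*pi * of_int \<lfloor>s/(2*pi)\<rfloor> \<le> s \<and> s < 2*pi * of_int \<lfloor>s/(2*pi)\<rfloor> + 2*pi" by simp
  then show "0 \<le> frac_period s" "frac_period s < 2*pi" unfolding frac_period_def by linarith+
qed

lemma frac_period_circ: "frac_period s \<in> circ" using frac_period_bounds[of s] by simp

lemma frac_period_shift: "frac_period (s + 2*pi * of_int k) = frac_period s"
proof -
  have "(s + 2*pi * of_int k)/(2*pi) = s/(2*pi) + of_int k" by (simp add: field_simps)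
  then show ?thesis unfolding frac_period_def by (simp add: algebra_simps)
qed

lemma frac_period_id: "0 \<le> s \<Longrightarrow> s < 2*pi \<Longrightarrow> frac_period s = s"
proof -
  assume "0 \<le> s" "s < 2*pi"
  then have "\<lfloor>s/(2*pi)\<rfloor> = 0" by (simp add: floor_eq_iff)
  then show ?thesis unfolding frac_period_def by simp
qed

lemma per_ext_on:
  assumes "u 0 = u (2*pi)" "s \<in> {2*pi * of_int k..2*pi * of_int k + 2*pi}"
  shows "per_ext u s = u (s - 2*pi * of_int k)"
proof -
  define r where "r = s - 2*pi * of_int k"
  have s: "s = r + 2*pi * of_int k" unfolding r_def by simp
  have r: "0 \<le> r" "r \<le> 2*pi" using assms(2) unfolding r_def by auto
  have "per_ext u s = u (frac_period r)" unfolding per_ext_eq s frac_period_shift ..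
  also have "\<dots> = u r"
  proof (cases "r = 2*pi")
    case True
    have "frac_period (0 + 2*pi * of_int 1) = frac_period 0" by (rule frac_period_shift)
    then have "frac_period r = 0" using True by (simp add: frac_period_id)
    then show ?thesis using assms(1) True by simp
  next
    case False
    then show ?thesis using r by (simp add: frac_period_id)
  qed
  finally show ?thesis unfolding r_def .
qed

lemma AE_shift:
  assumes "AE x in lebesgue. P x"
  shows "AE x in lebesgue. P (x + a :: real)"
proof -
  have "negligible ((+) (- a) ` {x. \<not> P x})" using assms unfolding AE_lebesgue_iff_negligible by (rule negligible_translation)
  moreover have "{x. \<not> P (x + a)} \<subseteq> (+) (- a) ` {x. \<not> P x}"
  proof
    fix x assume "x \<in> {x. \<not> P (x + a)}"
    then show "x \<in> (+) (- a) ` {x. \<not> P x}" by (intro image_eqI[of _ _ "x + a"]) auto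
  qed
  ultimately show ?thesis unfolding AE_lebesgue_iff_negligible by (rule negligible_subset)
qed

text \<open>
  A null set in one period has countably many translates; the boundary points of the periods form a countable set.
\<close>

lemma AE_frac_period:
  assumes "AE x in lebesgue. x \<in> {0<..<2*pi} \<longrightarrow> P x"
  shows "AE s in lebesgue. P (frac_period s)"
proof -
  have shift: "AE s in lebesgue. s - 2*pi * of_int k \<in> {0<..<2*pi} \<longrightarrow> P (s - 2*pi * of_int k)" for k :: int
    using AE_shift[OF assms, of "- (2*pi * of_int k)"] by simp
  then have 1: "AE s in lebesgue. \<forall>k::int. s - 2*pi * of_int k \<in> {0<..<2*pi} \<longrightarrow> P (s - 2*pi * of_int k)"
    unfolding AE_all_countable by (intro allI shift)
  have "range (\<lambda>k::int. 2*pi * of_int k) \<in> null_sets lebesgue"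
    by (intro null_sets_completionI countable_imp_null_set_lborel) simp
  from AE_not_in[OF this] 1 show ?thesis
  proof eventually_elim
    fix s assume s: "s \<notin> range (\<lambda>k::int. 2*pi * of_int k)" and k: "\<forall>k::int. s - 2*pi * of_int k \<in> {0<..<2*pi} \<longrightarrow> P (s - 2*pi * of_int k)"
    have "frac_period s \<noteq> 0" using s unfolding frac_period_def by auto
    then have "frac_period s \<in> {0<..<2*pi}" using frac_period_bounds[of s] by auto
    then show "P (frac_period s)" using k unfolding frac_period_def by blast
  qed
qed

lemma per_ext_continuous:
  assumes c: "continuous_on circ u" and per: "u 0 = u (2*pi)"
  shows "continuous_on UNIV (per_ext u)"
proof (intro continuous_at_imp_continuous_on ballI)
  fix s :: real
  define k where "k = \<lfloor>s/(2*pi)\<rfloor>"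
  have piece: "continuous_on {2*pi * of_int j..2*pi * of_int j + 2*pi} (per_ext u)" for j :: int
  proof -
    have "continuous_on {2*pi * of_int j..2*pi * of_int j + 2*pi} (\<lambda>t. u (t - 2*pi * of_int j))"
      by (rule continuous_on_compose2[OF c]) (auto intro!: continuous_intros)
    then show ?thesis by (rule continuous_on_eq) (use per_ext_on[OF per] in auto)
  qed
  define b where "b = 2*pi * of_int k"
  have j: "2*pi * of_int (k - 1) + 2*pi = b" "2*pi * of_int (k - 1) = b - 2*pi" by (simp_all add: b_def algebra_simps)
  have "continuous_on ({b - 2*pi..b} \<union> {b..b + 2*pi}) (per_ext u)"
    using piece[of "k - 1"] piece[of k] unfolding j unfolding b_def[symmetric] by (intro continuous_on_closed_Un) auto
  moreover have "{b - 2*pi..b} \<union> {b..b + 2*pi} = {b - 2*pi..b + 2*pi}" by auto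
  moreover have "s \<in> {b - 2*pi<..<b + 2*pi}" using frac_period_bounds[of s] unfolding frac_period_def b_def k_def by auto
  ultimately show "isCont (per_ext u) s" by (auto intro: continuous_on_interior)
qed

lemma per_ext_derivative:
  assumes du: "\<And>s. s \<in> circ \<Longrightarrow> (u has_vector_derivative u1 s) (at s within circ)"
    and s: "s \<notin> range (\<lambda>k::int. 2*pi * of_int k)" and per: "u 0 = u (2*pi)"
  shows "(per_ext u has_vector_derivative per_ext u1 s) (at s)"
proof -
  define b where "b = 2*pi * of_int \<lfloor>s/(2*pi)\<rfloor>"
  have f: "frac_period s = s - b" unfolding b_def frac_period_def ..
  have "s - b \<noteq> 0" using s unfolding b_def by auto
  then have r: "0 < s - b" "s - b < 2*pi" using frac_period_bounds[of s] unfolding f by auto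
  then have "(u has_vector_derivative u1 (s - b)) (at (s - b))"
    using du[of "s - b"] by (simp add: at_within_Icc_at)
  moreover have "((\<lambda>t. t - b) has_vector_derivative 1) (at s)" by (auto intro!: derivative_eq_intros)
  ultimately have "(u \<circ> (\<lambda>t. t - b) has_vector_derivative 1 *\<^sub>R u1 (s - b)) (at s)" by (intro vector_diff_chain_at)
  then have "(u \<circ> (\<lambda>t. t - b) has_vector_derivative per_ext u1 s) (at s)" unfolding per_ext_eq f by simp
  then show ?thesis
  proof (rule has_vector_derivative_transform_within_open[of _ _ _ "{b<..<b + 2*pi}"])
    show "(u \<circ> (\<lambda>t. t - b)) t = per_ext u t" if "t \<in> {b<..<b + 2*pi}" for t
      using per_ext_on[OF per, of t "\<lfloor>s/(2*pi)\<rfloor>"] that unfolding b_def[symmetric] by simp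
  qed (use r in auto)
qed

lemma per_ext_measurable_bounded:
  fixes w :: "real \<Rightarrow> complex"
  assumes c: "continuous_on circ w"
  obtains B where "per_ext w \<in> borel_measurable lebesgue" "0 \<le> B" "\<And>s. cmod (per_ext w s) \<le> B"
proof -
  have "(\<lambda>x. indicator circ x *\<^sub>R w x) \<in> borel_measurable borel"
    using borel_measurable_continuous_on_indicator[OF _ c] by simp
  moreover have "frac_period \<in> borel_measurable borel" unfolding frac_period_def[abs_def] by measurable
  ultimately have "(\<lambda>s. indicator circ (frac_period s) *\<^sub>R w (frac_period s)) \<in> borel_measurable borel"
    by (rule measurable_compose[rotated])
  moreover have "(\<lambda>s. indicat_real circ (frac_period s) *\<^sub>R w (frac_period s)) = per_ext w"
    using frac_period_circ by (auto simp: per_ext_eq fun_eq_iff)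
  ultimately have "per_ext w \<in> borel_measurable borel" by simp
  then have m: "per_ext w \<in> borel_measurable lebesgue" by (intro measurable_completion) simp
  have "compact (w ` circ)" by (intro compact_continuous_image c) simp
  then have "bounded (w ` circ)" by (rule compact_imp_bounded)
  then obtain B where B: "\<And>x. x \<in> circ \<Longrightarrow> cmod (w x) \<le> B" unfolding bounded_iff by blast
  have B': "cmod (per_ext w s) \<le> B" for s unfolding per_ext_eq by (rule B[OF frac_period_circ])
  show ?thesis by (rule that[OF m _ B']) (rule order_trans[OF norm_ge_zero B'[of 0]])
qed

lemma bounded_measurable_integrable:
  fixes g :: "real \<Rightarrow> complex"
  assumes m: "g \<in> borel_measurable lebesgue" and B: "\<And>s. cmod (g s) \<le> B" and S: "bounded S" "S \<in> sets lebesgue"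
  shows "integrable (lebesgue_on S) g" "L2_on S g"
proof -
  have B0: "0 \<le> B" by (rule order_trans[OF norm_ge_zero B[of 0]])
  have m': "g \<in> borel_measurable (lebesgue_on S)" by (rule measurable_restrict_space1[OF m])
  have const: "integrable (lebesgue_on S) (\<lambda>x. c)" for c :: real
    unfolding integrable_lebesgue_on_iff[OF S(2)] using integrable_bounded_indicator[OF S] by simp
  show "integrable (lebesgue_on S) g"
    by (rule Bochner_Integration.integrable_bound[OF const[of B] m']) (use B B0 in auto)
  have "integrable (lebesgue_on S) (\<lambda>x. (cmod (g x))^2)"
    by (rule Bochner_Integration.integrable_bound[OF const[of "B^2"]]) (use B B0 m' in \<open>auto intro!: power_mono\<close>)
  then show "L2_on S g" using m' unfolding L2_on_def by simp
qed

lemma per_ext_loc: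
  assumes c: "continuous_on circ w"
  shows "loc_integrable_on UNIV (per_ext w)" "loc_L2_on UNIV (per_ext w)"
proof -
  obtain B where B: "per_ext w \<in> borel_measurable lebesgue" "\<And>s. cmod (per_ext w s) \<le> B"
    using per_ext_measurable_bounded[OF c] by metis
  have K: "K \<in> sets lebesgue" if "compact K" for K :: "real set" using that by (simp add: compact_imp_closed borel_closed)
  show "loc_integrable_on UNIV (per_ext w)" "loc_L2_on UNIV (per_ext w)"
    unfolding loc_integrable_on_def loc_L2_on_def
    using bounded_measurable_integrable[OF B compact_imp_bounded K] by blast+
qed

text \<open>
  The product of the extension with a test function is continuous and, away from the multiples of \<open>2\<pi>\<close>, differentiable; finitely many
  exceptional points do not disturb the fundamental theorem of calculus. Continuity needs only \<open>u(0) = u(2\<pi>)\<close>, so \<open>u'\<close> may jump.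
\<close>

lemma per_ext_weak_deriv:
  assumes du: "\<And>s. s \<in> circ \<Longrightarrow> (u has_vector_derivative u1 s) (at s within circ)"
    and per: "u 0 = u (2*pi)" and c1: "continuous_on circ u1"
  shows "has_weak_deriv_on UNIV (per_ext u) (per_ext u1)"
  unfolding has_weak_deriv_on_def
proof (intro conjI allI impI)
  have c: "continuous_on circ u" by (rule has_vector_derivative_continuous_on[OF du])
  show L: "loc_integrable_on UNIV (per_ext u)" and L1: "loc_integrable_on UNIV (per_ext u1)" by (intro per_ext_loc c c1)+
  fix \<phi> assume \<phi>: "test_function_on UNIV \<phi>"
  obtain K where K: "compact K" "\<And>x. x \<notin> K \<Longrightarrow> \<phi> x = 0 \<and> deriv \<phi> x = 0" using test_function_facts(4)[OF \<phi>] by blast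
  obtain R where R: "0 < R" "\<And>x. x \<in> K \<Longrightarrow> \<bar>x\<bar> \<le> R"
    using compact_imp_bounded[OF K(1)] unfolding bounded_pos by auto
  define a where "a = R + 1"
  have zero: "\<phi> x = 0 \<and> deriv \<phi> x = 0" if "x \<notin> {- R..R}" for x using that K(2) R(2) by fastforce
  have int: "integrable lebesgue (\<lambda>x. \<psi> x *\<^sub>R g x)"
    if cp: "continuous_on UNIV \<psi>" and z: "\<And>x. x \<notin> {- R..R} \<Longrightarrow> \<psi> x = 0" and g: "loc_integrable_on UNIV g" for \<psi> :: "real \<Rightarrow> real" and g
  proof -
    have "integrable (lebesgue_on {- R..R}) g" using g unfolding loc_integrable_on_def by blast
    then have "integrable lebesgue (\<lambda>x. indicator {- R..R} x *\<^sub>R g x)" by (subst (asm) integrable_lebesgue_on_iff) simp_all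
    then have "integrable lebesgue (\<lambda>x. \<psi> x *\<^sub>R (indicator {- R..R} x *\<^sub>R g x))"
      by (rule continuous_times_integrable[OF cp, rotated]) (rule z)
    moreover have "(\<lambda>x. \<psi> x *\<^sub>R (indicat_real {- R..R} x *\<^sub>R g x)) = (\<lambda>x. \<psi> x *\<^sub>R g x)"
      using z by (auto simp: fun_eq_iff indicator_def)
    ultimately show ?thesis by simp
  qed
  have i1: "integrable lebesgue (\<lambda>x. deriv \<phi> x *\<^sub>R per_ext u x)"
    by (rule int[OF test_function_facts(3)[OF \<phi>] _ L]) (use zero in blast)
  have i2: "integrable lebesgue (\<lambda>x. \<phi> x *\<^sub>R per_ext u1 x)"
    by (rule int[OF test_function_facts(1)[OF \<phi>] _ L1]) (use zero in blast)
  define e where "e x = \<phi> x *\<^sub>R per_ext u1 x + deriv \<phi> x *\<^sub>R per_ext u x" for x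
  define P where "P x = \<phi> x *\<^sub>R per_ext u x" for x
  define T where "T = (\<lambda>k::int. 2*pi * of_int k) ` {\<lfloor>- a/(2*pi)\<rfloor>..\<lceil>a/(2*pi)\<rceil>}"
  have "(e has_integral P a - P (- a)) {- a..a}"
  proof (rule fundamental_theorem_of_calculus_interior_strong)
    show "finite T" unfolding T_def by simp
    show "- a \<le> a" using R by (simp add: a_def)
    show "continuous_on {- a..a} P" unfolding P_def
      by (intro continuous_on_scaleR test_function_facts(1)[OF \<phi>] continuous_on_subset[OF per_ext_continuous[OF c per]]) simp
    fix x assume x: "x \<in> {- a<..<a} - T"
    have "x \<notin> range (\<lambda>k::int. 2*pi * of_int k)"
    proof
      assume "x \<in> range (\<lambda>k::int. 2*pi * of_int k)"
      then obtain k :: int where k: "x = 2*pi * of_int k" by auto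
      have "- a < 2*pi * of_int k" "2*pi * of_int k < a" using x k by auto
      then have "- a/(2*pi) \<le> of_int k" "of_int k \<le> a/(2*pi)" by (simp_all add: field_simps)
      then have "k \<in> {\<lfloor>- a/(2*pi)\<rfloor>..\<lceil>a/(2*pi)\<rceil>}" by (auto simp: floor_le_iff le_ceiling_iff)
      then show False using x k unfolding T_def by blast
    qed
    note d = per_ext_derivative[OF du this per]
    have "(P has_vector_derivative \<phi> x *\<^sub>R per_ext u1 x + deriv \<phi> x *\<^sub>R per_ext u x) (at x)"
      unfolding P_def by (rule has_vector_derivative_scaleR[OF test_function_facts(2)[OF \<phi>] d])
    then show "(P has_vector_derivative e x) (at x)" unfolding e_def .
  qed
  moreover have "P a = 0" "P (- a) = 0" using zero[of a] zero[of "- a"] R by (auto simp: P_def a_def)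
  ultimately have "(e has_integral 0) {- a..a}" by simp
  then have "(e has_integral 0) UNIV"
    by (rule has_integral_on_superset) (use zero R in \<open>auto simp: e_def a_def\<close>)
  moreover have "(e has_integral (LINT x|lebesgue. e x)) UNIV"
    unfolding e_def by (intro has_integral_integral_lebesgue Bochner_Integration.integrable_add i1 i2)
  ultimately have "(LINT x|lebesgue. e x) = 0" by (rule has_integral_unique[symmetric])
  moreover have "(LINT x|lebesgue. e x) = (LINT x|lebesgue. \<phi> x *\<^sub>R per_ext u1 x) + (LINT x|lebesgue. deriv \<phi> x *\<^sub>R per_ext u x)"
    unfolding e_def by (rule Bochner_Integration.integral_add[OF i2 i1])
  moreover have UN: "(LINT x|lebesgue_on UNIV. f x) = (LINT x|lebesgue. f x)" for f :: "real \<Rightarrow> complex"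
    by (subst integral_lebesgue_on_eq) simp_all
  ultimately show "(LINT x|lebesgue_on UNIV. deriv \<phi> x *\<^sub>R per_ext u x) = - (LINT x|lebesgue_on UNIV. \<phi> x *\<^sub>R per_ext u1 x)"
    unfolding UN by (simp only: eq_neg_iff_add_eq_0 add.commute)
qed

section \<open>Weak and classical solutions\<close>

lemma classical_solution_continuous:
  assumes u: "classical_solution d \<zeta> \<omega> F u u1 u2" and d: "d \<noteq> 0" and cF: "continuous_on circ F"
  shows "continuous_on circ u" "continuous_on circ u1" "continuous_on circ u2"
proof -
  have U: "(u has_vector_derivative u1 s) (at s within circ)" "(u1 has_vector_derivative u2 s) (at s within circ)"
    "- of_real d * u2 s + \<i> * of_real \<omega> * u1 s + (of_real \<zeta> - \<i>) * u s - of_real ((cmod (u s))^2) * u s + \<i> * F s = 0"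
    if "s \<in> circ" for s using u that unfolding classical_solution_def by blast+
  show c: "continuous_on circ u" by (rule has_vector_derivative_continuous_on[OF U(1)])
  show c1: "continuous_on circ u1" by (rule has_vector_derivative_continuous_on[OF U(2)])
  have "continuous_on circ (\<lambda>s. (\<i> * of_real \<omega> * u1 s + (of_real \<zeta> - \<i>) * u s - of_real ((cmod (u s))^2) * u s + \<i> * F s)/of_real d)"
    using d by (intro continuous_intros c c1 cF) simp
  then show "continuous_on circ u2"
  proof (rule continuous_on_eq)
    fix s assume s: "s \<in> circ"
    have "of_real d * u2 s = \<i> * of_real \<omega> * u1 s + (of_real \<zeta> - \<i>) * u s - of_real ((cmod (u s))^2) * u s + \<i> * F s"
      using U(3)[OF s] by (simp add: algebra_simps)
    then show "(\<i> * of_real \<omega> * u1 s + (of_real \<zeta> - \<i>) * u s - of_real ((cmod (u s))^2) * u s + \<i> * F s)/of_real d = u2 s"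
      using d by (metis nonzero_mult_div_cancel_left of_real_eq_0_iff)
  qed
qed

lemma classical_to_weak:
  assumes u: "classical_solution d \<zeta> \<omega> F u u1 u2" and d: "d \<noteq> 0" and cF: "continuous_on circ F"
    and fF: "AE x in lebesgue. x \<in> {0<..<2*pi} \<longrightarrow> f x = F x"
  shows "LLE_solution d \<zeta> \<omega> f (per_ext u)"
proof -
  have U: "(u has_vector_derivative u1 s) (at s within circ)" "(u1 has_vector_derivative u2 s) (at s within circ)"
    "- of_real d * u2 s + \<i> * of_real \<omega> * u1 s + (of_real \<zeta> - \<i>) * u s - of_real ((cmod (u s))^2) * u s + \<i> * F s = 0"
    if "s \<in> circ" for s using u that unfolding classical_solution_def by blast+
  have per: "u 0 = u (2*pi)" "u1 0 = u1 (2*pi)" using u unfolding classical_solution_def by blast+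
  note c = classical_solution_continuous[OF u d cF]
  have w1: "has_weak_deriv_on UNIV (per_ext u) (per_ext u1)" by (rule per_ext_weak_deriv[OF U(1) per(1) c(2)])
  have w2: "has_weak_deriv_on UNIV (per_ext u1) (per_ext u2)" by (rule per_ext_weak_deriv[OF U(2) per(2) c(3)])
  have "per_ext u (x + 2*pi) = per_ext u x" for x using frac_period_shift[of x 1] by (simp add: per_ext_eq)
  then have "H2_per (per_ext u)" unfolding H2_per_def using w1 w2 per_ext_loc(2)[OF c(1)] per_ext_loc(2)[OF c(2)] per_ext_loc(2)[OF c(3)] by auto
  moreover have "AE s in lebesgue. - of_real d * weak_deriv_on UNIV (weak_deriv_on UNIV (per_ext u)) s + \<i> * of_real \<omega> * weak_deriv_on UNIV (per_ext u) s
      + (of_real \<zeta> - \<i>) * per_ext u s - of_real ((cmod (per_ext u s))\<^sup>2) * per_ext u s + \<i> * per_ext f s = 0"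
    using weak_derivs_determined(1,2)[OF w1 w2 open_UNIV] AE_frac_period[OF fF]
  proof eventually_elim
    fix s assume "s \<in> UNIV \<longrightarrow> weak_deriv_on UNIV (per_ext u) s = per_ext u1 s"
      "s \<in> UNIV \<longrightarrow> weak_deriv_on UNIV (weak_deriv_on UNIV (per_ext u)) s = per_ext u2 s" "f (frac_period s) = F (frac_period s)"
    then have e: "weak_deriv_on UNIV (per_ext u) s = u1 (frac_period s)" "weak_deriv_on UNIV (weak_deriv_on UNIV (per_ext u)) s = u2 (frac_period s)"
      "per_ext f s = F (frac_period s)" "per_ext u s = u (frac_period s)" by (simp_all add: per_ext_eq)
    show "- of_real d * weak_deriv_on UNIV (weak_deriv_on UNIV (per_ext u)) s + \<i> * of_real \<omega> * weak_deriv_on UNIV (per_ext u) s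
      + (of_real \<zeta> - \<i>) * per_ext u s - of_real ((cmod (per_ext u s))\<^sup>2) * per_ext u s + \<i> * per_ext f s = 0"
      unfolding e by (rule U(3)[OF frac_period_circ])
  qed
  ultimately show ?thesis unfolding LLE_solution_def Let_def by blast
qed

lemma AE_all_shifts:
  fixes v :: "real \<Rightarrow> complex"
  assumes "AE x in lebesgue. v (x + 2*pi) = v x"
  shows "AE x in lebesgue. \<forall>k::int. v (x + 2*pi * of_int k) = v x"
proof -
  have shift: "AE x in lebesgue. v ((x + 2*pi * of_int k) + 2*pi) = v (x + 2*pi * of_int k)" for k :: int
    by (rule AE_shift[OF assms])
  have "AE x in lebesgue. \<forall>k::int. v ((x + 2*pi * of_int k) + 2*pi) = v (x + 2*pi * of_int k)"
    unfolding AE_all_countable by (intro allI shift)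
  then show ?thesis
  proof eventually_elim
    fix x assume *: "\<forall>k::int. v ((x + 2*pi * of_int k) + 2*pi) = v (x + 2*pi * of_int k)"
    have step: "v (x + 2*pi * of_int (k + 1)) = v (x + 2*pi * of_int k)" for k :: int
      using *[rule_format, of k] by (simp add: algebra_simps)
    show "\<forall>k::int. v (x + 2*pi * of_int k) = v x"
    proof
      fix k :: int
      show "v (x + 2*pi * of_int k) = v x"
      proof (induction k rule: int_induct[where k=0])
        case (step2 i)
        then show ?case using step[of "i - 1"] by simp
      qed (use step in simp_all)
    qed
  qed
qed

text \<open>
  On an interval containing the closed period in its interior the solution has a continuously differentiable representative. Almost
  everywhere inside the period its second derivative equals the continuous function \<open>k\<close> obtained by solving the equation
  for it, so the first derivative is a primitive of \<open>k\<close>. The matching conditions hold because the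
  representative is periodic near 0 and \<open>2\<pi>\<close> as well.
\<close>

lemma weak_to_classical:
  assumes v: "LLE_solution d \<zeta> \<omega> f v" and d: "d \<noteq> 0" and cF: "continuous_on circ F"
    and fF: "AE x in lebesgue. x \<in> {0<..<2*pi} \<longrightarrow> f x = F x"
  obtains u u1 u2 where "classical_solution d \<zeta> \<omega> F u u1 u2" "AE s in lebesgue. v s = per_ext u s"
proof -
  define g where "g = weak_deriv_on UNIV v"
  define h where "h = weak_deriv_on UNIV g"
  have vper: "AE x in lebesgue. v (x + 2*pi) = v x" and
    eq: "AE s in lebesgue. - of_real d * h s + \<i> * of_real \<omega> * g s + (of_real \<zeta> - \<i>) * v s - of_real ((cmod (v s))\<^sup>2) * v s + \<i> * per_ext f s = 0"
    using v unfolding LLE_solution_def H2_per_def Let_def g_def h_def by blast+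
  obtain g' h' where "has_weak_deriv_on UNIV v g'" "has_weak_deriv_on UNIV g' h'"
    using v unfolding LLE_solution_def H2_per_def by blast
  from weak_derivs_determined(3,4)[OF this open_UNIV]
  have w: "has_weak_deriv_on UNIV v g" "has_weak_deriv_on UNIV g h" unfolding g_def h_def .
  define p q where "p = - (2*pi)" and "q = 4*pi"
  have pq: "p < q" unfolding p_def q_def using pi_gt_zero by linarith
  have UNIV_m: "(UNIV :: real set) \<in> sets lebesgue" by simp
  have int: "integrable (lebesgue_on {p<..<q}) k" if "loc_integrable_on UNIV k" for k
    by (rule integrable_lebesgue_on_subset[of "{p..q}"]) (use that in \<open>auto simp: loc_integrable_on_def\<close>)
  have ints: "integrable (lebesgue_on {p<..<q}) v" "integrable (lebesgue_on {p<..<q}) g" "integrable (lebesgue_on {p<..<q}) h"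
    using w unfolding has_weak_deriv_on_def by (auto intro: int)
  obtain U U1 where rep: "\<forall>x\<in>{p..q}. (U has_vector_derivative U1 x) (at x within {p..q})" "continuous_on {p..q} U1"
    "\<forall>x\<in>{p..q}. U1 x = U1 p + integral {p..x} h" "h integrable_on {p..q}"
    "AE x in lebesgue. x \<in> {p<..<q} \<longrightarrow> v x = U x" "AE x in lebesgue. x \<in> {p<..<q} \<longrightarrow> g x = U1 x"
    by (rule H2_representative[OF w UNIV_m subset_UNIV pq ints])
  note U = rep(1)[rule_format] rep(2) rep(3)[rule_format] rep(4-6)
  have cU: "continuous_on {p..q} U" using U(1) by (meson continuous_on_eq_continuous_within has_vector_derivative_continuous)
  have sub: "circ \<subseteq> {p..q}" and sub': "{0<..<2*pi} \<subseteq> {p<..<q}" unfolding p_def q_def by auto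
  have dU: "(U has_vector_derivative U1 s) (at s within circ)" if "s \<in> circ" for s
    using U(1)[of s] that sub by (blast intro: has_vector_derivative_within_subset)
  define k where "k s = (\<i> * of_real \<omega> * U1 s + (of_real \<zeta> - \<i>) * U s - of_real ((cmod (U s))^2) * U s + \<i> * F s)/of_real d" for s
  have ck: "continuous_on circ k" unfolding k_def
    using d by (intro continuous_intros continuous_on_subset[OF cU sub] continuous_on_subset[OF U(2) sub] cF) simp
  have hk: "AE s in lebesgue. s \<in> {0<..<2*pi} \<longrightarrow> h s = k s"
    using eq U(5) U(6) fF
  proof eventually_elim
    fix s assume e: "- of_real d * h s + \<i> * of_real \<omega> * g s + (of_real \<zeta> - \<i>) * v s - of_real ((cmod (v s))\<^sup>2) * v s + \<i> * per_ext f s = 0"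
      "s \<in> {p<..<q} \<longrightarrow> v s = U s" "s \<in> {p<..<q} \<longrightarrow> g s = U1 s" "s \<in> {0<..<2*pi} \<longrightarrow> f s = F s"
    show "s \<in> {0<..<2*pi} \<longrightarrow> h s = k s"
    proof
      assume s: "s \<in> {0<..<2*pi}"
      have "per_ext f s = F s" using s e(4) by (simp add: per_ext_eq frac_period_id)
      moreover have "v s = U s" "g s = U1 s" using e(2,3) s sub' by auto
      ultimately have "of_real d * h s = \<i> * of_real \<omega> * U1 s + (of_real \<zeta> - \<i>) * U s - of_real ((cmod (U s))^2) * U s + \<i> * F s"
        using e(1) by (simp add: algebra_simps)
      then show "h s = k s" unfolding k_def using d by (metis nonzero_mult_div_cancel_left of_real_eq_0_iff)
    qed
  qed
  have U1k: "U1 x = U1 0 + integral {0..x} k" if x: "x \<in> circ" for x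
  proof -
    have "0 \<in> {p..q}" "x \<in> {p..q}" using sub x by auto
    have "integral {p..0} h + integral {0..x} h = integral {p..x} h"
      by (rule Henstock_Kurzweil_Integration.integral_combine)
        (use \<open>0 \<in> {p..q}\<close> \<open>x \<in> {p..q}\<close> x in \<open>auto intro: integrable_on_subinterval[OF U(4)]\<close>)
    moreover have "integral {0..x} h = integral {0..x} k"
    proof -
      have "integral {0<..<x} h = integral {0<..<x} k"
        by (rule integral_spike[OF hk[unfolded AE_lebesgue_iff_negligible]]) (use x in auto)
      then show ?thesis unfolding integral_open_interval_real .
    qed
    ultimately show ?thesis using U(3)[OF \<open>0 \<in> {p..q}\<close>] U(3)[OF \<open>x \<in> {p..q}\<close>] by simp
  qed
  have dU1: "(U1 has_vector_derivative k s) (at s within circ)" if s: "s \<in> circ" for s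
  proof -
    have "((\<lambda>x. U1 0 + integral {0..x} k) has_vector_derivative 0 + k s) (at s within circ)"
      by (intro has_vector_derivative_add has_vector_derivative_const integral_has_vector_derivative[OF ck s])
    then have "((\<lambda>x. U1 0 + integral {0..x} k) has_vector_derivative k s) (at s within circ)" by simp
    then show ?thesis by (rule has_vector_derivative_transform[OF s, rotated]) (rule U1k)
  qed
  have Uper: "U (x + 2*pi) = U x" if x: "x \<in> {p..2*pi}" for x
  proof (rule AE_continuous_eq[OF _ _ _ _ x])
    show "continuous_on {p..2*pi} (\<lambda>x. U (x + 2*pi))"
      by (rule continuous_on_compose2[OF cU]) (auto intro!: continuous_intros simp: p_def q_def)
    show "continuous_on {p..2*pi} U" by (rule continuous_on_subset[OF cU]) (auto simp: q_def)
    show "p < 2*pi" unfolding p_def using pi_gt_zero by linarith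
    show "AE x in lebesgue. x \<in> {p<..<2*pi} \<longrightarrow> U (x + 2*pi) = U x"
      using vper U(5) AE_shift[OF U(5), of "2*pi"]
    proof eventually_elim
      fix x assume e: "v (x + 2*pi) = v x" "x \<in> {p<..<q} \<longrightarrow> v x = U x" "x + 2*pi \<in> {p<..<q} \<longrightarrow> v (x + 2*pi) = U (x + 2*pi)"
      show "x \<in> {p<..<2*pi} \<longrightarrow> U (x + 2*pi) = U x"
      proof
        assume "x \<in> {p<..<2*pi}"
        then have "x \<in> {p<..<q}" "x + 2*pi \<in> {p<..<q}" unfolding p_def q_def using pi_gt_zero by auto
        then show "U (x + 2*pi) = U x" using e by simp
      qed
    qed
  qed
  have per: "U 0 = U (2*pi)" using Uper[of 0] by (simp add: p_def)
  have per1: "U1 0 = U1 (2*pi)"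
  proof -
    have i: "p < 0" "0 < q" "p < 2*pi" "2*pi < q" unfolding p_def q_def using pi_gt_zero by linarith+
    have 0: "(U has_vector_derivative U1 0) (at 0)" using U(1)[of 0] i by (simp add: at_within_Icc_at)
    have "(U has_vector_derivative U1 (2*pi)) (at (2*pi))" using U(1)[of "2*pi"] i by (simp add: at_within_Icc_at)
    moreover have "((\<lambda>x. x + 2*pi) has_vector_derivative 1) (at 0)" by (auto intro!: derivative_eq_intros)
    ultimately have "(U \<circ> (\<lambda>x. x + 2*pi) has_vector_derivative 1 *\<^sub>R U1 (2*pi)) (at 0)" by (intro vector_diff_chain_at) simp_all
    then have "(U has_vector_derivative 1 *\<^sub>R U1 (2*pi)) (at 0)"
    proof (rule has_vector_derivative_transform_within_open[of _ _ _ "{p<..<2*pi}"])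
      show "(U \<circ> (\<lambda>x. x + 2*pi)) x = U x" if "x \<in> {p<..<2*pi}" for x using Uper[of x] that by simp
    qed (use i in auto)
    then show ?thesis using vector_derivative_unique_at[OF 0] by simp
  qed
  have "classical_solution d \<zeta> \<omega> F U U1 k" unfolding classical_solution_def
  proof (intro conjI ballI per per1 dU dU1)
    fix s
    have "of_real d * k s = \<i> * of_real \<omega> * U1 s + (of_real \<zeta> - \<i>) * U s - of_real ((cmod (U s))^2) * U s + \<i> * F s"
      unfolding k_def using d by simp
    then show "- of_real d * k s + \<i> * of_real \<omega> * U1 s + (of_real \<zeta> - \<i>) * U s - of_real ((cmod (U s))^2) * U s + \<i> * F s = 0"
      by (simp add: algebra_simps)
  qed
  moreover have "AE s in lebesgue. v s = per_ext U s"
  proof -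
    have "AE x in lebesgue. x \<in> {0<..<2*pi} \<longrightarrow> (\<forall>j::int. v (x + 2*pi * of_int j) = U x)"
      using AE_all_shifts[OF vper] U(5) by eventually_elim (use sub' in auto)
    from AE_frac_period[OF this] show ?thesis
    proof eventually_elim
      fix s assume *: "\<forall>j::int. v (frac_period s + 2*pi * of_int j) = U (frac_period s)"
      have "frac_period s + 2*pi * of_int \<lfloor>s/(2*pi)\<rfloor> = s" unfolding frac_period_def by simp
      then show "v s = per_ext U s" using *[rule_format, of "\<lfloor>s/(2*pi)\<rfloor>"] by (simp add: per_ext_eq)
    qed
  qed
  ultimately show ?thesis by (rule that)
qed

text \<open>
  The essential supremum is finite because \<open>G\<close> is bounded and \<open>g\<close>, being almost everywhere equal to it, is measurable; so its
  conversion to a real number is faithful.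
\<close>

lemma continuous_le_Linf_norm:
  assumes c: "continuous_on circ G" and gG: "AE x in lebesgue. x \<in> period \<longrightarrow> g x = G x" and s: "s \<in> circ"
  shows "cmod (G s) \<le> Linf_norm_on period g"
proof -
  define E where "E = esssup (lebesgue_on period) (\<lambda>x. ereal (cmod (g x)))"
  have pm: "period \<in> sets lebesgue" by simp
  have p0: "0 < 2*pi" by simp
  obtain B where B: "\<And>x. x \<in> circ \<Longrightarrow> cmod (G x) \<le> B"
    using compact_imp_bounded[OF compact_continuous_image[OF c compact_Icc]] unfolding bounded_iff by blast
  have "(\<lambda>x. indicator circ x *\<^sub>R G x) \<in> borel_measurable lebesgue"
    using borel_measurable_continuous_on_indicator[OF _ c] by (intro measurable_completion) simp
  then have "G \<in> borel_measurable (lebesgue_on circ)" by (subst borel_measurable_restrict_space_iff) (simp_all add: scaleR_conv_of_real)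
  then have "G \<in> borel_measurable (lebesgue_on period)"
    by (rule measurable_restrict_mono) auto
  then have "(\<lambda>x. indicator period x *\<^sub>R G x) \<in> borel_measurable lebesgue" by (subst (asm) borel_measurable_restrict_space_iff) simp_all
  then have "(\<lambda>x. indicator period x *\<^sub>R g x) \<in> borel_measurable lebesgue"
  proof (rule borel_measurable_AE)
    show "AE x in lebesgue. indicat_real period x *\<^sub>R G x = indicat_real period x *\<^sub>R g x"
      using gG by eventually_elim (auto simp: indicator_def)
  qed
  then have gm: "g \<in> borel_measurable (lebesgue_on period)" by (subst borel_measurable_restrict_space_iff) simp_all
  have "AE x in lebesgue_on period. ereal (cmod (g x)) \<le> ereal B"
    unfolding AE_lebesgue_on_iff[OF pm] using gG by eventually_elim (use B in auto)
  then have EB: "E \<le> ereal B" unfolding E_def using gm by (intro esssup_I) auto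
  have ae: "AE x in lebesgue. x \<in> period \<longrightarrow> ereal (cmod (G x)) \<le> E"
  proof -
    have "AE x in lebesgue. x \<in> period \<longrightarrow> ereal (cmod (g x)) \<le> E"
      using esssup_AE[of "\<lambda>x. ereal (cmod (g x))" "lebesgue_on period"] unfolding E_def AE_lebesgue_on_iff[OF pm] .
    then show ?thesis using gG by eventually_elim auto
  qed
  have "E \<noteq> - \<infinity>"
  proof
    assume "E = - \<infinity>"
    then have "AE x in lebesgue. x \<in> period \<longrightarrow> cmod (G x) \<le> - 1" using ae by (auto elim!: eventually_mono)
    from AE_continuous_le[OF _ this p0, of 0] c have "cmod (G 0) \<le> - 1" by (auto intro!: continuous_intros)
    then show False using norm_ge_zero[of "G 0"] by linarith
  qed
  then obtain e where e: "E = ereal e" using EB by (cases E) auto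
  have "cmod (G s) \<le> e"
    by (rule AE_continuous_le[OF _ _ p0 s, of "\<lambda>x. cmod (G x)"])
      (use ae e c in \<open>auto intro!: continuous_intros elim!: eventually_mono\<close>)
  then show ?thesis unfolding Linf_norm_on_def E_def[symmetric] e by simp
qed

lemma forcing_representative:
  assumes f: "H2_on period f"
  obtains F F1 where "\<forall>s\<in>circ. (F has_vector_derivative F1 s) (at s within circ)" "continuous_on circ F1"
    "AE x in lebesgue. x \<in> period \<longrightarrow> f x = F x" "l2 F = LLE_F f"
    "\<forall>s\<in>circ. cmod (F1 s) \<le> Linf_norm_on period (weak_deriv_on period f)"
proof -
  obtain g h where w: "has_weak_deriv_on period f g" "has_weak_deriv_on period g h" and L: "L2_on period f" "L2_on period g" "L2_on period h"
    using f unfolding H2_on_def by blast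
  have pm: "period \<in> sets lebesgue" and pb: "bounded period" and p0: "0 < 2*pi" by auto
  note int = L2_integrable[OF L(1) pb pm] L2_integrable[OF L(2) pb pm] L2_integrable[OF L(3) pb pm]
  obtain F F1 where F: "\<forall>x\<in>circ. (F has_vector_derivative F1 x) (at x within circ)" "continuous_on circ F1"
    "\<forall>x\<in>circ. F1 x = F1 0 + integral {0..x} h" "h integrable_on circ"
    "AE x in lebesgue. x \<in> period \<longrightarrow> f x = F x" "AE x in lebesgue. x \<in> period \<longrightarrow> g x = F1 x"
    by (rule H2_representative[OF w pm order_refl p0 int])
  have "AE x in lebesgue. x \<in> period \<longrightarrow> weak_deriv_on period f x = F1 x"
    using weak_derivs_determined(1)[OF w open_greaterThanLessThan] F(6) by eventually_elim simp
  note M = continuous_le_Linf_norm[OF F(2) this]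
  have "(LINT x|lebesgue_on period. (cmod (f x))^2) = integral period (\<lambda>x. (cmod (f x))^2)"
    by (rule lebesgue_integral_eq_integral[OF _ pm]) (use L(1) in \<open>simp add: L2_on_def\<close>)
  also have "\<dots> = integral period (\<lambda>x. (cmod (F x))^2)"
    by (rule integral_spike[OF F(5)[unfolded AE_lebesgue_iff_negligible]]) auto
  also have "\<dots> = integral circ (\<lambda>x. (cmod (F x))^2)" by (rule integral_open_interval_real[symmetric])
  finally have "l2 F = LLE_F f" unfolding l2_def LLE_F_def L2_norm_on_def by simp
  moreover have "\<forall>s\<in>circ. cmod (F1 s) \<le> Linf_norm_on period (weak_deriv_on period f)" using M by blast
  ultimately show ?thesis using that[OF F(1,2,5)] by blast
qed

lemma LLE_norms_nonneg: "0 \<le> LLE_F f" "0 \<le> L2_norm_on S g"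
  unfolding LLE_F_def L2_norm_on_def by (auto intro!: real_sqrt_ge_zero integral_nonneg_AE)

text \<open>
  All summands in the definition of \<open>LLE_B\<close> are nonnegative, and \<open>2M\<close> is one of those below the square root. The left-hand side is the
  combination that controls the slope in the a priori bound.
\<close>

lemma LLE_B_lower_bound:
  assumes M: "M = Linf_norm_on period (weak_deriv_on period f)" and M0: "0 \<le> M"
  shows "LLE_F f powr (11/4) / (2*\<bar>d\<bar>) + 2 * M * LLE_F f powr (1/4) + sqrt (2 * M) \<le> LLE_B d f"
proof -
  have "0 \<le> L2_norm_on period (weak_deriv_on period (weak_deriv_on period f)) * LLE_F f powr (1/2)"
    by (intro mult_nonneg_nonneg LLE_norms_nonneg) simp
  moreover have "0 \<le> 2 * M * sqrt (LLE_F f / (2*pi))" using M0 LLE_norms_nonneg(1)[of f] by simp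
  ultimately have "2 * M \<le> L2_norm_on period (weak_deriv_on period (weak_deriv_on period f)) * LLE_F f powr (1/2) + 2 * M * (sqrt (LLE_F f / (2*pi)) + 1)"
    by (simp add: distrib_left)
  then have "sqrt (2 * M) \<le> sqrt (L2_norm_on period (weak_deriv_on period (weak_deriv_on period f)) * LLE_F f powr (1/2) + 2 * M * (sqrt (LLE_F f / (2*pi)) + 1))"
    by (rule real_sqrt_le_mono)
  then show ?thesis unfolding LLE_B_def Let_def M[symmetric] by simp
qed

theorem theorem17:
  fixes d \<zeta> \<omega> :: real and f :: "real \<Rightarrow> complex"
  assumes "d \<noteq> 0" and "H2_on {0<..<2 * pi} f"
  shows "zeta_lower d f \<omega> \<le> 0 \<and> 0 \<le> zeta_upper d f \<omega> \<and>
    (sgn d * \<zeta> < zeta_lower d f \<omega> \<or> sgn d * \<zeta> > zeta_upper d f \<omega> \<or> sqrt 3 * LLE_C d f < 1 \<longrightarrow>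
      (\<exists>u. LLE_solution d \<zeta> \<omega> f u \<and>
        (\<forall>v. LLE_solution d \<zeta> \<omega> f v \<longrightarrow> (AE s in lebesgue. v s = u s))))"
proof (intro conjI impI)
  define M where "M = Linf_norm_on period (weak_deriv_on period f)"
  obtain F F1 where rep: "\<forall>s\<in>circ. (F has_vector_derivative F1 s) (at s within circ)" "continuous_on circ F1"
    "AE x in lebesgue. x \<in> period \<longrightarrow> f x = F x" "l2 F = LLE_F f" "\<forall>s\<in>circ. cmod (F1 s) \<le> M"
    unfolding M_def by (rule forcing_representative[OF assms(2)])
  note F = rep(1)[rule_format] rep(2-4) rep(5)[rule_format]
  have cF: "continuous_on circ F" by (rule has_vector_derivative_continuous_on[OF F(1)])
  have M0: "0 \<le> M" using order_trans[OF norm_ge_zero F(5)[of 0]] by simp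
  note B = LLE_B_lower_bound[OF M_def M0, of d]
  have "0 \<le> LLE_F f powr (11/4) / (2*\<bar>d\<bar>) + 2 * M * LLE_F f powr (1/4) + sqrt (2 * M)"
    using M0 by (intro add_nonneg_nonneg mult_nonneg_nonneg) auto
  then have B0: "0 \<le> LLE_B d f" using B by (rule order_trans)
  have D0: "0 \<le> LLE_D d \<omega> f" unfolding LLE_D_def using B0 by (intro add_nonneg_nonneg mult_nonneg_nonneg) auto
  show "zeta_lower d f \<omega> \<le> 0"
  proof -
    have "0 \<le> 27 * (LLE_F f powr (3/4) + 2 * pi * LLE_B d f) ^ 6 * LLE_D d \<omega> f / (8 * pi ^ 3)" using D0 by simp
    moreover have "- c\<^sup>2 * e - X \<le> 0" if "0 \<le> X" "0 \<le> e" for c e X :: real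
      using mult_nonneg_nonneg[OF zero_le_power2[of c] that(2)] that(1) by simp
    ultimately show ?thesis unfolding zeta_lower_def by simp
  qed
  show "0 \<le> zeta_upper d f \<omega>" unfolding zeta_upper_def by simp
  assume regime: "sgn d * \<zeta> < zeta_lower d f \<omega> \<or> sgn d * \<zeta> > zeta_upper d f \<omega> \<or> sqrt 3 * LLE_C d f < 1"
  have "\<exists>u u1 u2. classical_solution d \<zeta> \<omega> F u u1 u2 \<and>
    (\<forall>v v1 v2. classical_solution d \<zeta> \<omega> F v v1 v2 \<longrightarrow> (\<forall>s\<in>circ. v s = u s))"
  proof (rule classical_solution_unique_existence[OF assms(1) F(1,2,5), of "LLE_B d f" "LLE_C d f" "LLE_D d \<omega> f"])
    show "sgn d * \<zeta> < - ((LLE_C d f)\<^sup>2 * (if d < 0 then 1 else 0)) - 27 * (l2 F powr (3/4) + 2*pi * LLE_B d f)^6 * LLE_D d \<omega> f / (8*pi^3)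
      \<or> 3 * (LLE_C d f)\<^sup>2 + \<omega>\<^sup>2/(4*\<bar>d\<bar>) < sgn d * \<zeta> \<or> sqrt 3 * LLE_C d f < 1"
      using regime unfolding F(4) zeta_lower_def zeta_upper_def by simp
  qed (use B in \<open>simp_all only: F(4) LLE_C_def LLE_D_def\<close>)
  then obtain u u1 u2 where u: "classical_solution d \<zeta> \<omega> F u u1 u2"
    and uniq: "\<And>v v1 v2 s. classical_solution d \<zeta> \<omega> F v v1 v2 \<Longrightarrow> s \<in> circ \<Longrightarrow> v s = u s" by blast
  show "\<exists>u. LLE_solution d \<zeta> \<omega> f u \<and> (\<forall>v. LLE_solution d \<zeta> \<omega> f v \<longrightarrow> (AE s in lebesgue. v s = u s))"
  proof (intro exI conjI allI impI)
    show "LLE_solution d \<zeta> \<omega> f (per_ext u)" by (rule classical_to_weak[OF u assms(1) cF F(3)])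
    fix v assume "LLE_solution d \<zeta> \<omega> f v"
    then obtain w w1 w2 where w: "classical_solution d \<zeta> \<omega> F w w1 w2" "AE s in lebesgue. v s = per_ext w s"
      by (rule weak_to_classical[OF _ assms(1) cF F(3)])
    have "per_ext w s = per_ext u s" for s unfolding per_ext_eq by (rule uniq[OF w(1) frac_period_circ])
    then show "AE s in lebesgue. v s = per_ext u s" using w(2) by simp
  qed
qed

end
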